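(* Assume that the Cartan–Hadamard conjecture is true in all dimensions. Let $n\ge 2$ and let $g=e^{2u}|dx|^2$ be a smooth, complete, normal metric on $\mathbb{R}^n$ with $Q_g^{(n)}\le 0$ everywhere. Then the isoperimetric ratio of $g$ satisfies $I_g=1$.
   Context: Cartan–Hadamard conjecture in dimension $m$: for every complete simply connected Riemannian $m$-manifold $(M,h)$ with non-positive sectional curvature and every compact domain $\Omega\subset M$ with smooth boundary, $|\partial\Omega|_h^{\frac{m}{m-1}}\ge m^{\frac{m}{m-1}}|\mathbb{B}^m|^{\frac{1}{m-1}}|\Omega|_h$. "True in all dimensions" means for all $m\ge 2$. For a smooth function $u$ on $\mathbb{R}^n$, $g=e^{2u}|dx|^2$ denotes the conformal metric, and its $n$-th order $Q$-curvature is $Q_g^{(n)}=e^{-nu}(-\Delta)^{n/2}u$. When $n$ is even this is a local differential operator. When $n$ is odd, $(-\Delta)^{n/2}=(-\Delta)^{1/2}\circ(-\Delta)^{(n-1)/2}$, where $(-\Delta)^{1/2}f(x)=C(n)\,\mathrm{P.V.}\int_{\mathbb{R}^n}\frac{f(x)-f(y)}{|x-y|^{n+1}}dy$ with the standard normalizing constant $C(n)$, and one assumes $\int_{\mathbb{R}^n}\frac{|(-\Delta)^{(n-1)/2}u(x)|}{1+|x|^{n+1}}dx<\infty$ so that $Q_g^{(n)}$ is well defined. $|\mathbb{S}^n|$ is the volume of the standard unit $n$-sphere and $|\mathbb{B}^n|$ the volume of the unit ball in $\mathbb{R}^n$. The metric $g$ has finite total $Q$-curvature if $Q_g^{(n)}e^{nu}\in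 L^1(\mathbb{R}^n)$. A metric with finite total $Q$-curvature is called normal if there is a constant $C$ such that for all $x\in\mathbb{R}^n$ $$u(x)=\frac{2}{(n-1)!|\mathbb{S}^n|}\int_{\mathbb{R}^n}\log\frac{|y|}{|x-y|}\,Q_g^{(n)}(y)e^{nu(y)}\,dy+C .$$ For a compact domain $\Omega\subset\mathbb{R}^n$ with smooth boundary, $|\Omega|_g=\int_\Omega e^{nu}dx$, $|\partial\Omega|_g=\int_{\partial\Omega}e^{(n-1)u}d\sigma$, and $$I_g(\Omega)=\frac{|\partial\Omega|_g^{\frac{n}{n-1}}}{n^{\frac{n}{n-1}}|\mathbb{B}^n|^{\frac{1}{n-1}}|\Omega|_g},\qquad I_g=\inf_\Omega I_g(\Omega),$$ the infimum being over all compact domains $\Omega\subset\mathbb{R}^n$ with smooth boundary. *)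

theory Defs
  imports "HOL-Analysis.Analysis" "Jordan_Normal_Form.Determinant"
begin

section \<open>Calculus on \<open>\<real>\<^sup>k\<close> for a variable dimension \<open>k\<close>\<close>

text \<open>
  The dimension is quantified inside a hypothesis, so it cannot be a type. A point of \<open>\<real>\<^sup>k\<close> is an
  extensional function on \<open>{..<k}\<close>; this is both the carrier of the product topology \<open>euc k\<close> and the
  space of the product Lebesgue measure \<open>leb k\<close>.
\<close>

type_synonym coords = "nat \<Rightarrow> real"

definition euc :: "nat \<Rightarrow> coords topology" where
  "euc k = product_topology (\<lambda>_. euclideanreal) {..<k}"

abbreviation Rn :: "nat \<Rightarrow> coords set" where
  "Rn k \<equiv> topspace (euc k)"

definition leb :: "nat \<Rightarrow> coords measure" where
  "leb k = Pi\<^sub>M {..<k} (\<lambda>_. lborel)"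

definition enorm :: "nat \<Rightarrow> coords \<Rightarrow> real" where
  "enorm k x = L2_set x {..<k}"

definition edist :: "nat \<Rightarrow> coords \<Rightarrow> coords \<Rightarrow> real" where
  "edist k x y = L2_set (\<lambda>i. x i - y i) {..<k}"

definition pd :: "nat \<Rightarrow> (coords \<Rightarrow> real) \<Rightarrow> coords \<Rightarrow> real" where
  "pd i f x = deriv (\<lambda>t. f (x(i := t))) (x i)"

primrec Ck_on :: "nat \<Rightarrow> nat \<Rightarrow> coords set \<Rightarrow> (coords \<Rightarrow> real) \<Rightarrow> bool" where
  "Ck_on k 0 U f \<longleftrightarrow> continuous_map (subtopology (euc k) U) euclideanreal f"
| "Ck_on k (Suc r) U f \<longleftrightarrow> continuous_map (subtopology (euc k) U) euclideanreal f \<and>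
     (\<forall>i<k. (\<forall>x\<in>U. (\<lambda>t. f (x(i := t))) differentiable at (x i)) \<and> Ck_on k r U (pd i f))"

text \<open>Used only for sets \<open>U\<close> that are open in \<open>euc k\<close>.\<close>

definition smooth_on :: "nat \<Rightarrow> coords set \<Rightarrow> (coords \<Rightarrow> real) \<Rightarrow> bool" where
  "smooth_on k U f \<longleftrightarrow> (\<forall>r. Ck_on k r U f)"


section \<open>Smooth manifolds\<close>

text \<open>A chart is a pair of a domain and a coordinate map; values of the map off the domain are
  irrelevant.\<close>

type_synonym 'a chart = "'a set \<times> ('a \<Rightarrow> coords)"

definition transition :: "'a chart \<Rightarrow> 'a chart \<Rightarrow> coords \<Rightarrow> coords" where
  "transition c c' x = snd c' (inv_into (fst c) (snd c) x)"

definition smooth_atlas :: "nat \<Rightarrow> 'a topology \<Rightarrow> 'a chart set \<Rightarrow> bool" where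
  "smooth_atlas m X A \<longleftrightarrow>
     (\<Union>(U, \<phi>)\<in>A. U) = topspace X \<and>
     (\<forall>(U, \<phi>)\<in>A. openin X U \<and> openin (euc m) (\<phi> ` U) \<and>
        homeomorphic_map (subtopology X U) (subtopology (euc m) (\<phi> ` U)) \<phi>) \<and>
     (\<forall>c\<in>A. \<forall>c'\<in>A. \<forall>k<m. smooth_on m (snd c ` (fst c \<inter> fst c')) (\<lambda>x. transition c c' x k))"

definition smooth_structure :: "nat \<Rightarrow> 'a topology \<Rightarrow> 'a chart set \<Rightarrow> bool" where
  "smooth_structure m X A \<longleftrightarrow>
     smooth_atlas m X A \<and> (\<forall>c. smooth_atlas m X (insert c A) \<longrightarrow> c \<in> A)"

definition smooth_manifold :: "nat \<Rightarrow> 'a topology \<Rightarrow> 'a chart set \<Rightarrow> bool" where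
  "smooth_manifold m X A \<longleftrightarrow>
     Hausdorff_space X \<and> second_countable X \<and> smooth_structure m X A"

text \<open>The standard smooth structure of \<open>\<real>\<^sup>n\<close>.\<close>

definition euc_charts :: "nat \<Rightarrow> coords chart set" where
  "euc_charts n = {c. smooth_atlas n (euc n) {c, (Rn n, id)}}"

text \<open>The analogue for abstract topologies of the library's \<^const>\<open>simply_connected\<close>; as there,
  path-connectedness is included (take constant loops).\<close>

definition simply_connected_space :: "'a topology \<Rightarrow> bool" where
  "simply_connected_space X \<longleftrightarrow>
     (\<forall>p q. pathin X p \<and> p 1 = p 0 \<and> pathin X q \<and> q 1 = q 0 \<longrightarrow>
        homotopic_with (\<lambda>r. r 1 = r 0) (top_of_set {0..1}) X p q)"


section \<open>Riemannian metrics\<close>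

text \<open>A metric is given by its components: \<open>h c x i j\<close> is \<open>h(\<partial>\<^sub>i, \<partial>\<^sub>j)\<close> in the chart \<open>c\<close> at the point with
  coordinates \<open>x\<close>. The last conjunct below is the tensor transformation law.\<close>

type_synonym components = "coords \<Rightarrow> nat \<Rightarrow> nat \<Rightarrow> real"
type_synonym 'a tensor2 = "'a chart \<Rightarrow> components"

definition form :: "nat \<Rightarrow> components \<Rightarrow> coords \<Rightarrow> coords \<Rightarrow> coords \<Rightarrow> real" where
  "form m H x v w = (\<Sum>i<m. \<Sum>j<m. H x i j * v i * w j)"

definition riemannian_metric :: "nat \<Rightarrow> 'a chart set \<Rightarrow> 'a tensor2 \<Rightarrow> bool" where
  "riemannian_metric m A h \<longleftrightarrow>
     (\<forall>c\<in>A. 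
        (\<forall>i<m. \<forall>j<m. smooth_on m (snd c ` fst c) (\<lambda>x. h c x i j)) \<and>
        (\<forall>x \<in> snd c ` fst c.
           (\<forall>i<m. \<forall>j<m. h c x i j = h c x j i) \<and>
           (\<forall>v. (\<exists>i<m. v i \<noteq> 0) \<longrightarrow> form m (h c) x v v > 0)) \<and>
        (\<forall>c'\<in>A. \<forall>x \<in> snd c ` (fst c \<inter> fst c'). \<forall>i<m. \<forall>j<m.
           h c x i j = (\<Sum>k<m. \<Sum>l<m. h c' (transition c c' x) k l *
              pd i (\<lambda>y. transition c c' y k) x * pd j (\<lambda>y. transition c c' y l) x)))"

definition gram :: "nat \<Rightarrow> components \<Rightarrow> coords \<Rightarrow> real mat" where
  "gram k H x = mat k k (\<lambda>(i, j). H x i j)"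

definition gram_inv :: "nat \<Rightarrow> components \<Rightarrow> components" where
  "gram_inv m H x i j = adj_mat (gram m H x) $$ (i, j) / Determinant.det (gram m H x)"

definition christoffel :: "nat \<Rightarrow> components \<Rightarrow> nat \<Rightarrow> nat \<Rightarrow> nat \<Rightarrow> coords \<Rightarrow> real" where
  "christoffel m H l i j x = (\<Sum>p<m. gram_inv m H x l p *
     (pd i (\<lambda>y. H y j p) x + pd j (\<lambda>y. H y i p) x - pd p (\<lambda>y. H y i j) x) / 2)"

text \<open>\<open>riemann m H l i j k\<close> is the \<open>l\<close>-th component of \<open>R(\<partial>\<^sub>i, \<partial>\<^sub>j)\<partial>\<^sub>k\<close>, where
  \<open>R(X, Y)Z = \<nabla>\<^sub>X\<nabla>\<^sub>Y Z - \<nabla>\<^sub>Y\<nabla>\<^sub>X Z - \<nabla>\<^bsub>[X,Y]\<^esub> Z\<close>.\<close>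

definition riemann :: "nat \<Rightarrow> components \<Rightarrow> nat \<Rightarrow> nat \<Rightarrow> nat \<Rightarrow> nat \<Rightarrow> coords \<Rightarrow> real" where
  "riemann m H l i j k x =
     pd i (christoffel m H l j k) x - pd j (christoffel m H l i k) x +
     (\<Sum>p<m. christoffel m H l i p x * christoffel m H p j k x
            - christoffel m H l j p x * christoffel m H p i k x)"

text \<open>\<open>\<langle>R(v, w)w, v\<rangle> / (|v|\<^sup>2|w|\<^sup>2 - \<langle>v, w\<rangle>\<^sup>2)\<close>\<close>

definition sectional_curvature ::
    "nat \<Rightarrow> components \<Rightarrow> coords \<Rightarrow> coords \<Rightarrow> coords \<Rightarrow> real" where
  "sectional_curvature m H x v w =
     form m H x (\<lambda>l. \<Sum>i<m. \<Sum>j<m. \<Sum>k<m. riemann m H l i j k x * v i * w j * w k) v /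
     (form m H x v v * form m H x w w - (form m H x v w)\<^sup>2)"

definition nonpositive_curvature :: "nat \<Rightarrow> 'a chart set \<Rightarrow> 'a tensor2 \<Rightarrow> bool" where
  "nonpositive_curvature m A h \<longleftrightarrow>
     (\<forall>c\<in>A. \<forall>x \<in> snd c ` fst c. \<forall>v w.
        (\<forall>a b. (\<forall>i<m. a * v i + b * w i = 0) \<longrightarrow> a = 0 \<and> b = 0) \<longrightarrow>
        sectional_curvature m (h c) x v w \<le> 0)"

text \<open>\<open>curve_length m A h p q L\<close>: some piecewise \<open>C\<^sup>1\<close> curve from \<open>p\<close> to \<open>q\<close> has length \<open>L\<close>. The curve
  is cut into finitely many \<open>C\<^sup>1\<close> pieces, each parametrised on \<open>[0,1]\<close> and contained in one chart
  domain; \<open>v\<close> is the velocity in that chart.\<close>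

inductive curve_length ::
    "nat \<Rightarrow> 'a chart set \<Rightarrow> 'a tensor2 \<Rightarrow> 'a \<Rightarrow> 'a \<Rightarrow> real \<Rightarrow> bool"
  for m A h where
  "curve_length m A h p p 0"
| "\<lbrakk>c \<in> A; \<gamma> ` {0..1} \<subseteq> fst c;
    \<forall>i<m. continuous_on {0..1} (\<lambda>t. v t i);
    \<forall>i<m. \<forall>t\<in>{0..1}. ((\<lambda>s. snd c (\<gamma> s) i) has_real_derivative v t i) (at t within {0..1});
    curve_length m A h (\<gamma> 1) q L\<rbrakk>
   \<Longrightarrow> curve_length m A h (\<gamma> (0::real)) q
        (integral {0..1} (\<lambda>t. sqrt (form m (h c) (snd c (\<gamma> t)) (v t) (v t))) + L)"

definition riemannian_dist :: "nat \<Rightarrow> 'a chart set \<Rightarrow> 'a tensor2 \<Rightarrow> 'a \<Rightarrow> 'a \<Rightarrow> real" where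
  "riemannian_dist m A h p q = Inf {L. curve_length m A h p q L}"

definition complete_metric ::
    "nat \<Rightarrow> 'a topology \<Rightarrow> 'a chart set \<Rightarrow> 'a tensor2 \<Rightarrow> bool" where
  "complete_metric m X A h \<longleftrightarrow> Metric_space.mcomplete (topspace X) (riemannian_dist m A h)"


section \<open>Volume and area\<close>

text \<open>The Borel measure on \<open>X\<close> which, for each \<open>(V, \<eta>, \<delta>) \<in> D\<close>, has density \<open>\<delta>\<close> with respect to Lebesgue
  measure in the coordinates \<open>\<eta> : V \<rightarrow> \<real>\<^sup>k\<close>. It is unique when countably many of the (open) \<open>V\<close> cover \<open>X\<close>,
  and exists when the densities obey the change of variables formula; both hold where it is used.\<close>

definition glued_measure ::
    "nat \<Rightarrow> 'a topology \<Rightarrow> ('a set \<times> ('a \<Rightarrow> coords) \<times> (coords \<Rightarrow> real)) set \<Rightarrow> 'a measure" where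
  "glued_measure k X D = (THE \<mu>. space \<mu> = topspace X \<and>
     sets \<mu> = sigma_sets (topspace X) {U. openin X U} \<and>
     (\<forall>(V, \<eta>, \<delta>)\<in>D. \<forall>B\<in>sets \<mu>. B \<subseteq> V \<longrightarrow>
        emeasure \<mu> B = (\<integral>\<^sup>+ y. ennreal (\<delta> y) * indicator (\<eta> ` B) y \<partial>leb k)))"

definition volume_measure ::
    "nat \<Rightarrow> 'a topology \<Rightarrow> 'a chart set \<Rightarrow> 'a tensor2 \<Rightarrow> 'a measure" where
  "volume_measure m X A h = glued_measure m X
     {(U, \<phi>, \<lambda>x. sqrt (Determinant.det (gram m (h (U, \<phi>)) x))) | U \<phi>. (U, \<phi>) \<in> A}"

text \<open>The \<open>(m-1)\<close>-dimensional Riemannian measure of the metric induced by \<open>h\<close> on a smooth hypersurface \<open>S\<close>.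
  In a chart that maps \<open>S\<close> to the hyperplane \<open>x\<^bsub>m-1\<^esub> = 0\<close>, the other coordinates are coordinates on \<open>S\<close>
  and the components of the induced metric are those of \<open>h\<close> with indices below \<open>m - 1\<close>.\<close>

definition area_measure ::
    "nat \<Rightarrow> 'a topology \<Rightarrow> 'a chart set \<Rightarrow> 'a tensor2 \<Rightarrow> 'a set \<Rightarrow> 'a measure" where
  "area_measure m X A h S = glued_measure (m - 1) (subtopology X S)
     {(U \<inter> S, \<lambda>p. restrict (\<phi> p) {..<m - 1},
       \<lambda>y. sqrt (Determinant.det (gram (m - 1) (h (U, \<phi>)) (y(m - 1 := 0))))) | U \<phi>.
      (U, \<phi>) \<in> A \<and> \<phi> ` (U \<inter> S) = {x \<in> \<phi> ` U. x (m - 1) = 0}}"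

definition smooth_compact_domain ::
    "nat \<Rightarrow> 'a topology \<Rightarrow> 'a chart set \<Rightarrow> 'a set \<Rightarrow> bool" where
  "smooth_compact_domain m X A \<Omega> \<longleftrightarrow>
     compactin X \<Omega> \<and> connectedin X \<Omega> \<and> \<Omega> \<noteq> {} \<and>
     (\<forall>p \<in> X frontier_of \<Omega>. \<exists>(U, \<phi>)\<in>A. p \<in> U \<and>
        \<phi> ` (U \<inter> \<Omega>) = {x \<in> \<phi> ` U. x (m - 1) \<le> 0})"

definition ball_volume :: "nat \<Rightarrow> real" where
  "ball_volume k = measure (leb k) {x \<in> Rn k. enorm k x \<le> 1}"


section \<open>The Cartan--Hadamard conjecture\<close>

text \<open>Points of \<open>M\<close> are drawn from the type \<^typ>\<open>coords\<close>, which serves only as a set of the cardinality of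
  the continuum: every connected second countable manifold is isomorphic to one with such a carrier.
  The topology \<open>X\<close> of \<open>M\<close> is arbitrary and unrelated to that of \<^typ>\<open>coords\<close>.\<close>

definition cartan_hadamard_conjecture :: "nat \<Rightarrow> bool" where
  "cartan_hadamard_conjecture m \<longleftrightarrow>
     (\<forall>(X :: coords topology) A h \<Omega>.
        smooth_manifold m X A \<and> simply_connected_space X \<and>
        riemannian_metric m A h \<and> complete_metric m X A h \<and> nonpositive_curvature m A h \<and>
        smooth_compact_domain m X A \<Omega> \<longrightarrow>
        measure (area_measure m X A h (X frontier_of \<Omega>)) (X frontier_of \<Omega>)
            powr (real m / (real m - 1))
        \<ge> real m powr (real m / (real m - 1)) * ball_volume m powr (1 / (real m - 1)) *
          measure (volume_measure m X A h) \<Omega>)"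


section \<open>Conformal metrics and \<open>Q\<close>-curvature\<close>

text \<open>The components of \<open>e\<^bsup>2u\<^esup>|dx|\<^sup>2\<close> in an arbitrary chart of \<open>\<real>\<^sup>n\<close>.\<close>

definition conformal_metric :: "nat \<Rightarrow> (coords \<Rightarrow> real) \<Rightarrow> coords tensor2" where
  "conformal_metric n u c x i j =
     exp (2 * u (inv_into (fst c) (snd c) x)) *
     (\<Sum>k<n. pd i (\<lambda>y. inv_into (fst c) (snd c) y k) x * pd j (\<lambda>y. inv_into (fst c) (snd c) y k) x)"

definition euc_area_measure :: "nat \<Rightarrow> coords set \<Rightarrow> coords measure" where
  "euc_area_measure n S = area_measure n (euc n) (euc_charts n) (conformal_metric n (\<lambda>_. 0)) S"

text \<open>The volume of the unit \<open>n\<close>-sphere in \<open>\<real>\<^bsup>n+1\<^esup>\<close>.\<close>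

definition sphere_volume :: "nat \<Rightarrow> real" where
  "sphere_volume n =
     measure (euc_area_measure (n + 1) {x \<in> Rn (n + 1). enorm (n + 1) x = 1})
       {x \<in> Rn (n + 1). enorm (n + 1) x = 1}"

definition neg_laplacian :: "nat \<Rightarrow> (coords \<Rightarrow> real) \<Rightarrow> coords \<Rightarrow> real" where
  "neg_laplacian n f x = - (\<Sum>i<n. pd i (pd i f) x)"

text \<open>\<open>(-\<Delta>)\<^bsup>1/2\<^esup>\<close> with its normalizing constant \<open>C(n) = \<Gamma>((n+1)/2) / \<pi>\<^bsup>(n+1)/2\<^esup>\<close>, for which the Fourier
  multiplier is \<open>|\<xi>|\<close>.\<close>

definition half_laplacian :: "nat \<Rightarrow> (coords \<Rightarrow> real) \<Rightarrow> coords \<Rightarrow> real" where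
  "half_laplacian n f x =
     Gamma ((real n + 1) / 2) / pi powr ((real n + 1) / 2) *
     Lim (at_right 0) (\<lambda>\<epsilon>. LINT y : {y \<in> Rn n. edist n x y > \<epsilon>} | leb n.
        (f x - f y) / edist n x y ^ (n + 1))"

definition laplacian_half_power :: "nat \<Rightarrow> (coords \<Rightarrow> real) \<Rightarrow> coords \<Rightarrow> real" where
  "laplacian_half_power n u =
     (if even n then (neg_laplacian n ^^ (n div 2)) u
      else half_laplacian n ((neg_laplacian n ^^ ((n - 1) div 2)) u))"

definition Q_well_defined :: "nat \<Rightarrow> (coords \<Rightarrow> real) \<Rightarrow> bool" where
  "Q_well_defined n u \<longleftrightarrow>
     (odd n \<longrightarrow> integrable (leb n)
        (\<lambda>x. \<bar>(neg_laplacian n ^^ ((n - 1) div 2)) u x\<bar> / (1 + enorm n x ^ (n + 1))))"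

definition Q_curvature :: "nat \<Rightarrow> (coords \<Rightarrow> real) \<Rightarrow> coords \<Rightarrow> real" where
  "Q_curvature n u x = exp (- real n * u x) * laplacian_half_power n u x"

definition finite_total_Q :: "nat \<Rightarrow> (coords \<Rightarrow> real) \<Rightarrow> bool" where
  "finite_total_Q n u \<longleftrightarrow> integrable (leb n) (\<lambda>x. Q_curvature n u x * exp (real n * u x))"

text \<open>The integrability conjunct states that the integral in the formula for \<open>u\<close> converges; without it
  a divergent integral would be read as \<open>0\<close>.\<close>

definition normal_metric :: "nat \<Rightarrow> (coords \<Rightarrow> real) \<Rightarrow> bool" where
  "normal_metric n u \<longleftrightarrow> finite_total_Q n u \<and>
     (\<exists>C. \<forall>x\<in>Rn n.
        integrable (leb n)
          (\<lambda>y. ln (enorm n y / edist n x y) * (Q_curvature n u y * exp (real n * u y))) \<and>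
        u x = 2 / (fact (n - 1) * sphere_volume n) *
          (LINT y|leb n. ln (enorm n y / edist n x y) * (Q_curvature n u y * exp (real n * u y))) + C)"


section \<open>The isoperimetric ratio\<close>

definition conformal_volume :: "nat \<Rightarrow> (coords \<Rightarrow> real) \<Rightarrow> coords set \<Rightarrow> real" where
  "conformal_volume n u \<Omega> = (LINT x : \<Omega> | leb n. exp (real n * u x))"

definition conformal_area :: "nat \<Rightarrow> (coords \<Rightarrow> real) \<Rightarrow> coords set \<Rightarrow> real" where
  "conformal_area n u \<Omega> =
     (LINT x | euc_area_measure n (euc n frontier_of \<Omega>). exp ((real n - 1) * u x))"

definition isoperimetric_ratio_of :: "nat \<Rightarrow> (coords \<Rightarrow> real) \<Rightarrow> coords set \<Rightarrow> real" where
  "isoperimetric_ratio_of n u \<Omega> =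
     conformal_area n u \<Omega> powr (real n / (real n - 1)) /
     (real n powr (real n / (real n - 1)) * ball_volume n powr (1 / (real n - 1)) *
      conformal_volume n u \<Omega>)"

definition isoperimetric_ratio :: "nat \<Rightarrow> (coords \<Rightarrow> real) \<Rightarrow> real" where
  "isoperimetric_ratio n u =
     (INF \<Omega>\<in>{\<Omega>. smooth_compact_domain n (euc n) (euc_charts n) \<Omega>}. isoperimetric_ratio_of n u \<Omega>)"

end

theory Submission
  imports Defs
begin

text \<open>
  A normal metric with \<open>Q \<le> 0\<close> has \<open>u(x) = \<integral> ln (|x - y| / |y|) d\<mu>(y) + C\<close> for a positive measure \<open>\<mu>\<close>. The Hessian
  of \<open>ln |z|\<close> has non-negative trace on every plane, hence so has that of \<open>u\<close>. The sectional curvature of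
  \<open>e\<^sup>2\<^sup>u|dx|\<^sup>2\<close> on a plane \<open>P\<close> is \<open>- e\<^sup>-\<^sup>2\<^sup>u\<close> times the sum of the trace of the Hessian on \<open>P\<close> and the squared
  length of the component of the gradient normal to \<open>P\<close>, so it is non-positive, and the Cartan--Hadamard conjecture in
  dimension \<open>n\<close> bounds all isoperimetric ratios below by \<open>1\<close>. Small balls are nearly Euclidean, and their
  ratios tend to \<open>1\<close>.

  The trace inequality is obtained without differentiating under the integral sign, from a maximum
  principle for the potentials of the regularised kernels \<open>ln \<surd>(|z|\<^sup>2 + e\<^sup>2)\<close>. That charts give consistent
  volumes and areas rests on the change of variables formula, for which a local diffeomorphism is
  factored into maps that change a single coordinate.
\<close>

section \<open>Partial derivatives in coordinates\<close>

text \<open>In a single direction the second derivative of ln |z| has no sign. Its Hessian is (I - 2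
  z z^T / |z|^2) / |z|^2, and the trace of this on a plane is 2 (1 - |z_P|^2 / |z|^2) / |z|^2, where
  z_P is the projection of z to the plane. Sectional curvature sees u only through such traces and
  the gradient; this is how the sign of Q, an operator of order n, can control curvature at all. Two
  obstacles shape the rest. The second derivatives of the kernel blow up like |z|^-2 while the
  density is only known to be integrable, so the sign has to reach u through finite differences of
  continuous functions. And the conjecture speaks of abstract manifolds: curvature must be
  non-positive in every chart of a maximal atlas, and volume and area are measures given by a
  description operator. These have to be shown to exist and to be \<open>exp (n * u)\<close> and
  \<open>exp ((n - 1) * u)\<close> times their Euclidean counterparts before the inequality says
  anything about \<open>isoperimetric_ratio_of\<close>.\<close>

lemma Rn_extensional: "Rn k = extensional {..<k}"
  by (simp add: euc_def PiE_UNIV_domain PiE_def)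

lemma Rn_upd: "x \<in> Rn k \<Longrightarrow> i < k \<Longrightarrow> x(i := t) \<in> Rn k"
  by (auto simp: Rn_extensional extensional_def)

lemma Rn_eqI: "x \<in> Rn k \<Longrightarrow> y \<in> Rn k \<Longrightarrow> (\<And>i. i < k \<Longrightarrow> x i = y i) \<Longrightarrow> x = y"
  unfolding Rn_extensional by (rule extensionalityI) auto

lemma restrict_Rn: "restrict f {..<k} \<in> Rn k"
  by (simp add: Rn_extensional)

text \<open>On \<open>Rn k\<close> the coordinates from k on are frozen at \<open>undefined\<close>,
  so the projections to them are constant and add no open sets. This turns the abstract product
  topology into a subspace of a type, where \<open>continuous_on\<close> and the facts about it
  apply.\<close>

lemma euc_eq_top_of_set: "euc k = top_of_set (Rn k)"
proof -
  have c: "continuous_on S (\<lambda>x::coords. x i)" for S i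
    by (rule continuous_on_subset[OF continuous_on_product_coordinates]) auto
  have 1: "continuous_map (euc k) (top_of_set (Rn k)) (\<lambda>x. x)"
  proof -
    have "continuous_map (euc k) euclideanreal (\<lambda>x. x i)" for i
    proof (cases "i < k")
      case True
      then show ?thesis unfolding euc_def
        by (intro continuous_map_product_projection) auto
    next
      case False
      have "continuous_map (euc k) euclideanreal (\<lambda>x. undefined)" by simp
      then show ?thesis
        by (rule continuous_map_eq) (use False in \<open>auto simp: Rn_extensional extensional_def\<close>)
    qed
    then have "continuous_map (euc k) (product_topology (\<lambda>i. euclideanreal) UNIV) (\<lambda>x. x)"
      by (subst continuous_map_componentwise_UNIV) auto
    then show ?thesis
      unfolding euclidean_product_topology by (auto simp: continuous_map_in_subtopology)
  qed
  have 2: "continuous_map (top_of_set (Rn k)) (euc k) (\<lambda>x. x)"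
    unfolding euc_def
    by (subst continuous_map_componentwise) (auto simp: c PiE_def)
  show ?thesis
    unfolding topology_eq
  proof (intro allI iffI)
    fix S assume S: "openin (euc k) S"
    then have "openin (top_of_set (Rn k)) {x \<in> topspace (top_of_set (Rn k)). x \<in> S}"
      by (intro openin_continuous_map_preimage[OF 2])
    moreover have "{x \<in> topspace (top_of_set (Rn k)). x \<in> S} = S"
      using openin_subset[OF S] by auto
    ultimately show "openin (top_of_set (Rn k)) S" by simp
  next
    fix S assume S: "openin (top_of_set (Rn k)) S"
    then have "openin (euc k) {x \<in> topspace (euc k). x \<in> S}"
      by (intro openin_continuous_map_preimage[OF 1])
    moreover have "{x \<in> topspace (euc k). x \<in> S} = S"
      using openin_subset[OF S] by auto
    ultimately show "openin (euc k) S" by simp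
  qed
qed

lemma subtopology_euc: "U \<subseteq> Rn k \<Longrightarrow> subtopology (euc k) U = top_of_set U"
  by (subst euc_eq_top_of_set) (simp add: subtopology_subtopology inf_absorb2)

lemma continuous_map_euc: "U \<subseteq> Rn k \<Longrightarrow> continuous_map (subtopology (euc k) U) euclideanreal f \<longleftrightarrow> continuous_on U f"
  by (simp add: subtopology_euc)

lemma continuous_on_coord: "continuous_on S (\<lambda>x::coords. x i)"
  by (rule continuous_on_subset[OF continuous_on_product_coordinates]) auto

text \<open>Cubes serve as basic neighbourhoods because they are stable under replacing one
  coordinate by another value in range, the move on which \<open>pd\<close> rests, and because they
  meet each coordinate line in an interval.\<close>

definition cube :: "nat \<Rightarrow> coords \<Rightarrow> real \<Rightarrow> coords set" where
  "cube k x e = {y \<in> Rn k. \<forall>i<k. \<bar>y i - x i\<bar> < e}"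

lemma openin_cube: "openin (euc k) (cube k x e)"
proof -
  have "cube k x e = Rn k \<inter> (\<Inter>i\<in>{..<k}. {y. \<bar>y i - x i\<bar> < e})"
    by (auto simp: cube_def)
  moreover have "open (\<Inter>i\<in>{..<k}. {y::coords. \<bar>y i - x i\<bar> < e})"
    by (intro open_INT ballI open_Collect_less continuous_intros) auto
  ultimately show ?thesis by (subst euc_eq_top_of_set) (auto simp: openin_open)
qed

lemma cube_mono: "e \<le> e' \<Longrightarrow> cube k x e \<subseteq> cube k x e'"
  by (force simp: cube_def)

lemma cube_center: "x \<in> Rn k \<Longrightarrow> e > 0 \<Longrightarrow> x \<in> cube k x e"
  by (auto simp: cube_def)

lemma openin_imp_cube:
  assumes "openin (euc k) U" "x \<in> U"
  obtains e where "e > 0" "cube k x e \<subseteq> U"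
proof -
  from assms obtain V where V: "\<forall>i\<in>{..<k}. open (V i)" "x \<in> PiE {..<k} V" "PiE {..<k} V \<subseteq> U"
    unfolding euc_def openin_product_topology_alt by (auto; metis)
  have "\<exists>e>0. \<forall>t. \<bar>t - x i\<bar> < e \<longrightarrow> t \<in> V i" if "i < k" for i
    using V(1,2) that by (auto simp: open_real PiE_def Pi_def)
  then obtain e where e: "\<And>i. i < k \<Longrightarrow> e i > 0" "\<And>i t. i < k \<Longrightarrow> \<bar>t - x i\<bar> < e i \<Longrightarrow> t \<in> V i"
    by metis
  define d where "d = Min (insert 1 (e ` {..<k}))"
  have d: "d > 0" "\<And>i. i < k \<Longrightarrow> d \<le> e i"
    using e(1) unfolding d_def by (auto simp: Min_gr_iff)
  have "cube k x d \<subseteq> PiE {..<k} V"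
  proof
    fix y assume y: "y \<in> cube k x d"
    have "y i \<in> V i" if "i < k" for i
      using y d(2)[OF that] that by (intro e(2)) (auto simp: cube_def intro: less_le_trans)
    then show "y \<in> PiE {..<k} V"
      using y by (auto simp: cube_def Rn_extensional PiE_iff)
  qed
  with V(3) have "cube k x d \<subseteq> U" by (rule subset_trans[rotated])
  with d(1) show thesis by (rule that)
qed

lemma openin_euc_cubeI:
  assumes "U \<subseteq> Rn k" "\<And>x. x \<in> U \<Longrightarrow> \<exists>e>0. cube k x e \<subseteq> U"
  shows "openin (euc k) U"
  by (subst openin_subopen) (use assms openin_cube cube_center in \<open>meson subset_iff\<close>)

lemma continuous_on_cubeI:
  fixes f :: "coords \<Rightarrow> real"
  assumes "U \<subseteq> Rn k" "\<And>x d. x \<in> U \<Longrightarrow> d > 0 \<Longrightarrow> \<exists>e>0. \<forall>y\<in>U \<inter> cube k x e. \<bar>f y - f x\<bar> < d"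
  shows "continuous_on U f"
  unfolding continuous_on_topological
proof (intro ballI allI impI)
  fix x and B :: "real set" assume x: "x \<in> U" and B: "open B" "f x \<in> B"
  then obtain d where d: "d > 0" "\<And>t. \<bar>t - f x\<bar> < d \<Longrightarrow> t \<in> B" by (auto simp: open_real)
  obtain e where e: "e > 0" "\<forall>y\<in>U \<inter> cube k x e. \<bar>f y - f x\<bar> < d" using assms(2)[OF x d(1)] by blast
  define A where "A = (\<Inter>i\<in>{..<k}. {y::coords. \<bar>y i - x i\<bar> < e})"
  have "open A" unfolding A_def
    by (intro open_INT ballI open_Collect_less continuous_intros) auto
  moreover have "x \<in> A" using e by (simp add: A_def)
  moreover have "f y \<in> B" if "y \<in> U" "y \<in> A" for y
    using that e(2) d(2) assms(1) by (auto simp: A_def cube_def)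
  ultimately show "\<exists>A. open A \<and> x \<in> A \<and> (\<forall>y\<in>U. y \<in> A \<longrightarrow> f y \<in> B)" by blast
qed

lemma continuous_on_cube:
  fixes f :: "coords \<Rightarrow> real"
  assumes "openin (euc k) U" "continuous_on U f" "x \<in> U" "d > 0"
  obtains e where "e > 0" "cube k x e \<subseteq> U" "\<And>y. y \<in> cube k x e \<Longrightarrow> \<bar>f y - f x\<bar> < d"
proof -
  have "openin (top_of_set U) (U \<inter> f -` ball (f x) d)"
    using assms(2) by (intro continuous_openin_preimage_gen) auto
  then have "openin (euc k) (U \<inter> f -` ball (f x) d)"
    using assms(1) openin_trans euc_eq_top_of_set by metis
  then obtain e where "e > 0" "cube k x e \<subseteq> U \<inter> f -` ball (f x) d"
    using openin_imp_cube[of k "U \<inter> f -` ball (f x) d" x] assms by auto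
  then show thesis using that[of e] by (auto simp: dist_real_def subset_iff abs_minus_commute)
qed

lemma continuous_on_coordsI:
  fixes g :: "'b::topological_space \<Rightarrow> coords"
  assumes "\<And>i. i < k \<Longrightarrow> continuous_on U (\<lambda>x. g x i)" "\<And>x. x \<in> U \<Longrightarrow> g x \<in> Rn k"
  shows "continuous_on U g"
proof (rule continuous_on_coordinatewise_then_product)
  fix i
  show "continuous_on U (\<lambda>x. g x i)"
  proof (cases "i < k")
    case False
    have "continuous_on U (\<lambda>x. undefined :: real)" by simp
    then show ?thesis
      by (rule continuous_on_eq) (use False assms(2) in \<open>auto simp: Rn_extensional extensional_def\<close>)
  qed (use assms in auto)
qed

lemma continuous_on_upd: "continuous_on S (\<lambda>t. (x::coords)(i := t))"
proof (rule continuous_on_coordinatewise_then_product)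
  show "continuous_on S (\<lambda>t. (x(i := t)) j)" for j by (cases "j = i") auto
qed

text \<open>With \<open>nhds\<close> instead of \<open>at\<close>, as the congruence rules for
  derivatives also compare the values at the point itself.\<close>

lemma eventually_upd:
  assumes "openin (euc k) U" "x \<in> U" "i < k"
  shows "eventually (\<lambda>t. x(i := t) \<in> U) (nhds (x i))"
proof -
  obtain e where e: "e > 0" "cube k x e \<subseteq> U" using openin_imp_cube assms by metis
  have xR: "x \<in> Rn k" using assms openin_subset by blast
  have "\<bar>t - x i\<bar> < e \<Longrightarrow> x(i := t) \<in> U" for t
    using e Rn_upd[OF xR assms(3)] by (auto simp: cube_def)
  then show ?thesis using e(1) by (auto simp: eventually_nhds_metric dist_real_def)
qed

text \<open>\<open>pd\<close> is a value of \<open>deriv\<close> and says nothing about existence;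
  this predicate carries the differentiability along with the value.\<close>

definition has_pd :: "nat \<Rightarrow> (coords \<Rightarrow> real) \<Rightarrow> real \<Rightarrow> coords \<Rightarrow> bool" where
  "has_pd i f d x \<longleftrightarrow> ((\<lambda>t. f (x(i := t))) has_real_derivative d) (at (x i))"

lemma has_pd_imp_pd: "has_pd i f d x \<Longrightarrow> pd i f x = d"
  by (simp add: has_pd_def pd_def DERIV_imp_deriv)

lemma differentiable_imp_has_pd:
  "(\<lambda>t. f (x(i := t))) differentiable at (x i) \<Longrightarrow> has_pd i f (pd i f x) x"
  unfolding has_pd_def pd_def by (simp add: DERIV_deriv_iff_real_differentiable)

lemma has_pd_imp_differentiable:
  "has_pd i f d x \<Longrightarrow> (\<lambda>t. f (x(i := t))) differentiable at (x i)"
  unfolding has_pd_def using real_differentiable_def by blast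

lemma has_pd_cong:
  assumes "has_pd i f d x" "openin (euc k) U" "x \<in> U" "i < k" "\<And>y. y \<in> U \<Longrightarrow> f y = g y"
  shows "has_pd i g d x"
proof -
  have "eventually (\<lambda>t. f (x(i := t)) = g (x(i := t))) (nhds (x i))"
    using eventually_upd[OF assms(2-4)] by eventually_elim (use assms(5) in auto)
  then show ?thesis using assms(1) unfolding has_pd_def by (simp add: DERIV_cong_ev)
qed

lemma pd_cong:
  assumes "openin (euc k) U" "x \<in> U" "i < k" "\<And>y. y \<in> U \<Longrightarrow> f y = g y"
  shows "pd i f x = pd i g x"
proof -
  have "eventually (\<lambda>t. f (x(i := t)) = g (x(i := t))) (nhds (x i))"
    using eventually_upd[OF assms(1-3)] by eventually_elim (use assms(4) in auto)
  then show ?thesis unfolding pd_def by (intro deriv_cong_ev) auto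
qed

section \<open>Functions of class C^r on open sets\<close>

lemma Ck_on_0_iff: "openin (euc k) U \<Longrightarrow> Ck_on k 0 U f \<longleftrightarrow> continuous_on U f"
  using continuous_map_euc[OF openin_subset] by simp

lemma Ck_on_Suc_iff:
  assumes "openin (euc k) U"
  shows "Ck_on k (Suc r) U f \<longleftrightarrow> continuous_on U f \<and>
    (\<forall>i<k. (\<forall>x\<in>U. has_pd i f (pd i f x) x) \<and> Ck_on k r U (pd i f))"
  using continuous_map_euc[OF openin_subset[OF assms], of f]
  by (auto intro: differentiable_imp_has_pd has_pd_imp_differentiable)

lemma Ck_on_Suc_D: "Ck_on k (Suc r) U f \<Longrightarrow> Ck_on k r U f"
proof (induction r arbitrary: f)
  case (Suc r)
  then have "Ck_on k r U (pd i f)" if "i < k" for i using that by auto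
  then show ?case using Suc.prems by auto
qed auto

lemma Ck_on_subset: "Ck_on k r U f \<Longrightarrow> V \<subseteq> U \<Longrightarrow> Ck_on k r V f"
proof (induction r arbitrary: f)
  case 0
  then show ?case by (auto intro: continuous_map_from_subtopology_mono)
next
  case (Suc r)
  then show ?case by (auto intro: continuous_map_from_subtopology_mono)
qed

lemma Ck_on_pd: "Ck_on k (Suc r) U f \<Longrightarrow> i < k \<Longrightarrow> Ck_on k r U (pd i f)"
  by simp

declare Ck_on.simps [simp del]

lemma Ck_on_cong:
  assumes U: "openin (euc k) U" and "Ck_on k r U f" "\<And>y. y \<in> U \<Longrightarrow> f y = g y"
  shows "Ck_on k r U g"
  using assms(2,3)
proof (induction r arbitrary: f g)
  case 0
  then show ?case by (simp add: Ck_on_0_iff[OF U] cong: continuous_on_cong)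
next
  case (Suc r)
  have eq: "pd i f x = pd i g x" if "x \<in> U" "i < k" for x i
    using pd_cong[OF U that] Suc.prems by blast
  show ?case unfolding Ck_on_Suc_iff[OF U]
  proof (intro conjI allI impI ballI)
    show "continuous_on U g" using Suc.prems by (simp add: Ck_on_Suc_iff[OF U] cong: continuous_on_cong)
    fix i assume i: "i < k"
    show "Ck_on k r U (pd i g)"
      by (rule Suc.IH[of "pd i f"]) (use Suc.prems i eq Ck_on_Suc_iff[OF U] in auto)
    fix x assume x: "x \<in> U"
    show "has_pd i g (pd i g x) x"
    proof -
      have "has_pd i f (pd i f x) x" using Suc.prems(1) x i by (simp add: Ck_on_Suc_iff[OF U])
      from has_pd_cong[OF this U x i Suc.prems(2)] show ?thesis using eq[OF x i] by simp
    qed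
  qed
qed

lemma Ck_on_SucI:
  assumes U: "openin (euc k) U" and "continuous_on U f"
    "\<And>i x. i < k \<Longrightarrow> x \<in> U \<Longrightarrow> has_pd i f (f' i x) x" "\<And>i. i < k \<Longrightarrow> Ck_on k r U (f' i)"
  shows "Ck_on k (Suc r) U f"
  unfolding Ck_on_Suc_iff[OF U]
proof (intro conjI allI impI ballI)
  fix i assume i: "i < k"
  have eq: "pd i f x = f' i x" if "x \<in> U" for x using assms(3)[OF i that] has_pd_imp_pd by blast
  show "Ck_on k r U (pd i f)" using Ck_on_cong[OF U assms(4)[OF i]] eq by metis
  show "has_pd i f (pd i f x) x" if "x \<in> U" for x using assms(3)[OF i that] eq[OF that] by simp
qed fact

lemma Ck_on_le: "Ck_on k r U f \<Longrightarrow> s \<le> r \<Longrightarrow> Ck_on k s U f"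
  by (induction r) (auto simp: le_Suc_eq dest: Ck_on_Suc_D)

lemma Ck_on_continuous: "openin (euc k) U \<Longrightarrow> Ck_on k r U f \<Longrightarrow> continuous_on U f"
  using Ck_on_le[of k r U f 0] Ck_on_0_iff by blast

lemma Ck_on_has_pd: "openin (euc k) U \<Longrightarrow> Ck_on k (Suc r) U f \<Longrightarrow> i < k \<Longrightarrow> x \<in> U \<Longrightarrow> has_pd i f (pd i f x) x"
  by (simp add: Ck_on_Suc_iff)

lemma Ck_on_const: "openin (euc k) U \<Longrightarrow> Ck_on k r U (\<lambda>x. c)"
proof (induction r arbitrary: c)
  case (Suc r)
  then show ?case
    by (intro Ck_on_SucI[where f'="\<lambda>i x. 0"]) (auto simp: has_pd_def)
qed (simp add: Ck_on_0_iff)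

lemma Ck_on_coord: "openin (euc k) U \<Longrightarrow> Ck_on k r U (\<lambda>x. x j)"
proof (cases r)
  case 0
  then show "openin (euc k) U \<Longrightarrow> ?thesis" by (simp add: Ck_on_0_iff continuous_on_coord)
next
  case (Suc r)
  assume U: "openin (euc k) U"
  then show ?thesis unfolding Suc
    by (intro Ck_on_SucI[where f'="\<lambda>i x. if i = j then 1 else 0"] Ck_on_const)
       (auto simp: has_pd_def continuous_on_coord intro!: derivative_eq_intros)
qed

lemma Ck_on_add:
  assumes U: "openin (euc k) U"
  shows "Ck_on k r U f \<Longrightarrow> Ck_on k r U g \<Longrightarrow> Ck_on k r U (\<lambda>x. f x + g x)"
proof (induction r arbitrary: f g)
  case 0
  then show ?case by (simp add: Ck_on_0_iff[OF U] continuous_on_add continuous_on_mult)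
next
  case (Suc r)
  show ?case
  proof (rule Ck_on_SucI[OF U, where f'="\<lambda>i x. pd i f x + pd i g x"])
    show "continuous_on U (\<lambda>x. f x + g x)"
      using Suc.prems Ck_on_continuous[OF U] by (intro continuous_intros) blast+
    fix i assume i: "i < k"
    show "Ck_on k r U (\<lambda>x. pd i f x + pd i g x)"
      using Suc.IH Suc.prems i Ck_on_pd by blast
    fix x assume x: "x \<in> U"
    show "has_pd i (\<lambda>x. f x + g x) (pd i f x + pd i g x) x"
      using Ck_on_has_pd[OF U Suc.prems(1) i x] Ck_on_has_pd[OF U Suc.prems(2) i x]
      unfolding has_pd_def by (rule DERIV_add)
  qed
qed

lemma Ck_on_mult:
  assumes U: "openin (euc k) U"
  shows "Ck_on k r U f \<Longrightarrow> Ck_on k r U g \<Longrightarrow> Ck_on k r U (\<lambda>x. f x * g x)"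
proof (induction r arbitrary: f g)
  case 0
  then show ?case by (simp add: Ck_on_0_iff[OF U] continuous_on_add continuous_on_mult)
next
  case (Suc r)
  show ?case
  proof (rule Ck_on_SucI[OF U, where f'="\<lambda>i x. pd i f x * g x + pd i g x * f x"])
    show "continuous_on U (\<lambda>x. f x * g x)"
      using Suc.prems Ck_on_continuous[OF U] by (intro continuous_intros) blast+
    fix i assume i: "i < k"
    show "Ck_on k r U (\<lambda>x. pd i f x * g x + pd i g x * f x)"
      using Suc.IH Suc.prems i Ck_on_pd Ck_on_Suc_D Ck_on_add[OF U] by metis
    fix x assume x: "x \<in> U"
    show "has_pd i (\<lambda>x. f x * g x) (pd i f x * g x + pd i g x * f x) x"
      using DERIV_mult[OF Ck_on_has_pd[OF U Suc.prems(1) i x, unfolded has_pd_def] Ck_on_has_pd[OF U Suc.prems(2) i x, unfolded has_pd_def]]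
      unfolding has_pd_def by simp
  qed
qed

lemma Ck_on_sum:
  assumes U: "openin (euc k) U"
  shows "(\<And>j. j \<in> I \<Longrightarrow> Ck_on k r U (f j)) \<Longrightarrow> Ck_on k r U (\<lambda>x. \<Sum>j\<in>I. f j x)"
proof (induction I rule: infinite_finite_induct)
  case (insert j I)
  then show ?case using Ck_on_add[OF U, of r "f j"] by simp
qed (auto intro: Ck_on_const[OF U])

lemma Ck_on_uminus: "openin (euc k) U \<Longrightarrow> Ck_on k r U f \<Longrightarrow> Ck_on k r U (\<lambda>x. - f x)"
  using Ck_on_mult[of k U r "\<lambda>x. -1" f] Ck_on_const by auto

lemma Ck_on_diff: "openin (euc k) U \<Longrightarrow> Ck_on k r U f \<Longrightarrow> Ck_on k r U g \<Longrightarrow> Ck_on k r U (\<lambda>x. f x - g x)"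
  using Ck_on_add[of k U r f "\<lambda>x. - g x"] Ck_on_uminus[of k U r g] by auto

text \<open>\<open>G\<close> lists an outer function together with all its derivatives, so that
  differentiating \<open>G s\<close> after f gives \<open>G (Suc s)\<close> after f times a partial
  derivative of f, again of the same shape. Hence s stays arbitrary in the induction on r. The
  exponential and the square root are obtained from this.\<close>

lemma Ck_on_real_compose:
  assumes U: "openin (euc k) U"
    and G: "\<And>s t. t \<in> I \<Longrightarrow> (G s has_real_derivative G (Suc s) t) (at t)"
    and f: "Ck_on k r U f" "\<And>x. x \<in> U \<Longrightarrow> f x \<in> I"
  shows "Ck_on k r U (\<lambda>x. G s (f x))"
  using f
proof (induction r arbitrary: s)
  case 0
  have "continuous_on I (G s)" for s
    using G by (meson DERIV_isCont continuous_at_imp_continuous_on)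
  with 0 have "continuous_on U (\<lambda>x. G s (f x))"
    by (auto simp: Ck_on_0_iff[OF U] intro: continuous_on_compose2[of I])
  then show ?case by (simp add: Ck_on_0_iff[OF U])
next
  case (Suc r)
  have cG: "continuous_on I (G s)" for s
    using G by (meson DERIV_isCont continuous_at_imp_continuous_on)
  show ?case
  proof (rule Ck_on_SucI[OF U, where f'="\<lambda>i x. G (Suc s) (f x) * pd i f x"])
    show "continuous_on U (\<lambda>x. G s (f x))"
      by (rule continuous_on_compose2[OF cG Ck_on_continuous[OF U Suc.prems(1)]]) (use Suc.prems in auto)
    fix i assume i: "i < k"
    show "Ck_on k r U (\<lambda>x. G (Suc s) (f x) * pd i f x)"
      using Suc.IH Suc.prems i Ck_on_pd Ck_on_Suc_D Ck_on_mult[OF U] by metis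
    fix x assume x: "x \<in> U"
    show "has_pd i (\<lambda>x. G s (f x)) (G (Suc s) (f x) * pd i f x) x"
      using DERIV_chain2[of "G s" _ "\<lambda>t. f (x(i := t))" "x i"] G[of "f x" s] Suc.prems(2)[OF x]
        Ck_on_has_pd[OF U Suc.prems(1) i x]
      unfolding has_pd_def by auto
  qed
qed

text \<open>The closed segment leaves open which end point is larger, which saves a case distinction
  wherever the mean value theorem is applied.\<close>

lemma pd_mvt:
  assumes "\<And>t. t \<in> closed_segment a b \<Longrightarrow> has_pd m f (pd m f (y(m := t))) (y(m := t))"
  obtains t where "t \<in> closed_segment a b" "f (y(m := b)) - f (y(m := a)) = pd m f (y(m := t)) * (b - a)"
proof -
  have D: "((\<lambda>s. f (y(m := s))) has_real_derivative pd m f (y(m := t))) (at t)"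
    if "t \<in> closed_segment a b" for t
    using assms[OF that] by (simp add: has_pd_def)
  consider "a < b" | "a = b" | "b < a" by linarith
  then show thesis
  proof cases
    case 1
    then obtain z where "a < z" "z < b" "f (y(m := b)) - f (y(m := a)) = (b - a) * pd m f (y(m := z))"
      using MVT2[OF 1, of "\<lambda>s. f (y(m := s))" "\<lambda>t. pd m f (y(m := t))"] D 
      by (auto simp: closed_segment_eq_real_ivl)
    then show thesis using 1 that[of z] by (auto simp: closed_segment_eq_real_ivl)
  next
    case 2
    then show thesis using that[of a] by auto
  next
    case 3
    then obtain z where "b < z" "z < a" "f (y(m := a)) - f (y(m := b)) = (a - b) * pd m f (y(m := z))"
      using MVT2[OF 3, of "\<lambda>s. f (y(m := s))" "\<lambda>t. pd m f (y(m := t))"] D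
      by (auto simp: closed_segment_eq_real_ivl)
    then show thesis using 3 that[of z] by (auto simp: closed_segment_eq_real_ivl algebra_simps)
  qed
qed

text \<open>Telescoping over the coordinates, with the mean value theorem in each of them.\<close>

lemma chain_rule_curve:
  assumes U: "openin (euc k) U" and f: "Ck_on k 1 U f"
    and g: "g t0 \<in> U" "\<And>s. g s \<in> Rn k"
    and v: "\<And>i. i < k \<Longrightarrow> ((\<lambda>s. g s i) has_real_derivative v i) (at t0)"
  shows "((\<lambda>s. f (g s)) has_real_derivative (\<Sum>i<k. pd i f (g t0) * v i)) (at t0)"
proof -
  define x where "x = g t0"
  have xR: "x \<in> Rn k" using g by (simp add: x_def)
  \<comment> \<open>The first m coordinates come from the curve at s and the others from its value x
    at \<open>t0\<close>, so consecutive points differ in coordinate m only.\<close>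
  define P where "P m s = (\<lambda>j. if j < m then g s j else x j)" for m s
  have P_Rn: "P m s \<in> Rn k" for m s
    using g(2)[of s] xR by (auto simp: P_def Rn_extensional extensional_def)
  have P0: "P 0 s = x" for s by (simp add: P_def)
  have Pk: "P k s = g s" for s
    using g(2)[of s] xR by (auto simp: P_def Rn_extensional extensional_def fun_eq_iff)
  have PS: "P (Suc m) s = (P m s)(m := g s m)" for m s
    by (auto simp: P_def fun_eq_iff)
  have Pid: "P m s = (P m s)(m := x m)" for m s
    by (auto simp: P_def fun_eq_iff)
  have ev: "eventually (\<lambda>s. g s \<in> cube k x e) (at t0)" if "e > 0" for e
  proof -
    have "eventually (\<lambda>s. \<forall>i\<in>{..<k}. \<bar>g s i - x i\<bar> < e) (at t0)"
    proof (rule eventually_ball_finite)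
      show "\<forall>i\<in>{..<k}. eventually (\<lambda>s. \<bar>g s i - x i\<bar> < e) (at t0)"
      proof
        fix i assume "i \<in> {..<k}"
        then have "((\<lambda>s. g s i) \<longlongrightarrow> x i) (at t0)"
          using DERIV_isCont[OF v, of i] by (auto simp: isCont_def x_def)
        then show "eventually (\<lambda>s. \<bar>g s i - x i\<bar> < e) (at t0)"
          using that by (auto simp: tendsto_iff dist_real_def)
      qed
    qed auto
    then show ?thesis by eventually_elim (use g(2) in \<open>auto simp: cube_def\<close>)
  qed
  obtain e0 where e0: "e0 > 0" "cube k x e0 \<subseteq> U"
    using openin_imp_cube[OF U] g(1) x_def by metis
  have step: "((\<lambda>s. f (P (Suc m) s) - f (P m s)) has_real_derivative pd m f x * v m) (at t0)" if m: "m < k" for m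
  proof -
    \<comment> \<open>In every coordinate the intermediate point is no further from x than
      \<open>g s\<close>. It therefore tends to x, and continuity of \<open>pd m f\<close> gives the
      limit of the difference quotient.\<close>
    have "\<exists>z. z \<in> Rn k \<and> (\<forall>i<k. \<bar>z i - x i\<bar> \<le> \<bar>g s i - x i\<bar>) \<and>
        f (P (Suc m) s) - f (P m s) = pd m f z * (g s m - x m)" if s: "g s \<in> cube k x e0" for s
    proof -
      have near: "(P m s)(m := t) \<in> Rn k \<and> (\<forall>i<k. \<bar>((P m s)(m := t)) i - x i\<bar> \<le> \<bar>g s i - x i\<bar>)"
        if "t \<in> closed_segment (x m) (g s m)" for t
      proof (intro conjI allI impI)
        show "(P m s)(m := t) \<in> Rn k" using Rn_upd[OF P_Rn m] .
        fix i assume "i < k"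
        show "\<bar>((P m s)(m := t)) i - x i\<bar> \<le> \<bar>g s i - x i\<bar>"
          using that by (auto simp: P_def closed_segment_eq_real_ivl split: if_splits)
      qed
      have "(P m s)(m := t) \<in> U" if "t \<in> closed_segment (x m) (g s m)" for t
      proof -
        have "(P m s)(m := t) \<in> cube k x e0"
          using near[OF that] s unfolding cube_def by (blast intro: le_less_trans)
        then show ?thesis using e0 by blast
      qed
      then have "has_pd m f (pd m f ((P m s)(m := t))) ((P m s)(m := t))"
        if "t \<in> closed_segment (x m) (g s m)" for t
        using Ck_on_has_pd[OF U, of 0 f m] f m that by (simp add: numeral_eq_Suc)
      from pd_mvt[of "x m" "g s m" m f "P m s", OF this]
      obtain t where "t \<in> closed_segment (x m) (g s m)"
        "f ((P m s)(m := g s m)) - f ((P m s)(m := x m)) = pd m f ((P m s)(m := t)) * (g s m - x m)" by blast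
      then show ?thesis using near PS[of m s] Pid[of m s] by (intro exI[of _ "(P m s)(m := t)"]) auto
    qed
    then obtain z where z: "\<And>s. g s \<in> cube k x e0 \<Longrightarrow> z s \<in> Rn k"
      "\<And>s i. g s \<in> cube k x e0 \<Longrightarrow> i < k \<Longrightarrow> \<bar>z s i - x i\<bar> \<le> \<bar>g s i - x i\<bar>"
      "\<And>s. g s \<in> cube k x e0 \<Longrightarrow> f (P (Suc m) s) - f (P m s) = pd m f (z s) * (g s m - x m)"
      by metis
    have cont: "continuous_on U (pd m f)"
      using Ck_on_continuous[OF U Ck_on_pd[of k 0 U f m]] f m by simp
    have lim: "((\<lambda>s. pd m f (z s)) \<longlongrightarrow> pd m f x) (at t0)"
      unfolding tendsto_iff
    proof (intro allI impI)
      fix d :: real assume "d > 0"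
      then obtain e where e: "e > 0" "\<And>y. y \<in> cube k x e \<Longrightarrow> \<bar>pd m f y - pd m f x\<bar> < d"
        using continuous_on_cube[OF U cont] g(1) x_def by metis
      show "eventually (\<lambda>s. dist (pd m f (z s)) (pd m f x) < d) (at t0)"
        using ev[OF e(1)] ev[OF e0(1)]
      proof eventually_elim
        case (elim s)
        then have "z s \<in> cube k x e" using z(1,2)[of s] by (force simp: cube_def)
        then show ?case using e(2) by (simp add: dist_real_def)
      qed
    qed
    have "((\<lambda>s. (g s m - x m) / (s - t0)) \<longlongrightarrow> v m) (at t0)"
      using v[OF m] by (simp add: has_field_derivative_iff x_def)
    then have "((\<lambda>s. pd m f (z s) * ((g s m - x m) / (s - t0))) \<longlongrightarrow> pd m f x * v m) (at t0)"
      by (intro tendsto_mult lim)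
    moreover have "eventually (\<lambda>s. pd m f (z s) * ((g s m - x m) / (s - t0)) =
        ((f (P (Suc m) s) - f (P m s)) - (f (P (Suc m) t0) - f (P m t0))) / (s - t0)) (at t0)"
      using ev[OF e0(1)]
    proof eventually_elim
      case (elim s)
      have "P (Suc m) t0 = P m t0" by (auto simp: P_def x_def)
      then show ?case using z(3)[OF elim] by simp
    qed
    ultimately show ?thesis
      unfolding has_field_derivative_iff by (rule Lim_transform_eventually)
  qed
  have "(\<lambda>s. f (g s)) = (\<lambda>s. (\<Sum>m<k. f (P (Suc m) s) - f (P m s)) + f x)"
  proof
    show "f (g s) = (\<Sum>m<k. f (P (Suc m) s) - f (P m s)) + f x" for s
      using sum_lessThan_telescope[of "\<lambda>m. f (P m s)" k] by (simp add: P0 Pk)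
  qed
  moreover have "((\<lambda>s. (\<Sum>m<k. f (P (Suc m) s) - f (P m s)) + f x) has_real_derivative (\<Sum>m<k. pd m f x * v m) + 0) (at t0)"
    by (intro DERIV_add DERIV_sum step DERIV_const) auto
  ultimately show ?thesis unfolding x_def[symmetric] by simp
qed

lemma has_pd_compose:
  assumes U: "openin (euc k) U" and f: "Ck_on k 1 U f" and V: "openin (euc l) V"
    and g: "\<And>x. x \<in> V \<Longrightarrow> g x \<in> U" "\<And>i. i < k \<Longrightarrow> has_pd j (\<lambda>x. g x i) (pd j (\<lambda>x. g x i) x) x"
    and x: "x \<in> V" "j < l"
  shows "has_pd j (\<lambda>x. f (g x)) (\<Sum>i<k. pd i f (g x) * pd j (\<lambda>x. g x i) x) x"
proof -
  \<comment> \<open>The curve has to take values in \<open>Rn k\<close> for every parameter, also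
    where \<open>x(j := t)\<close> has left V. There it is set to the constant \<open>g x\<close>,
    which changes nothing near \<open>x j\<close>.\<close>
  define h where "h t = (if x(j := t) \<in> V then g (x(j := t)) else g x)" for t
  have UR: "U \<subseteq> Rn k" using openin_subset[OF U] .
  have ev: "eventually (\<lambda>t. x(j := t) \<in> V) (nhds (x j))" using eventually_upd[OF V x] .
  have "((\<lambda>t. f (h t)) has_real_derivative (\<Sum>i<k. pd i f (h (x j)) * pd j (\<lambda>x. g x i) x)) (at (x j))"
  proof (rule chain_rule_curve[OF U f])
    show "h (x j) \<in> U" using g x by (simp add: h_def)
    show "h s \<in> Rn k" for s using g x UR by (auto simp: h_def)
    fix i assume i: "i < k"
    have "eventually (\<lambda>t. h t i = g (x(j := t)) i) (nhds (x j))"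
      using ev by eventually_elim (simp add: h_def)
    then show "((\<lambda>s. h s i) has_real_derivative pd j (\<lambda>x. g x i) x) (at (x j))"
      using g(2)[OF i] unfolding has_pd_def by (simp add: DERIV_cong_ev)
  qed
  moreover have "eventually (\<lambda>t. f (h t) = f (g (x(j := t)))) (nhds (x j))"
    using ev by eventually_elim (simp add: h_def)
  ultimately show ?thesis using x by (simp add: has_pd_def DERIV_cong_ev h_def)
qed

text \<open>Induction on r with f arbitrary: by the chain rule the derivatives of the composition
  are sums of products of \<open>pd i f\<close> after g, covered by the induction hypothesis, with
  derivatives of g.\<close>

lemma Ck_on_compose:
  assumes U: "openin (euc k) U" and V: "openin (euc l) V"
  shows "Ck_on k r U f \<Longrightarrow> (\<And>i. i < k \<Longrightarrow> Ck_on l r V (\<lambda>x. g x i)) \<Longrightarrow> (\<And>x. x \<in> V \<Longrightarrow> g x \<in> U)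
    \<Longrightarrow> Ck_on l r V (\<lambda>x. f (g x))"
proof (induction r arbitrary: f)
  case 0
  have "continuous_on V g"
    using 0 openin_subset[OF U] by (intro continuous_on_coordsI[of k]) (auto simp: Ck_on_0_iff[OF V])
  then have "continuous_on V (\<lambda>x. f (g x))"
    using 0 by (auto simp: Ck_on_0_iff[OF U] intro: continuous_on_compose2[of U f])
  then show ?case by (simp add: Ck_on_0_iff[OF V])
next
  case (Suc r)
  have f1: "Ck_on k 1 U f" using Ck_on_le[OF Suc.prems(1)] by simp
  have g: "has_pd j (\<lambda>x. g x i) (pd j (\<lambda>x. g x i) x) x" if "i < k" "j < l" "x \<in> V" for i j x
    using Ck_on_has_pd[OF V Suc.prems(2)] that by blast
  show ?case
  proof (rule Ck_on_SucI[OF V, where f'="\<lambda>j x. \<Sum>i<k. pd i f (g x) * pd j (\<lambda>x. g x i) x"])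
    have "continuous_on V g"
      using Suc.prems openin_subset[OF U] Ck_on_continuous[OF V] by (intro continuous_on_coordsI[of k]) blast+
    then show "continuous_on V (\<lambda>x. f (g x))"
      using Suc.prems Ck_on_continuous[OF U] by (auto intro: continuous_on_compose2[of U f])
    fix j assume j: "j < l"
    show "Ck_on l r V (\<lambda>x. \<Sum>i<k. pd i f (g x) * pd j (\<lambda>x. g x i) x)"
    proof (intro Ck_on_sum[OF V] Ck_on_mult[OF V])
      fix i assume "i \<in> {..<k}"
      then show "Ck_on l r V (\<lambda>x. pd i f (g x))" "Ck_on l r V (pd j (\<lambda>x. g x i))"
        using Suc.IH[of "pd i f"] Suc.prems Ck_on_pd Ck_on_Suc_D j by blast+
    qed
    fix x assume x: "x \<in> V"
    show "has_pd j (\<lambda>x. f (g x)) (\<Sum>i<k. pd i f (g x) * pd j (\<lambda>x. g x i) x) x"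
      using has_pd_compose[OF U f1 V Suc.prems(3) g x j] x j by blast
  qed
qed

lemma pd_compose:
  assumes U: "openin (euc k) U" and f: "Ck_on k 1 U f" and V: "openin (euc l) V"
    and g: "\<And>x. x \<in> V \<Longrightarrow> g x \<in> U" "\<And>i. i < k \<Longrightarrow> Ck_on l 1 V (\<lambda>x. g x i)"
    and x: "x \<in> V" "j < l"
  shows "pd j (\<lambda>x. f (g x)) x = (\<Sum>i<k. pd i f (g x) * pd j (\<lambda>x. g x i) x)"
proof (rule has_pd_imp_pd, rule has_pd_compose[OF U f V g(1)])
  show "has_pd j (\<lambda>x. g x i) (pd j (\<lambda>x. g x i) x) x" if "i < k" for i
    using Ck_on_has_pd[OF V, of 0 "\<lambda>x. g x i"] g(2)[OF that] x by simp
qed (use x in auto)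

text \<open>Two applications of the mean value theorem, one in coordinate i to the difference in
  direction j, the other in coordinate j to the derivative so obtained. The left-hand side is
  symmetric in i and j, and \<open>pd_commute\<close> exploits this.\<close>

lemma second_difference:
  assumes U: "openin (euc k) U" and f: "Ck_on k 2 U f" and ij: "i < k" "j < k" "i \<noteq> j"
    and c: "cube k x e \<subseteq> U" "x \<in> Rn k" and h: "0 < h" "h < e"
  obtains p where "p \<in> cube k x e"
    "f (x(i := x i + h, j := x j + h)) - f (x(i := x i + h)) - f (x(j := x j + h)) + f x = h\<^sup>2 * pd j (pd i f) p"
proof -
  have in_c: "x(i := x i + s, j := x j + t) \<in> cube k x e" if "\<bar>s\<bar> \<le> h" "\<bar>t\<bar> \<le> h" for s t
    using that h ij Rn_upd[OF Rn_upd[OF c(2) ij(1)] ij(2)] by (auto simp: cube_def)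
  have d1: "has_pd i f (pd i f y) y" if "y \<in> U" for y
    using Ck_on_has_pd[OF U, of 1 f i y] f ij that by (simp add: numeral_2_eq_2)
  have d2: "has_pd j (pd i f) (pd j (pd i f) y) y" if "y \<in> U" for y
    using Ck_on_has_pd[OF U, of 0 "pd i f" j y] Ck_on_pd[of k 1 U f i] f ij that by (simp add: numeral_2_eq_2)
  define g where "g s = f (x(i := s, j := x j + h)) - f (x(i := s))" for s
  have dg: "(g has_real_derivative pd i f (x(i := s, j := x j + h)) - pd i f (x(i := s))) (at s)"
    if "x i \<le> s" "s \<le> x i + h" for s
  proof -
    have "x(i := s, j := x j + h) \<in> U" "x(i := s) \<in> U"
      using in_c[of "s - x i" h] in_c[of "s - x i" 0] that h c ij by (auto simp: fun_upd_triv fun_upd_twist[of i j])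
    from d1[OF this(1)] d1[OF this(2)] show ?thesis
      unfolding has_pd_def g_def using ij by (intro DERIV_diff) (auto simp: fun_upd_twist[of i j])
  qed
  obtain s where s: "x i < s" "s < x i + h"
    "g (x i + h) - g (x i) = h * (pd i f (x(i := s, j := x j + h)) - pd i f (x(i := s)))"
    using MVT2[of "x i" "x i + h" g, OF _ dg] h by auto
  have *: "\<exists>t. x j < t \<and> t < x j + h \<and> pd i f (x(i := s, j := x j + h)) - pd i f (x(i := s, j := x j)) =
      h * pd j (pd i f) (x(i := s, j := t))"
  proof -
    have "((\<lambda>t. pd i f (x(i := s, j := t))) has_real_derivative pd j (pd i f) (x(i := s, j := t))) (at t)"
      if "x j \<le> t" "t \<le> x j + h" for t
      using d2[of "x(i := s, j := t)"] in_c[of "s - x i" "t - x j"] c s that by (auto simp: has_pd_def)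
    from MVT2[of "x j" "x j + h" "\<lambda>t. pd i f (x(i := s, j := t))", OF _ this] h show ?thesis by auto
  qed
  obtain t where t: "x j < t" "t < x j + h"
    "pd i f (x(i := s, j := x j + h)) - pd i f (x(i := s)) = h * pd j (pd i f) (x(i := s, j := t))"
  proof -
    have "x(i := s, j := x j) = x(i := s)" using ij by (auto simp: fun_eq_iff)
    then show thesis using that * by auto
  qed
  show thesis
  proof (rule that)
    show "x(i := s, j := t) \<in> cube k x e" using in_c[of "s - x i" "t - x j"] s t by auto
    show "f (x(i := x i + h, j := x j + h)) - f (x(i := x i + h)) - f (x(j := x j + h)) + f x = h\<^sup>2 * pd j (pd i f) (x(i := s, j := t))"
      using s(3) t(3) by (simp add: g_def power2_eq_square algebra_simps)
  qed
qed

lemma pd_commute: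
  assumes U: "openin (euc k) U" and f: "Ck_on k 2 U f" and ij: "i < k" "j < k" and x: "x \<in> U"
  shows "pd j (pd i f) x = pd i (pd j f) x"
proof (cases "i = j")
  case False
  have xR: "x \<in> Rn k" using x openin_subset[OF U] by blast
  have c: "continuous_on U (pd b (pd a f))" if "a < k" "b < k" for a b
    using Ck_on_pd[OF Ck_on_pd[of k "Suc 0" U f a], of b] f that Ck_on_0_iff[OF U] by (simp add: numeral_2_eq_2)
  show ?thesis
  proof (rule ccontr)
    assume ne: "\<not> ?thesis"
    \<comment> \<open>Half the gap: both mixed derivatives vary by less than d on a small cube, so
      if they agree at two points p and q of it, their values at x differ by less than 2 d.\<close>
    define d where "d = \<bar>pd j (pd i f) x - pd i (pd j f) x\<bar> / 2"
    have d: "d > 0" using ne by (simp add: d_def)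
    obtain e1 where e1: "e1 > 0" "cube k x e1 \<subseteq> U" "\<And>y. y \<in> cube k x e1 \<Longrightarrow> \<bar>pd j (pd i f) y - pd j (pd i f) x\<bar> < d"
      using continuous_on_cube[OF U c[OF ij] x d] by blast
    obtain e2 where e2: "e2 > 0" "\<And>y. y \<in> cube k x e2 \<Longrightarrow> \<bar>pd i (pd j f) y - pd i (pd j f) x\<bar> < d"
      using continuous_on_cube[OF U c[OF ij(2,1)] x d] by metis
    define e where "e = min e1 e2"
    have "e \<le> e1" "e \<le> e2" unfolding e_def by simp_all
    then have e: "e > 0" "cube k x e \<subseteq> cube k x e1" "cube k x e \<subseteq> cube k x e2"
      using e1(1) e2(1) by (simp_all only: cube_mono) (simp add: e_def)
    have eU: "cube k x e \<subseteq> U" and h: "0 < e / 2" "e / 2 < e" using e e1 by auto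
    obtain p where p: "p \<in> cube k x e" "f (x(i := x i + e/2, j := x j + e/2)) - f (x(i := x i + e/2)) - f (x(j := x j + e/2)) + f x = (e/2)\<^sup>2 * pd j (pd i f) p"
      using second_difference[OF U f ij False eU xR h] by blast
    obtain q where q: "q \<in> cube k x e" "f (x(j := x j + e/2, i := x i + e/2)) - f (x(j := x j + e/2)) - f (x(i := x i + e/2)) + f x = (e/2)\<^sup>2 * pd i (pd j f) q"
      using second_difference[OF U f ij(2,1) _ eU xR h] False by blast
    have "x(j := x j + e/2, i := x i + e/2) = x(i := x i + e/2, j := x j + e/2)" using False by (auto simp: fun_eq_iff)
    from p(2) q(2)[unfolded this] have "(e/2)\<^sup>2 * pd j (pd i f) p = (e/2)\<^sup>2 * pd i (pd j f) q" by linarith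
    then have "pd j (pd i f) p = pd i (pd j f) q" using e(1) by simp
    then show False
      using e1(3)[of p] e2(2)[of q] p(1) q(1) e(2,3) unfolding d_def by (auto simp: subset_iff abs_if split: if_splits)
  qed
qed simp

section \<open>Change of variables\<close>

lemma space_leb: "space (leb k) = Rn k"
  by (simp add: leb_def space_PiM Rn_extensional PiE_def Pi_def)

lemma measurable_coords:
  assumes "\<And>i. i < k \<Longrightarrow> (\<lambda>x. f x i) \<in> borel_measurable M" "\<And>x. x \<in> space M \<Longrightarrow> f x \<in> Rn k"
  shows "f \<in> M \<rightarrow>\<^sub>M leb k"
  unfolding leb_def using assms
  by (intro measurable_PiM_single') (auto simp: Rn_extensional PiE_def)

lemma measurable_leb_coord: "i < k \<Longrightarrow> (\<lambda>x. x i) \<in> borel_measurable (leb k)"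
  unfolding leb_def using measurable_component_singleton[of i "{..<k}" "\<lambda>_. lborel :: real measure"] by simp

text \<open>An open set of \<open>euc k\<close> is the trace of an open set of the whole function
  space, and the Borel sets there are those of the countable product.\<close>

lemma openin_imp_sets_leb:
  assumes "openin (euc k) U"
  shows "U \<in> sets (leb k)"
proof -
  obtain T where T: "open T" "U = Rn k \<inter> T"
    using assms euc_eq_top_of_set[of k] by (metis openin_open)
  have "(\<lambda>x. x) \<in> leb k \<rightarrow>\<^sub>M PiM UNIV (\<lambda>_. borel :: real measure)"
  proof (rule measurable_PiM_single')
    fix i :: nat
    show "(\<lambda>x. x i) \<in> borel_measurable (leb k)"
    proof (cases "i < k")
      case False
      have "(\<lambda>x. undefined :: real) \<in> borel_measurable (leb k)" by simp
      then show ?thesis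
        by (rule measurable_cong[THEN iffD1, rotated]) (use False in \<open>auto simp: space_leb Rn_extensional extensional_def\<close>)
    qed (rule measurable_leb_coord)
  qed auto
  then have "(\<lambda>x. x) -` T \<inter> space (leb k) \<in> sets (leb k)"
    by (rule measurable_sets) (use T in \<open>simp add: sets_PiM_equal_borel\<close>)
  moreover have "(\<lambda>x. x) -` T \<inter> space (leb k) = U" using T by (auto simp: space_leb)
  ultimately show ?thesis by simp
qed

text \<open>\<open>glued_measure\<close> generates its measurable sets from the open sets of a
  topology; on \<open>euc k\<close> these have to be recognised as the sets of
  \<open>leb k\<close>.\<close>

lemma sets_leb: "sets (leb k) = sigma_sets (Rn k) {U. openin (euc k) U}"
proof
  define S where "S = sigma (Rn k) {U. openin (euc k) U}"
  have sub: "{U. openin (euc k) U} \<subseteq> Pow (Rn k)" using openin_subset by blast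
  have S: "space S = Rn k" "sets S = sigma_sets (Rn k) {U. openin (euc k) U}"
    using sub by (simp_all add: S_def)
  have "(\<lambda>x. x) \<in> S \<rightarrow>\<^sub>M leb k"
  proof (rule measurable_coords)
    fix i :: nat
    show "(\<lambda>x. x i) \<in> borel_measurable S"
    proof (rule borel_measurableI)
      fix T :: "real set" assume "open T"
      then have "openin (top_of_set (Rn k)) (Rn k \<inter> (\<lambda>x. x i) -` T)"
        using continuous_on_coord by (intro continuous_openin_preimage_gen)
      then have "openin (euc k) (Rn k \<inter> (\<lambda>x. x i) -` T)"
        using euc_eq_top_of_set[of k] by metis
      then show "(\<lambda>x. x i) -` T \<inter> space S \<in> sets S" by (auto simp: S Int_commute)
    qed
  qed (simp add: S)
  then have "(\<lambda>x. x) -` A \<inter> space S \<in> sets S" if "A \<in> sets (leb k)" for A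
    using measurable_sets that by blast
  moreover have "(\<lambda>x. x) -` A \<inter> space S = A" if "A \<in> sets (leb k)" for A
    using sets.sets_into_space[OF that] by (auto simp: S space_leb)
  ultimately show "sets (leb k) \<subseteq> sigma_sets (Rn k) {U. openin (euc k) U}" using S by auto
  show "sigma_sets (Rn k) {U. openin (euc k) U} \<subseteq> sets (leb k)"
    using sets.sigma_sets_subset[of "{U. openin (euc k) U}" "leb k"] openin_imp_sets_leb by (auto simp: space_leb)
qed

interpretation lborels: product_sigma_finite "\<lambda>_::nat. lborel :: real measure" ..

interpretation leb: sigma_finite_measure "leb k" for k
  unfolding leb_def by (rule lborels.sigma_finite) simp

text \<open>Tonelli's theorem with coordinate m innermost. The outer measure lives on functions over
  the other indices, which become points of \<open>Rn k\<close> only after the update at m.\<close>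

lemma nn_integral_leb_coord:
  assumes "m < k" "f \<in> borel_measurable (leb k)"
  shows "(\<integral>\<^sup>+x. f x \<partial>leb k) = (\<integral>\<^sup>+x. (\<integral>\<^sup>+t. f (x(m := t)) \<partial>lborel) \<partial>PiM ({..<k} - {m}) (\<lambda>_. lborel))"
proof -
  have "{..<k} = insert m ({..<k} - {m})" using assms by auto
  then show ?thesis
    using lborels.product_nn_integral_insert[of "{..<k} - {m}" m f] assms unfolding leb_def by simp
qed

lemma continuous_on_measurable_restrict_leb:
  fixes f :: "coords \<Rightarrow> real"
  assumes U: "openin (euc k) U" and f: "continuous_on U f"
  shows "f \<in> borel_measurable (restrict_space (leb k) U)"
proof (rule borel_measurableI)
  have sp: "space (restrict_space (leb k) U) = U"
    using openin_subset[OF U] by (auto simp: space_restrict_space space_leb)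
  fix T :: "real set" assume "open T"
  then have "openin (top_of_set U) (U \<inter> f -` T)"
    using f by (intro continuous_openin_preimage_gen)
  then have "openin (euc k) (U \<inter> f -` T)"
    using U openin_trans euc_eq_top_of_set by metis
  then have "U \<inter> f -` T \<in> sets (leb k)" by (rule openin_imp_sets_leb)
  then show "f -` T \<inter> space (restrict_space (leb k) U) \<in> sets (restrict_space (leb k) U)"
    unfolding sp using openin_imp_sets_leb[OF U] sets.sets_into_space
    by (subst sets_restrict_space_iff) (auto simp: space_leb Int_commute Int_absorb2[OF openin_subset[OF U]])
qed

lemma continuous_on_measurable_leb:
  fixes f :: "coords \<Rightarrow> real"
  assumes U: "openin (euc k) U" and f: "continuous_on U f" and B: "B \<in> sets (leb k)" "B \<subseteq> U"
  shows "(\<lambda>x. f x * indicator B x) \<in> borel_measurable (leb k)"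
proof -
  have "f \<in> borel_measurable (restrict_space (leb k) U)" by (rule continuous_on_measurable_restrict_leb[OF U f])
  then have "(\<lambda>x. indicator U x *\<^sub>R f x) \<in> borel_measurable (leb k)"
    using openin_imp_sets_leb[OF U] by (subst (asm) borel_measurable_restrict_space_iff) auto
  then have "(\<lambda>x. (indicator U x *\<^sub>R f x) * indicator B x) \<in> borel_measurable (leb k)"
    using B by measurable
  moreover have "(\<lambda>x. (indicator U x *\<^sub>R f x) * indicator B x) = (\<lambda>x. f x * indicator B x)"
    using B by (auto simp: indicator_def fun_eq_iff)
  ultimately show ?thesis by simp
qed

lemma continuous_on_measurable_ennreal_leb:
  fixes f :: "coords \<Rightarrow> real"
  assumes "openin (euc k) U" "continuous_on U f" "B \<in> sets (leb k)" "B \<subseteq> U"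
  shows "(\<lambda>x. ennreal (f x) * indicator B x) \<in> borel_measurable (leb k)"
proof -
  have "(\<lambda>x. ennreal (f x * indicator B x)) \<in> borel_measurable (leb k)"
    using continuous_on_measurable_leb[OF assms] by measurable
  moreover have "(\<lambda>x. ennreal (f x * indicator B x)) = (\<lambda>x. ennreal (f x) * indicator B x)"
    by (auto simp: indicator_def)
  ultimately show ?thesis by simp
qed

lemma vimage_in_sets_leb:
  assumes U: "openin (euc k) U" and f: "continuous_on U f" "f ` U \<subseteq> Rn l" and B: "B \<in> sets (leb l)"
  shows "U \<inter> f -` B \<in> sets (leb k)"
proof -
  have sp: "space (restrict_space (leb k) U) = U"
    using openin_subset[OF U] by (auto simp: space_restrict_space space_leb)
  have "f \<in> restrict_space (leb k) U \<rightarrow>\<^sub>M leb l"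
  proof (rule measurable_coords)
    show "(\<lambda>x. f x i) \<in> borel_measurable (restrict_space (leb k) U)" for i
      by (rule continuous_on_measurable_restrict_leb[OF U])
        (rule continuous_on_compose2[OF continuous_on_coord f(1)], auto)
  qed (use f sp in auto)
  then have "f -` B \<inter> U \<in> sets (restrict_space (leb k) U)"
    using measurable_sets[OF _ B] sp by metis
  then show ?thesis
    using openin_imp_sets_leb[OF U] by (subst (asm) sets_restrict_space_iff) (auto simp: space_leb Int_commute Int_absorb2[OF openin_subset[OF U]])
qed

text \<open>Change of variables for absolutely integrable functions, applied to the constant 1,
  settles the case of an image of finite measure. As integrability on one side is equivalent to
  integrability on the other, an image of infinite measure forces the integral to be infinite as
  well.\<close>

lemma emeasure_image_real:
  fixes g g' :: "real \<Rightarrow> real"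
  assumes B: "B \<in> sets borel" and gB: "g ` B \<in> sets borel" and inj: "inj_on g B"
    and der: "\<And>t. t \<in> B \<Longrightarrow> (g has_real_derivative g' t) (at t)"
    and meas: "(\<lambda>t. \<bar>g' t\<bar> * indicator B t) \<in> borel_measurable borel"
  shows "emeasure lborel (g ` B) = (\<integral>\<^sup>+t. ennreal \<bar>g' t\<bar> * indicator B t \<partial>lborel)"
proof -
  let ?one = "\<lambda>_::real. 1::real"
  have BL: "B \<in> sets lebesgue" using B by (simp add: sets_completionI_sets)
  have cov: "(\<lambda>x. \<bar>g' x\<bar> * ?one (g x)) absolutely_integrable_on B \<and> integral B (\<lambda>x. \<bar>g' x\<bar> * ?one (g x)) = b
     \<longleftrightarrow> ?one absolutely_integrable_on (g ` B) \<and> integral (g ` B) ?one = b" for b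
    using BL der inj by (intro has_absolute_integral_change_of_variables_1') (auto intro: has_field_derivative_at_within)
  have eq: "(\<integral>\<^sup>+t. ennreal \<bar>g' t\<bar> * indicator B t \<partial>lborel) = (\<integral>\<^sup>+t. ennreal (\<bar>g' t\<bar> * indicator B t) \<partial>lborel)"
    by (intro nn_integral_cong) (auto simp: indicator_def)
  have int1: "?one absolutely_integrable_on (g ` B) \<longleftrightarrow> emeasure lborel (g ` B) < \<infinity>"
    using gB integrable_indicator_iff[of lebesgue "g ` B"]
    by (simp add: set_integrable_def sets_completionI_sets)
  have I1: "integral (g ` B) ?one = measure lborel (g ` B)" if "emeasure lborel (g ` B) < \<infinity>"
    using set_lebesgue_integral_eq_integral(2)[of "g ` B" ?one] int1 that gB
    by (simp add: set_lebesgue_integral_def sets_completionI_sets)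
  have int2: "(\<lambda>x. \<bar>g' x\<bar> * ?one (g x)) absolutely_integrable_on B \<longleftrightarrow> integrable lborel (\<lambda>t. \<bar>g' t\<bar> * indicator B t)"
    using meas by (simp add: set_integrable_def mult.commute[of "indicator _ _"] integrable_completion)
  have I2: "(\<integral>\<^sup>+t. ennreal (\<bar>g' t\<bar> * indicator B t) \<partial>lborel) = ennreal (integral B (\<lambda>x. \<bar>g' x\<bar> * ?one (g x)))"
    if "integrable lborel (\<lambda>t. \<bar>g' t\<bar> * indicator B t)"
  proof -
    have "(\<integral>\<^sup>+t. ennreal (\<bar>g' t\<bar> * indicator B t) \<partial>lborel) = ennreal (LINT t|lborel. \<bar>g' t\<bar> * indicator B t)"
      using that by (intro nn_integral_eq_integral) auto
    also have "(LINT t|lborel. \<bar>g' t\<bar> * indicator B t) = integral B (\<lambda>x. \<bar>g' x\<bar> * ?one (g x))"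
      using set_lebesgue_integral_eq_integral(2)[of B "\<lambda>x. \<bar>g' x\<bar> * ?one (g x)"] int2 that meas
      by (simp add: set_lebesgue_integral_def mult.commute[of "indicator _ _"] integral_completion)
    finally show ?thesis .
  qed
  show ?thesis
  proof (cases "emeasure lborel (g ` B) < \<infinity>")
    case True
    then have "(\<lambda>x. \<bar>g' x\<bar> * ?one (g x)) absolutely_integrable_on B \<and> integral B (\<lambda>x. \<bar>g' x\<bar> * ?one (g x)) = measure lborel (g ` B)"
      using cov[of "measure lborel (g ` B)"] int1 I1 by blast
    then show ?thesis using eq I2 int2 True by (simp add: emeasure_eq_ennreal_measure)
  next
    case False
    have "(\<integral>\<^sup>+t. ennreal (\<bar>g' t\<bar> * indicator B t) \<partial>lborel) = \<infinity>"
    proof (rule ccontr)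
      assume "\<not> ?thesis"
      then have "integrable lborel (\<lambda>t. \<bar>g' t\<bar> * indicator B t)"
        using meas by (intro integrableI_nonneg) (auto simp: less_top)
      then show False using int2 cov int1 False by blast
    qed
    then show ?thesis using False eq by (simp add: less_top[symmetric])
  qed
qed

section \<open>Jacobian matrices and determinants\<close>

definition jac :: "nat \<Rightarrow> (coords \<Rightarrow> coords) \<Rightarrow> coords \<Rightarrow> real mat" where
  "jac k T x = mat k k (\<lambda>(i, j). pd j (\<lambda>y. T y i) x)"

definition jdet :: "nat \<Rightarrow> (coords \<Rightarrow> coords) \<Rightarrow> coords \<Rightarrow> real" where
  "jdet k T x = Determinant.det (jac k T x)"

definition C1_map :: "nat \<Rightarrow> coords set \<Rightarrow> (coords \<Rightarrow> coords) \<Rightarrow> bool" where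
  "C1_map k U T \<longleftrightarrow> T ` U \<subseteq> Rn k \<and> (\<forall>i<k. Ck_on k 1 U (\<lambda>x. T x i))"

lemma jac_carrier [simp]: "jac k T x \<in> carrier_mat k k"
  by (simp add: jac_def)

lemma C1_map_subset: "C1_map k U T \<Longrightarrow> W \<subseteq> U \<Longrightarrow> C1_map k W T"
  unfolding C1_map_def using Ck_on_subset by blast

lemma C1_map_continuous: "openin (euc k) U \<Longrightarrow> C1_map k U T \<Longrightarrow> continuous_on U T"
  unfolding C1_map_def by (intro continuous_on_coordsI[of k]) (auto intro: Ck_on_continuous)

lemma C1_map_compose:
  assumes U: "openin (euc k) U" and V: "openin (euc k) V"
    and f: "C1_map k U f" and g: "C1_map k V g" and gU: "g ` V \<subseteq> U"
  shows "C1_map k V (\<lambda>x. f (g x))"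
  unfolding C1_map_def
proof (intro conjI allI impI)
  show "(\<lambda>x. f (g x)) ` V \<subseteq> Rn k" using f gU by (auto simp: C1_map_def)
  fix i assume "i < k"
  then show "Ck_on k 1 V (\<lambda>x. f (g x) i)"
    using f g gU by (intro Ck_on_compose[OF U V, of 1 "\<lambda>y. f y i" g]) (auto simp: C1_map_def)
qed

lemma jac_compose:
  assumes U: "openin (euc k) U" and V: "openin (euc k) V"
    and f: "C1_map k U f" and g: "C1_map k V g" and gU: "g ` V \<subseteq> U" and x: "x \<in> V"
  shows "jac k (\<lambda>x. f (g x)) x = jac k f (g x) * jac k g x"
proof (rule eq_matI)
  fix i j assume ij: "i < dim_row (jac k f (g x) * jac k g x)" "j < dim_col (jac k f (g x) * jac k g x)"
  then have ij: "i < k" "j < k" by (auto simp: jac_def)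
  have "jac k (\<lambda>x. f (g x)) x $$ (i, j) = (\<Sum>l<k. pd l (\<lambda>y. f y i) (g x) * pd j (\<lambda>x. g x l) x)"
    unfolding jac_def using ij f g gU x
    by (simp, intro pd_compose[OF U _ V]) (auto simp: C1_map_def)
  then show "jac k (\<lambda>x. f (g x)) x $$ (i, j) = (jac k f (g x) * jac k g x) $$ (i, j)"
    using ij by (simp add: jac_def scalar_prod_def lessThan_atLeast0)
qed (auto simp: jac_def)

lemma jdet_compose:
  assumes "openin (euc k) U" "openin (euc k) V"
    "C1_map k U f" "C1_map k V g" "g ` V \<subseteq> U" "x \<in> V"
  shows "jdet k (\<lambda>x. f (g x)) x = jdet k f (g x) * jdet k g x"
  unfolding jdet_def jac_compose[OF assms] by (rule Determinant.det_mult[OF jac_carrier jac_carrier])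

lemma pd_coord: "pd j (\<lambda>y. y i) x = (if i = j then 1 else 0)"
  by (rule has_pd_imp_pd) (auto simp: has_pd_def intro!: derivative_eq_intros)

lemma jdet_cong:
  assumes "openin (euc k) U" "x \<in> U" "\<And>y. y \<in> U \<Longrightarrow> f y = g y"
  shows "jdet k f x = jdet k g x"
proof -
  have "jac k f x = jac k g x"
    unfolding jac_def by (rule eq_matI) (auto intro!: pd_cong[OF assms(1,2)] simp: assms(3))
  then show ?thesis by (simp add: jdet_def)
qed

lemma jdet_id: "jdet k (\<lambda>x. x) x = 1"
proof -
  have "jac k (\<lambda>x. x) x = 1\<^sub>m k" unfolding jac_def by (rule eq_matI) (auto simp: pd_coord)
  then show ?thesis by (simp add: jdet_def)
qed

lemma jdet_left_inverse:
  assumes "openin (euc k) U" "openin (euc k) V"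
    "C1_map k U f" "C1_map k V g" "g ` V \<subseteq> U" "x \<in> V" "\<And>y. y \<in> V \<Longrightarrow> f (g y) = y"
  shows "jdet k f (g x) * jdet k g x = 1"
  using jdet_compose[OF assms(1-6)] jdet_cong[OF assms(2,6), of "\<lambda>x. f (g x)" "\<lambda>x. x"] assms(7) jdet_id by metis

lemma continuous_on_det:
  assumes "\<And>i j. i < k \<Longrightarrow> j < k \<Longrightarrow> continuous_on U (\<lambda>x. H x i j :: real)"
  shows "continuous_on U (\<lambda>x. Determinant.det (mat k k (\<lambda>(i, j). H x i j)))"
proof -
  have eq: "(\<lambda>x. Determinant.det (mat k k (\<lambda>(i, j). H x i j))) =
      (\<lambda>x. \<Sum>p\<in>{p. p permutes {0..<k}}. signof p * (\<Prod>i=0..<k. H x i (p i)))"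
    by (subst det_def'[of _ k]) (auto simp: fun_eq_iff permutes_in_image intro!: sum.cong prod.cong)
  show ?thesis
    unfolding eq by (intro continuous_on_sum continuous_on_mult continuous_on_const continuous_on_prod assms)
      (auto dest: permutes_in_image)
qed

lemma continuous_on_jdet:
  assumes "openin (euc k) U" "C1_map k U T"
  shows "continuous_on U (jdet k T)"
proof -
  have "continuous_on U (pd j (\<lambda>y. T y i))" if "i < k" "j < k" for i j
    using assms Ck_on_pd[of k 0 U "\<lambda>x. T x i" j] that Ck_on_0_iff by (auto simp: C1_map_def)
  then show ?thesis unfolding jdet_def jac_def
    using continuous_on_det[of k U "\<lambda>x i j. pd j (\<lambda>y. T y i) x"] by simp
qed

text \<open>In the Leibniz formula a permutation must fix every row other than m to avoid a zero
  entry, and then it fixes m as well.\<close>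

lemma det_update_row:
  fixes g :: "nat \<Rightarrow> real"
  assumes m: "m < k"
  shows "Determinant.det (mat k k (\<lambda>(i, j). if i = m then g j else if i = j then 1 else 0)) = g m"
proof -
  let ?A = "mat k k (\<lambda>(i, j). if i = m then g j else if i = j then 1 else 0)"
  have "Determinant.det ?A = (\<Sum>p\<in>{p. p permutes {0..<k}}. signof p * (\<Prod>i=0..<k. ?A $$ (i, p i)))"
    by (rule det_def') simp
  also have "\<dots> = (\<Sum>p\<in>{id}. signof p * (\<Prod>i=0..<k. ?A $$ (i, p i)))"
  proof (rule sum.mono_neutral_right)
    show "\<forall>p\<in>{p. p permutes {0..<k}} - {id}. signof p * (\<Prod>i=0..<k. ?A $$ (i, p i)) = 0"
    proof
      fix p assume p: "p \<in> {p. p permutes {0..<k}} - {id}"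
      then have pp: "p permutes {0..<k}" by simp
      have "\<exists>i<k. i \<noteq> m \<and> p i \<noteq> i"
      proof (rule ccontr)
        assume "\<not> ?thesis"
        then have a: "p i = i" if "i \<noteq> m" for i using that pp by (cases "i < k") (auto simp: permutes_def)
        have "p m = m" using a permutes_inj[OF pp] by (metis inj_eq)
        then have "p = id" using a by (metis eq_id_iff)
        then show False using p by simp
      qed
      then obtain i where i: "i < k" "i \<noteq> m" "p i \<noteq> i" by blast
      have "p i < k" using pp i permutes_in_image[OF pp, of i] by auto
      then have "?A $$ (i, p i) = 0" using i by simp
      then have "(\<Prod>i=0..<k. ?A $$ (i, p i)) = 0" using i by (intro prod_zero) auto
      then show "signof p * (\<Prod>i=0..<k. ?A $$ (i, p i)) = 0" by simp
    qed
  qed (auto simp: finite_permutations permutes_id)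
  also have "\<dots> = (\<Prod>i=0..<k. if i = m then g m else 1)" 
  proof -
    have "(\<Prod>i=0..<k. ?A $$ (i, id i)) = (\<Prod>i=0..<k. if i = m then g m else 1)" by (rule prod.cong) auto
    then show ?thesis by simp
  qed
  also have "\<dots> = g m" using m by (simp add: prod.delta)
  finally show ?thesis .
qed

text \<open>Row m is a combination of the later unit rows with its own entries as coefficients;
  \<open>v\<close> lists the coefficients of this linear relation. Used contrapositively: a
  nonsingular Jacobian matrix whose rows after m are unit rows has a non-zero entry in row m at some
  column up to m.\<close>

lemma det_zero_row_mod_units:
  fixes A :: "real mat"
  assumes A: "A \<in> carrier_mat k k" and m: "m < k"
    and unit: "\<And>i j. m < i \<Longrightarrow> i < k \<Longrightarrow> j < k \<Longrightarrow> A $$ (i, j) = (if i = j then 1 else 0)"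
    and zero: "\<And>j. j \<le> m \<Longrightarrow> A $$ (m, j) = 0"
  shows "Determinant.det A = 0"
proof -
  define v where "v = vec k (\<lambda>r. if r = m then 1 else if r > m then - A $$ (m, r) else 0)"
  have v: "v \<in> carrier_vec k" by (simp add: v_def)
  have "v \<noteq> 0\<^sub>v k"
  proof
    assume "v = 0\<^sub>v k"
    then have "vec_index v m = 0" using m by simp
    then show False using m by (simp add: v_def)
  qed
  moreover have "transpose_mat A *\<^sub>v v = 0\<^sub>v k"
  proof (rule eq_vecI)
    fix c assume "c < dim_vec (0\<^sub>v k :: real vec)"
    then have c: "c < k" by simp
    have "vec_index (transpose_mat A *\<^sub>v v) c = (\<Sum>r=0..<k. A $$ (r, c) * (if r = m then 1 else if r > m then - A $$ (m, r) else 0))"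
      using A c by (auto simp: scalar_prod_def v_def intro!: sum.cong)
    also have "\<dots> = (\<Sum>r=0..<k. (if r = m then A $$ (m, c) else 0) + (if r = c then if c > m then - A $$ (m, c) else 0 else 0))"
      using unit c by (intro sum.cong) auto
    also have "\<dots> = A $$ (m, c) + (if c > m then - A $$ (m, c) else 0)"
      using m c by (simp add: sum.distrib sum.delta)
    also have "\<dots> = 0" using zero[of c] by auto
    finally show "vec_index (transpose_mat A *\<^sub>v v) c = vec_index (0\<^sub>v k) c" using c by simp
  qed (use A in simp)
  ultimately have "Determinant.det (transpose_mat A) = 0"
    using det_0_iff_vec_prod_zero[of "transpose_mat A" k] A v by auto
  then show ?thesis using det_transpose[OF A] by simp
qed

text \<open>Measurability of the image is part of the notion because, in a composition, the image
  under one map is the set to which the formula for the next map is applied.\<close>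

definition volume_formula :: "nat \<Rightarrow> (coords \<Rightarrow> coords) \<Rightarrow> coords set \<Rightarrow> bool" where
  "volume_formula k T W \<longleftrightarrow> (\<forall>B\<in>sets (leb k). B \<subseteq> W \<longrightarrow> T ` B \<in> sets (leb k) \<and>
     emeasure (leb k) (T ` B) = (\<integral>\<^sup>+x. ennreal \<bar>jdet k T x\<bar> * indicator B x \<partial>leb k))"

lemma volume_formula_subset: "volume_formula k T W \<Longrightarrow> W' \<subseteq> W \<Longrightarrow> volume_formula k T W'"
  unfolding volume_formula_def by blast

lemma volume_formula_cong:
  assumes "volume_formula k T W" "openin (euc k) W" "\<And>x. x \<in> W \<Longrightarrow> T x = T' x"
  shows "volume_formula k T' W"
  unfolding volume_formula_def
proof (intro ballI impI)
  fix B assume B: "B \<in> sets (leb k)" "B \<subseteq> W"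
  have "T' ` B = T ` B" using assms(3) B by (metis image_cong subsetD)
  moreover have "(\<integral>\<^sup>+x. ennreal \<bar>jdet k T' x\<bar> * indicator B x \<partial>leb k) = (\<integral>\<^sup>+x. ennreal \<bar>jdet k T x\<bar> * indicator B x \<partial>leb k)"
    using jdet_cong[OF assms(2) _ assms(3)] B by (intro nn_integral_cong) (auto simp: indicator_def)
  ultimately show "T' ` B \<in> sets (leb k) \<and> emeasure (leb k) (T' ` B) = (\<integral>\<^sup>+x. ennreal \<bar>jdet k T' x\<bar> * indicator B x \<partial>leb k)"
    using assms(1) B unfolding volume_formula_def by metis
qed

text \<open>The formula for sets says that T pushes the measure on B with density
  \<open>\<bar>jdet k T x\<bar>\<close> forward to Lebesgue measure on the image of B. Integrating f
  against both gives the formula for functions.\<close>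

lemma nn_integral_volume_formula:
  assumes T: "volume_formula k T W" "openin (euc k) W" "C1_map k W T" "inj_on T W"
    and B: "B \<in> sets (leb k)" "B \<subseteq> W" and f: "(\<lambda>y. f y * indicator (T ` B) y) \<in> borel_measurable (leb k)"
  shows "(\<integral>\<^sup>+y. f y * indicator (T ` B) y \<partial>leb k) = (\<integral>\<^sup>+x. f (T x) * ennreal \<bar>jdet k T x\<bar> * indicator B x \<partial>leb k)"
proof -
  \<comment> \<open>A push-forward needs a measurable map on the whole space, so T is continued by a
    constant off W.\<close>
  define T' where "T' x = (if x \<in> W then T x else restrict (\<lambda>_. 0) {..<k})" for x
  have WR: "W \<subseteq> Rn k" using openin_subset[OF T(2)] .
  have W: "W \<in> sets (leb k)" by (rule openin_imp_sets_leb[OF T(2)])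
  have T'R: "T' x \<in> Rn k" for x using T(3) by (auto simp: T'_def C1_map_def restrict_Rn)
  have mT': "T' \<in> leb k \<rightarrow>\<^sub>M leb k"
  proof (rule measurable_coords)
    fix i assume i: "i < k"
    have "continuous_on W (\<lambda>x. T x i)" using T i by (auto simp: C1_map_def intro: Ck_on_continuous)
    from continuous_on_measurable_leb[OF T(2) this W] have "(\<lambda>x. T x i * indicator W x) \<in> borel_measurable (leb k)" by simp
    moreover have "(\<lambda>x. T x i * indicator W x) = (\<lambda>x. T' x i)" using i by (auto simp: T'_def fun_eq_iff)
    ultimately show "(\<lambda>x. T' x i) \<in> borel_measurable (leb k)" by simp
  qed (rule T'R)
  define w where "w x = ennreal \<bar>jdet k T x\<bar> * indicator B x" for x
  have mw: "w \<in> borel_measurable (leb k)" unfolding w_def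
    using continuous_on_measurable_ennreal_leb[OF T(2) _ B, of "\<lambda>x. \<bar>jdet k T x\<bar>"]
      continuous_on_jdet[OF T(2,3)] by (simp add: continuous_on_rabs)
  have TB: "T ` B \<in> sets (leb k)" using T(1) B by (auto simp: volume_formula_def)
  have eq: "distr (density (leb k) w) (leb k) T' = density (leb k) (indicator (T ` B))"
  proof (rule measure_eqI)
    fix A assume "A \<in> sets (distr (density (leb k) w) (leb k) T')"
    then have A: "A \<in> sets (leb k)" by simp
    have A': "T' -` A \<inter> space (leb k) \<in> sets (leb k)" using measurable_sets[OF mT' A] .
    have BA: "B \<inter> (T' -` A \<inter> space (leb k)) \<in> sets (leb k)" using B A' by auto
    have img: "T ` (B \<inter> (T' -` A \<inter> space (leb k))) = T ` B \<inter> A"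
      using B WR by (auto simp: T'_def space_leb image_iff subset_iff)
    have "emeasure (distr (density (leb k) w) (leb k) T') A = (\<integral>\<^sup>+x. w x * indicator (T' -` A \<inter> space (leb k)) x \<partial>leb k)"
      using A mT' mw A' by (simp add: emeasure_distr emeasure_density)
    also have "\<dots> = (\<integral>\<^sup>+x. ennreal \<bar>jdet k T x\<bar> * indicator (B \<inter> (T' -` A \<inter> space (leb k))) x \<partial>leb k)"
      by (intro nn_integral_cong) (auto simp: w_def indicator_def)
    also have "\<dots> = emeasure (leb k) (T ` B \<inter> A)"
      using T(1)[unfolded volume_formula_def, rule_format, OF BA] B(2) img by (metis (no_types, lifting) inf.coboundedI1)
    also have "\<dots> = (\<integral>\<^sup>+x. indicator (T ` B \<inter> A) x \<partial>leb k)"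
      using A TB by (intro nn_integral_indicator[symmetric]) auto
    also have "\<dots> = (\<integral>\<^sup>+x. indicator (T ` B) x * indicator A x \<partial>leb k)"
      by (simp add: indicator_inter_arith)
    also have "\<dots> = emeasure (density (leb k) (indicator (T ` B))) A"
      using A TB by (subst emeasure_density) auto
    finally show "emeasure (distr (density (leb k) w) (leb k) T') A = emeasure (density (leb k) (indicator (T ` B))) A" .
  qed simp
  define f' where "f' y = f y * indicator (T ` B) y" for y
  have f': "f' \<in> borel_measurable (leb k)" using f by (simp add: f'_def[abs_def])
  have "(\<integral>\<^sup>+y. f y * indicator (T ` B) y \<partial>leb k) = (\<integral>\<^sup>+y. indicator (T ` B) y * f' y \<partial>leb k)"
    by (intro nn_integral_cong) (auto simp: f'_def indicator_def)
  also have "\<dots> = (\<integral>\<^sup>+y. f' y \<partial>density (leb k) (indicator (T ` B)))"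
    using TB f' by (subst nn_integral_density) auto
  also have "\<dots> = (\<integral>\<^sup>+x. f' (T' x) \<partial>density (leb k) w)"
    unfolding eq[symmetric] using mT' f' by (subst nn_integral_distr) auto
  also have "\<dots> = (\<integral>\<^sup>+x. w x * f' (T' x) \<partial>leb k)"
    using mw mT' f' by (subst nn_integral_density) auto
  also have "\<dots> = (\<integral>\<^sup>+x. f (T x) * ennreal \<bar>jdet k T x\<bar> * indicator B x \<partial>leb k)"
    using B(2) by (intro nn_integral_cong) (auto simp: w_def f'_def T'_def indicator_def mult.commute)
  finally show ?thesis .
qed

lemma volume_formula_compose:
  assumes T1: "volume_formula k T1 W1" "openin (euc k) W1" "C1_map k W1 T1" "inj_on T1 W1"
    and T2: "volume_formula k T2 W2" "openin (euc k) W2" "C1_map k W2 T2"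
    and sub: "T1 ` W1 \<subseteq> W2"
  shows "volume_formula k (\<lambda>x. T2 (T1 x)) W1"
  unfolding volume_formula_def
proof (intro ballI impI conjI)
  fix B assume B: "B \<in> sets (leb k)" "B \<subseteq> W1"
  have B1: "T1 ` B \<in> sets (leb k)" "T1 ` B \<subseteq> W2"
    using T1(1) B sub by (auto simp: volume_formula_def)
  have im: "(\<lambda>x. T2 (T1 x)) ` B = T2 ` T1 ` B" by auto
  show "(\<lambda>x. T2 (T1 x)) ` B \<in> sets (leb k)"
    unfolding im using T2(1) B1 by (auto simp: volume_formula_def)
  have "emeasure (leb k) (T2 ` T1 ` B) = (\<integral>\<^sup>+y. ennreal \<bar>jdet k T2 y\<bar> * indicator (T1 ` B) y \<partial>leb k)"
    using T2(1) B1 by (auto simp: volume_formula_def)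
  also have "\<dots> = (\<integral>\<^sup>+x. ennreal \<bar>jdet k T2 (T1 x)\<bar> * ennreal \<bar>jdet k T1 x\<bar> * indicator B x \<partial>leb k)"
    by (rule nn_integral_volume_formula[OF T1 B],
        rule continuous_on_measurable_ennreal_leb[OF T2(2) _ B1])
       (intro continuous_on_rabs continuous_on_jdet T2)
  also have "\<dots> = (\<integral>\<^sup>+x. ennreal \<bar>jdet k (\<lambda>x. T2 (T1 x)) x\<bar> * indicator B x \<partial>leb k)"
    using jdet_compose[OF T2(2) T1(2) T2(3) T1(3) sub] B
    by (intro nn_integral_cong) (auto simp: indicator_def abs_mult ennreal_mult)
  finally show "emeasure (leb k) ((\<lambda>x. T2 (T1 x)) ` B) = (\<integral>\<^sup>+x. ennreal \<bar>jdet k (\<lambda>x. T2 (T1 x)) x\<bar> * indicator B x \<partial>leb k)"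
    unfolding im .
qed

lemma Ck_on_1_has_pd: "openin (euc k) U \<Longrightarrow> Ck_on k 1 U f \<Longrightarrow> i < k \<Longrightarrow> x \<in> U \<Longrightarrow> has_pd i f (pd i f x) x"
  using Ck_on_has_pd[of k U 0 f] by simp

lemma Ck_on_1_continuous_pd: "openin (euc k) U \<Longrightarrow> Ck_on k 1 U f \<Longrightarrow> i < k \<Longrightarrow> continuous_on U (pd i f)"
  using Ck_on_pd[of k 0 U f i] Ck_on_0_iff by simp

text \<open>A map that changes only coordinate m, to the value of g. The sign s treats increasing
  and decreasing g together: \<open>s * g\<close> is strictly increasing along lines in direction m,
  since the domain is a cube and meets them in intervals. The inverse function theorem for such maps
  comes down to the intermediate value theorem in one variable.\<close>

locale primitive_map =
  fixes k m :: nat and a :: coords and e :: real and g :: "coords \<Rightarrow> real" and s :: real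
  assumes m: "m < k" and a: "a \<in> Rn k" and e: "e > 0"
    and g: "Ck_on k 1 (cube k a e) g"
    and s: "\<bar>s\<bar> = 1" and pos: "\<And>x. x \<in> cube k a e \<Longrightarrow> s * pd m g x > 0"
begin

abbreviation "W \<equiv> cube k a e"
definition "T x = x(m := g x)"
definition "V = T ` W"
definition "h y = inv_into W T y m"
definition "S y = y(m := h y)"

lemma openW: "openin (euc k) W" by (rule openin_cube)

lemma W_Rn: "x \<in> W \<Longrightarrow> x \<in> Rn k" by (simp add: cube_def)

lemma W_upd_iff: "x \<in> W \<Longrightarrow> x(m := t) \<in> W \<longleftrightarrow> \<bar>t - a m\<bar> < e"
  using m by (auto simp: cube_def Rn_upd)

lemma W_between:
  assumes "y(m := t1) \<in> W" "y(m := t2) \<in> W" "t \<in> closed_segment t1 t2"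
  shows "y(m := t) \<in> W"
proof -
  have "\<bar>t1 - a m\<bar> < e" "\<bar>t2 - a m\<bar> < e"
    using W_upd_iff[OF assms(1), of t1] W_upd_iff[OF assms(1), of t2] assms by auto
  then have "\<bar>t - a m\<bar> < e" using assms(3) by (auto simp: closed_segment_eq_real_ivl split: if_splits)
  then show ?thesis using W_upd_iff[OF assms(1), of t] by auto
qed

lemma mvt:
  assumes "y(m := t1) \<in> W" "y(m := t2) \<in> W"
  obtains t where "t \<in> closed_segment t1 t2" "y(m := t) \<in> W"
    "g (y(m := t2)) - g (y(m := t1)) = pd m g (y(m := t)) * (t2 - t1)"
proof -
  have "has_pd m g (pd m g (y(m := t))) (y(m := t))" if "t \<in> closed_segment t1 t2" for t
    using W_between[OF assms that] Ck_on_1_has_pd[OF openW g m] by blast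
  then show thesis using pd_mvt[of t1 t2 m g y] that W_between[OF assms] by metis
qed

lemma strict:
  assumes "y(m := t1) \<in> W" "y(m := t2) \<in> W" "t1 < t2"
  shows "s * g (y(m := t1)) < s * g (y(m := t2))"
proof -
  obtain t where t: "y(m := t) \<in> W" "g (y(m := t2)) - g (y(m := t1)) = pd m g (y(m := t)) * (t2 - t1)"
    using mvt[OF assms(1,2)] by blast
  have "s * g (y(m := t2)) - s * g (y(m := t1)) = (s * pd m g (y(m := t))) * (t2 - t1)"
    using t(2) by (simp add: right_diff_distrib[symmetric] mult.assoc)
  also have "\<dots> > 0" using pos[OF t(1)] assms(3) by simp
  finally show ?thesis by simp
qed

lemma inj: "inj_on T W"
proof (rule inj_onI)
  fix x y assume xy: "x \<in> W" "y \<in> W" "T x = T y"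
  have off: "x i = y i" if "i \<noteq> m" for i using fun_cong[OF xy(3), of i] that by (simp add: T_def)
  have gg: "g x = g y" using fun_cong[OF xy(3), of m] by (simp add: T_def)
  have y: "y = x(m := y m)" using off by (auto simp: fun_eq_iff)
  have "x m = y m"
  proof (rule ccontr)
    assume "x m \<noteq> y m"
    then consider "x m < y m" | "y m < x m" by linarith
    then show False
      using strict[of x "x m" "y m"] strict[of x "y m" "x m"] xy y gg by cases auto
  qed
  with y show "x = y" by (metis fun_upd_triv)
qed

lemma h_T: "x \<in> W \<Longrightarrow> h (T x) = x m"
  using inj by (simp add: h_def inv_into_f_f)

lemma S_T: "x \<in> W \<Longrightarrow> S (T x) = x"
  unfolding S_def h_T by (simp add: T_def)

lemma S_in: "y \<in> V \<Longrightarrow> S y \<in> W"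
  using S_T by (auto simp: V_def)

lemma T_S: "y \<in> V \<Longrightarrow> T (S y) = y"
  using S_T by (auto simp: V_def)

lemma g_S: "y \<in> V \<Longrightarrow> g (S y) = y m"
  using fun_cong[OF T_S, of y m] by (simp add: T_def)

lemma S_m: "S y m = h y" by (simp add: S_def)

lemma T_Rn: "x \<in> W \<Longrightarrow> T x \<in> Rn k"
  using Rn_upd[OF W_Rn m] by (simp add: T_def)

text \<open>At distance d/2 from x in direction m the function \<open>s * g\<close> takes values on
  both sides of \<open>s * g x\<close>, with a margin that persists under small changes of the other
  coordinates. The intermediate value theorem then solves \<open>g (y(m := t)) = y m\<close> for
  every y near the image point.\<close>

lemma open_map:
  assumes N: "openin (euc k) N" "N \<subseteq> W"
  shows "openin (euc k) (T ` N)"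
proof (rule openin_euc_cubeI)
  show "T ` N \<subseteq> Rn k" using N T_Rn by auto
  fix y0 assume "y0 \<in> T ` N"
  then obtain x where x: "x \<in> N" "y0 = T x" by blast
  obtain d where d: "d > 0" "cube k x d \<subseteq> N" using openin_imp_cube N x by metis
  have xR: "x \<in> Rn k" using x N W_Rn by blast
  define xp where "xp = x(m := x m + d/2)"
  define xm where "xm = x(m := x m - d/2)"
  have inN: "xp \<in> N" "xm \<in> N"
    using d Rn_upd[OF xR m] by (auto simp: xp_def xm_def cube_def intro!: subsetD[OF d(2)])
  have lt: "s * g x < s * g xp" "s * g xm < s * g x"
    using strict[of x "x m" "x m + d/2"] strict[of x "x m - d/2" "x m"] inN x N d by (auto simp: xp_def xm_def)
  \<comment> \<open>Half of this margin absorbs the change of g at the two end points, the other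
    half the distance of \<open>y m\<close> from \<open>g x\<close>.\<close>
  define \<eta> where "\<eta> = min (s * g xp - s * g x) (s * g x - s * g xm)"
  have \<eta>: "\<eta> > 0" using lt by (simp add: \<eta>_def)
  have cg: "continuous_on W g" by (rule Ck_on_continuous[OF openW g])
  obtain r1 where r1: "r1 > 0" "\<And>y. y \<in> cube k xp r1 \<Longrightarrow> \<bar>g y - g xp\<bar> < \<eta>/2"
    using continuous_on_cube[OF openW cg, of xp "\<eta>/2"] inN N \<eta> by (metis half_gt_zero subsetD)
  obtain r2 where r2: "r2 > 0" "\<And>y. y \<in> cube k xm r2 \<Longrightarrow> \<bar>g y - g xm\<bar> < \<eta>/2"
    using continuous_on_cube[OF openW cg, of xm "\<eta>/2"] inN N \<eta> by (metis half_gt_zero subsetD)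
  define r where "r = min (min r1 r2) (min d (\<eta>/2))"
  have r: "r > 0" "r \<le> r1" "r \<le> r2" "r \<le> d" "r \<le> \<eta>/2" using r1 r2 d \<eta> by (auto simp: r_def)
  have "cube k y0 r \<subseteq> T ` N"
  proof
    fix y assume y: "y \<in> cube k y0 r"
    have yR: "y \<in> Rn k" using y by (simp add: cube_def)
    have off: "\<bar>y i - x i\<bar> < r" if "i < k" "i \<noteq> m" for i using y that x by (auto simp: cube_def T_def)
    have ym: "\<bar>y m - g x\<bar> < \<eta>/2" using y m x r by (auto simp: cube_def T_def)
    have inN: "y(m := t) \<in> N" if "\<bar>t - x m\<bar> < d" for t
      using off that r Rn_upd[OF yR m] by (intro subsetD[OF d(2)]) (force simp: cube_def)
    have "y(m := x m + d/2) \<in> cube k xp r1" "y(m := x m - d/2) \<in> cube k xm r2"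
      using off r1(1) r2(1) r Rn_upd[OF yR m] by (force simp: cube_def xp_def xm_def)+
    then have b: "\<bar>g (y(m := x m + d/2)) - g xp\<bar> < \<eta>/2" "\<bar>g (y(m := x m - d/2)) - g xm\<bar> < \<eta>/2"
      using r1 r2 by blast+
    have s1: "s = 1 \<or> s = -1" using s by linarith
    have le: "s * g (y(m := x m - d/2)) \<le> s * y m" "s * y m \<le> s * g (y(m := x m + d/2))"
      using b ym s1 \<eta>_def by (auto simp: min_def split: if_splits; linarith)+
    have "\<exists>t\<ge>x m - d/2. t \<le> x m + d/2 \<and> s * g (y(m := t)) = s * y m"
    proof (rule IVT'[of "\<lambda>t. s * g (y(m := t))", OF le])
      show "continuous_on {x m - d/2..x m + d/2} (\<lambda>t. s * g (y(m := t)))"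
      proof (intro continuous_on_mult continuous_on_const)
        show "continuous_on {x m - d/2..x m + d/2} (\<lambda>t. g (y(m := t)))"
          by (rule continuous_on_compose2[OF cg continuous_on_upd]) (use inN N d in \<open>auto simp: abs_if split: if_splits\<close>)
      qed
    qed (use d in auto)
    then obtain t where t: "x m - d/2 \<le> t" "t \<le> x m + d/2" "s * g (y(m := t)) = s * y m" by blast
    have gt: "g (y(m := t)) = y m" using t(3) s by auto
    have "y(m := t) \<in> N" using t d by (intro inN) (auto simp: abs_if)
    moreover have "T (y(m := t)) = y" using gt by (simp add: T_def)
    ultimately show "y \<in> T ` N" by (metis imageI)
  qed
  then show "\<exists>e>0. cube k y0 e \<subseteq> T ` N" using r by blast
qed

lemma openV: "openin (euc k) V"
  unfolding V_def by (rule open_map[OF openW]) simp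

text \<open>Openness of T on small cubes around \<open>S y0\<close> amounts to continuity of the
  inverse.\<close>

lemma S_near:
  assumes y: "y0 \<in> V" and d: "d > 0"
  obtains r where "r > 0" "cube k y0 r \<subseteq> V" "\<And>y. y \<in> cube k y0 r \<Longrightarrow> S y \<in> cube k (S y0) d"
proof -
  obtain d1 where d1: "d1 > 0" "cube k (S y0) d1 \<subseteq> W" using openin_imp_cube[OF openW S_in[OF y]] by blast
  define N where "N = cube k (S y0) (min d d1)"
  have N: "openin (euc k) N" "N \<subseteq> W" "N \<subseteq> cube k (S y0) d"
    using d1(2) cube_mono[of "min d d1" d1] cube_mono[of "min d d1" d] unfolding N_def
    by (auto intro: openin_cube)
  have "S y0 \<in> N" using cube_center[OF W_Rn[OF S_in[OF y]], of "min d d1"] d d1 by (simp add: N_def)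
  then have "y0 \<in> T ` N" using T_S[OF y] by (metis imageI)
  then obtain r where r: "r > 0" "cube k y0 r \<subseteq> T ` N" using openin_imp_cube[OF open_map[OF N(1,2)]] by blast
  show thesis
  proof (rule that[OF r(1)])
    show "cube k y0 r \<subseteq> V" using r N by (auto simp: V_def)
    fix y assume "y \<in> cube k y0 r"
    then obtain x where "x \<in> N" "y = T x" using r by blast
    then have "S y = x" using S_T N by blast
    then show "S y \<in> cube k (S y0) d" using \<open>x \<in> N\<close> N by blast
  qed
qed

lemma continuous_h: "continuous_on V h"
proof (rule continuous_on_cubeI)
  show "V \<subseteq> Rn k" using openin_subset[OF openV] .
  fix y0 d :: _ assume y0: "y0 \<in> V" and d: "(d::real) > 0"
  obtain r where "r > 0" "\<And>y. y \<in> cube k y0 r \<Longrightarrow> S y \<in> cube k (S y0) d" using S_near[OF y0 d] by metis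
  then show "\<exists>e>0. \<forall>y\<in>V \<inter> cube k y0 e. \<bar>h y - h y0\<bar> < d"
    using m by (intro exI[of _ r]) (auto simp: cube_def S_m[symmetric])
qed

lemma continuous_S: "continuous_on V S"
proof (rule continuous_on_coordsI[of k])
  show "S y \<in> Rn k" if "y \<in> V" for y using W_Rn[OF S_in[OF that]] .
  show "continuous_on V (\<lambda>x. S x i)" for i
    by (cases "i = m") (auto simp: S_def continuous_h continuous_on_coord)
qed

text \<open>Implicit differentiation. \<open>F\<close> measures by how much the equation defining h
  fails when coordinate m is frozen at \<open>h y0\<close>. The mean value theorem in that
  coordinate writes it as \<open>pd m g\<close> at an intermediate point times the increment of h;
  dividing by \<open>t - c\<close> gives the quotient of derivatives in the limit.\<close>

lemma has_pd_h:
  assumes y0: "y0 \<in> V" and j: "j < k"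
  shows "has_pd j h ((if j = m then 1 else - pd j g (S y0)) / pd m g (S y0)) y0"
proof -
  define c where "c = y0 j"
  define x0 where "x0 = S y0"
  define Y where "Y t = y0(j := t)" for t
  have Yc: "Y c = y0" by (simp add: Y_def c_def)
  have x0W: "x0 \<in> W" using S_in[OF y0] by (simp add: x0_def)
  have x0: "x0 = y0(m := h y0)" by (simp add: x0_def S_def)
  have VR: "y \<in> V \<Longrightarrow> y \<in> Rn k" for y using openin_subset[OF openV] by auto
  have nearY: "eventually (\<lambda>t. Y t \<in> cube k y0 r) (at c)" if "r > 0" for r
  proof -
    have "Y t \<in> cube k y0 r" if "\<bar>t - c\<bar> < r" for t
      using that \<open>r > 0\<close> Rn_upd[OF VR[OF y0] j] by (auto simp: cube_def Y_def c_def)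
    then show ?thesis using that unfolding eventually_at dist_real_def by auto
  qed
  have evV: "eventually (\<lambda>t. Y t \<in> V) (at c)"
  proof -
    obtain r where "r > 0" "cube k y0 r \<subseteq> V" using openin_imp_cube[OF openV y0] by blast
    then show ?thesis using nearY[of r] by (auto elim!: eventually_mono)
  qed
  define F where "F t = Y t m - g ((Y t)(m := h y0))" for t
  have Fc: "F c = 0" using g_S[OF y0] by (simp add: F_def Yc x0[symmetric] x0_def)
  have dF: "(F has_real_derivative (if j = m then 1 else - pd j g x0)) (at c)"
  proof (cases "j = m")
    case True
    then have "F = (\<lambda>t. t - g x0)" by (auto simp: F_def Y_def x0 fun_eq_iff)
    then show ?thesis using True by (auto intro!: derivative_eq_intros)
  next
    case False
    then have F: "F = (\<lambda>t. y0 m - g (x0(j := t)))" by (auto simp: F_def Y_def x0 fun_upd_twist[OF False])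
    have "x0 j = c" using False by (simp add: x0 c_def)
    then show ?thesis using Ck_on_1_has_pd[OF openW g j x0W] False unfolding F has_pd_def
      by (auto intro!: derivative_eq_intros)
  qed
  have ex: "\<exists>z. (z \<in> W \<and> (\<forall>i<k. \<bar>z i - x0 i\<bar> \<le> \<bar>S (Y t) i - x0 i\<bar>)) \<and> F t = pd m g z * (h (Y t) - h y0)" if "Y t \<in> V" for t
  proof -
    have 1: "(Y t)(m := h (Y t)) \<in> W" using S_in[OF that] by (simp add: S_def)
    have 2: "(Y t)(m := h y0) \<in> W" using W_upd_iff[OF 1, of "h y0"] W_upd_iff[OF x0W, of "h y0"] x0W x0 by auto
    obtain v where v: "v \<in> closed_segment (h y0) (h (Y t))" "(Y t)(m := v) \<in> W"
      "g ((Y t)(m := h (Y t))) - g ((Y t)(m := h y0)) = pd m g ((Y t)(m := v)) * (h (Y t) - h y0)"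
      using mvt[OF 2 1] by blast
    have "g ((Y t)(m := h (Y t))) = Y t m" using g_S[OF that] by (simp add: S_def)
    then have "F t = pd m g ((Y t)(m := v)) * (h (Y t) - h y0)" using v(3) by (simp add: F_def)
    moreover have "\<bar>((Y t)(m := v)) i - x0 i\<bar> \<le> \<bar>S (Y t) i - x0 i\<bar>" for i
      using v(1) by (auto simp: S_def x0 closed_segment_eq_real_ivl split: if_splits)
    ultimately show ?thesis using v(2) by blast
  qed
  then obtain z where z: "\<And>t. Y t \<in> V \<Longrightarrow> z t \<in> W" "\<And>t i. Y t \<in> V \<Longrightarrow> i < k \<Longrightarrow> \<bar>z t i - x0 i\<bar> \<le> \<bar>S (Y t) i - x0 i\<bar>"
    "\<And>t. Y t \<in> V \<Longrightarrow> F t = pd m g (z t) * (h (Y t) - h y0)" by metis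
  have lim: "((\<lambda>t. pd m g (z t)) \<longlongrightarrow> pd m g x0) (at c)"
    unfolding tendsto_iff
  proof (intro allI impI)
    fix d :: real assume "d > 0"
    then obtain r where r: "r > 0" "\<And>y. y \<in> cube k x0 r \<Longrightarrow> \<bar>pd m g y - pd m g x0\<bar> < d"
      using continuous_on_cube[OF openW Ck_on_1_continuous_pd[OF openW g m] x0W] by metis
    obtain r' where r': "r' > 0" "\<And>y. y \<in> cube k y0 r' \<Longrightarrow> S y \<in> cube k x0 r"
      using S_near[OF y0 r(1)] x0_def by metis
    show "eventually (\<lambda>t. dist (pd m g (z t)) (pd m g x0) < d) (at c)"
      using evV nearY[OF r'(1)]
    proof eventually_elim
      case (elim t)
      have "\<bar>z t i - x0 i\<bar> < r" if "i < k" for i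
        using z(2)[OF elim(1) that] r'(2)[OF elim(2)] that by (auto simp: cube_def intro: le_less_trans)
      then have "z t \<in> cube k x0 r" using z(1)[OF elim(1)] by (auto simp: cube_def)
      then show ?case using r by (simp add: dist_real_def)
    qed
  qed
  have nz: "pd m g x \<noteq> 0" if "x \<in> W" for x using pos[OF that] by auto
  have "((\<lambda>t. (F t - F c) / (t - c) / pd m g (z t)) \<longlongrightarrow> (if j = m then 1 else - pd j g x0) / pd m g x0) (at c)"
    using dF unfolding has_field_derivative_iff by (intro tendsto_divide lim nz x0W)
  moreover have "eventually (\<lambda>t. (F t - F c) / (t - c) / pd m g (z t) = (h (Y t) - h (Y c)) / (t - c)) (at c)"
    using evV by eventually_elim (use z nz Yc Fc in simp)
  ultimately have "((\<lambda>t. (h (Y t) - h (Y c)) / (t - c)) \<longlongrightarrow> (if j = m then 1 else - pd j g x0) / pd m g x0) (at c)"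
    by (rule Lim_transform_eventually)
  then show ?thesis unfolding has_pd_def has_field_derivative_iff Y_def c_def x0_def by simp
qed

lemma C1_h: "Ck_on k 1 V h"
proof -
  have "Ck_on k (Suc 0) V h"
  proof (rule Ck_on_SucI[OF openV continuous_h has_pd_h])
    fix i assume i: "i < k"
    have c: "continuous_on V (\<lambda>y. pd j g (S y))" if "j < k" for j
      by (rule continuous_on_compose2[OF Ck_on_1_continuous_pd[OF openW g that] continuous_S]) (use S_in in auto)
    show "Ck_on k 0 V (\<lambda>y. (if i = m then 1 else - pd i g (S y)) / pd m g (S y))"
      unfolding Ck_on_0_iff[OF openV]
    proof -
      have "pd m g (S y) \<noteq> 0" if "y \<in> V" for y using pos[OF S_in[OF that]] by auto
      then show "continuous_on V (\<lambda>y. (if i = m then 1 else - pd i g (S y)) / pd m g (S y))"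
        by (cases "i = m") (auto intro!: continuous_intros c m i)
    qed
  qed auto
  then show ?thesis by simp
qed

lemma C1_S: "C1_map k V S"
  unfolding C1_map_def
proof (intro conjI allI impI)
  show "S ` V \<subseteq> Rn k" using S_in W_Rn by auto
  fix i assume "i < k"
  show "Ck_on k 1 V (\<lambda>x. S x i)"
    by (cases "i = m") (simp_all add: S_def C1_h Ck_on_coord[OF openV] flip: One_nat_def)
qed

lemma C1_T: "C1_map k W T"
  unfolding C1_map_def
proof (intro conjI allI impI)
  show "T ` W \<subseteq> Rn k" using T_Rn by auto
  fix i assume "i < k"
  show "Ck_on k 1 W (\<lambda>x. T x i)"
    using g by (cases "i = m") (simp_all add: T_def Ck_on_coord[OF openW] flip: One_nat_def)
qed

lemma jdet_T: "jdet k T x = pd m g x"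
proof -
  have "(\<lambda>y. T y i) = (if i = m then g else (\<lambda>y. y i))" for i by (auto simp: T_def)
  then have "jac k T x = mat k k (\<lambda>(i, j). if i = m then pd j g x else if i = j then 1 else 0)"
    unfolding jac_def by (intro eq_matI) (auto simp: pd_coord)
  then show ?thesis using det_update_row[OF m, of "\<lambda>j. pd j g x"] by (simp add: jdet_def)
qed

text \<open>By Tonelli's theorem it suffices to compare slices in direction m. There T acts as a map
  of one variable with derivative \<open>pd m g\<close>, which is also the Jacobian determinant of
  T.\<close>

lemma volume_formula_T: "volume_formula k T W"
  unfolding volume_formula_def
proof (intro ballI impI conjI)
  fix B assume B: "B \<in> sets (leb k)" "B \<subseteq> W"
  \<comment> \<open>Images of measurable sets are measurable, being preimages under the continuous
    inverse.\<close>
  have TB: "T ` B = V \<inter> S -` B"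
    using B S_T T_S by (auto simp: V_def image_iff)
  show sTB: "T ` B \<in> sets (leb k)" unfolding TB
    by (rule vimage_in_sets_leb[OF openV continuous_S _ B(1)]) (use S_in W_Rn in auto)
  define Q where "Q = PiM ({..<k} - {m}) (\<lambda>_. lborel :: real measure)"
  have spQ: "x(m := t) \<in> Rn k" if "x \<in> space Q" for x t
    using that m by (auto simp: Q_def space_PiM PiE_def Rn_extensional extensional_def)
  have cpd: "continuous_on W (\<lambda>x. \<bar>pd m g x\<bar>)"
    by (intro continuous_on_rabs Ck_on_1_continuous_pd[OF openW g m])
  have meas1: "(\<lambda>t. x(m := t)) \<in> lborel \<rightarrow>\<^sub>M leb k" if "x \<in> space Q" for x
  proof (rule measurable_coords)
    show "(\<lambda>t. (x(m := t)) i) \<in> borel_measurable lborel" for i by (cases "i = m") auto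
  qed (use spQ that in auto)
  have inner: "(\<integral>\<^sup>+t. indicator (T ` B) (x(m := t)) \<partial>lborel) = (\<integral>\<^sup>+t. ennreal \<bar>pd m g (x(m := t))\<bar> * indicator B (x(m := t)) \<partial>lborel)"
    if x: "x \<in> space Q" for x
  proof -
    define Bx where "Bx = {t. x(m := t) \<in> B}"
    define gx where "gx t = g (x(m := t))" for t
    have bBx: "Bx \<in> sets borel" using measurable_sets[OF meas1[OF x] B(1)] by (simp add: Bx_def vimage_def)
    have im: "gx ` Bx = {t. x(m := t) \<in> T ` B}"
    proof (intro equalityI subsetI)
      fix t assume "t \<in> gx ` Bx"
      then obtain r where "x(m := r) \<in> B" "t = gx r" by (auto simp: Bx_def)
      then show "t \<in> {t. x(m := t) \<in> T ` B}" by (auto simp: T_def gx_def intro!: image_eqI[of _ _ "x(m := r)"])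
    next
      fix t assume "t \<in> {t. x(m := t) \<in> T ` B}"
      then obtain b where b: "b \<in> B" "x(m := t) = b(m := g b)" by (auto simp: T_def)
      have "b = x(m := b m)"
      proof
        fix i show "b i = (x(m := b m)) i" using fun_cong[OF b(2), of i] by (cases "i = m") auto
      qed
      moreover have "t = g b" using fun_cong[OF b(2), of m] by simp
      ultimately have "b m \<in> Bx" "t = gx (b m)" using b(1) by (auto simp: Bx_def gx_def)
      then show "t \<in> gx ` Bx" by blast
    qed
    have "(\<lambda>t. \<bar>pd m g (x(m := t))\<bar> * indicator B (x(m := t))) \<in> borel_measurable borel"
      using measurable_compose[OF meas1[OF x] continuous_on_measurable_leb[OF openW cpd B]] by simp
    then have m2: "(\<lambda>t. \<bar>pd m g (x(m := t))\<bar> * indicator Bx t) \<in> borel_measurable borel"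
      by (simp add: Bx_def indicator_def)
    have "(\<integral>\<^sup>+t. indicator (T ` B) (x(m := t)) \<partial>lborel) = (\<integral>\<^sup>+t. indicator (gx ` Bx) t \<partial>lborel)"
      unfolding im by (intro nn_integral_cong) (auto simp: indicator_def)
    also have "\<dots> = emeasure lborel (gx ` Bx)"
      using measurable_sets[OF meas1[OF x] sTB] unfolding im by (simp add: vimage_def)
    also have "\<dots> = (\<integral>\<^sup>+t. ennreal \<bar>pd m g (x(m := t))\<bar> * indicator Bx t \<partial>lborel)"
    proof (rule emeasure_image_real[OF bBx _ _ _ m2])
      show "gx ` Bx \<in> sets borel" using measurable_sets[OF meas1[OF x] sTB] unfolding im by (simp add: vimage_def)
      show "inj_on gx Bx"
      proof (rule inj_onI)
        fix t r assume tr: "t \<in> Bx" "r \<in> Bx" "gx t = gx r"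
        then have "T (x(m := t)) = T (x(m := r))" by (simp add: T_def gx_def)
        then have "x(m := t) = x(m := r)" using inj_onD[OF inj] tr B by (auto simp: Bx_def)
        then show "t = r" by (metis fun_upd_same)
      qed
      fix t assume "t \<in> Bx"
      then have "x(m := t) \<in> W" using B by (auto simp: Bx_def)
      from Ck_on_1_has_pd[OF openW g m this] show "(gx has_real_derivative pd m g (x(m := t))) (at t)"
        by (simp add: has_pd_def gx_def[abs_def])
    qed
    finally show ?thesis by (simp add: Bx_def indicator_def)
  qed
  have "emeasure (leb k) (T ` B) = (\<integral>\<^sup>+x. indicator (T ` B) x \<partial>leb k)" using sTB by simp
  also have "\<dots> = (\<integral>\<^sup>+x. (\<integral>\<^sup>+t. indicator (T ` B) (x(m := t)) \<partial>lborel) \<partial>Q)"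
    unfolding Q_def using sTB by (intro nn_integral_leb_coord[OF m]) auto
  also have "\<dots> = (\<integral>\<^sup>+x. (\<integral>\<^sup>+t. ennreal \<bar>pd m g (x(m := t))\<bar> * indicator B (x(m := t)) \<partial>lborel) \<partial>Q)"
    by (intro nn_integral_cong inner)
  also have "\<dots> = (\<integral>\<^sup>+x. ennreal \<bar>pd m g x\<bar> * indicator B x \<partial>leb k)"
    unfolding Q_def by (rule nn_integral_leb_coord[OF m continuous_on_measurable_ennreal_leb[OF openW cpd B], symmetric])
  finally show "emeasure (leb k) (T ` B) = (\<integral>\<^sup>+x. ennreal \<bar>jdet k T x\<bar> * indicator B x \<partial>leb k)"
    by (simp add: jdet_T)
qed

end


section \<open>Transpositions of coordinates and the general change of variables\<close>

lemma openin_vimage: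
  assumes V: "openin (euc k) V" and f: "continuous_on V f" "f ` V \<subseteq> Rn l" and U: "openin (euc l) U"
  shows "openin (euc k) (V \<inter> f -` U)"
proof -
  obtain T where T: "open T" "U = Rn l \<inter> T" using U euc_eq_top_of_set[of l] by (metis openin_open)
  have "openin (top_of_set V) (V \<inter> f -` T)" using f(1) T(1) by (rule continuous_openin_preimage_gen)
  moreover have "V \<inter> f -` T = V \<inter> f -` U" using f T by auto
  ultimately show ?thesis using V openin_trans euc_eq_top_of_set by metis
qed

definition swp :: "nat \<Rightarrow> nat \<Rightarrow> coords \<Rightarrow> coords" where
  "swp i m x = x(i := x m, m := x i)"

lemma swp_apply: "swp i m x l = x (Transposition.transpose i m l)"
  by (auto simp: swp_def transpose_def)

lemma swp_swp [simp]: "swp i m (swp i m x) = x"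
  by (auto simp: swp_def fun_eq_iff)

lemma swp_Rn: "i < k \<Longrightarrow> m < k \<Longrightarrow> x \<in> Rn k \<Longrightarrow> swp i m x \<in> Rn k"
  by (simp add: swp_def Rn_upd)

lemma image_swp: "i < k \<Longrightarrow> m < k \<Longrightarrow> swp i m ` Rn k \<subseteq> Rn k"
  using swp_Rn by auto

lemma openin_Rn: "openin (euc k) (Rn k)" by simp

lemma C1_swp:
  assumes "i < k" "m < k"
  shows "C1_map k (Rn k) (swp i m)"
  unfolding C1_map_def using assms by (auto simp: swp_apply swp_Rn intro: Ck_on_coord)

lemma pd_swp: "pd m (\<lambda>x. f (swp i m x)) x = pd i f (swp i m x)"
proof -
  have "swp i m (x(m := t)) = (swp i m x)(i := t)" for t by (auto simp: swp_def fun_eq_iff)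
  moreover have "swp i m x i = x m" by (auto simp: swp_def)
  ultimately show ?thesis by (simp add: pd_def)
qed

lemma jdet_swp:
  assumes "i < k" "m < k" "x \<in> Rn k"
  shows "jdet k (swp i m) x \<noteq> 0"
  using jdet_left_inverse[OF openin_Rn openin_Rn C1_swp C1_swp, of i k m i m x] assms image_swp[OF assms(1,2)] by auto

text \<open>The Jacobian matrix of a transposition of coordinates is constant and the map is an
  involution, so the determinant squares to 1.\<close>

lemma abs_jdet_swp:
  assumes "i < k" "m < k" "x \<in> Rn k"
  shows "\<bar>jdet k (swp i m) x\<bar> = 1"
proof -
  have pd: "pd j (\<lambda>y. swp i m y l) x = (if Transposition.transpose i m l = j then 1 else 0)" for j l y
    unfolding swp_apply by (rule pd_coord)
  have "jdet k (swp i m) x = jdet k (swp i m) (swp i m x)"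
    unfolding jdet_def jac_def swp_apply pd_coord ..
  moreover have "jdet k (swp i m) (swp i m x) * jdet k (swp i m) x = 1"
    using jdet_left_inverse[OF openin_Rn openin_Rn C1_swp C1_swp, of i k m i m x] assms image_swp[OF assms(1,2)] by auto
  ultimately have "(jdet k (swp i m) x)\<^sup>2 = 1" by (simp add: power2_eq_square)
  then show ?thesis by (simp add: power2_eq_1_iff abs_eq_iff')
qed

text \<open>All factors of the product measure are equal, so a transposition preserves the measure
  of boxes, and boxes determine the measure.\<close>

lemma distr_swp:
  assumes im: "i < k" "m < k"
  shows "distr (leb k) (leb k) (swp i m) = leb k"
proof -
  let ?t = "Transposition.transpose i m"
  have meas: "swp i m \<in> leb k \<rightarrow>\<^sub>M leb k"
  proof (rule measurable_coords)
    show "(\<lambda>x. swp i m x l) \<in> borel_measurable (leb k)" if "l < k" for l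
      unfolding swp_apply using that im by (intro measurable_leb_coord) (auto simp: Transposition.transpose_def)
  qed (use im swp_Rn in \<open>auto simp: space_leb\<close>)
  have perm: "?t permutes {..<k}" using im by (intro permutes_swap_id) auto
  have lt: "?t l < k \<longleftrightarrow> l < k" for l using im by (auto simp: Transposition.transpose_def)
  have "distr (leb k) (leb k) (swp i m) = PiM {..<k} (\<lambda>_. lborel)"
  proof (rule lborels.PiM_eqI)
    fix A :: "nat \<Rightarrow> real set" assume A: "\<And>l. l \<in> {..<k} \<Longrightarrow> A l \<in> sets lborel"
    have box: "PiE {..<k} A \<in> sets (leb k)" unfolding leb_def using A by (intro sets_PiM_I_finite) auto
    have "swp i m -` PiE {..<k} A \<inter> space (leb k) = PiE {..<k} (\<lambda>l. A (?t l))"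
    proof (intro equalityI subsetI)
      fix x assume x: "x \<in> swp i m -` PiE {..<k} A \<inter> space (leb k)"
      have "x l \<in> A (?t l)" if "l < k" for l
      proof -
        have "swp i m x (?t l) \<in> A (?t l)" using x lt[of l] that by auto
        then show ?thesis by (simp add: swp_apply)
      qed
      then show "x \<in> PiE {..<k} (\<lambda>l. A (?t l))" using x by (auto simp: space_leb Rn_extensional PiE_iff)
    next
      fix x assume x: "x \<in> PiE {..<k} (\<lambda>l. A (?t l))"
      then have xR: "x \<in> Rn k" by (auto simp: Rn_extensional PiE_def)
      have "swp i m x l \<in> A l" if "l < k" for l
      proof -
        have "x (?t l) \<in> A (?t (?t l))" using x lt[of l] that by blast
        then show ?thesis by (simp add: swp_apply)
      qed
      then show "x \<in> swp i m -` PiE {..<k} A \<inter> space (leb k)"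
        using swp_Rn[OF im xR] xR by (auto simp: space_leb Rn_extensional PiE_iff)
    qed
    then have "emeasure (distr (leb k) (leb k) (swp i m)) (PiE {..<k} A) = emeasure (leb k) (PiE {..<k} (\<lambda>l. A (?t l)))"
      using meas box by (simp add: emeasure_distr)
    also have "\<dots> = (\<Prod>l\<in>{..<k}. emeasure lborel (A (?t l)))"
      unfolding leb_def by (rule lborels.emeasure_PiM) (use A lt in auto)
    also have "\<dots> = (\<Prod>l\<in>{..<k}. emeasure lborel (A l))"
      using prod.permute[OF perm, of "\<lambda>l. emeasure lborel (A l)"] by (simp add: comp_def)
    finally show "emeasure (distr (leb k) (leb k) (swp i m)) (PiE {..<k} A) = (\<Prod>l\<in>{..<k}. emeasure lborel (A l))" .
  qed (auto simp: leb_def)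
  then show ?thesis by (simp add: leb_def)
qed

lemma volume_formula_swp:
  assumes im: "i < k" "m < k"
  shows "volume_formula k (swp i m) (Rn k)"
  unfolding volume_formula_def
proof (intro ballI impI conjI)
  fix B assume B: "B \<in> sets (leb k)" "B \<subseteq> Rn k"
  have im_eq: "swp i m ` B = Rn k \<inter> swp i m -` B"
  proof (intro equalityI subsetI)
    fix x assume "x \<in> Rn k \<inter> swp i m -` B"
    then show "x \<in> swp i m ` B" by (intro image_eqI[of _ _ "swp i m x"]) auto
  qed (use B swp_Rn[OF im] in auto)
  have cont: "continuous_on (Rn k) (swp i m)" by (rule C1_map_continuous[OF openin_Rn C1_swp[OF im]])
  show "swp i m ` B \<in> sets (leb k)" unfolding im_eq
    by (rule vimage_in_sets_leb[OF openin_Rn cont _ B(1)]) (use swp_Rn[OF im] in auto)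
  have meas: "swp i m \<in> leb k \<rightarrow>\<^sub>M leb k"
  proof (rule measurable_coords)
    show "(\<lambda>x. swp i m x l) \<in> borel_measurable (leb k)" if "l < k" for l
      unfolding swp_apply using that im by (intro measurable_leb_coord) (auto simp: Transposition.transpose_def)
  qed (use im swp_Rn in \<open>auto simp: space_leb\<close>)
  have "emeasure (leb k) (swp i m ` B) = emeasure (distr (leb k) (leb k) (swp i m)) B"
    using meas B by (simp add: emeasure_distr im_eq space_leb Int_commute)
  also have "\<dots> = emeasure (leb k) B" by (simp add: distr_swp[OF im])
  also have "\<dots> = (\<integral>\<^sup>+x. indicator B x \<partial>leb k)" using B by simp
  also have "\<dots> = (\<integral>\<^sup>+x. ennreal \<bar>jdet k (swp i m) x\<bar> * indicator B x \<partial>leb k)"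
    using abs_jdet_swp[OF im] B by (intro nn_integral_cong) (auto simp: indicator_def)
  finally show "emeasure (leb k) (swp i m ` B) = (\<integral>\<^sup>+x. ennreal \<bar>jdet k (swp i m) x\<bar> * indicator B x \<partial>leb k)" .
qed

text \<open>Induction on the number of coordinates that \<open>T\<close> changes: up to a transposition, \<open>T\<close> is locally a map that
  changes one coordinate only, followed by a map that changes one coordinate fewer.\<close>

lemma volume_formula_local:
  assumes "openin (euc k) U" "a \<in> U" "C1_map k U T" "\<And>x. x \<in> U \<Longrightarrow> jdet k T x \<noteq> 0"
    "\<And>x j. x \<in> U \<Longrightarrow> m \<le> j \<Longrightarrow> j < k \<Longrightarrow> T x j = x j" "m \<le> k"
  shows "\<exists>W. openin (euc k) W \<and> a \<in> W \<and> W \<subseteq> U \<and> inj_on T W \<and> volume_formula k T W"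
  using assms
proof (induction m arbitrary: U T a)
  case 0
  have UR: "U \<subseteq> Rn k" using openin_subset[OF 0(1)] .
  have id: "x = T x" if "x \<in> U" for x
    by (rule Rn_eqI[of _ k]) (use 0 UR that in \<open>auto simp: C1_map_def\<close>)
  have "volume_formula k (\<lambda>x. x) U" unfolding volume_formula_def by (simp add: jdet_id)
  from volume_formula_cong[OF this 0(1) id] have "volume_formula k T U" .
  moreover have "inj_on T U" using id by (metis inj_onI)
  ultimately show ?case using 0(1,2) by blast
next
  case (Suc m)
  note U = Suc.prems(1) and aU = Suc.prems(2) and T = Suc.prems(3) and nz = Suc.prems(4) and fixed = Suc.prems(5)
  have mk: "m < k" using Suc.prems(6) by simp
  have UR: "x \<in> U \<Longrightarrow> x \<in> Rn k" for x using openin_subset[OF U] by auto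
  \<comment> \<open>Otherwise row m of the Jacobian matrix would be a combination of the unit rows
    after it.\<close>
  have "\<exists>i\<le>m. pd i (\<lambda>y. T y m) a \<noteq> 0"
  proof (rule ccontr)
    assume c: "\<not> ?thesis"
    have "Determinant.det (jac k T a) = 0"
    proof (rule det_zero_row_mod_units[OF jac_carrier mk])
      show "jac k T a $$ (m, j) = 0" if "j \<le> m" for j using c that mk by (auto simp: jac_def)
      fix i j assume ij: "m < i" "i < k" "j < k"
      have "pd j (\<lambda>y. T y i) a = pd j (\<lambda>y. y i) a"
        by (rule pd_cong[OF U aU ij(3)]) (use fixed ij in auto)
      then show "jac k T a $$ (i, j) = (if i = j then 1 else 0)" using ij by (simp add: jac_def pd_coord)
    qed
    then show False using nz[OF aU] by (simp add: jdet_def)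
  qed
  then obtain i where i: "i \<le> m" "pd i (\<lambda>y. T y m) a \<noteq> 0" by blast
  have ik: "i < k" using i mk by simp
  let ?\<sigma> = "swp i m"
  have cs: "continuous_on (Rn k) ?\<sigma>" by (rule C1_map_continuous[OF openin_Rn C1_swp[OF ik mk]])
  define U1 where "U1 = Rn k \<inter> ?\<sigma> -` U"
  have U1: "openin (euc k) U1" unfolding U1_def
    by (rule openin_vimage[OF openin_Rn cs _ U]) (use swp_Rn[OF ik mk] in auto)
  have s1: "C1_map k U1 ?\<sigma>" by (rule C1_map_subset[OF C1_swp[OF ik mk]]) (simp add: U1_def)
  \<comment> \<open>The transposition moves the direction with non-zero derivative to place m, so
    that component m of T' can serve as a new coordinate m.\<close>
  define T' where "T' x = T (?\<sigma> x)" for x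
  have T': "C1_map k U1 T'" unfolding T'_def by (rule C1_map_compose[OF U U1 T s1]) (auto simp: U1_def)
  have nz': "jdet k T' x \<noteq> 0" if "x \<in> U1" for x
  proof -
    have "?\<sigma> ` U1 \<subseteq> U" by (auto simp: U1_def)
    from jdet_compose[OF U U1 T s1 this that] show ?thesis
      unfolding T'_def using nz[of "?\<sigma> x"] jdet_swp[OF ik mk, of x] that by (simp add: U1_def)
  qed
  define a' where "a' = ?\<sigma> a"
  have a': "a' \<in> U1" using aU UR[OF aU] swp_Rn[OF ik mk] by (simp add: a'_def U1_def)
  define g where "g x = T' x m" for x
  have g: "Ck_on k 1 U1 g" using T' mk by (simp add: C1_map_def g_def[abs_def])
  have "pd m g a' = pd i (\<lambda>y. T y m) (?\<sigma> a')"
    unfolding g_def[abs_def] T'_def using pd_swp[of m "\<lambda>y. T y m" i a'] by simp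
  then have pda: "pd m g a' \<noteq> 0" using i by (simp add: a'_def)
  obtain e where e: "e > 0" "cube k a' e \<subseteq> U1" "\<And>y. y \<in> cube k a' e \<Longrightarrow> \<bar>pd m g y - pd m g a'\<bar> < \<bar>pd m g a'\<bar>"
    using continuous_on_cube[OF U1 Ck_on_1_continuous_pd[OF U1 g mk] a', of "\<bar>pd m g a'\<bar>"] pda by auto
  interpret pm: primitive_map k m a' e g "sgn (pd m g a')"
  proof
    show "a' \<in> Rn k" using a' openin_subset[OF U1] by auto
    show "Ck_on k 1 (cube k a' e) g" using Ck_on_subset[OF g e(2)] .
    show "\<bar>sgn (pd m g a')\<bar> = 1" using pda by (simp add: sgn_if)
    show "0 < sgn (pd m g a') * pd m g x" if "x \<in> cube k a' e" for x
      using e(3)[OF that] by (auto simp: sgn_if abs_if split: if_splits)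
  qed (use mk e in auto)
  \<comment> \<open>Undoing the primitive map leaves a map that fixes coordinate m as well:
    component m of T' is g, and g after \<open>pm.S\<close> is the coordinate itself. Later
    coordinates stay fixed because the transposition moves only i \<le> m and m.\<close>
  define T2 where "T2 y = T' (pm.S y)" for y
  have SU1: "pm.S ` pm.V \<subseteq> U1" using pm.S_in e by auto
  have T2: "C1_map k pm.V T2" unfolding T2_def by (rule C1_map_compose[OF U1 pm.openV T' pm.C1_S SU1])
  have a'W: "a' \<in> pm.W" using cube_center pm.a e by blast
  have "\<exists>W. openin (euc k) W \<and> pm.T a' \<in> W \<and> W \<subseteq> pm.V \<and> inj_on T2 W \<and> volume_formula k T2 W"
  proof (rule Suc.IH[OF pm.openV _ T2])
    show "pm.T a' \<in> pm.V" using a'W by (simp add: pm.V_def)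
    fix y assume y: "y \<in> pm.V"
    have "jdet k pm.T (pm.S y) * jdet k pm.S y = 1"
      by (rule jdet_left_inverse[OF pm.openW pm.openV pm.C1_T pm.C1_S _ y pm.T_S]) (use pm.S_in in auto)
    then have "jdet k pm.S y \<noteq> 0" by auto
    moreover have "jdet k T2 y = jdet k T' (pm.S y) * jdet k pm.S y"
      unfolding T2_def by (rule jdet_compose[OF U1 pm.openV T' pm.C1_S SU1 y])
    ultimately show "jdet k T2 y \<noteq> 0" using nz'[of "pm.S y"] SU1 y by auto
    fix j assume j: "m \<le> j" "j < k"
    show "T2 y j = y j"
    proof (cases "j = m")
      case True
      then show ?thesis using pm.g_S[OF y] by (simp add: T2_def g_def)
    next
      case False
      have "T2 y j = swp i m (pm.S y) j" unfolding T2_def T'_def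
        using SU1 y j False by (intro fixed) (auto simp: U1_def)
      also have "\<dots> = y j" using False j i by (simp add: swp_def pm.S_def)
      finally show ?thesis .
    qed
  qed (use mk in simp)
  then obtain W2 where W2: "openin (euc k) W2" "pm.T a' \<in> W2" "W2 \<subseteq> pm.V" "inj_on T2 W2" "volume_formula k T2 W2" by blast
  define W1 where "W1 = pm.W \<inter> pm.T -` W2"
  have W1: "openin (euc k) W1" unfolding W1_def
    by (rule openin_vimage[OF pm.openW C1_map_continuous[OF pm.openW pm.C1_T] _ W2(1)]) (use pm.T_Rn in auto)
  have W1s: "W1 \<subseteq> pm.W" "pm.T ` W1 \<subseteq> W2" by (auto simp: W1_def)
  have eqT': "T2 (pm.T x) = T' x" if "x \<in> W1" for x using pm.S_T[of x] that W1s by (auto simp: T2_def)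
  have "volume_formula k (\<lambda>x. T2 (pm.T x)) W1"
    by (rule volume_formula_compose[OF volume_formula_subset[OF pm.volume_formula_T W1s(1)] W1
        C1_map_subset[OF pm.C1_T W1s(1)] inj_on_subset[OF pm.inj W1s(1)] W2(5,1) C1_map_subset[OF T2 W2(3)] W1s(2)])
  from volume_formula_cong[OF this W1 eqT'] have vf1: "volume_formula k T' W1" .
  have inj1: "inj_on T' W1"
  proof (rule inj_onI)
    fix x y assume "x \<in> W1" "y \<in> W1" "T' x = T' y"
    note xy = this
    then have "T2 (pm.T x) = T2 (pm.T y)" by (simp add: eqT')
    then have "pm.T x = pm.T y" using inj_onD[OF W2(4)] xy(1,2) W1s by blast
    then show "x = y" using inj_onD[OF pm.inj] xy(1,2) W1s by blast
  qed
  have W1U1: "W1 \<subseteq> U1" using W1s e by auto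
  define W where "W = Rn k \<inter> ?\<sigma> -` W1"
  have W: "openin (euc k) W" unfolding W_def
    by (rule openin_vimage[OF openin_Rn cs _ W1]) (use swp_Rn[OF ik mk] in auto)
  have aW: "a \<in> W" using a'W W2(2) UR[OF aU] by (simp add: W_def W1_def a'_def)
  have WU: "W \<subseteq> U"
  proof
    fix x assume "x \<in> W"
    then have "?\<sigma> (?\<sigma> x) \<in> U" using W1U1 by (auto simp: W_def U1_def)
    then show "x \<in> U" by simp
  qed
  have injs: "inj_on ?\<sigma> W" by (metis inj_onI swp_swp)
  have WRn: "W \<subseteq> Rn k" by (simp add: W_def)
  have "volume_formula k (\<lambda>x. T' (?\<sigma> x)) W"
    by (rule volume_formula_compose[OF volume_formula_subset[OF volume_formula_swp[OF ik mk] WRn] W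
        C1_map_subset[OF C1_swp[OF ik mk] WRn] injs vf1 W1 C1_map_subset[OF T' W1U1]]) (auto simp: W_def)
  then have vf: "volume_formula k T W" by (simp add: T'_def)
  have "inj_on T W"
  proof (rule inj_onI)
    fix x y assume xy: "x \<in> W" "y \<in> W" "T x = T y"
    then have "T' (?\<sigma> x) = T' (?\<sigma> y)" by (simp add: T'_def)
    then have "?\<sigma> x = ?\<sigma> y" using inj_onD[OF inj1] xy by (auto simp: W_def)
    then show "x = y" by (metis swp_swp)
  qed
  then show ?case using W aW WU vf by blast
qed

text \<open>By the Lindelof property countably many of the local neighbourhoods cover U. B is cut
  along the disjointed cover; injectivity on all of U keeps the images of the pieces disjoint, so
  their measures add up.\<close>

theorem volume_formula_diffeo:
  assumes U: "openin (euc k) U" and T: "C1_map k U T" "\<And>x. x \<in> U \<Longrightarrow> jdet k T x \<noteq> 0" "inj_on T U"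
  shows "volume_formula k T U"
proof -
  define \<W> where "\<W> = {W. openin (euc k) W \<and> W \<subseteq> U \<and> volume_formula k T W}"
  have UR: "U \<subseteq> Rn k" using openin_subset[OF U] .
  have cover: "\<Union>\<W> = U"
  proof
    show "U \<subseteq> \<Union>\<W>"
    proof
      fix a assume "a \<in> U"
      then obtain W where "openin (euc k) W" "a \<in> W" "W \<subseteq> U" "volume_formula k T W"
        using volume_formula_local[OF U _ T(1,2), of a k] by auto
      then show "a \<in> \<Union>\<W>" by (auto simp: \<W>_def)
    qed
  qed (auto simp: \<W>_def)
  have "openin (top_of_set (Rn k)) W" if "W \<in> \<W>" for W using that euc_eq_top_of_set[of k] by (auto simp: \<W>_def)
  then obtain \<V> where \<V>: "\<V> \<subseteq> \<W>" "countable \<V>" "\<Union>\<V> = \<Union>\<W>"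
    using Lindelof_openin[of \<W> "Rn k"] by metis
  \<comment> \<open>The empty set is added so that the enumeration has the right range even for an
    empty cover.\<close>
  define w where "w = from_nat_into (insert {} \<V>)"
  have rw: "range w = insert {} \<V>" unfolding w_def using \<V>(2) by (intro range_from_nat_into) auto
  have vw: "volume_formula k T (w n) \<and> openin (euc k) (w n)" for n
  proof -
    have "w n \<in> insert {} \<V>" using rw by auto
    then show ?thesis using \<V>(1) by (auto simp: \<W>_def volume_formula_def)
  qed
  have Uw: "(\<Union>n. w n) = U" using rw \<V>(3) cover by auto
  show ?thesis unfolding volume_formula_def
  proof (intro ballI impI)
    fix B assume B: "B \<in> sets (leb k)" "B \<subseteq> U"
    define C where "C n = B \<inter> disjointed w n" for n
    have ws: "w n \<in> sets (leb k)" for n using vw openin_imp_sets_leb by blast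
    have "disjointed w n \<in> sets (leb k)" for n
      using sets.range_disjointed_sets[of w "leb k"] ws by auto
    then have Cs: "C n \<in> sets (leb k)" for n using B by (auto simp: C_def)
    have Cw: "C n \<subseteq> w n" for n using disjointed_subset[of w n] by (auto simp: C_def)
    have CB: "(\<Union>n. C n) = B" using B Uw by (auto simp: C_def UN_disjointed_eq simp flip: Int_UN_distrib)
    have dC: "disjoint_family C" using disjoint_family_disjointed[of w]
      by (auto simp: disjoint_family_on_def C_def)
    have TC: "T ` C n \<in> sets (leb k)" "emeasure (leb k) (T ` C n) = (\<integral>\<^sup>+x. ennreal \<bar>jdet k T x\<bar> * indicator (C n) x \<partial>leb k)" for n
      using vw[of n] Cs Cw unfolding volume_formula_def by blast+
    have TB: "T ` B = (\<Union>n. T ` C n)" using CB by auto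
    have dTC: "disjoint_family (\<lambda>n. T ` C n)"
      unfolding disjoint_family_on_def
    proof (intro ballI impI)
      fix p q :: nat assume "p \<noteq> q"
      then have "C p \<inter> C q = {}" using dC by (auto simp: disjoint_family_on_def)
      moreover have "C p \<subseteq> U" "C q \<subseteq> U" using CB B by auto
      ultimately show "T ` C p \<inter> T ` C q = {}" using inj_on_image_Int[OF T(3), of "C p" "C q"] by auto
    qed
    have sTB: "T ` B \<in> sets (leb k)" unfolding TB using TC by auto
    have mj: "(\<lambda>x. ennreal \<bar>jdet k T x\<bar> * indicator (C n) x) \<in> borel_measurable (leb k)" for n
      using Cs CB B continuous_on_jdet[OF U T(1)]
      by (intro continuous_on_measurable_ennreal_leb[OF U] continuous_on_rabs) auto
    have "emeasure (leb k) (T ` B) = (\<Sum>n. emeasure (leb k) (T ` C n))"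
      unfolding TB using TC dTC by (intro suminf_emeasure[symmetric]) auto
    also have "\<dots> = (\<Sum>n. \<integral>\<^sup>+x. ennreal \<bar>jdet k T x\<bar> * indicator (C n) x \<partial>leb k)"
      using TC by simp
    also have "\<dots> = (\<integral>\<^sup>+x. (\<Sum>n. ennreal \<bar>jdet k T x\<bar> * indicator (C n) x) \<partial>leb k)"
      using mj by (intro nn_integral_suminf[symmetric])
    also have "\<dots> = (\<integral>\<^sup>+x. ennreal \<bar>jdet k T x\<bar> * indicator B x \<partial>leb k)"
      using suminf_indicator[OF dC] CB by (simp add: ennreal_suminf_cmult)
    finally show "T ` B \<in> sets (leb k) \<and> emeasure (leb k) (T ` B) = (\<integral>\<^sup>+x. ennreal \<bar>jdet k T x\<bar> * indicator B x \<partial>leb k)"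
      using sTB by simp
  qed
qed

section \<open>Charts of Euclidean space\<close>

lemma smooth_on_cong: "openin (euc k) U \<Longrightarrow> smooth_on k U f \<Longrightarrow> (\<And>y. y \<in> U \<Longrightarrow> f y = g y) \<Longrightarrow> smooth_on k U g"
  unfolding smooth_on_def using Ck_on_cong by blast

lemma smooth_on_subset: "smooth_on k U f \<Longrightarrow> V \<subseteq> U \<Longrightarrow> smooth_on k V f"
  unfolding smooth_on_def using Ck_on_subset by blast

lemma smooth_on_compose:
  assumes "openin (euc k) U" "openin (euc l) V" "smooth_on k U f"
    "\<And>i. i < k \<Longrightarrow> smooth_on l V (\<lambda>x. g x i)" "\<And>x. x \<in> V \<Longrightarrow> g x \<in> U"
  shows "smooth_on l V (\<lambda>x. f (g x))"
  unfolding smooth_on_def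
proof
  show "Ck_on l r V (\<lambda>x. f (g x))" for r
    by (rule Ck_on_compose[OF assms(1,2)]) (use assms in \<open>auto simp: smooth_on_def\<close>)
qed

lemma smooth_on_coord: "openin (euc k) U \<Longrightarrow> smooth_on k U (\<lambda>x. x i)"
  unfolding smooth_on_def by (intro allI Ck_on_coord)

lemma smooth_on_mult: "openin (euc k) U \<Longrightarrow> smooth_on k U f \<Longrightarrow> smooth_on k U g \<Longrightarrow> smooth_on k U (\<lambda>x. f x * g x)"
  unfolding smooth_on_def by (intro allI Ck_on_mult) auto

lemma smooth_on_add: "openin (euc k) U \<Longrightarrow> smooth_on k U f \<Longrightarrow> smooth_on k U g \<Longrightarrow> smooth_on k U (\<lambda>x. f x + g x)"
  unfolding smooth_on_def by (intro allI Ck_on_add) auto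

lemma smooth_on_diff: "openin (euc k) U \<Longrightarrow> smooth_on k U f \<Longrightarrow> smooth_on k U g \<Longrightarrow> smooth_on k U (\<lambda>x. f x - g x)"
  unfolding smooth_on_def by (intro allI Ck_on_diff) auto

lemma smooth_on_const: "openin (euc k) U \<Longrightarrow> smooth_on k U (\<lambda>x. c)"
  unfolding smooth_on_def by (intro allI Ck_on_const)

lemma smooth_on_sum: "openin (euc k) U \<Longrightarrow> (\<And>j. j \<in> I \<Longrightarrow> smooth_on k U (f j)) \<Longrightarrow> smooth_on k U (\<lambda>x. \<Sum>j\<in>I. f j x)"
  unfolding smooth_on_def by (intro allI Ck_on_sum) auto

lemma smooth_on_exp: "openin (euc k) U \<Longrightarrow> smooth_on k U f \<Longrightarrow> smooth_on k U (\<lambda>x. exp (f x :: real))"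
  unfolding smooth_on_def
  by (intro allI Ck_on_real_compose[where G="\<lambda>_. exp" and I=UNIV]) (auto intro: DERIV_exp)

lemma smooth_on_pd: "smooth_on k U f \<Longrightarrow> i < k \<Longrightarrow> smooth_on k U (pd i f)"
  unfolding smooth_on_def using Ck_on_pd by blast

lemma smooth_on_Ck: "smooth_on k U f \<Longrightarrow> Ck_on k r U f"
  by (simp add: smooth_on_def)

lemma smooth_on_continuous: "openin (euc k) U \<Longrightarrow> smooth_on k U f \<Longrightarrow> continuous_on U f"
  using Ck_on_continuous smooth_on_Ck by blast

lemma smooth_on_has_pd: "openin (euc k) U \<Longrightarrow> smooth_on k U f \<Longrightarrow> i < k \<Longrightarrow> x \<in> U \<Longrightarrow> has_pd i f (pd i f x) x"
  using Ck_on_1_has_pd smooth_on_Ck by blast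

lemma smooth_on_pd_commute: "openin (euc k) U \<Longrightarrow> smooth_on k U f \<Longrightarrow> i < k \<Longrightarrow> j < k \<Longrightarrow> x \<in> U \<Longrightarrow> pd j (pd i f) x = pd i (pd j f) x"
  using pd_commute[of k U f i j x] smooth_on_Ck by blast

lemma homeomorphic_map_euc_iff:
  assumes "U \<subseteq> Rn k" "V \<subseteq> Rn l" "f ` U = V" "inj_on f U"
  shows "homeomorphic_map (subtopology (euc k) U) (subtopology (euc l) V) f \<longleftrightarrow>
    continuous_on U f \<and> continuous_on V (inv_into U f)"
proof
  assume h: "homeomorphic_map (subtopology (euc k) U) (subtopology (euc l) V) f"
  then obtain g where g: "homeomorphic_maps (subtopology (euc k) U) (subtopology (euc l) V) f g"
    using homeomorphic_map_maps by blast
  have 1: "continuous_on U f" "continuous_on V g" "\<And>x. x \<in> U \<Longrightarrow> g (f x) = x"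
    using g assms by (auto simp: homeomorphic_maps_def subtopology_euc)
  have "inv_into U f y = g y" if "y \<in> V" for y using that assms 1(3) by (auto simp: inv_into_f_f)
  then have "continuous_on V (inv_into U f)" using 1(2) by (simp cong: continuous_on_cong)
  then show "continuous_on U f \<and> continuous_on V (inv_into U f)" using 1 by simp
next
  assume "continuous_on U f \<and> continuous_on V (inv_into U f)"
  then have "homeomorphic_maps (subtopology (euc k) U) (subtopology (euc l) V) f (inv_into U f)"
    using assms by (auto simp: homeomorphic_maps_def subtopology_euc inv_into_into inv_into_f_f f_inv_into_f)
  then show "homeomorphic_map (subtopology (euc k) U) (subtopology (euc l) V) f"
    using homeomorphic_map_maps by blast
qed

section \<open>Charts compatible with Cartesian coordinates\<close>

abbreviation chart_inv :: "'a chart \<Rightarrow> coords \<Rightarrow> 'a" where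
  "chart_inv c \<equiv> inv_into (fst c) (snd c)"

abbreviation chart_im :: "'a chart \<Rightarrow> coords set" where
  "chart_im c \<equiv> snd c ` fst c"

lemma smooth_atlas_iff:
  "smooth_atlas m X A \<longleftrightarrow>
     (\<Union>c\<in>A. fst c) = topspace X \<and>
     (\<forall>c\<in>A. openin X (fst c) \<and> openin (euc m) (chart_im c) \<and>
        homeomorphic_map (subtopology X (fst c)) (subtopology (euc m) (chart_im c)) (snd c)) \<and>
     (\<forall>c\<in>A. \<forall>c'\<in>A. \<forall>k<m. smooth_on m (snd c ` (fst c \<inter> fst c')) (\<lambda>x. transition c c' x k))"
  unfolding smooth_atlas_def by (simp add: case_prod_unfold)

text \<open>The transitions between c and the identity chart are the coordinate map of c in one
  direction and its inverse in the other, so compatibility amounts to smoothness of both.\<close>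

lemma euc_charts_iff:
  "c \<in> euc_charts n \<longleftrightarrow> openin (euc n) (fst c) \<and> openin (euc n) (chart_im c) \<and> inj_on (snd c) (fst c) \<and>
     (\<forall>k<n. smooth_on n (fst c) (\<lambda>x. snd c x k)) \<and>
     (\<forall>k<n. smooth_on n (chart_im c) (\<lambda>x. chart_inv c x k))" (is "_ \<longleftrightarrow> ?R")
proof
  assume "c \<in> euc_charts n"
  then have a: "smooth_atlas n (euc n) {c, (Rn n, id)}" by (simp add: euc_charts_def)
  have o: "openin (euc n) (fst c)" "openin (euc n) (chart_im c)"
    and h: "homeomorphic_map (subtopology (euc n) (fst c)) (subtopology (euc n) (chart_im c)) (snd c)"
    using a by (simp_all add: smooth_atlas_iff)
  have sub: "fst c \<subseteq> Rn n" using openin_subset[OF o(1)] .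
  have inj: "inj_on (snd c) (fst c)" using homeomorphic_imp_injective_map[OF h] sub by (simp add: inf_absorb2)
  have "smooth_on n (fst c) (\<lambda>x. snd c x k)" if "k < n" for k
  proof (rule smooth_on_cong[OF o(1)])
    show "smooth_on n (fst c) (\<lambda>x. transition (Rn n, id) c x k)"
      using a that sub by (simp add: smooth_atlas_iff inf_absorb2)
    fix y assume "y \<in> fst c"
    then have "inv_into (Rn n) id y = y" using inv_into_f_f[of id "Rn n" y] sub by auto
    then show "transition (Rn n, id) c y k = snd c y k" by (simp add: transition_def)
  qed
  moreover have "smooth_on n (chart_im c) (\<lambda>x. chart_inv c x k)" if "k < n" for k
    using a that sub by (simp add: smooth_atlas_iff inf_absorb1 transition_def)
  ultimately show ?R using o inj by blast
next
  assume R: ?R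
  have sub: "fst c \<subseteq> Rn n" "chart_im c \<subseteq> Rn n" using R openin_subset by blast+
  have id: "inv_into (Rn n) id y = y" if "y \<in> Rn n" for y
    using inv_into_f_f[of id "Rn n" y] that by auto
  have "continuous_on (fst c) (snd c)" "continuous_on (chart_im c) (chart_inv c)"
    using R sub inv_into_into[of _ "snd c" "fst c"]
    by (auto intro!: continuous_on_coordsI[of n] smooth_on_continuous)
  then have h: "homeomorphic_map (subtopology (euc n) (fst c)) (subtopology (euc n) (chart_im c)) (snd c)"
    using R sub by (subst homeomorphic_map_euc_iff) auto
  have "smooth_on n (snd c ` (fst c \<inter> fst c)) (\<lambda>x. transition c c x k)" for k
    using R by (auto simp: transition_def f_inv_into_f intro: smooth_on_cong[OF _ smooth_on_coord])
  moreover have "smooth_on n (snd c ` (fst c \<inter> Rn n)) (\<lambda>x. transition c (Rn n, id) x k)" if "k < n" for k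
    using R sub that by (simp add: transition_def inf_absorb1)
  moreover have "smooth_on n (id ` (Rn n \<inter> fst c)) (\<lambda>x. transition (Rn n, id) c x k)" if "k < n" for k
  proof (rule smooth_on_cong)
    show "openin (euc n) (id ` (Rn n \<inter> fst c))" "smooth_on n (id ` (Rn n \<inter> fst c)) (\<lambda>x. snd c x k)"
      using R sub that by (simp_all add: inf_absorb2)
  qed (auto simp: transition_def id)
  moreover have "smooth_on n (id ` (Rn n \<inter> Rn n)) (\<lambda>x. transition (Rn n, id) (Rn n, id) x k)" for k
    by (rule smooth_on_cong[OF _ smooth_on_coord]) (auto simp: transition_def id)
  moreover have "homeomorphic_map (subtopology (euc n) (Rn n)) (subtopology (euc n) (id ` Rn n)) id" by simp
  ultimately have "smooth_atlas n (euc n) {c, (Rn n, id)}"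
    using R h sub unfolding smooth_atlas_iff by auto
  then show "c \<in> euc_charts n" by (simp add: euc_charts_def)
qed

lemma id_in_euc_charts: "(Rn n, id) \<in> euc_charts n"
proof -
  have id: "inv_into (Rn n) id y = y" if "y \<in> Rn n" for y
    using inv_into_f_f[of id "Rn n" y] that by auto
  have "smooth_on n (Rn n) (\<lambda>x. inv_into (Rn n) id x k)" for k
    by (rule smooth_on_cong[OF openin_Rn smooth_on_coord[OF openin_Rn]]) (simp add: id)
  then show ?thesis
    by (simp add: euc_charts_iff smooth_on_coord)
qed

locale euc_chart =
  fixes n :: nat and c :: "coords chart"
  assumes c: "c \<in> euc_charts n"
begin

abbreviation "U \<equiv> fst c"
abbreviation "\<phi> \<equiv> snd c"
abbreviation "V \<equiv> snd c ` fst c"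
abbreviation "\<psi> \<equiv> inv_into (fst c) (snd c)"

lemma openU: "openin (euc n) U" and openV: "openin (euc n) V" and inj_\<phi>: "inj_on \<phi> U"
  and smooth_\<phi>: "i < n \<Longrightarrow> smooth_on n U (\<lambda>x. \<phi> x i)"
  and smooth_\<psi>: "i < n \<Longrightarrow> smooth_on n V (\<lambda>x. \<psi> x i)"
  using c by (auto simp: euc_charts_iff)

lemma U_Rn: "x \<in> U \<Longrightarrow> x \<in> Rn n" using openin_subset[OF openU] by auto
lemma V_Rn: "x \<in> V \<Longrightarrow> x \<in> Rn n" using openin_subset[OF openV] by auto
lemma \<psi>_in: "y \<in> V \<Longrightarrow> \<psi> y \<in> U" by (rule inv_into_into)
lemma \<phi>_\<psi>: "y \<in> V \<Longrightarrow> \<phi> (\<psi> y) = y" by (simp add: f_inv_into_f)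
lemma \<psi>_\<phi>: "x \<in> U \<Longrightarrow> \<psi> (\<phi> x) = x" using inj_\<phi> by (rule inv_into_f_f)

lemma C1_\<phi>: "C1_map n U \<phi>"
  using smooth_\<phi> smooth_on_Ck V_Rn by (auto simp: C1_map_def)

lemma C1_\<psi>: "C1_map n V \<psi>"
  using smooth_\<psi> smooth_on_Ck U_Rn \<psi>_in by (auto simp: C1_map_def)

lemma continuous_\<phi>: "continuous_on U \<phi>" using C1_map_continuous[OF openU C1_\<phi>] .
lemma continuous_\<psi>: "continuous_on V \<psi>" using C1_map_continuous[OF openV C1_\<psi>] .

lemma homeo: "homeomorphic_map (subtopology (euc n) U) (subtopology (euc n) V) \<phi>"
  using continuous_\<phi> continuous_\<psi> inj_\<phi> openin_subset[OF openU] openin_subset[OF openV]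
  by (subst homeomorphic_map_euc_iff) auto

lemma image_\<phi>: "W \<subseteq> U \<Longrightarrow> \<phi> ` W = V \<inter> \<psi> -` W"
proof (intro equalityI subsetI)
  fix y assume "y \<in> V \<inter> \<psi> -` W"
  then show "y \<in> \<phi> ` W" using \<phi>_\<psi> by (metis IntD1 IntD2 imageI vimageD)
qed (use \<psi>_\<phi> in auto)

lemma open_image_\<phi>: "openin (euc n) W \<Longrightarrow> W \<subseteq> U \<Longrightarrow> openin (euc n) (\<phi> ` W)"
proof -
  assume W: "openin (euc n) W" "W \<subseteq> U"
  have "\<psi> ` V \<subseteq> Rn n" using \<psi>_in U_Rn by blast
  from openin_vimage[OF openV continuous_\<psi> this W(1)] show ?thesis unfolding image_\<phi>[OF W(2)] .
qed

text \<open>\<open>J\<close> is the Jacobian matrix of the inverse chart and \<open>K\<close> that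
  of the chart at the corresponding point; they are inverse to each other. In \<open>J a i\<close>
  the first index is Cartesian and the second belongs to the chart, in \<open>K l a\<close> it is
  the other way round.\<close>

definition J :: "nat \<Rightarrow> nat \<Rightarrow> coords \<Rightarrow> real" where
  "J a i x = pd i (\<lambda>y. \<psi> y a) x"

definition K :: "nat \<Rightarrow> nat \<Rightarrow> coords \<Rightarrow> real" where
  "K l a x = pd a (\<lambda>y. \<phi> y l) (\<psi> x)"

lemma smooth_J: "a < n \<Longrightarrow> i < n \<Longrightarrow> smooth_on n V (J a i)"
  unfolding J_def[abs_def] by (rule smooth_on_pd[OF smooth_\<psi>])

lemma smooth_K: "l < n \<Longrightarrow> a < n \<Longrightarrow> smooth_on n V (K l a)"
  unfolding K_def[abs_def]
  by (rule smooth_on_compose[OF openU openV smooth_on_pd[OF smooth_\<phi>] smooth_\<psi> \<psi>_in])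

lemma K_J:
  assumes x: "x \<in> V" and li: "l < n" "i < n"
  shows "(\<Sum>a<n. K l a x * J a i x) = (if l = i then 1 else 0)"
proof -
  have "pd i (\<lambda>y. \<phi> (\<psi> y) l) x = (\<Sum>a<n. pd a (\<lambda>y. \<phi> y l) (\<psi> x) * pd i (\<lambda>y. \<psi> y a) x)"
    by (rule pd_compose[OF openU smooth_on_Ck[OF smooth_\<phi>[OF li(1)]] openV \<psi>_in smooth_on_Ck[OF smooth_\<psi>] x li(2)])
  moreover have "pd i (\<lambda>y. \<phi> (\<psi> y) l) x = pd i (\<lambda>y. y l) x"
    by (rule pd_cong[OF openV x li(2)]) (simp add: \<phi>_\<psi>)
  ultimately show ?thesis by (simp add: pd_coord K_def J_def)
qed

lemma J_K:
  assumes x: "x \<in> V" and ab: "a < n" "b < n"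
  shows "(\<Sum>l<n. J a l x * K l b x) = (if a = b then 1 else 0)"
proof -
  have \<psi>x: "\<psi> x \<in> U" using \<psi>_in[OF x] .
  have "pd b (\<lambda>y. \<psi> (\<phi> y) a) (\<psi> x) = (\<Sum>l<n. pd l (\<lambda>y. \<psi> y a) (\<phi> (\<psi> x)) * pd b (\<lambda>y. \<phi> y l) (\<psi> x))"
    by (rule pd_compose[OF openV smooth_on_Ck[OF smooth_\<psi>[OF ab(1)]] openU _ smooth_on_Ck[OF smooth_\<phi>] \<psi>x ab(2)]) auto
  moreover have "pd b (\<lambda>y. \<psi> (\<phi> y) a) (\<psi> x) = pd b (\<lambda>y. y a) (\<psi> x)"
    by (rule pd_cong[OF openU \<psi>x ab(2)]) (simp add: \<psi>_\<phi>)
  ultimately show ?thesis using \<phi>_\<psi>[OF x] by (simp add: pd_coord K_def J_def)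
qed

lemma conformal_metric_eq:
  "conformal_metric n u c x i j = exp (2 * u (\<psi> x)) * (\<Sum>k<n. J k i x * J k j x)"
  by (simp add: conformal_metric_def J_def)

end

lemma euc_chartI: "c \<in> euc_charts n \<Longrightarrow> euc_chart n c"
  by (rule euc_chart.intro)

locale two_euc_charts = c1: euc_chart n c + c2: euc_chart n c' for n c c'
begin

abbreviation "W \<equiv> snd c ` (fst c \<inter> fst c')"

lemma openW: "openin (euc n) W"
  by (rule c1.open_image_\<phi>) (use c1.openU c2.openU in auto)

lemma \<psi>_W: "x \<in> W \<Longrightarrow> c1.\<psi> x \<in> fst c \<inter> fst c'"
  using c1.\<psi>_\<phi> by auto

lemma transition_in: "x \<in> W \<Longrightarrow> transition c c' x \<in> c2.V"
  using \<psi>_W by (auto simp: transition_def)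

lemma \<psi>_transition: "x \<in> W \<Longrightarrow> c2.\<psi> (transition c c' x) = c1.\<psi> x"
  using c2.\<psi>_\<phi> \<psi>_W by (auto simp: transition_def)

lemma smooth_transition: "k < n \<Longrightarrow> smooth_on n W (\<lambda>x. transition c c' x k)"
  unfolding transition_def
  by (rule smooth_on_compose[OF c2.openU openW c2.smooth_\<phi>])
     (use \<psi>_W in \<open>auto intro: smooth_on_subset[OF c1.smooth_\<psi>]\<close>)

lemma J_transition:
  assumes x: "x \<in> W" and ai: "a < n" "i < n"
  shows "c1.J a i x = (\<Sum>k<n. c2.J a k (transition c c' x) * pd i (\<lambda>y. transition c c' y k) x)"
proof -
  have "c1.J a i x = pd i (\<lambda>y. c2.\<psi> (transition c c' y) a) x"
    unfolding c1.J_def by (rule pd_cong[OF openW x ai(2)]) (simp add: \<psi>_transition)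
  also have "\<dots> = (\<Sum>k<n. c2.J a k (transition c c' x) * pd i (\<lambda>y. transition c c' y k) x)"
    unfolding c2.J_def
    by (rule pd_compose[OF c2.openV smooth_on_Ck[OF c2.smooth_\<psi>[OF ai(1)]] openW transition_in smooth_on_Ck[OF smooth_transition] x ai(2)])
  finally show ?thesis .
qed

lemma conformal_metric_transition:
  assumes x: "x \<in> W" and ij: "i < n" "j < n"
  shows "conformal_metric n u c x i j = (\<Sum>k<n. \<Sum>l<n. conformal_metric n u c' (transition c c' x) k l *
              pd i (\<lambda>y. transition c c' y k) x * pd j (\<lambda>y. transition c c' y l) x)"
proof -
  let ?e = "exp (2 * u (c1.\<psi> x))"
  let ?J = "\<lambda>a k. c2.J a k (transition c c' x)"
  let ?t = "\<lambda>i k. pd i (\<lambda>y. transition c c' y k) x"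
  have "conformal_metric n u c x i j = ?e * (\<Sum>a<n. (\<Sum>k<n. ?J a k * ?t i k) * (\<Sum>l<n. ?J a l * ?t j l))"
    using J_transition[OF x] ij by (simp add: c1.conformal_metric_eq)
  also have "\<dots> = (\<Sum>a<n. \<Sum>k<n. \<Sum>l<n. ?e * ?J a k * ?J a l * ?t i k * ?t j l)"
    by (subst sum_distrib_left, intro sum.cong refl, subst sum_product) (simp add: sum_distrib_left mult_ac)
  also have "\<dots> = (\<Sum>k<n. \<Sum>a<n. \<Sum>l<n. ?e * ?J a k * ?J a l * ?t i k * ?t j l)"
    by (rule sum.swap)
  also have "\<dots> = (\<Sum>k<n. \<Sum>l<n. \<Sum>a<n. ?e * ?J a k * ?J a l * ?t i k * ?t j l)"
    by (intro sum.cong refl sum.swap)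
  also have "\<dots> = (\<Sum>k<n. \<Sum>l<n. conformal_metric n u c' (transition c c' x) k l * ?t i k * ?t j l)"
    by (simp add: c2.conformal_metric_eq \<psi>_transition[OF x] sum_distrib_left sum_distrib_right mult_ac)
  finally show ?thesis .
qed

end

text \<open>Maximality is built into \<open>euc_charts\<close>, which asks for compatibility with
  the identity chart only. That two such charts are compatible with each other follows by passing
  through Cartesian coordinates.\<close>

lemma smooth_structure_euc: "smooth_structure n (euc n) (euc_charts n)"
  unfolding smooth_structure_def
proof (intro conjI allI impI)
  show "smooth_atlas n (euc n) (euc_charts n)"
    unfolding smooth_atlas_iff
  proof (intro conjI ballI allI impI)
    show "(\<Union>c\<in>euc_charts n. fst c) = topspace (euc n)"
    proof
      show "(\<Union>c\<in>euc_charts n. fst c) \<subseteq> topspace (euc n)"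
        using euc_chart.U_Rn euc_chartI by blast
      show "topspace (euc n) \<subseteq> (\<Union>c\<in>euc_charts n. fst c)"
        using UN_upper[OF id_in_euc_charts[of n], of fst] by simp
    qed
    fix c assume "c \<in> euc_charts n"
    then interpret euc_chart n c by (rule euc_chartI)
    show "openin (euc n) (fst c)" "openin (euc n) (chart_im c)"
      "homeomorphic_map (subtopology (euc n) (fst c)) (subtopology (euc n) (chart_im c)) (snd c)"
      by (rule openU openV homeo)+
  next
    fix c c' k assume "c \<in> euc_charts n" "c' \<in> euc_charts n" "k < n"
    then interpret two_euc_charts n c c' by (simp add: two_euc_charts_def euc_chartI)
    show "smooth_on n (snd c ` (fst c \<inter> fst c')) (\<lambda>x. transition c c' x k)"
      using smooth_transition \<open>k < n\<close> .
  qed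
  fix c assume "smooth_atlas n (euc n) (insert c (euc_charts n))"
  then have a: "smooth_atlas n (euc n) (insert c (euc_charts n))" .
  have "fst c \<subseteq> Rn n" using a openin_subset[of "euc n" "fst c"] unfolding smooth_atlas_iff by simp
  then have u: "(\<Union>c'\<in>{c, (Rn n, id)}. fst c') = Rn n" by auto
  have sub: "\<And>c'. c' \<in> {c, (Rn n, id)} \<Longrightarrow> c' \<in> insert c (euc_charts n)" using id_in_euc_charts by auto
  have "smooth_atlas n (euc n) {c, (Rn n, id)}"
    unfolding smooth_atlas_iff
  proof (intro conjI ballI u)
    fix c' assume "c' \<in> {c, (Rn n, id)}"
    then have c': "c' \<in> insert c (euc_charts n)" by (rule sub)
    show "openin (euc n) (fst c')" "openin (euc n) (chart_im c')"
      "homeomorphic_map (subtopology (euc n) (fst c')) (subtopology (euc n) (chart_im c')) (snd c')"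
      using a c' unfolding smooth_atlas_iff by blast+
    fix c'' assume "c'' \<in> {c, (Rn n, id)}"
    then have "c'' \<in> insert c (euc_charts n)" by (rule sub)
    then show "\<forall>k<n. smooth_on n (snd c' ` (fst c' \<inter> fst c'')) (\<lambda>x. transition c' c'' x k)"
      using a c' unfolding smooth_atlas_iff by blast
  qed
  then show "c \<in> euc_charts n" by (simp add: euc_charts_def)
qed

lemma smooth_manifold_euc: "smooth_manifold n (euc n) (euc_charts n)"
  unfolding smooth_manifold_def
proof (intro conjI smooth_structure_euc)
  show "Hausdorff_space (euc n)"
    unfolding euc_def by (simp add: Hausdorff_space_product_topology)
  have "second_countable (euclidean :: coords topology)"
    unfolding second_countable_def using ex_countable_basis topological_basis_def
    by (metis (no_types, lifting) open_openin topological_basisE)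
  then show "second_countable (euc n)"
    by (subst euc_eq_top_of_set) (rule second_countable_subtopology)
qed

lemma simply_connected_space_euc: "simply_connected_space (euc n)"
  unfolding simply_connected_space_def
proof (intro allI impI)
  fix p q :: "real \<Rightarrow> coords" assume pq: "pathin (euc n) p \<and> p 1 = p 0 \<and> pathin (euc n) q \<and> q 1 = q 0"
  \<comment> \<open>The straight-line homotopy; it keeps loops closed because p and q each have
    equal end points.\<close>
  define h where "h z = restrict (\<lambda>i. (1 - fst z) * p (snd z) i + fst z * q (snd z) i) {..<n}" for z :: "real \<times> real"
  have comp: "continuous_map (top_of_set {0..1}) euclideanreal (\<lambda>t. r t i)" if "pathin (euc n) r" "i < n" for r i
    using that unfolding pathin_def euc_def continuous_map_componentwise by auto
  have Rn: "r t \<in> Rn n" if "pathin (euc n) r" "t \<in> {0..1}" for r t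
    using that unfolding pathin_def by (force simp: continuous_map_def)
  have "\<exists>h. continuous_map (prod_topology (top_of_set {0..1::real}) (top_of_set {0..1::real})) (euc n) h \<and>
     (\<forall>x\<in>topspace (top_of_set {0..1}). h (0, x) = p x) \<and> (\<forall>x\<in>topspace (top_of_set {0..1}). h (1, x) = q x) \<and>
     (\<forall>t\<in>{0..1::real}. h (t, 1) = h (t, 0))"
  proof (intro exI[of _ h] conjI ballI)
    have c: "continuous_map (prod_topology (top_of_set {0..1::real}) (top_of_set {0..1::real})) euclideanreal (\<lambda>z. r (snd z) i)"
      if "pathin (euc n) r" "i < n" for r i
      using continuous_map_compose[OF continuous_map_snd comp[OF that], of "top_of_set {0..1::real}"] by (simp add: comp_def)
    have f: "continuous_map (prod_topology (top_of_set {0..1::real}) (top_of_set {0..1::real})) euclideanreal fst"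
      using continuous_map_fst[of "top_of_set {0..1::real}" "top_of_set {0..1::real}"] by (simp add: continuous_map_in_subtopology)
    show "continuous_map (prod_topology (top_of_set {0..1::real}) (top_of_set {0..1::real})) (euc n) h"
      unfolding euc_def continuous_map_componentwise
    proof (intro conjI ballI)
      fix i assume i: "i \<in> {..<n}"
      then have "(\<lambda>z. h z i) = (\<lambda>z. (1 - fst z) * p (snd z) i + fst z * q (snd z) i)" by (simp add: h_def)
      moreover have "continuous_map (prod_topology (top_of_set {0..1::real}) (top_of_set {0..1::real})) euclideanreal (\<lambda>z. (1 - fst z) * p (snd z) i + fst z * q (snd z) i)"
        using i pq by (intro continuous_map_add continuous_map_real_mult continuous_map_diff continuous_map_const[THEN iffD2] f c) auto
      ultimately show "continuous_map (prod_topology (top_of_set {0..1::real}) (top_of_set {0..1::real})) euclideanreal (\<lambda>z. h z i)" by simp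
    qed (auto simp: h_def)
  next
    fix x :: real assume "x \<in> topspace (top_of_set {0..1})"
    then have "p x \<in> Rn n" "q x \<in> Rn n" using Rn pq by auto
    then show "h (0, x) = p x" "h (1, x) = q x"
      by (auto simp: h_def fun_eq_iff Rn_extensional extensional_def restrict_def)
  next
    show "h (t, 1) = h (t, 0)" for t using pq by (simp add: h_def)
  qed
  then show "homotopic_with (\<lambda>r. r 1 = r 0) (top_of_set {0..1}) (euc n) p q"
    by (subst homotopic_with) auto
qed

text \<open>In Cartesian components \<open>w = J v\<close> the form is \<open>exp (2 * u)\<close>
  times the squared Euclidean length of w. Positivity follows because w vanishes only together with
  v, \<open>K\<close> being inverse to \<open>J\<close>.\<close>

lemma riemannian_metric_conformal:
  assumes u: "smooth_on n (Rn n) u"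
  shows "riemannian_metric n (euc_charts n) (conformal_metric n u)"
  unfolding riemannian_metric_def
proof (intro ballI conjI allI impI)
  fix c assume "c \<in> euc_charts n"
  then interpret euc_chart n c by (rule euc_chartI)
  have "smooth_on n V (\<lambda>x. u (\<psi> x))"
    by (rule smooth_on_compose[OF openin_Rn openV u smooth_\<psi>]) (use \<psi>_in U_Rn in auto)
  then show "smooth_on n (chart_im c) (\<lambda>x. conformal_metric n u c x i j)" if "i < n" "j < n" for i j
    unfolding conformal_metric_eq using that
    by (intro smooth_on_mult[OF openV] smooth_on_exp[OF openV] smooth_on_sum[OF openV] smooth_J smooth_on_const[OF openV]) auto
  fix x assume x: "x \<in> chart_im c"
  show "conformal_metric n u c x i j = conformal_metric n u c x j i" for i j
    by (simp add: conformal_metric_eq mult.commute)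
  fix v :: coords assume "\<exists>i<n. v i \<noteq> 0"
  then obtain l where l: "l < n" "v l \<noteq> 0" by blast
  define w where "w a = (\<Sum>i<n. J a i x * v i)" for a
  have "form n (conformal_metric n u c) x v v = (\<Sum>i<n. \<Sum>j<n. \<Sum>a<n. exp (2 * u (\<psi> x)) * (J a i x * v i) * (J a j x * v j))"
    by (simp add: form_def conformal_metric_eq sum_distrib_left sum_distrib_right mult_ac)
  also have "\<dots> = (\<Sum>i<n. \<Sum>a<n. \<Sum>j<n. exp (2 * u (\<psi> x)) * (J a i x * v i) * (J a j x * v j))"
    by (intro sum.cong refl sum.swap)
  also have "\<dots> = (\<Sum>a<n. \<Sum>i<n. \<Sum>j<n. exp (2 * u (\<psi> x)) * (J a i x * v i) * (J a j x * v j))"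
    by (rule sum.swap)
  also have "\<dots> = exp (2 * u (\<psi> x)) * (\<Sum>a<n. w a * w a)"
    by (simp add: w_def sum_product sum_distrib_left mult_ac)
  finally have f: "form n (conformal_metric n u c) x v v = exp (2 * u (\<psi> x)) * (\<Sum>a<n. w a * w a)" .
  have "(\<Sum>a<n. K l a x * w a) = (\<Sum>a<n. \<Sum>i<n. K l a x * J a i x * v i)"
    by (simp add: w_def sum_distrib_left mult_ac)
  also have "\<dots> = (\<Sum>i<n. (\<Sum>a<n. K l a x * J a i x) * v i)"
    by (subst sum.swap) (simp add: sum_distrib_right)
  also have "\<dots> = (\<Sum>i<n. (if l = i then v i else 0))"
    using K_J[OF x l(1)] by (intro sum.cong) auto
  also have "\<dots> = v l" using l by simp
  finally have "\<exists>a<n. w a \<noteq> 0" using l by (metis (no_types, lifting) lessThan_iff mult_zero_right sum.neutral)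
  then obtain a where a: "a < n" "w a \<noteq> 0" by blast
  have "0 < w a * w a" using a by (simp add: zero_less_mult_iff) (metis linorder_neqE_linordered_idom)
  also have "\<dots> \<le> (\<Sum>a<n. w a * w a)" using a by (intro member_le_sum) auto
  finally show "0 < form n (conformal_metric n u c) x v v" unfolding f by simp
next
  fix c c' x i j assume "c \<in> euc_charts n" "c' \<in> euc_charts n" and x: "x \<in> snd c ` (fst c \<inter> fst c')" "i < n" "j < n"
  then interpret two_euc_charts n c c' by (simp add: two_euc_charts_def euc_chartI)
  show "conformal_metric n u c x i j = (\<Sum>k<n. \<Sum>l<n. conformal_metric n u c' (transition c c' x) k l *
              pd i (\<lambda>y. transition c c' y k) x * pd j (\<lambda>y. transition c c' y l) x)"
    by (rule conformal_metric_transition[OF x])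
qed

section \<open>Curvature of conformal metrics\<close>

lemma has_pd_add: "has_pd i f a x \<Longrightarrow> has_pd i g b x \<Longrightarrow> has_pd i (\<lambda>x. f x + g x) (a + b) x"
  unfolding has_pd_def by (rule DERIV_add)

lemma has_pd_diff: "has_pd i f a x \<Longrightarrow> has_pd i g b x \<Longrightarrow> has_pd i (\<lambda>x. f x - g x) (a - b) x"
  unfolding has_pd_def by (rule DERIV_diff)

lemma has_pd_mult: "has_pd i f a x \<Longrightarrow> has_pd i g b x \<Longrightarrow> has_pd i (\<lambda>x. f x * g x) (a * g x + f x * b) x"
  unfolding has_pd_def using DERIV_mult[of "\<lambda>t. f (x(i := t))" a "x i" UNIV "\<lambda>t. g (x(i := t))" b] by (simp add: mult.commute)

lemma has_pd_sum: "(\<And>a. a \<in> A \<Longrightarrow> has_pd i (f a) (d a) x) \<Longrightarrow> has_pd i (\<lambda>x. \<Sum>a\<in>A. f a x) (\<Sum>a\<in>A. d a) x"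
  unfolding has_pd_def by (rule DERIV_sum)

lemma has_pd_exp2: "has_pd i f a x \<Longrightarrow> has_pd i (\<lambda>x. exp (2 * f x)) (exp (2 * f x) * (2 * a)) x"
  unfolding has_pd_def by (auto intro!: derivative_eq_intros)

section \<open>Inner products and Gram determinants\<close>

definition dot :: "nat \<Rightarrow> coords \<Rightarrow> coords \<Rightarrow> real" where
  "dot n X Y = (\<Sum>a<n. X a * Y a)"

lemma dot_commute: "dot n X Y = dot n Y X"
  by (simp add: dot_def mult.commute)

lemma dot_diff: "dot n (\<lambda>a. X a - Y a) Z = dot n X Z - dot n Y Z"
  by (simp add: dot_def sum_subtractf algebra_simps)

lemma dot_scale: "dot n (\<lambda>a. X a * c) Z = c * dot n X Z" "dot n (\<lambda>a. c * X a) Z = c * dot n X Z"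
  by (simp_all add: dot_def sum_distrib_left mult_ac)

lemma dot_self_nonneg: "dot n X X \<ge> 0"
  by (simp add: dot_def sum_nonneg)

lemma dot_cauchy_schwarz: "(dot n X Y)\<^sup>2 \<le> dot n X X * dot n Y Y"
proof -
  have "0 \<le> dot n (\<lambda>a. dot n Y Y * X a - dot n X Y * Y a) (\<lambda>a. dot n Y Y * X a - dot n X Y * Y a)"
    by (rule dot_self_nonneg)
  also have "\<dots> = dot n Y Y * (dot n X X * dot n Y Y - (dot n X Y)\<^sup>2)"
    unfolding dot_diff dot_scale
    by (subst (1 2) dot_commute, unfold dot_diff dot_scale)
       (simp add: algebra_simps power2_eq_square dot_commute[of n Y X])
  finally have *: "0 \<le> dot n Y Y * (dot n X X * dot n Y Y - (dot n X Y)\<^sup>2)" .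
  show ?thesis
  proof (cases "dot n Y Y = 0")
    case True
    then have "Y a = 0" if "a < n" for a
      using that by (simp add: dot_def sum_nonneg_eq_0_iff)
    then have "dot n X Y = 0" by (simp add: dot_def)
    then show ?thesis using True by simp
  next
    case False
    then have "dot n Y Y > 0" using dot_self_nonneg[of n Y] by simp
    then show ?thesis using * by (simp add: zero_le_mult_iff)
  qed
qed

text \<open>The Gram determinant of D, X and Y is non-negative: \<open>Z\<close> is \<Delta> times
  the component of D orthogonal to X and Y, with \<alpha> and \<beta> from Cramer's rule, and
  \<open>dot n Z Z \<ge> 0\<close> is divided by \<Delta>. With D the gradient of u, this accounts
  for the normal component of the gradient in the curvature.\<close>

lemma gram_det_nonneg:
  assumes "dot n X X * dot n Y Y - (dot n X Y)\<^sup>2 > 0"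
  shows "dot n X X * (dot n D Y)\<^sup>2 + dot n Y Y * (dot n D X)\<^sup>2 - 2 * dot n X Y * dot n D X * dot n D Y
    \<le> dot n D D * (dot n X X * dot n Y Y - (dot n X Y)\<^sup>2)"
proof -
  define \<Delta> where "\<Delta> = dot n X X * dot n Y Y - (dot n X Y)\<^sup>2"
  define \<alpha> where "\<alpha> = dot n D X * dot n Y Y - dot n D Y * dot n X Y"
  define \<beta> where "\<beta> = dot n D Y * dot n X X - dot n D X * dot n X Y"
  define Z where "Z a = \<Delta> * D a - \<alpha> * X a - \<beta> * Y a" for a
  have Z: "dot n Z W = \<Delta> * dot n D W - \<alpha> * dot n X W - \<beta> * dot n Y W" for W
    unfolding Z_def dot_diff dot_scale ..
  have "0 \<le> dot n Z Z" by (rule dot_self_nonneg)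
  also have "dot n Z Z = \<Delta> * dot n Z D - \<alpha> * dot n Z X - \<beta> * dot n Z Y"
    using Z[of Z] dot_commute by metis
  also have "\<dots> = \<Delta> * (dot n D D * \<Delta> - (dot n X X * (dot n D Y)\<^sup>2 + dot n Y Y * (dot n D X)\<^sup>2 - 2 * dot n X Y * dot n D X * dot n D Y))"
    unfolding Z \<Delta>_def \<alpha>_def \<beta>_def dot_commute[of n Y X] dot_commute[of n X D] dot_commute[of n Y D]
    by (simp add: algebra_simps power2_eq_square)
  finally show ?thesis using assms unfolding \<Delta>_def[symmetric] by (simp add: zero_le_mult_iff)
qed

text \<open>The curvature condition ranges over all charts, so it is computed in an arbitrary one,
  but with Cartesian components for vectors. In these the flat connection is plain differentiation,
  and only the conformal factor contributes correction terms.\<close>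

locale conformal_chart = euc_chart n c for n c +
  fixes u :: "coords \<Rightarrow> real"
  assumes u: "smooth_on n (Rn n) u"
begin

definition "w x = u (\<psi> x)"
definition "D a x = pd a u (\<psi> x)"
definition "DD a b x = pd b (pd a u) (\<psi> x)"
definition "dw i x = (\<Sum>a<n. D a x * J a i x)"
definition "J2 a i j x = pd i (J a j) x"
definition "G i j x = (\<Sum>a<n. J a i x * J a j x)"
text \<open>Cartesian components of the covariant derivative of the coordinate field X_j along X_i:
  the flat derivative \<open>J2\<close> plus the correction for a conformal change, X_i dw_j + X_j
  dw_i - <X_i, X_j> grad u.\<close>

definition "S a i j x = J2 a i j x + J a i x * dw j x + J a j x * dw i x - D a x * G i j x"
definition "\<Gamma> l i j x = (\<Sum>a<n. K l a x * S a i j x)"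
abbreviation "H \<equiv> conformal_metric n u c"

lemma \<psi>_Rn: "x \<in> V \<Longrightarrow> \<psi> x \<in> Rn n" using \<psi>_in U_Rn by blast

lemma H_eq: "H x i j = exp (2 * w x) * G i j x"
  by (simp add: conformal_metric_eq w_def G_def)

lemma G_commute: "G i j x = G j i x" by (simp add: G_def mult.commute)

lemma smooth_D: "a < n \<Longrightarrow> smooth_on n V (D a)"
  unfolding D_def[abs_def]
  by (rule smooth_on_compose[OF openin_Rn openV smooth_on_pd[OF u] smooth_\<psi> \<psi>_Rn])

lemma smooth_J2: "a < n \<Longrightarrow> i < n \<Longrightarrow> j < n \<Longrightarrow> smooth_on n V (J2 a i j)"
  unfolding J2_def[abs_def] by (rule smooth_on_pd[OF smooth_J])

lemma smooth_dw: "i < n \<Longrightarrow> smooth_on n V (dw i)"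
  unfolding dw_def[abs_def] by (intro smooth_on_sum[OF openV] smooth_on_mult[OF openV] smooth_D smooth_J) auto

lemma smooth_G: "i < n \<Longrightarrow> j < n \<Longrightarrow> smooth_on n V (G i j)"
  unfolding G_def[abs_def] by (intro smooth_on_sum[OF openV] smooth_on_mult[OF openV] smooth_J) auto

lemma smooth_S: "a < n \<Longrightarrow> i < n \<Longrightarrow> j < n \<Longrightarrow> smooth_on n V (S a i j)"
  unfolding S_def[abs_def]
  by (intro smooth_on_add[OF openV] smooth_on_diff[OF openV] smooth_on_mult[OF openV] smooth_J2 smooth_J smooth_dw smooth_D smooth_G) auto

lemma smooth_\<Gamma>: "l < n \<Longrightarrow> i < n \<Longrightarrow> j < n \<Longrightarrow> smooth_on n V (\<Gamma> l i j)"
  unfolding \<Gamma>_def[abs_def] by (intro smooth_on_sum[OF openV] smooth_on_mult[OF openV] smooth_K smooth_S) auto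

lemma J2_commute:
  assumes x: "x \<in> V" and "a < n" "i < n" "j < n"
  shows "J2 a i j x = J2 a j i x"
  unfolding J2_def J_def[abs_def]
  using smooth_on_pd_commute[OF openV smooth_\<psi>[OF assms(2)] assms(4,3) x] .

lemma DD_commute:
  assumes x: "x \<in> V" and "a < n" "b < n"
  shows "DD a b x = DD b a x"
  unfolding DD_def using smooth_on_pd_commute[OF openin_Rn u assms(2,3) \<psi>_Rn[OF x]] .

lemma has_pd_J: "x \<in> V \<Longrightarrow> a < n \<Longrightarrow> i < n \<Longrightarrow> j < n \<Longrightarrow> has_pd i (J a j) (J2 a i j x) x"
  unfolding J2_def by (rule smooth_on_has_pd[OF openV smooth_J])

lemma has_pd_comp_\<psi>:
  assumes f: "smooth_on n (Rn n) f" and x: "x \<in> V" and i: "i < n"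
  shows "has_pd i (\<lambda>x. f (\<psi> x)) (\<Sum>a<n. pd a f (\<psi> x) * J a i x) x"
  unfolding J_def
  by (rule has_pd_compose[OF openin_Rn smooth_on_Ck[OF f] openV \<psi>_Rn smooth_on_has_pd[OF openV smooth_\<psi>] x i]) (use i x in auto)

lemma has_pd_w: "x \<in> V \<Longrightarrow> i < n \<Longrightarrow> has_pd i w (dw i x) x"
  using has_pd_comp_\<psi>[OF u] by (simp add: w_def[abs_def] dw_def D_def)

lemma has_pd_D: "x \<in> V \<Longrightarrow> a < n \<Longrightarrow> i < n \<Longrightarrow> has_pd i (D a) (\<Sum>b<n. DD a b x * J b i x) x"
  using has_pd_comp_\<psi>[OF smooth_on_pd[OF u]] by (simp add: D_def[abs_def] DD_def)

definition "dD i a x = (\<Sum>b<n. DD a b x * J b i x)"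
definition "ddw i k x = (\<Sum>a<n. dD i a x * J a k x + D a x * J2 a i k x)"
definition "dG i j k x = (\<Sum>a<n. J2 a i j x * J a k x + J a j x * J2 a i k x)"

lemma has_pd_dw: "x \<in> V \<Longrightarrow> i < n \<Longrightarrow> k < n \<Longrightarrow> has_pd i (dw k) (ddw i k x) x"
  unfolding dw_def[abs_def] ddw_def dD_def by (intro has_pd_sum has_pd_mult has_pd_D has_pd_J) auto

lemma has_pd_G: "x \<in> V \<Longrightarrow> i < n \<Longrightarrow> j < n \<Longrightarrow> k < n \<Longrightarrow> has_pd i (G j k) (dG i j k x) x"
  unfolding G_def[abs_def] dG_def by (intro has_pd_sum has_pd_mult has_pd_J) auto

lemma pd_H:
  assumes "x \<in> V" "i < n" "j < n" "k < n"
  shows "pd i (\<lambda>y. H y j k) x = exp (2 * w x) * (2 * dw i x * G j k x + dG i j k x)"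
proof -
  have "has_pd i (\<lambda>y. H y j k) (exp (2 * w x) * (2 * dw i x) * G j k x + exp (2 * w x) * dG i j k x) x"
    unfolding H_eq[abs_def] using assms by (intro has_pd_mult has_pd_exp2 has_pd_w has_pd_G)
  from has_pd_imp_pd[OF this] show ?thesis by (simp add: algebra_simps)
qed

text \<open>In the Koszul expression the derivatives of \<open>G\<close> leave \<open>J2\<close>
  paired with \<open>J\<close>, as the other second derivatives of the chart cancel by symmetry; the
  derivatives of the factor \<open>exp (2 * w)\<close> give the conformal correction contained in
  \<open>S\<close>.\<close>

lemma christoffel_lower:
  assumes x: "x \<in> V" and ij: "i < n" "j < n" "p < n"
  shows "(pd i (\<lambda>y. H y j p) x + pd j (\<lambda>y. H y i p) x - pd p (\<lambda>y. H y i j) x) / 2 =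
    exp (2 * w x) * (\<Sum>a<n. J a p x * S a i j x)"
proof -
  have d: "dG i j p x + dG j i p x - dG p i j x = 2 * (\<Sum>a<n. J2 a i j x * J a p x)"
    unfolding dG_def sum.distrib[symmetric] sum_subtractf[symmetric] sum_distrib_left
    using J2_commute[OF x _ ij(1,2)] J2_commute[OF x _ ij(1,3)] J2_commute[OF x _ ij(2,3)]
    by (intro sum.cong) (auto simp: algebra_simps)
  have s: "(\<Sum>a<n. J a p x * S a i j x) = (\<Sum>a<n. J2 a i j x * J a p x) + G i p x * dw j x + G j p x * dw i x - dw p x * G i j x"
    unfolding G_def[of i p] G_def[of j p] dw_def[of p] sum_distrib_right sum.distrib[symmetric] sum_subtractf[symmetric]
    by (intro sum.cong) (auto simp: algebra_simps S_def)
  have "(pd i (\<lambda>y. H y j p) x + pd j (\<lambda>y. H y i p) x - pd p (\<lambda>y. H y i j) x) / 2 =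
     exp (2 * w x) * (dw i x * G j p x + dw j x * G i p x - dw p x * G i j x + (dG i j p x + dG j i p x - dG p i j x) / 2)"
    using pd_H[OF x] ij by (simp add: field_simps)
  then show ?thesis unfolding d s by (simp add: algebra_simps)
qed

lemma J_\<Gamma>:
  assumes x: "x \<in> V" and a: "a < n"
  shows "(\<Sum>l<n. J a l x * \<Gamma> l i j x) = S a i j x"
proof -
  have "(\<Sum>l<n. J a l x * \<Gamma> l i j x) = (\<Sum>l<n. \<Sum>b<n. J a l x * K l b x * S b i j x)"
    by (simp add: \<Gamma>_def sum_distrib_left mult_ac)
  also have "\<dots> = (\<Sum>b<n. (\<Sum>l<n. J a l x * K l b x) * S b i j x)"
    by (subst sum.swap) (simp add: sum_distrib_right)
  also have "\<dots> = (\<Sum>b<n. if b = a then S b i j x else 0)"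
    using J_K[OF x a] by (intro sum.cong) auto
  also have "\<dots> = S a i j x" using a by simp
  finally show ?thesis .
qed

lemma gram_det_nonzero:
  assumes x: "x \<in> V"
  shows "Determinant.det (gram n H x) \<noteq> 0"
proof
  have car: "gram n H x \<in> carrier_mat n n" by (simp add: gram_def)
  assume "Determinant.det (gram n H x) = 0"
  then obtain v where v: "v \<in> carrier_vec n" "v \<noteq> 0\<^sub>v n" "gram n H x *\<^sub>v v = 0\<^sub>v n"
    using det_0_iff_vec_prod_zero[OF car] by blast
  define v' where "v' i = vec_index v i" for i
  have "\<exists>i<n. v' i \<noteq> 0"
  proof (rule ccontr)
    assume "\<not> ?thesis"
    then have "v = 0\<^sub>v n" using v(1) by (intro eq_vecI) (auto simp: v'_def)
    then show False using v(2) by simp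
  qed
  then have pos: "form n H x v' v' > 0"
    using riemannian_metric_conformal[OF u] c x unfolding riemannian_metric_def by blast
  have "(\<Sum>j<n. H x i j * v' j) = 0" if "i < n" for i
  proof -
    have "vec_index (gram n H x *\<^sub>v v) i = 0" using v(3) that by simp
    then show ?thesis using that v(1) by (simp add: gram_def scalar_prod_def v'_def lessThan_atLeast0)
  qed
  moreover have "form n H x v' v' = (\<Sum>i<n. v' i * (\<Sum>j<n. H x i j * v' j))"
    by (simp add: form_def sum_distrib_left mult_ac)
  ultimately show False using pos by simp
qed

lemma gram_inv_left:
  assumes x: "x \<in> V" and l: "l < n" "q < n"
  shows "(\<Sum>p<n. gram_inv n H x l p * H x p q) = (if l = q then 1 else 0)"
proof -
  let ?M = "gram n H x"
  have car: "?M \<in> carrier_mat n n" by (simp add: gram_def)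
  have "(adj_mat ?M * ?M) $$ (l, q) = (Determinant.det ?M \<cdot>\<^sub>m 1\<^sub>m n) $$ (l, q)"
    using adj_mat[OF car] by simp
  then have "(\<Sum>p<n. adj_mat ?M $$ (l, p) * H x p q) = Determinant.det ?M * (if l = q then 1 else 0)"
    using l adj_mat(1)[OF car] by (auto simp: scalar_prod_def gram_def lessThan_atLeast0 intro!: sum.cong)
  then have "(\<Sum>p<n. adj_mat ?M $$ (l, p) * H x p q) / Determinant.det ?M = (if l = q then 1 else 0)"
    using gram_det_nonzero[OF x] by simp
  then show ?thesis by (simp add: gram_inv_def sum_divide_distrib)
qed

text \<open>The lowered symbols are the metric applied to \<open>\<Gamma>\<close>, so contraction
  with the inverse Gram matrix returns \<open>\<Gamma>\<close>; no explicit formula for the inverse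
  enters.\<close>

lemma christoffel_eq:
  assumes x: "x \<in> V" and ij: "l < n" "i < n" "j < n"
  shows "christoffel n H l i j x = \<Gamma> l i j x"
proof -
  have low: "exp (2 * w x) * (\<Sum>a<n. J a p x * S a i j x) = (\<Sum>q<n. H x p q * \<Gamma> q i j x)" if "p < n" for p
  proof -
    have "(\<Sum>q<n. H x p q * \<Gamma> q i j x) = (\<Sum>q<n. \<Sum>a<n. exp (2 * w x) * (J a p x * (J a q x * \<Gamma> q i j x)))"
      by (simp add: H_eq G_def sum_distrib_left sum_distrib_right sum_distrib_left mult_ac)
    also have "\<dots> = (\<Sum>a<n. exp (2 * w x) * (J a p x * (\<Sum>q<n. J a q x * \<Gamma> q i j x)))"
      by (subst sum.swap) (simp add: sum_distrib_left)
    also have "\<dots> = exp (2 * w x) * (\<Sum>a<n. J a p x * S a i j x)"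
      using J_\<Gamma>[OF x] by (simp add: sum_distrib_left)
    finally show ?thesis by simp
  qed
  have "christoffel n H l i j x = (\<Sum>p<n. gram_inv n H x l p * (exp (2 * w x) * (\<Sum>a<n. J a p x * S a i j x)))"
    unfolding christoffel_def
  proof (intro sum.cong refl)
    fix p assume "p \<in> {..<n}"
    then show "gram_inv n H x l p * (pd i (\<lambda>y. H y j p) x + pd j (\<lambda>y. H y i p) x - pd p (\<lambda>y. H y i j) x) / 2 =
      gram_inv n H x l p * (exp (2 * w x) * (\<Sum>a<n. J a p x * S a i j x))"
      using christoffel_lower[OF x ij(2,3), of p] by simp
  qed
  also have "\<dots> = (\<Sum>p<n. \<Sum>q<n. gram_inv n H x l p * H x p q * \<Gamma> q i j x)"
    by (intro sum.cong refl) (simp only: low lessThan_iff, simp add: sum_distrib_left mult_ac)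
  also have "\<dots> = (\<Sum>q<n. (\<Sum>p<n. gram_inv n H x l p * H x p q) * \<Gamma> q i j x)"
    by (subst sum.swap) (simp add: sum_distrib_right)
  also have "\<dots> = (\<Sum>q<n. if q = l then \<Gamma> q i j x else 0)"
    using gram_inv_left[OF x ij(1)] by (intro sum.cong) auto
  also have "\<dots> = \<Gamma> l i j x" using ij by simp
  finally show ?thesis .
qed

definition "dS i a j k x = pd i (J2 a j k) x + (J2 a i j x * dw k x + J a j x * ddw i k x)
   + (J2 a i k x * dw j x + J a k x * ddw i j x) - (dD i a x * G j k x + D a x * dG i j k x)"

lemma has_pd_S:
  assumes "x \<in> V" "a < n" "i < n" "j < n" "k < n"
  shows "has_pd i (S a j k) (dS i a j k x) x"
  unfolding S_def[abs_def] dS_def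
  using assms has_pd_D[OF assms(1,2,3)] unfolding dD_def[symmetric]
  by (intro has_pd_add has_pd_diff has_pd_mult has_pd_J has_pd_dw has_pd_G smooth_on_has_pd[OF openV smooth_J2]) auto

text \<open>Cartesian components of the second covariant derivative of X_k along X_j and then X_i:
  the rule for a vector field W in direction i, dW + X_i <D, W> + dw_i W - D <X_i, W>, is applied to
  the field with components \<open>S a j k\<close>.\<close>

definition "R a i j k x = dS i a j k x + J a i x * (\<Sum>b<n. D b x * S b j k x) + dw i x * S a j k x
   - D a x * (\<Sum>b<n. J b i x * S b j k x)"

text \<open>Contraction with \<open>J\<close> passes to Cartesian components. Moving
  \<open>J\<close> under the derivative costs the terms
  \<open>J2 a i l x * \<Gamma> l j k x\<close>, which cancel against the flat part \<open>J2\<close>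
  of \<open>S\<close> in the quadratic terms (\<open>comb\<close>); what is left of these is the
  conformal correction in \<open>R\<close>.\<close>

lemma J_riemann:
  assumes x: "x \<in> V" and a: "a < n" and ijk: "i < n" "j < n" "k < n"
  shows "(\<Sum>l<n. J a l x * riemann n H l i j k x) = R a i j k x - R a j i k x"
proof -
  have pd\<Gamma>: "(\<Sum>l<n. J a l x * pd i (christoffel n H l j k) x) = dS i a j k x - (\<Sum>l<n. J2 a i l x * \<Gamma> l j k x)"
    if i: "i < n" and j: "j < n" for i j
  proof -
    have "has_pd i (\<lambda>x. \<Sum>l<n. J a l x * \<Gamma> l j k x) (\<Sum>l<n. J2 a i l x * \<Gamma> l j k x + J a l x * pd i (\<Gamma> l j k) x) x"
      using x a i j ijk by (intro has_pd_sum has_pd_mult has_pd_J smooth_on_has_pd[OF openV smooth_\<Gamma>]) auto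
    from has_pd_cong[OF this openV x i, of "S a j k"]
    have "has_pd i (S a j k) (\<Sum>l<n. J2 a i l x * \<Gamma> l j k x + J a l x * pd i (\<Gamma> l j k) x) x"
      using J_\<Gamma>[OF _ a] by blast
    from has_pd_imp_pd[OF this] has_pd_imp_pd[OF has_pd_S[OF x a i j ijk(3)]]
    have "(\<Sum>l<n. J2 a i l x * \<Gamma> l j k x) + (\<Sum>l<n. J a l x * pd i (\<Gamma> l j k) x) = dS i a j k x"
      by (simp add: sum.distrib)
    moreover have "pd i (christoffel n H l j k) x = pd i (\<Gamma> l j k) x" if "l < n" for l
      by (rule pd_cong[OF openV x i]) (use that j ijk christoffel_eq in auto)
    ultimately show ?thesis by simp
  qed
  have quad: "(\<Sum>l<n. J a l x * (\<Sum>p<n. christoffel n H l i p x * christoffel n H p j k x)) = (\<Sum>p<n. S a i p x * \<Gamma> p j k x)"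
    if i: "i < n" and j: "j < n" for i j
  proof -
    have "(\<Sum>l<n. J a l x * (\<Sum>p<n. christoffel n H l i p x * christoffel n H p j k x))
        = (\<Sum>l<n. \<Sum>p<n. J a l x * \<Gamma> l i p x * \<Gamma> p j k x)"
      using christoffel_eq[OF x] i j ijk by (simp add: sum_distrib_left mult_ac)
    also have "\<dots> = (\<Sum>p<n. (\<Sum>l<n. J a l x * \<Gamma> l i p x) * \<Gamma> p j k x)"
      by (subst sum.swap) (simp add: sum_distrib_right)
    also have "\<dots> = (\<Sum>p<n. S a i p x * \<Gamma> p j k x)" using J_\<Gamma>[OF x a] by simp
    finally show ?thesis .
  qed
  have comb: "(\<Sum>p<n. S a i p x * \<Gamma> p j k x) - (\<Sum>l<n. J2 a i l x * \<Gamma> l j k x) =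
      J a i x * (\<Sum>b<n. D b x * S b j k x) + dw i x * S a j k x - D a x * (\<Sum>b<n. J b i x * S b j k x)"
    if i: "i < n" and j: "j < n" for i j
  proof -
    have V: "(\<Sum>p<n. dw p x * \<Gamma> p j k x) = (\<Sum>b<n. D b x * S b j k x)"
    proof -
      have "(\<Sum>p<n. dw p x * \<Gamma> p j k x) = (\<Sum>p<n. \<Sum>b<n. D b x * (J b p x * \<Gamma> p j k x))"
        by (simp add: dw_def sum_distrib_right sum_distrib_left mult_ac)
      also have "\<dots> = (\<Sum>b<n. D b x * (\<Sum>p<n. J b p x * \<Gamma> p j k x))"
        by (subst sum.swap) (simp add: sum_distrib_left)
      finally show ?thesis using J_\<Gamma>[OF x] by simp
    qed
    have G: "(\<Sum>p<n. G i p x * \<Gamma> p j k x) = (\<Sum>b<n. J b i x * S b j k x)"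
    proof -
      have "(\<Sum>p<n. G i p x * \<Gamma> p j k x) = (\<Sum>p<n. \<Sum>b<n. J b i x * (J b p x * \<Gamma> p j k x))"
        by (simp add: G_def sum_distrib_right sum_distrib_left mult_ac)
      also have "\<dots> = (\<Sum>b<n. J b i x * (\<Sum>p<n. J b p x * \<Gamma> p j k x))"
        by (subst sum.swap) (simp add: sum_distrib_left)
      finally show ?thesis using J_\<Gamma>[OF x] by simp
    qed
    have "(\<Sum>p<n. S a i p x * \<Gamma> p j k x) - (\<Sum>l<n. J2 a i l x * \<Gamma> l j k x) =
      J a i x * (\<Sum>p<n. dw p x * \<Gamma> p j k x) + dw i x * (\<Sum>p<n. J a p x * \<Gamma> p j k x) - D a x * (\<Sum>p<n. G i p x * \<Gamma> p j k x)"
      unfolding sum_distrib_left sum.distrib[symmetric] sum_subtractf[symmetric]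
      by (intro sum.cong) (auto simp: S_def algebra_simps)
    then show ?thesis unfolding V G J_\<Gamma>[OF x a] .
  qed
  have "(\<Sum>l<n. J a l x * riemann n H l i j k x) =
     (\<Sum>l<n. J a l x * pd i (christoffel n H l j k) x) - (\<Sum>l<n. J a l x * pd j (christoffel n H l i k) x)
     + ((\<Sum>l<n. J a l x * (\<Sum>p<n. christoffel n H l i p x * christoffel n H p j k x))
       - (\<Sum>l<n. J a l x * (\<Sum>p<n. christoffel n H l j p x * christoffel n H p i k x)))"
    unfolding sum.distrib[symmetric] sum_subtractf[symmetric]
    by (intro sum.cong) (auto simp: riemann_def algebra_simps sum_subtractf)
  also have "\<dots> = dS i a j k x + ((\<Sum>p<n. S a i p x * \<Gamma> p j k x) - (\<Sum>l<n. J2 a i l x * \<Gamma> l j k x))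
      - (dS j a i k x + ((\<Sum>p<n. S a j p x * \<Gamma> p i k x) - (\<Sum>l<n. J2 a j l x * \<Gamma> l i k x)))"
    using pd\<Gamma>[OF ijk(1,2)] pd\<Gamma>[OF ijk(2,1)] quad[OF ijk(1,2)] quad[OF ijk(2,1)] by simp
  finally show ?thesis unfolding comb[OF ijk(1,2)] comb[OF ijk(2,1)] R_def by simp
qed

definition "Hs i k x = (\<Sum>a<n. dD i a x * J a k x)"
definition "D2 x = (\<Sum>b<n. D b x * D b x)"

text \<open>Everything with second or third derivatives of the chart is symmetric in i and j and
  drops out, as it must for a tensor. What remains is the classical expression for the curvature of
  a conformally flat metric through the Hessian and the gradient of u.\<close>

lemma R_antisym:
  assumes x: "x \<in> V" and a: "a < n" and ijk: "i < n" "j < n" "k < n"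
  shows "R a i j k x - R a j i k x =
     (J a j x * Hs i k x - J a i x * Hs j k x) + (dD j a x * G i k x - dD i a x * G j k x)
   + (J a i x * (dw j x * dw k x) - J a j x * (dw i x * dw k x))
   - D2 x * (J a i x * G j k x - J a j x * G i k x)
   - D a x * (dw j x * G i k x - dw i x * G j k x)"
proof -
  define P where "P i k = (\<Sum>b<n. D b x * J2 b i k x)" for i k
  define N where "N i j k = (\<Sum>b<n. J b i x * J2 b j k x)" for i j k
  have J3: "pd i (J2 a j k) x = pd j (J2 a i k) x"
    unfolding J2_def[abs_def] by (rule smooth_on_pd_commute[OF openV smooth_J[OF a ijk(3)] ijk(2,1) x])
  have ddw: "ddw p q x = Hs p q x + P p q" for p q by (simp add: ddw_def Hs_def P_def sum.distrib)
  have dG: "dG p q r x = N r p q + N q p r" for p q r by (simp add: dG_def N_def sum.distrib mult_ac)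
  have DS: "(\<Sum>b<n. D b x * S b p k x) = P p k + 2 * dw p x * dw k x - D2 x * G p k x" for p
  proof -
    have "(\<Sum>b<n. D b x * S b p k x) = P p k + dw p x * dw k x + dw k x * dw p x - D2 x * G p k x"
      unfolding P_def D2_def dw_def[of p x] dw_def[of k x] sum_distrib_right sum.distrib[symmetric] sum_subtractf[symmetric] S_def
      by (intro sum.cong) (auto simp: algebra_simps dw_def sum_distrib_left)
    then show ?thesis by simp
  qed
  have JS: "(\<Sum>b<n. J b q x * S b p k x) = N q p k + G q p x * dw k x + G q k x * dw p x - dw q x * G p k x" for p q
    unfolding N_def G_def[of q p] G_def[of q k] dw_def[of q x] sum_distrib_right sum.distrib[symmetric] sum_subtractf[symmetric]
    by (intro sum.cong) (auto simp: algebra_simps S_def)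
  have sym: "J2 a i j x = J2 a j i x" "Hs i j x = Hs j i x" "P i j = P j i" "N p i j = N p j i" for p
  proof -
    show "J2 a i j x = J2 a j i x" using J2_commute[OF x a] ijk by simp
    show "P i j = P j i" "N p i j = N p j i" unfolding P_def N_def using J2_commute[OF x] ijk by simp_all
    have "Hs i j x = (\<Sum>a<n. \<Sum>b<n. DD a b x * J b i x * J a j x)"
      by (simp add: Hs_def dD_def sum_distrib_right)
    also have "\<dots> = (\<Sum>b<n. \<Sum>a<n. DD a b x * J b i x * J a j x)" by (rule sum.swap)
    also have "\<dots> = (\<Sum>b<n. \<Sum>a<n. DD b a x * J a j x * J b i x)"
      using DD_commute[OF x] by (intro sum.cong) (auto simp: mult_ac)
    also have "\<dots> = Hs j i x" by (simp add: Hs_def dD_def sum_distrib_right)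
    finally show "Hs i j x = Hs j i x" .
  qed
  have G: "G j i x = G i j x" by (rule G_commute)
  show ?thesis
    unfolding R_def dS_def DS JS ddw dG J3 S_def[of a] G
    using sym by (simp add: algebra_simps)
qed

text \<open>The contraction that occurs in \<open>sectional_curvature\<close>, where the second
  vector fills two slots. Under it each term of \<open>R_antisym\<close> factors into sums over
  fewer indices.\<close>

definition contr :: "coords \<Rightarrow> coords \<Rightarrow> (nat \<Rightarrow> nat \<Rightarrow> nat \<Rightarrow> real) \<Rightarrow> real" where
  "contr v z F = (\<Sum>i<n. \<Sum>j<n. \<Sum>k<n. F i j k * v i * z j * z k)"

lemma contr_add: "contr v z (\<lambda>i j k. F i j k + F' i j k) = contr v z F + contr v z F'"
  by (simp add: contr_def sum.distrib algebra_simps)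

lemma contr_diff: "contr v z (\<lambda>i j k. F i j k - F' i j k) = contr v z F - contr v z F'"
  by (simp add: contr_def sum_subtractf algebra_simps)

lemma contr_scale: "contr v z (\<lambda>i j k. d * F i j k) = d * contr v z F"
  by (simp add: contr_def sum_distrib_left mult_ac)

lemma contr_i: "contr v z (\<lambda>i j k. p i * q j k) = (\<Sum>i<n. p i * v i) * (\<Sum>j<n. \<Sum>k<n. q j k * z j * z k)"
  unfolding contr_def sum_distrib_right by (simp add: sum_distrib_left mult_ac)

lemma contr_j: "contr v z (\<lambda>i j k. p j * q i k) = (\<Sum>j<n. p j * z j) * (\<Sum>i<n. \<Sum>k<n. q i k * v i * z k)"
proof -
  have "contr v z (\<lambda>i j k. p j * q i k) = (\<Sum>j<n. \<Sum>i<n. \<Sum>k<n. p j * q i k * v i * z j * z k)"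
    unfolding contr_def by (rule sum.swap)
  also have "\<dots> = (\<Sum>j<n. p j * z j) * (\<Sum>i<n. \<Sum>k<n. q i k * v i * z k)"
    unfolding sum_distrib_right by (simp add: sum_distrib_left mult_ac)
  finally show ?thesis .
qed

text \<open>\<open>R_antisym\<close> is contracted with v, z, z and paired with v, everything being
  expressed by the Cartesian vectors \<open>X v\<close> and \<open>X z\<close>. The first group is
  the Hessian on their plane; the other two together are minus the Gram determinant of the gradient
  and these vectors.\<close>

lemma curvature_numerator:
  assumes x: "x \<in> V"
  defines "X \<equiv> \<lambda>v a. \<Sum>i<n. J a i x * v i"
  defines "h \<equiv> \<lambda>X Y. \<Sum>a<n. \<Sum>b<n. DD a b x * X a * Y b"
  shows "form n H x (\<lambda>l. \<Sum>i<n. \<Sum>j<n. \<Sum>k<n. riemann n H l i j k x * v i * z j * z k) v =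
    exp (2 * w x) * (- (dot n (X v) (X v) * h (X z) (X z) + dot n (X z) (X z) * h (X v) (X v) - 2 * dot n (X v) (X z) * h (X v) (X z))
     + (dot n (X v) (X v) * (dot n (\<lambda>a. D a x) (X z))\<^sup>2 + dot n (X z) (X z) * (dot n (\<lambda>a. D a x) (X v))\<^sup>2
        - 2 * dot n (X v) (X z) * dot n (\<lambda>a. D a x) (X v) * dot n (\<lambda>a. D a x) (X z))
     - dot n (\<lambda>a. D a x) (\<lambda>a. D a x) * (dot n (X v) (X v) * dot n (X z) (X z) - (dot n (X v) (X z))\<^sup>2))"
proof -
  let ?D = "\<lambda>a. D a x"
  have h_commute: "h Y Z = h Z Y" for Y Z
  proof -
    have "h Y Z = (\<Sum>b<n. \<Sum>a<n. DD a b x * Y a * Z b)" unfolding h_def by (rule sum.swap)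
    also have "\<dots> = h Z Y" unfolding h_def using DD_commute[OF x] by (intro sum.cong) (auto simp: mult_ac)
    finally show ?thesis .
  qed
  have dwX: "(\<Sum>i<n. dw i x * y i) = dot n ?D (X y)" for y
  proof -
    have "(\<Sum>i<n. dw i x * y i) = (\<Sum>i<n. \<Sum>a<n. D a x * (J a i x * y i))"
      by (simp add: dw_def sum_distrib_right sum_distrib_left mult_ac)
    also have "\<dots> = dot n ?D (X y)" by (subst sum.swap) (simp add: dot_def X_def sum_distrib_left)
    finally show ?thesis .
  qed
  have bil: "(\<Sum>i<n. \<Sum>k<n. (\<Sum>a<n. f i a * J a k x) * y i * t k) = (\<Sum>a<n. (\<Sum>i<n. f i a * y i) * X t a)" for f y t
  proof -
    have "(\<Sum>i<n. \<Sum>k<n. (\<Sum>a<n. f i a * J a k x) * y i * t k) = (\<Sum>i<n. \<Sum>k<n. \<Sum>a<n. (f i a * y i) * (J a k x * t k))"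
      by (simp add: sum_distrib_right sum_distrib_left mult_ac)
    also have "\<dots> = (\<Sum>i<n. \<Sum>a<n. \<Sum>k<n. (f i a * y i) * (J a k x * t k))"
      by (intro sum.cong refl sum.swap)
    also have "\<dots> = (\<Sum>a<n. \<Sum>i<n. \<Sum>k<n. (f i a * y i) * (J a k x * t k))" by (rule sum.swap)
    also have "\<dots> = (\<Sum>a<n. (\<Sum>i<n. f i a * y i) * X t a)"
      by (simp add: X_def sum_product)
    finally show ?thesis .
  qed
  have GX: "(\<Sum>i<n. \<Sum>k<n. G i k x * y i * t k) = dot n (X y) (X t)" for y t
    unfolding G_def using bil[of "\<lambda>i a. J a i x" y t] by (simp add: dot_def X_def)
  have dDX: "(\<Sum>i<n. dD i a x * y i) = (\<Sum>b<n. DD a b x * X y b)" for a y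
  proof -
    have "(\<Sum>i<n. dD i a x * y i) = (\<Sum>i<n. \<Sum>b<n. DD a b x * (J b i x * y i))"
      by (simp add: dD_def sum_distrib_right sum_distrib_left mult_ac)
    also have "\<dots> = (\<Sum>b<n. DD a b x * X y b)" by (subst sum.swap) (simp add: X_def sum_distrib_left)
    finally show ?thesis .
  qed
  have HX: "(\<Sum>i<n. \<Sum>k<n. Hs i k x * y i * t k) = h (X y) (X t)" for y t
  proof -
    have "(\<Sum>i<n. \<Sum>k<n. Hs i k x * y i * t k) = (\<Sum>a<n. (\<Sum>b<n. DD a b x * X y b) * X t a)"
      unfolding Hs_def bil dDX ..
    also have "\<dots> = h (X t) (X y)" by (simp add: h_def sum_distrib_right sum_distrib_left mult_ac)
    finally show ?thesis using h_commute by simp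
  qed
  have VV: "(\<Sum>i<n. \<Sum>k<n. (dw i x * dw k x) * y i * t k) = dot n ?D (X y) * dot n ?D (X t)" for y t
    unfolding dwX[symmetric] sum_product by (simp add: mult_ac)
  have Xv: "(\<Sum>i<n. J a i x * y i) = X y a" for y a by (simp add: X_def)
  define C where "C a = (X z a * h (X v) (X z) - X v a * h (X z) (X z))
      + ((\<Sum>b<n. DD a b x * X z b) * dot n (X v) (X z) - (\<Sum>b<n. DD a b x * X v b) * dot n (X z) (X z))
      + (X v a * (dot n ?D (X z))\<^sup>2 - X z a * (dot n ?D (X v) * dot n ?D (X z)))
      - dot n ?D ?D * (X v a * dot n (X z) (X z) - X z a * dot n (X v) (X z))
      - D a x * (dot n ?D (X z) * dot n (X v) (X z) - dot n ?D (X v) * dot n (X z) (X z))" for a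
  have con: "(\<Sum>l<n. J a l x * contr v z (\<lambda>i j k. riemann n H l i j k x)) = C a" if a: "a < n" for a
  proof -
    have "(\<Sum>l<n. J a l x * contr v z (\<lambda>i j k. riemann n H l i j k x)) = contr v z (\<lambda>i j k. \<Sum>l<n. J a l x * riemann n H l i j k x)"
    proof -
      have "(\<Sum>l<n. J a l x * contr v z (\<lambda>i j k. riemann n H l i j k x)) = (\<Sum>l<n. contr v z (\<lambda>i j k. J a l x * riemann n H l i j k x))"
        by (simp add: contr_scale)
      also have "\<dots> = contr v z (\<lambda>i j k. \<Sum>l<n. J a l x * riemann n H l i j k x)"
      proof -
        have "(\<Sum>l\<in>L. contr v z (F l)) = contr v z (\<lambda>i j k. \<Sum>l\<in>L. F l i j k)" if "finite L" for L :: "nat set" and F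
          using that by induction (simp_all add: contr_add contr_def[of v z "\<lambda>i j k. 0"])
        from this[of "{..<n}"] show ?thesis by simp
      qed
      finally show ?thesis .
    qed
    also have "\<dots> = contr v z (\<lambda>i j k. (J a j x * Hs i k x - J a i x * Hs j k x) + (dD j a x * G i k x - dD i a x * G j k x)
       + (J a i x * (dw j x * dw k x) - J a j x * (dw i x * dw k x))
       - D2 x * (J a i x * G j k x - J a j x * G i k x)
       - D a x * (dw j x * G i k x - dw i x * G j k x))"
      unfolding contr_def using J_riemann[OF x a] R_antisym[OF x a] by (intro sum.cong refl) auto
    also have "\<dots> = C a"
      unfolding contr_add contr_diff contr_scale contr_i contr_j HX GX VV dwX dDX Xv C_def
      by (simp add: D2_def dot_def[of n ?D ?D] power2_eq_square)
    finally show ?thesis .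
  qed
  have DDX: "(\<Sum>a<n. (\<Sum>b<n. DD a b x * X y b) * X v a) = h (X v) (X y)" for y
    by (simp add: h_def sum_distrib_right sum_distrib_left mult_ac)
  have sumC: "(\<Sum>a<n. C a * X v a) = (dot n (X z) (X v) * h (X v) (X z) - dot n (X v) (X v) * h (X z) (X z))
      + (h (X v) (X z) * dot n (X v) (X z) - h (X v) (X v) * dot n (X z) (X z))
      + (dot n (X v) (X v) * (dot n ?D (X z))\<^sup>2 - dot n (X z) (X v) * (dot n ?D (X v) * dot n ?D (X z)))
      - dot n ?D ?D * (dot n (X v) (X v) * dot n (X z) (X z) - dot n (X z) (X v) * dot n (X v) (X z))
      - dot n ?D (X v) * (dot n ?D (X z) * dot n (X v) (X z) - dot n ?D (X v) * dot n (X z) (X z))"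
    (is "_ = ?rhs")
  proof -
    \<comment> \<open>The factors that do not depend on a get the uniform shape \<open>t i\<close>,
      so that the distributive law can be instantiated for exactly these factors while their own
      sums stay folded.\<close>
    define t where "t i = [h (X v) (X z), h (X z) (X z), dot n (X v) (X z), dot n (X z) (X z), (dot n ?D (X z))\<^sup>2,
       dot n ?D (X v) * dot n ?D (X z), dot n ?D ?D,
       dot n ?D (X z) * dot n (X v) (X z) - dot n ?D (X v) * dot n (X z) (X z)] ! i" for i :: nat
    have "(\<Sum>a<n. C a * X v a) =
       (\<Sum>a<n. X z a * X v a) * t 0 - (\<Sum>a<n. X v a * X v a) * t 1
       + (\<Sum>a<n. (\<Sum>b<n. DD a b x * X z b) * X v a) * t 2 - (\<Sum>a<n. (\<Sum>b<n. DD a b x * X v b) * X v a) * t 3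
       + (\<Sum>a<n. X v a * X v a) * t 4 - (\<Sum>a<n. X z a * X v a) * t 5
       - ((\<Sum>a<n. X v a * X v a) * (t 6 * t 3) - (\<Sum>a<n. X z a * X v a) * (t 6 * t 2)) - (\<Sum>a<n. D a x * X v a) * t 7"
      unfolding sum_distrib_right[of "\<lambda>a. _ a * _ a" _ "t _"] sum_distrib_right[of "\<lambda>a. _ a * _ a" _ "t _ * t _"] sum.distrib[symmetric] sum_subtractf[symmetric]
      by (intro sum.cong refl) (simp add: C_def t_def algebra_simps)
    also have "\<dots> = ?rhs"
      unfolding DDX by (simp add: dot_def[symmetric] t_def algebra_simps dot_commute[of n "X z" "X v"] dot_commute[of n "X v" ?D])
    finally show ?thesis .
  qed
  have "form n H x (\<lambda>l. \<Sum>i<n. \<Sum>j<n. \<Sum>k<n. riemann n H l i j k x * v i * z j * z k) v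
    = (\<Sum>l<n. \<Sum>m<n. \<Sum>a<n. exp (2 * w x) * ((J a l x * contr v z (\<lambda>i j k. riemann n H l i j k x)) * (J a m x * v m)))"
    unfolding form_def contr_def[symmetric] H_eq G_def by (simp add: sum_distrib_left sum_distrib_right sum_distrib_left mult_ac)
  also have "\<dots> = (\<Sum>l<n. \<Sum>a<n. \<Sum>m<n. exp (2 * w x) * ((J a l x * contr v z (\<lambda>i j k. riemann n H l i j k x)) * (J a m x * v m)))"
    by (intro sum.cong refl sum.swap)
  also have "\<dots> = (\<Sum>a<n. \<Sum>l<n. \<Sum>m<n. exp (2 * w x) * ((J a l x * contr v z (\<lambda>i j k. riemann n H l i j k x)) * (J a m x * v m)))"
    by (rule sum.swap)
  also have "\<dots> = (\<Sum>a<n. exp (2 * w x) * ((\<Sum>l<n. J a l x * contr v z (\<lambda>i j k. riemann n H l i j k x)) * X v a))"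
    by (intro sum.cong refl, unfold X_def, subst sum_product) (simp add: sum_distrib_left)
  also have "\<dots> = exp (2 * w x) * (\<Sum>a<n. C a * X v a)" by (simp add: con sum_distrib_left)
  finally show ?thesis unfolding sumC
    by (simp add: dot_commute[of n "X z" "X v"] algebra_simps power2_eq_square)
qed

lemma form_H:
  defines "X \<equiv> \<lambda>x v a. \<Sum>i<n. J a i x * v i"
  shows "form n H x v z = exp (2 * w x) * dot n (X x v) (X x z)"
proof -
  have "form n H x v z = (\<Sum>i<n. \<Sum>j<n. \<Sum>a<n. exp (2 * w x) * (J a i x * v i) * (J a j x * z j))"
    by (simp add: form_def H_eq G_def sum_distrib_left sum_distrib_right sum_distrib_left mult_ac)
  also have "\<dots> = (\<Sum>i<n. \<Sum>a<n. \<Sum>j<n. exp (2 * w x) * (J a i x * v i) * (J a j x * z j))"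
    by (intro sum.cong refl sum.swap)
  also have "\<dots> = (\<Sum>a<n. \<Sum>i<n. \<Sum>j<n. exp (2 * w x) * (J a i x * v i) * (J a j x * z j))"
    by (rule sum.swap)
  also have "\<dots> = exp (2 * w x) * dot n (X x v) (X x z)"
    unfolding dot_def X_def
    by (subst sum_distrib_left, intro sum.cong refl, subst sum_product) (simp add: sum_distrib_left mult_ac)
  finally show ?thesis .
qed

text \<open>The expression in \<open>sub\<close> is the Gram determinant of X and Y times the trace
  of the Hessian on their plane. In this form it needs no orthonormal basis and makes sense for
  dependent vectors too.\<close>

lemma sectional_curvature_nonpos:
  assumes x: "x \<in> V"
    and sub: "\<And>X Y. dot n X X * (\<Sum>a<n. \<Sum>b<n. DD a b x * Y a * Y b) + dot n Y Y * (\<Sum>a<n. \<Sum>b<n. DD a b x * X a * X b)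
      - 2 * dot n X Y * (\<Sum>a<n. \<Sum>b<n. DD a b x * X a * Y b) \<ge> 0"
  shows "sectional_curvature n H x v z \<le> 0"
proof -
  define X where "X v a = (\<Sum>i<n. J a i x * v i)" for v :: coords and a
  define \<Delta> where "\<Delta> = dot n (X v) (X v) * dot n (X z) (X z) - (dot n (X v) (X z))\<^sup>2"
  have \<Delta>0: "\<Delta> \<ge> 0" using dot_cauchy_schwarz[of n "X v" "X z"] by (simp add: \<Delta>_def)
  have den: "form n H x v v * form n H x z z - (form n H x v z)\<^sup>2 = (exp (2 * w x))\<^sup>2 * \<Delta>"
  proof -
    have f: "form n H x p q = exp (2 * w x) * dot n (X p) (X q)" for p q by (simp add: form_H X_def[abs_def])
    show ?thesis unfolding f \<Delta>_def by (simp add: algebra_simps power2_eq_square)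
  qed
  show ?thesis
  proof (cases "\<Delta> = 0")
    \<comment> \<open>For dependent vectors the denominator vanishes and the quotient is 0 by
      convention.\<close>
    case True
    then show ?thesis by (simp add: sectional_curvature_def den)
  next
    case False
    then have pos: "\<Delta> > 0" using \<Delta>0 by simp
    have "form n H x (\<lambda>l. \<Sum>i<n. \<Sum>j<n. \<Sum>k<n. riemann n H l i j k x * v i * z j * z k) v \<le> 0"
      unfolding curvature_numerator[OF x] X_def[symmetric]
      using sub[of "X v" "X z"] gram_det_nonneg[of n "X v" "X z" "\<lambda>a. D a x"] pos
      by (intro mult_nonneg_nonpos) (auto simp: \<Delta>_def)
    then show ?thesis unfolding sectional_curvature_def den using pos
      by (intro divide_nonpos_pos) auto
  qed
qed

end

lemma nonpositive_curvature_conformal: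
  assumes u: "smooth_on n (Rn n) u"
    and sub: "\<And>y X Y. y \<in> Rn n \<Longrightarrow> dot n X X * (\<Sum>a<n. \<Sum>b<n. pd b (pd a u) y * Y a * Y b)
      + dot n Y Y * (\<Sum>a<n. \<Sum>b<n. pd b (pd a u) y * X a * X b)
      - 2 * dot n X Y * (\<Sum>a<n. \<Sum>b<n. pd b (pd a u) y * X a * Y b) \<ge> 0"
  shows "nonpositive_curvature n (euc_charts n) (conformal_metric n u)"
  unfolding nonpositive_curvature_def
proof (intro ballI allI impI)
  fix c x v z assume c: "c \<in> euc_charts n" and x: "x \<in> chart_im c"
  interpret conformal_chart n c u
    using c u by (intro conformal_chart.intro euc_chartI conformal_chart_axioms.intro)
  show "sectional_curvature n (conformal_metric n u c) x v z \<le> 0"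
    by (rule sectional_curvature_nonpos[OF x]) (use sub[OF \<psi>_Rn[OF x]] in \<open>simp add: DD_def\<close>)
qed

section \<open>Logarithmic potentials\<close>

lemma edist_nonneg [simp]: "edist n x y \<ge> 0"
  by (simp add: edist_def L2_set_nonneg)

lemma enorm_nonneg [simp]: "enorm n x \<ge> 0"
  by (simp add: enorm_def L2_set_nonneg)

lemma edist_squared: "(edist n x y)\<^sup>2 = (\<Sum>i<n. (x i - y i)\<^sup>2)"
  by (simp add: edist_def L2_set_def sum_nonneg)

lemma enorm_squared: "(enorm n x)\<^sup>2 = (\<Sum>i<n. (x i)\<^sup>2)"
  by (simp add: enorm_def L2_set_def sum_nonneg)

lemma edist_triangle: "edist n x z \<le> edist n x y + edist n y z"
  using L2_set_triangle_ineq[of "\<lambda>i. x i - y i" "\<lambda>i. y i - z i" "{..<n}"] by (simp add: edist_def)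

lemma edist_commute: "edist n x y = edist n y x"
  by (simp add: edist_def L2_set_def power2_commute)

lemma edist_eq_0_iff: "x \<in> Rn n \<Longrightarrow> y \<in> Rn n \<Longrightarrow> edist n x y = 0 \<longleftrightarrow> x = y"
  by (auto simp: edist_def L2_set_eq_0_iff intro: Rn_eqI)

lemma enorm_eq_0_iff: "x \<in> Rn n \<Longrightarrow> enorm n x = 0 \<longleftrightarrow> x = restrict (\<lambda>_. 0) {..<n}"
  by (auto simp: enorm_def L2_set_eq_0_iff restrict_Rn intro!: Rn_eqI[of _ n])

lemma measurable_edist: "edist n x \<in> borel_measurable (leb n)"
  unfolding edist_def[abs_def] L2_set_def
  by (rule measurable_compose[OF _ borel_measurable_sqrt])
    (intro borel_measurable_sum borel_measurable_power borel_measurable_diff borel_measurable_const measurable_leb_coord, auto)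

lemma measurable_enorm: "enorm n \<in> borel_measurable (leb n)"
  unfolding enorm_def[abs_def] L2_set_def
  by (rule measurable_compose[OF _ borel_measurable_sqrt])
    (intro borel_measurable_sum borel_measurable_power measurable_leb_coord, auto)

lemma singleton_null_leb:
  assumes "n \<ge> 1" "x \<in> Rn n"
  shows "{x} \<in> null_sets (leb n)"
proof -
  have eq: "{x} = PiE {..<n} (\<lambda>i. {x i})"
    using assms(2) PiE_singleton[of x "{..<n}"] by (simp add: Rn_extensional)
  have "emeasure (leb n) {x} = (\<Prod>i\<in>{..<n}. emeasure lborel {x i})"
    unfolding leb_def eq by (rule lborels.emeasure_PiM) auto
  also have "\<dots> = 0" using assms(1) by (auto intro!: prod_zero)
  finally have "emeasure (leb n) {x} = 0" .
  moreover have "{x} \<in> sets (leb n)" unfolding leb_def eq by (rule sets_PiM_I_finite) auto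
  ultimately show ?thesis by (auto simp: null_sets_def)
qed

text \<open>\<open>ln x \<le> x - 1\<close> and 2 b e \<le> b^2 + e^2 suffice for a bound in terms
  of a - b and e alone. It serves to show that the regularised potentials are continuous, for which
  the crude quadratic term does no harm.\<close>

lemma half_ln_shift_lipschitz:
  fixes a b e :: real
  assumes "a \<ge> 0" "b \<ge> 0" "e > 0"
  shows "\<bar>ln (a\<^sup>2 + e\<^sup>2) / 2 - ln (b\<^sup>2 + e\<^sup>2) / 2\<bar> \<le> \<bar>a - b\<bar> / e + (a - b)\<^sup>2 / e\<^sup>2"
proof -
  have main: "ln (a\<^sup>2 + e\<^sup>2) - ln (b\<^sup>2 + e\<^sup>2) \<le> (a - b) / e + (a - b)\<^sup>2 / e\<^sup>2"
    if "b \<le> a" "0 \<le> b" for a b :: real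
  proof -
    have p: "0 < b\<^sup>2 + e\<^sup>2" "0 < a\<^sup>2 + e\<^sup>2" using assms by (simp_all add: add_nonneg_pos)
    have "ln (a\<^sup>2 + e\<^sup>2) - ln (b\<^sup>2 + e\<^sup>2) = ln ((a\<^sup>2 + e\<^sup>2) / (b\<^sup>2 + e\<^sup>2))" using p assms(3) by (simp add: ln_div)
    also have "\<dots> \<le> (a\<^sup>2 + e\<^sup>2) / (b\<^sup>2 + e\<^sup>2) - 1" using p by (intro ln_le_minus_one) simp
    also have "\<dots> = ((a\<^sup>2 + e\<^sup>2) - (b\<^sup>2 + e\<^sup>2)) / (b\<^sup>2 + e\<^sup>2)"
    proof -
      have "x / c - 1 = (x - c) / c" if "c \<noteq> 0" for x c :: real using that by (simp add: diff_divide_distrib)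
      then show ?thesis using p(1) by (metis less_irrefl)
    qed
    also have "(a\<^sup>2 + e\<^sup>2) - (b\<^sup>2 + e\<^sup>2) = (a - b) * (2 * b) + (a - b)\<^sup>2"
      by (simp add: power2_eq_square algebra_simps)
    also have "\<dots> / (b\<^sup>2 + e\<^sup>2) = (a - b) * (2 * b / (b\<^sup>2 + e\<^sup>2)) + (a - b)\<^sup>2 / (b\<^sup>2 + e\<^sup>2)"
      by (simp add: add_divide_distrib)
    also have "\<dots> \<le> (a - b) * (1 / e) + (a - b)\<^sup>2 / e\<^sup>2"
    proof (intro add_mono mult_left_mono divide_left_mono)
      have "0 \<le> (b - e)\<^sup>2" by simp
      then have "2 * b * e \<le> b\<^sup>2 + e\<^sup>2" by (simp add: power2_eq_square algebra_simps)
      then show "2 * b / (b\<^sup>2 + e\<^sup>2) \<le> 1 / e" using p assms by (simp add: field_simps)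
    qed (use p assms that in auto)
    finally show ?thesis by simp
  qed
  have nn: "0 \<le> \<bar>a - b\<bar> / e + (a - b)\<^sup>2 / e\<^sup>2" using assms by simp
  consider "b \<le> a" | "a \<le> b" by linarith
  then show ?thesis
  proof cases
    case 1
    have "ln (b\<^sup>2 + e\<^sup>2) \<le> ln (a\<^sup>2 + e\<^sup>2)" using 1 assms by (simp add: add_nonneg_pos power_mono)
    then show ?thesis using main[OF 1 assms(2)] nn 1 by (simp add: abs_if)
  next
    case 2
    have "ln (a\<^sup>2 + e\<^sup>2) \<le> ln (b\<^sup>2 + e\<^sup>2)" using 2 assms by (simp add: add_nonneg_pos power_mono)
    then show ?thesis using main[OF 2 assms(1)] nn 2 by (simp add: abs_if power2_commute[of a b])
  qed
qed

text \<open>The second difference of \<open>ln |z|\<close>, regularised, along two orthonormal directions: \<open>s\<close> is \<open>|z|\<^sup>2 + e\<^sup>2\<close>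
  and \<open>a\<close>, \<open>b\<close> are the components of \<open>z\<close>, so that \<open>a\<^sup>2 + b\<^sup>2 \<le> s\<close> by Bessel's inequality.\<close>

lemma four_point_ln:
  fixes s h a b e :: real
  assumes h: "0 < h" "h < e" and s: "e\<^sup>2 \<le> s" and ab: "a\<^sup>2 + b\<^sup>2 \<le> s - e\<^sup>2"
  shows "ln (s + h\<^sup>2 + 2 * h * a) / 2 + ln (s + h\<^sup>2 - 2 * h * a) / 2 + ln (s + h\<^sup>2 + 2 * h * b) / 2
    + ln (s + h\<^sup>2 - 2 * h * b) / 2 - 4 * (ln s / 2) \<ge> ln (1 - h ^ 4 / e ^ 4)"
proof -
  have e: "e > 0" using h by simp
  have sp: "s > 0" using s e by (meson less_le_trans zero_less_power)
  have pos: "s + h\<^sup>2 + 2 * h * c > 0" "s + h\<^sup>2 - 2 * h * c > 0" if "c\<^sup>2 \<le> s - e\<^sup>2" for c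
  proof -
    have eq: "s + h\<^sup>2 + 2 * h * c = (s - c\<^sup>2) + (h + c)\<^sup>2" "s + h\<^sup>2 - 2 * h * c = (s - c\<^sup>2) + (h - c)\<^sup>2"
      by (simp_all add: power2_eq_square algebra_simps)
    have "e\<^sup>2 > 0" using e by simp
    then have "s - c\<^sup>2 > 0" using that by linarith
    then show "s + h\<^sup>2 + 2 * h * c > 0" "s + h\<^sup>2 - 2 * h * c > 0"
      unfolding eq using zero_le_power2[of "h + c"] zero_le_power2[of "h - c"] by linarith+
  qed
  have a2: "a\<^sup>2 \<le> s - e\<^sup>2" "b\<^sup>2 \<le> s - e\<^sup>2" using ab by (smt (verit) zero_le_power2)+
  \<comment> \<open>The four arguments multiply to (A^2 - 4 h^2 a^2) (A^2 - 4 h^2 b^2), which is at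
    least A^2 (A^2 - 4 h^2 (a^2 + b^2)). Replacing a^2 + b^2 by its bound s gives a perfect square,
    because A^2 - 4 h^2 s = (s - h^2)^2; so the second difference is at least
    \<open>ln (1 - h^4 / s^2)\<close>.\<close>
  define A where "A = s + h\<^sup>2"
  have sh: "h\<^sup>2 < s" using h s by (smt (verit) power2_less_imp_less power_strict_mono zero_less_numeral)
  have "(s\<^sup>2 - h ^ 4)\<^sup>2 = A\<^sup>2 * (A\<^sup>2 - 4 * h\<^sup>2 * s)"
    by (simp add: A_def power2_eq_square power4_eq_xxxx algebra_simps)
  also have "\<dots> \<le> A\<^sup>2 * (A\<^sup>2 - 4 * h\<^sup>2 * (a\<^sup>2 + b\<^sup>2))"
  proof -
    have "a\<^sup>2 + b\<^sup>2 \<le> s" using ab by (smt (verit) zero_le_power2)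
    then have "4 * h\<^sup>2 * (a\<^sup>2 + b\<^sup>2) \<le> 4 * h\<^sup>2 * s" by (intro mult_left_mono) auto
    then show ?thesis by (intro mult_left_mono) auto
  qed
  also have "\<dots> \<le> (A\<^sup>2 - 4 * h\<^sup>2 * a\<^sup>2) * (A\<^sup>2 - 4 * h\<^sup>2 * b\<^sup>2)"
  proof -
    have "(A\<^sup>2 - 4 * h\<^sup>2 * a\<^sup>2) * (A\<^sup>2 - 4 * h\<^sup>2 * b\<^sup>2) = A\<^sup>2 * (A\<^sup>2 - 4 * h\<^sup>2 * (a\<^sup>2 + b\<^sup>2)) + 16 * (h\<^sup>2 * a * b)\<^sup>2"
      by (simp add: power2_eq_square algebra_simps)
    then show ?thesis by simp
  qed
  also have "\<dots> = (s + h\<^sup>2 + 2 * h * a) * (s + h\<^sup>2 - 2 * h * a) * ((s + h\<^sup>2 + 2 * h * b) * (s + h\<^sup>2 - 2 * h * b))" (is "_ = ?P")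
    by (simp add: A_def power2_eq_square algebra_simps)
  finally have le: "(s\<^sup>2 - h ^ 4)\<^sup>2 \<le> ?P" .
  have s4: "s\<^sup>2 - h ^ 4 > 0" using sh sp h by (smt (verit) power2_eq_square power_strict_mono mult_strict_mono zero_le_power2 power4_eq_xxxx mult.assoc)
  \<comment> \<open>Replacing s by its lower bound e^2 makes the error uniform in the point.\<close>
  have "ln (1 - h ^ 4 / e ^ 4) \<le> ln (1 - h ^ 4 / s\<^sup>2)"
  proof (rule ln_mono)
    have "h ^ 4 < e ^ 4" using h by (intro power_strict_mono) auto
    then show "0 < 1 - h ^ 4 / e ^ 4" using e by simp
    have "e ^ 4 \<le> s\<^sup>2" using power_mono[OF s, of 2] by (simp add: power_mult[symmetric])
    then have "h ^ 4 / s\<^sup>2 \<le> h ^ 4 / e ^ 4" using e h sp by (intro divide_left_mono) auto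
    then show "1 - h ^ 4 / e ^ 4 \<le> 1 - h ^ 4 / s\<^sup>2" by simp
  qed
  also have "\<dots> = ln (s\<^sup>2 - h ^ 4) - ln (s\<^sup>2)"
  proof -
    have "1 - h ^ 4 / s\<^sup>2 = (s\<^sup>2 - h ^ 4) / s\<^sup>2" using sp by (simp add: diff_divide_distrib)
    then show ?thesis using s4 sp by (simp add: ln_div)
  qed
  also have "\<dots> = ln ((s\<^sup>2 - h ^ 4)\<^sup>2) / 2 - 2 * ln s"
    using s4 sp by (simp add: ln_realpow)
  also have "\<dots> \<le> ln ?P / 2 - 2 * ln s"
    using le s4 by (intro diff_mono divide_right_mono ln_mono) auto
  also have "ln ?P = ln (s + h\<^sup>2 + 2 * h * a) + ln (s + h\<^sup>2 - 2 * h * a) + (ln (s + h\<^sup>2 + 2 * h * b) + ln (s + h\<^sup>2 - 2 * h * b))"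
    using pos[OF a2(1)] pos[OF a2(2)] by (simp add: ln_mult)
  finally show ?thesis by (simp add: field_simps)
qed

text \<open>Here d and d' are the distances of a point from two points at distance 1 from each
  other. For d \<ge> 1/2 the left-hand side is at most \<open>ln 5\<close>, as 5 = 1 + 1 / (1/2)^2.
  For smaller d it grows like \<open>- ln d\<close>, while d' \<ge> 1/2 keeps \<open>ln d'\<close>
  bounded below. Thus the regularisation error is controlled by the difference of two logarithmic
  kernels, whose integrability is known.\<close>

lemma ln_one_plus_inverse_bound:
  fixes d d' :: real
  assumes "d > 0" "d' > 0" "\<bar>d' - 1\<bar> \<le> d"
  shows "ln (1 + 1 / d\<^sup>2) / 2 \<le> \<bar>ln d' - ln d\<bar> + ln 5"
proof (cases "d \<ge> 1/2")
  case True
  have "d\<^sup>2 \<ge> (1/2)\<^sup>2" using True by (intro power_mono) auto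
  then have "1 + 1 / d\<^sup>2 \<le> 5" using assms by (simp add: field_simps power2_eq_square)
  then have "ln (1 + 1 / d\<^sup>2) \<le> ln 5" using assms by (intro ln_mono) (auto intro: add_pos_nonneg)
  moreover have "0 \<le> ln (5::real)" by simp
  ultimately show ?thesis by linarith
next
  case False
  have d': "d' \<ge> 1/2" using False assms by (auto simp: abs_if split: if_splits)
  have d1: "d\<^sup>2 \<le> 1" using False assms by (intro power_le_one) auto
  have "1 + 1 / d\<^sup>2 = (d\<^sup>2 + 1) / d\<^sup>2" using assms by (simp add: field_simps)
  also have "\<dots> \<le> 5 / d\<^sup>2" using d1 by (intro divide_right_mono) auto
  finally have "1 + 1 / d\<^sup>2 \<le> 5 / d\<^sup>2" .
  then have "ln (1 + 1 / d\<^sup>2) \<le> ln (5 / d\<^sup>2)" using assms by (intro ln_mono) (auto intro: add_pos_nonneg)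
  also have "\<dots> = ln 5 - 2 * ln d" using assms by (simp add: ln_div ln_realpow)
  finally have 1: "ln (1 + 1 / d\<^sup>2) / 2 \<le> ln 5 / 2 - ln d" by simp
  have "ln (1/2) \<le> ln d'" using d' by (intro ln_mono) auto
  then have "- ln d \<le> \<bar>ln d' - ln d\<bar> + ln 2" by (simp add: ln_div)
  moreover have "ln 5 / 2 + ln 2 \<le> ln (5::real)"
  proof -
    have "2 * ln (2::real) = ln 4" using ln_realpow[of "2::real" 2] by simp
    also have "\<dots> \<le> ln 5" by simp
    finally show ?thesis by simp
  qed
  ultimately show ?thesis using 1 by linarith
qed

text \<open>The density g will be a non-negative multiple of \<open>- Q exp (n u)\<close>. Besides
  its sign and finite mass only the convergence of each single integral is assumed, together with
  the resulting representation of u as a superposition of logarithms, normalised by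
  \<open>ln (enorm n y)\<close>.\<close>

locale log_potential =
  fixes n :: nat and g :: "coords \<Rightarrow> real" and C :: real and u :: "coords \<Rightarrow> real"
  assumes n: "n \<ge> 1" and g: "integrable (leb n) g" and g_nonneg: "\<And>y. y \<in> Rn n \<Longrightarrow> g y \<ge> 0"
    and int_k: "\<And>x. x \<in> Rn n \<Longrightarrow> integrable (leb n) (\<lambda>y. ln (edist n x y / enorm n y) * g y)"
    and u_eq: "\<And>x. x \<in> Rn n \<Longrightarrow> u x = (LINT y|leb n. ln (edist n x y / enorm n y) * g y) + C"
begin

definition "origin = restrict (\<lambda>_. 0 :: real) {..<n}"

lemma AE_generic:
  assumes "x \<in> Rn n"
  shows "AE y in leb n. y \<in> Rn n \<and> edist n x y > 0 \<and> enorm n y > 0"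
proof -
  have "{x} \<union> {origin} \<in> null_sets (leb n)"
    using singleton_null_leb[OF n] assms by (intro null_sets.Un) (auto simp: origin_def restrict_Rn)
  then show ?thesis
  proof (rule AE_I')
    have "edist n x y > 0 \<longleftrightarrow> x \<noteq> y" "enorm n y > 0 \<longleftrightarrow> y \<noteq> origin" if "y \<in> Rn n" for y
      using edist_eq_0_iff[OF assms that] enorm_eq_0_iff[OF that] edist_nonneg[of n x y] enorm_nonneg[of n y]
      by (auto simp: origin_def less_le)
    then show "{y \<in> space (leb n). \<not> (y \<in> Rn n \<and> edist n x y > 0 \<and> enorm n y > 0)} \<subseteq> {x} \<union> {origin}"
      by (auto simp: space_leb)
  qed
qed

definition ke :: "real \<Rightarrow> coords \<Rightarrow> coords \<Rightarrow> real" where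
  "ke e x y = ln ((edist n x y)\<^sup>2 + e\<^sup>2) / 2 - ln (enorm n y)"

definition ue :: "real \<Rightarrow> coords \<Rightarrow> real" where
  "ue e x = (LINT y|leb n. ke e x y * g y) + C"

lemma measurable_g: "g \<in> borel_measurable (leb n)" using g by auto

lemma measurable_ke: "ke e x \<in> borel_measurable (leb n)"
  unfolding ke_def[abs_def] using measurable_edist measurable_enorm by measurable

text \<open>The gain of the regularised kernel over the logarithm off the diagonal: non-negative,
  increasing in e and tending to 0 with e. So \<open>ue e\<close> decreases to u as e decreases to
  0.\<close>

definition er :: "real \<Rightarrow> coords \<Rightarrow> coords \<Rightarrow> real" where
  "er e x y = ln (1 + e\<^sup>2 / (edist n x y)\<^sup>2) / 2"

lemma measurable_er: "er e x \<in> borel_measurable (leb n)"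
  unfolding er_def[abs_def] using measurable_edist by measurable

lemma er_nonneg: "er e x y \<ge> 0"
  unfolding er_def by simp

lemma er_mono: "0 \<le> e \<Longrightarrow> e \<le> e' \<Longrightarrow> er e x y \<le> er e' x y"
  unfolding er_def by (intro divide_right_mono ln_mono add_mono power_mono) (auto intro: add_pos_nonneg)

lemma ke_split:
  assumes "edist n x y > 0" "enorm n y > 0"
  shows "ke e x y = ln (edist n x y / enorm n y) + er e x y"
proof -
  have "ln ((edist n x y)\<^sup>2 + e\<^sup>2) = ln ((edist n x y)\<^sup>2 * (1 + e\<^sup>2 / (edist n x y)\<^sup>2))"
    using assms by (simp add: algebra_simps)
  also have "\<dots> = 2 * ln (edist n x y) + ln (1 + e\<^sup>2 / (edist n x y)\<^sup>2)"
  proof -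
    have "0 < 1 + e\<^sup>2 / (edist n x y)\<^sup>2" by (intro add_pos_nonneg) auto
    then show ?thesis using assms by (subst ln_mult_pos) (auto simp: ln_realpow)
  qed
  finally show ?thesis using assms by (simp add: ke_def er_def ln_div)
qed

lemma integrable_er1:
  assumes x: "x \<in> Rn n"
  shows "integrable (leb n) (\<lambda>y. er 1 x y * g y)"
proof -
  \<comment> \<open>An auxiliary point at distance 1 from x: the integrals for x and x' both
    converge, and the difference of their integrands dominates the regularisation error up to
    \<open>ln 5 * g y\<close>.\<close>
  define x' where "x' = x(0 := x 0 + 1)"
  have x': "x' \<in> Rn n" using x n by (simp add: x'_def Rn_upd)
  have "(edist n x' x)\<^sup>2 = (\<Sum>i<n. if i = 0 then 1 else 0)"
    unfolding edist_squared by (intro sum.cong) (auto simp: x'_def)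
  then have "(edist n x' x)\<^sup>2 = 1" using n by simp
  then have d1: "edist n x' x = 1" using edist_nonneg[of n x' x] by (simp add: power2_eq_1_iff)
  let ?k = "\<lambda>x y. ln (edist n x y / enorm n y) * g y"
  have b: "integrable (leb n) (\<lambda>y. \<bar>?k x' y - ?k x y\<bar> + ln 5 * g y)"
    using int_k[OF x] int_k[OF x'] g by simp
  show ?thesis
  proof (rule Bochner_Integration.integrable_bound[OF b])
    show "(\<lambda>y. er 1 x y * g y) \<in> borel_measurable (leb n)"
      using measurable_er measurable_g by measurable
    show "AE y in leb n. norm (er 1 x y * g y) \<le> norm (\<bar>?k x' y - ?k x y\<bar> + ln 5 * g y)"
      using AE_generic[OF x] AE_generic[OF x']
    proof eventually_elim
      case (elim y)
      have gy: "g y \<ge> 0" using g_nonneg elim by blast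
      have "\<bar>edist n x' y - 1\<bar> \<le> edist n x y"
        using edist_triangle[of n x' y x] edist_triangle[of n x' x y] d1 edist_commute[of n x y] by linarith
      from ln_one_plus_inverse_bound[OF _ _ this]
      have "er 1 x y \<le> \<bar>ln (edist n x' y) - ln (edist n x y)\<bar> + ln 5"
        using elim by (simp add: er_def)
      then have "er 1 x y * g y \<le> (\<bar>ln (edist n x' y / enorm n y) - ln (edist n x y / enorm n y)\<bar> + ln 5) * g y"
        using elim gy by (intro mult_right_mono) (auto simp: ln_div)
      also have "\<dots> = \<bar>?k x' y - ?k x y\<bar> + ln 5 * g y"
        using gy by (simp add: algebra_simps abs_mult_pos' flip: abs_mult_pos)
      finally show ?case using er_nonneg[of 1 x y] gy by simp
    qed
  qed
qed

lemma integrable_er: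
  assumes x: "x \<in> Rn n" and e: "0 \<le> e" "e \<le> 1"
  shows "integrable (leb n) (\<lambda>y. er e x y * g y)"
proof (rule Bochner_Integration.integrable_bound[OF integrable_er1[OF x]])
  show "(\<lambda>y. er e x y * g y) \<in> borel_measurable (leb n)"
    using measurable_er measurable_g by measurable
  show "AE y in leb n. norm (er e x y * g y) \<le> norm (er 1 x y * g y)"
    using er_mono[OF e] er_nonneg by (auto simp: abs_mult intro!: mult_right_mono)
qed

lemma ke_g_AE:
  assumes x: "x \<in> Rn n"
  shows "AE y in leb n. ke e x y * g y = ln (edist n x y / enorm n y) * g y + er e x y * g y"
  using AE_generic[OF x] by eventually_elim (simp add: ke_split algebra_simps)

lemma integrable_ke:
  assumes x: "x \<in> Rn n" and e: "0 \<le> e" "e \<le> 1"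
  shows "integrable (leb n) (\<lambda>y. ke e x y * g y)"
proof (rule integrable_cong_AE_imp)
  show "integrable (leb n) (\<lambda>y. ln (edist n x y / enorm n y) * g y + er e x y * g y)"
    using int_k[OF x] integrable_er[OF x e] by simp
  show "(\<lambda>y. ke e x y * g y) \<in> borel_measurable (leb n)"
    using measurable_ke measurable_g by measurable
  show "AE y in leb n. ln (edist n x y / enorm n y) * g y + er e x y * g y = ke e x y * g y"
    using ke_g_AE[OF x, of e] by eventually_elim simp
qed

lemma ue_eq:
  assumes x: "x \<in> Rn n" and e: "0 \<le> e" "e \<le> 1"
  shows "ue e x = u x + (LINT y|leb n. er e x y * g y)"
proof -
  have "(LINT y|leb n. ke e x y * g y) = (LINT y|leb n. ln (edist n x y / enorm n y) * g y + er e x y * g y)"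
    using ke_g_AE[OF x, of e] measurable_ke measurable_g int_k[OF x] integrable_er[OF x e]
    by (intro integral_cong_AE) (auto intro: borel_measurable_times)
  also have "\<dots> = (LINT y|leb n. ln (edist n x y / enorm n y) * g y) + (LINT y|leb n. er e x y * g y)"
    using int_k[OF x] integrable_er[OF x e] by simp
  finally show ?thesis by (simp add: ue_def u_eq[OF x])
qed

lemma ue_ge: "x \<in> Rn n \<Longrightarrow> 0 \<le> e \<Longrightarrow> e \<le> 1 \<Longrightarrow> u x \<le> ue e x"
  using ue_eq[of x e] Bochner_Integration.integral_nonneg[of "leb n" "\<lambda>y. er e x y * g y"] er_nonneg[of e x] g_nonneg
  by (simp add: space_leb)

lemma ue_mono:
  assumes x: "x \<in> Rn n" and e: "0 \<le> e" "e \<le> e'" "e' \<le> 1"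
  shows "ue e x \<le> ue e' x"
proof -
  have "(LINT y|leb n. er e x y * g y) \<le> (LINT y|leb n. er e' x y * g y)"
    using integrable_er[OF x] e er_mono[OF e(1,2), of x] g_nonneg
    by (intro integral_mono) (auto simp: space_leb intro!: mult_right_mono)
  then show ?thesis using ue_eq[OF x] e by simp
qed

lemma ue_tendsto:
  assumes x: "x \<in> Rn n"
  shows "(\<lambda>m. ue (inverse (real (Suc m))) x) \<longlonglongrightarrow> u x"
proof -
  have "(\<lambda>m. LINT y|leb n. er (inverse (real (Suc m))) x y * g y) \<longlonglongrightarrow> (LINT y|leb n. 0)"
  proof (rule integral_dominated_convergence[OF _ _ integrable_er1[OF x]])
    show "AE y in leb n. (\<lambda>m. er (inverse (real (Suc m))) x y * g y) \<longlonglongrightarrow> 0"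
    proof (intro AE_I2)
      fix y
      have "(\<lambda>m. (inverse (real (Suc m)))\<^sup>2 / (edist n x y)\<^sup>2) \<longlonglongrightarrow> 0\<^sup>2 / (edist n x y)\<^sup>2"
      \<comment> \<open>On the diagonal both fractions are 0 because division by 0 is.\<close>
      proof (cases "edist n x y = 0")
        case False
        then show ?thesis by (intro tendsto_divide tendsto_power LIMSEQ_inverse_real_of_nat tendsto_const) auto
      qed simp
      then have "(\<lambda>m. ln (1 + (inverse (real (Suc m)))\<^sup>2 / (edist n x y)\<^sup>2) / 2 * g y) \<longlonglongrightarrow> ln (1 + 0) / 2 * g y"
        by (intro tendsto_mult tendsto_divide tendsto_ln tendsto_add tendsto_const) auto
      then show "(\<lambda>m. er (inverse (real (Suc m))) x y * g y) \<longlonglongrightarrow> 0" by (simp add: er_def)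
    qed
    show "AE y in leb n. norm (er (inverse (real (Suc m))) x y * g y) \<le> er 1 x y * g y" for m
      using er_mono[of "inverse (real (Suc m))" 1 x] er_nonneg g_nonneg
      by (auto simp: abs_mult space_leb field_simps intro!: AE_I2 mult_left_mono)
  qed (use measurable_er measurable_g in \<open>auto intro: borel_measurable_times\<close>)
  then have "(\<lambda>m. u x + (LINT y|leb n. er (inverse (real (Suc m))) x y * g y)) \<longlonglongrightarrow> u x + 0"
    by (intro tendsto_add tendsto_const) simp
  moreover have "ue (inverse (real (Suc m))) x = u x + (LINT y|leb n. er (inverse (real (Suc m))) x y * g y)" for m
    by (rule ue_eq[OF x]) (auto simp: field_simps)
  ultimately show ?thesis by simp
qed

lemma ue_lipschitz:
  assumes x: "x \<in> Rn n" "x' \<in> Rn n" and e: "0 < e" "e \<le> 1"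
  shows "\<bar>ue e x - ue e x'\<bar> \<le> (edist n x x' / e + (edist n x x')\<^sup>2 / e\<^sup>2) * (LINT y|leb n. g y)"
proof -
  let ?c = "edist n x x' / e + (edist n x x')\<^sup>2 / e\<^sup>2"
  have i: "integrable (leb n) (\<lambda>y. ke e x y * g y)" "integrable (leb n) (\<lambda>y. ke e x' y * g y)"
    using integrable_ke x e by auto
  have "\<bar>ue e x - ue e x'\<bar> = \<bar>LINT y|leb n. ke e x y * g y - ke e x' y * g y\<bar>"
    using i by (simp add: ue_def)
  also have "\<dots> \<le> (LINT y|leb n. \<bar>ke e x y * g y - ke e x' y * g y\<bar>)"
    by (rule integral_abs_bound)
  also have "\<dots> \<le> (LINT y|leb n. ?c * g y)"
  proof (rule integral_mono)
    fix y assume "y \<in> space (leb n)"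
    then have gy: "g y \<ge> 0" using g_nonneg by (simp add: space_leb)
    have d: "\<bar>edist n x y - edist n x' y\<bar> \<le> edist n x x'"
      using edist_triangle[of n x y x'] edist_triangle[of n x' y x] edist_commute[of n x x'] by linarith
    have "\<bar>ke e x y - ke e x' y\<bar> \<le> \<bar>edist n x y - edist n x' y\<bar> / e + (edist n x y - edist n x' y)\<^sup>2 / e\<^sup>2"
      using half_ln_shift_lipschitz[of "edist n x y" "edist n x' y" e] e by (simp add: ke_def)
    also have "\<dots> \<le> ?c"
      using d e power_mono[OF d, of 2] by (intro add_mono divide_right_mono) auto
    finally have "\<bar>ke e x y - ke e x' y\<bar> * g y \<le> ?c * g y" using gy by (intro mult_right_mono)
    then show "\<bar>ke e x y * g y - ke e x' y * g y\<bar> \<le> ?c * g y"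
      using gy by (metis abs_mult abs_of_nonneg left_diff_distrib)
  qed (use i g in auto)
  also have "\<dots> = ?c * (LINT y|leb n. g y)" by simp
  finally show ?thesis .
qed


text \<open>\<open>four_point_ln\<close> integrated against g. The error is proportional to the
  total mass and does not depend on x.\<close>

lemma four_point_ue:
  assumes x: "x \<in> Rn n" and h: "0 < h" "h < e" "e \<le> 1"
    and vw: "(\<Sum>a<n. v a * v a) = 1" "(\<Sum>a<n. w a * w a) = 1" "(\<Sum>a<n. v a * w a) = (0::real)"
  defines "sh \<equiv> \<lambda>r z. restrict (\<lambda>a. x a + r * z a) {..<n}"
  shows "ue e (sh h v) + ue e (sh (-h) v) + ue e (sh h w) + ue e (sh (-h) w) - 4 * ue e x
    \<ge> ln (1 - h ^ 4 / e ^ 4) * (LINT y|leb n. g y)"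
proof -
  have e: "e > 0" using h by simp
  have shR: "sh r z \<in> Rn n" for r z by (simp add: sh_def restrict_Rn)
  note ik = integrable_ke[OF _ less_imp_le[OF e] h(3)]
  have "ln (1 - h ^ 4 / e ^ 4) * (LINT y|leb n. g y) = (LINT y|leb n. ln (1 - h ^ 4 / e ^ 4) * g y)" by simp
  also have "\<dots> \<le> (LINT y|leb n. ke e (sh h v) y * g y + ke e (sh (-h) v) y * g y + ke e (sh h w) y * g y
      + ke e (sh (-h) w) y * g y - 4 * (ke e x y * g y))"
  proof (rule integral_mono)
    fix y assume "y \<in> space (leb n)"
    then have gy: "g y \<ge> 0" using g_nonneg by (simp add: space_leb)
    define z where "z a = x a - y a" for a
    define s where "s = (\<Sum>a<n. z a * z a) + e\<^sup>2"
    define a where "a = (\<Sum>i<n. z i * v i)"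
    define b where "b = (\<Sum>i<n. z i * w i)"
    have ds: "(edist n (sh r p) y)\<^sup>2 + e\<^sup>2 = s + r\<^sup>2 * (\<Sum>a<n. p a * p a) + 2 * r * (\<Sum>i<n. z i * p i)" for r p
    proof -
      have "(edist n (sh r p) y)\<^sup>2 = (\<Sum>i<n. z i * z i + r\<^sup>2 * (p i * p i) + 2 * r * (z i * p i))"
        unfolding edist_squared by (intro sum.cong) (auto simp: sh_def z_def power2_eq_square algebra_simps)
      then show ?thesis by (simp add: s_def sum.distrib sum_distrib_left)
    qed
    have d0: "(edist n x y)\<^sup>2 + e\<^sup>2 = s" unfolding edist_squared s_def z_def by (simp add: power2_eq_square)
    \<comment> \<open>Bessel's inequality, from the square of what remains of z after projection to
      v and w.\<close>
    have "0 \<le> (\<Sum>i<n. (z i - a * v i - b * w i)\<^sup>2)" by (simp add: sum_nonneg)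
    also have "\<dots> = (\<Sum>i<n. z i * z i + a\<^sup>2 * (v i * v i) + b\<^sup>2 * (w i * w i) - 2 * a * (z i * v i) - 2 * b * (z i * w i) + 2 * a * b * (v i * w i))"
      by (intro sum.cong) (auto simp: power2_eq_square algebra_simps)
    also have "\<dots> = (s - e\<^sup>2) + a\<^sup>2 + b\<^sup>2 - 2 * a * a - 2 * b * b"
      unfolding sum.distrib sum_subtractf sum_distrib_left[symmetric] vw a_def[symmetric] b_def[symmetric] by (simp add: s_def)
    finally have ab: "a\<^sup>2 + b\<^sup>2 \<le> s - e\<^sup>2" by (simp add: power2_eq_square)
    have s: "e\<^sup>2 \<le> s" by (simp add: s_def sum_nonneg)
    have "ln (1 - h ^ 4 / e ^ 4) \<le> ke e (sh h v) y + ke e (sh (-h) v) y + ke e (sh h w) y + ke e (sh (-h) w) y - 4 * ke e x y"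
      using four_point_ln[OF h(1,2) s ab] unfolding ke_def ds d0 vw a_def[symmetric] b_def[symmetric] by (simp add: algebra_simps)
    from mult_right_mono[OF this gy]
    show "ln (1 - h ^ 4 / e ^ 4) * g y \<le> ke e (sh h v) y * g y + ke e (sh (-h) v) y * g y + ke e (sh h w) y * g y
      + ke e (sh (-h) w) y * g y - 4 * (ke e x y * g y)" by (simp add: algebra_simps)
  qed (use ik shR x g in auto)
  also have "\<dots> = (LINT y|leb n. ke e (sh h v) y * g y) + (LINT y|leb n. ke e (sh (-h) v) y * g y) + (LINT y|leb n. ke e (sh h w) y * g y)
      + (LINT y|leb n. ke e (sh (-h) w) y * g y) - 4 * (LINT y|leb n. ke e x y * g y)"
    using ik[OF shR] ik[OF x] by simp
  finally show ?thesis by (simp add: ue_def)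
qed

end

section \<open>Hessians and comparison with quadratic functions\<close>

definition hess :: "nat \<Rightarrow> (coords \<Rightarrow> real) \<Rightarrow> coords \<Rightarrow> coords \<Rightarrow> coords \<Rightarrow> real" where
  "hess n u x X Y = (\<Sum>a<n. \<Sum>b<n. pd b (pd a u) x * X a * Y b)"

lemma hess_linear:
  "hess n u x (\<lambda>a. c * X a) Y = c * hess n u x X Y" "hess n u x X (\<lambda>a. c * Y a) = c * hess n u x X Y"
  "hess n u x (\<lambda>a. X a + X' a) Y = hess n u x X Y + hess n u x X' Y"
  "hess n u x X (\<lambda>a. Y a + Y' a) = hess n u x X Y + hess n u x X Y'"
  by (simp_all add: hess_def sum_distrib_left sum.distrib algebra_simps)

lemma hess_commute:
  assumes "smooth_on n (Rn n) u" "x \<in> Rn n"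
  shows "hess n u x X Y = hess n u x Y X"
proof -
  have "hess n u x X Y = (\<Sum>b<n. \<Sum>a<n. pd b (pd a u) x * X a * Y b)" unfolding hess_def by (rule sum.swap)
  also have "\<dots> = hess n u x Y X"
    unfolding hess_def using smooth_on_pd_commute[OF openin_Rn assms(1) _ _ assms(2)] by (intro sum.cong) (auto simp: mult_ac)
  finally show ?thesis .
qed

text \<open>Along a segment from x, \<open>q\<close> is u minus a quadratic comparison function.
  Continuity of the second derivatives makes \<open>q''\<close> negative near x, so
  \<open>q'\<close> decreases from \<open>q' 0 = 0\<close> and \<open>q 1\<close> lies strictly
  below \<open>q 0\<close>.\<close>

lemma taylor_strict:
  assumes u: "smooth_on n (Rn n) u" and x: "x \<in> Rn n" and \<eta>: "\<eta> > 0"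
  obtains \<rho> where "\<rho> > 0" "\<And>z. (\<Sum>a<n. z a * z a) \<le> \<rho>\<^sup>2 \<Longrightarrow> (\<Sum>a<n. z a * z a) > 0 \<Longrightarrow>
    u (restrict (\<lambda>a. x a + z a) {..<n}) < u x + (\<Sum>a<n. pd a u x * z a) + hess n u x z z / 2 + \<eta> * (\<Sum>a<n. z a * z a)"
proof -
  define d where "d y = (\<Sum>a<n. \<Sum>b<n. \<bar>pd b (pd a u) y - pd b (pd a u) x\<bar>)" for y
  have "continuous_on (Rn n) (pd b (pd a u))" if "a < n" "b < n" for a b
    using smooth_on_continuous[OF openin_Rn smooth_on_pd[OF smooth_on_pd[OF u that(1)] that(2)]] .
  then have "continuous_on (Rn n) d" unfolding d_def[abs_def] by (intro continuous_intros) auto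
  then obtain e where e: "e > 0" "\<And>y. y \<in> cube n x e \<Longrightarrow> \<bar>d y - d x\<bar> < \<eta>"
    using continuous_on_cube[OF openin_Rn _ x \<eta>, of d] by metis
  have d0: "d x = 0" by (simp add: d_def)
  show thesis
  proof (rule that)
    show "e / 2 > 0" using e by simp
    fix z assume z: "(\<Sum>a<n. z a * z a) \<le> (e/2)\<^sup>2" "(\<Sum>a<n. z a * z a) > 0"
    define N where "N = (\<Sum>a<n. z a * z a)"
    have za: "\<bar>z a\<bar> \<le> sqrt N" if "a < n" for a
    proof -
      have "z a * z a \<le> N" unfolding N_def using that by (intro member_le_sum) auto
      from real_sqrt_le_mono[OF this] show ?thesis by (simp only: real_sqrt_abs2)
    qed
    have sN: "sqrt N \<le> e / 2" using z(1) e(1) real_sqrt_le_mono[of N "(e/2)\<^sup>2"] by (simp add: N_def)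
    define \<gamma> where "\<gamma> r = restrict (\<lambda>a. x a + r * z a) {..<n}" for r
    have \<gamma>R: "\<gamma> r \<in> Rn n" for r by (simp add: \<gamma>_def restrict_Rn)
    have \<gamma>0: "\<gamma> 0 = x" using x by (auto simp: \<gamma>_def Rn_extensional extensional_def restrict_def fun_eq_iff)
    have \<gamma>e: "\<gamma> r \<in> cube n x e" if "0 \<le> r" "r \<le> 1" for r
    proof -
      have "\<bar>r * z a\<bar> < e" if "a < n" for a
      proof -
        have "\<bar>r * z a\<bar> \<le> 1 * \<bar>z a\<bar>" unfolding abs_mult using \<open>0 \<le> r\<close> \<open>r \<le> 1\<close> by (intro mult_right_mono) auto
        then show ?thesis using za[OF that] sN e(1) by linarith
      qed
      then show ?thesis using \<gamma>R[of r] by (auto simp: cube_def \<gamma>_def)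
    qed
    have chain: "((\<lambda>r. f (\<gamma> r)) has_real_derivative (\<Sum>a<n. pd a f (\<gamma> r) * z a)) (at r)" if "smooth_on n (Rn n) f" for f r
      by (rule chain_rule_curve[OF openin_Rn smooth_on_Ck[OF that] \<gamma>R \<gamma>R]) (auto simp: \<gamma>_def intro!: derivative_eq_intros)
    define A where "A = (\<Sum>a<n. pd a u x * z a)"
    define B where "B = hess n u x z z"
    \<comment> \<open>With the coefficient \<eta> N / 2 of r^2 the second derivative is the Hessian
      minus B + \<eta> N; the other half of \<eta> N in the claim is slack.\<close>
    define q where "q r = u (\<gamma> r) - r * A - r\<^sup>2 * (B / 2 + \<eta> * N / 2 * 1)" for r
    define q' where "q' r = (\<Sum>a<n. pd a u (\<gamma> r) * z a) - A - r * (B + \<eta> * N)" for r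
    define q'' where "q'' r = hess n u (\<gamma> r) z z - (B + \<eta> * N)" for r
    have dq: "(q has_real_derivative q' r) (at r)" for r
      unfolding q_def[abs_def] q'_def by (auto intro!: derivative_eq_intros chain[OF u] simp: algebra_simps)
    have dq': "(q' has_real_derivative q'' r) (at r)" for r
    proof -
      have "((\<lambda>r. \<Sum>a<n. pd a u (\<gamma> r) * z a) has_real_derivative (\<Sum>a<n. (\<Sum>b<n. pd b (pd a u) (\<gamma> r) * z b) * z a)) (at r)"
        by (intro DERIV_sum DERIV_cmult_right chain smooth_on_pd[OF u]) auto
      moreover have "(\<Sum>a<n. (\<Sum>b<n. pd b (pd a u) (\<gamma> r) * z b) * z a) = hess n u (\<gamma> r) z z"
        by (simp add: hess_def sum_distrib_right sum_distrib_left mult_ac)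
      ultimately have "((\<lambda>r. \<Sum>a<n. pd a u (\<gamma> r) * z a) has_real_derivative hess n u (\<gamma> r) z z) (at r)" by simp
      from DERIV_diff[OF DERIV_diff[OF this DERIV_const] DERIV_cmult_right[OF DERIV_ident]]
      show ?thesis unfolding q'_def[abs_def] q''_def by simp
    qed
    have neg: "q'' r < 0" if r: "0 \<le> r" "r \<le> 1" for r
    proof -
      have "hess n u (\<gamma> r) z z - B = (\<Sum>a<n. \<Sum>b<n. (pd b (pd a u) (\<gamma> r) - pd b (pd a u) x) * z a * z b)"
        by (simp add: hess_def B_def sum_subtractf algebra_simps)
      also have "\<dots> \<le> (\<Sum>a<n. \<Sum>b<n. \<bar>pd b (pd a u) (\<gamma> r) - pd b (pd a u) x\<bar> * N)"
      proof (intro sum_mono)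
        fix a b assume ab: "a \<in> {..<n}" "b \<in> {..<n}"
        have N0: "N \<ge> 0" using z by (simp add: N_def)
        have "\<bar>z a\<bar> * \<bar>z b\<bar> \<le> sqrt N * sqrt N" using ab za N0 by (intro mult_mono) auto
        then have "\<bar>z a * z b\<bar> \<le> N" using N0 by (simp add: abs_mult)
        then have "\<bar>pd b (pd a u) (\<gamma> r) - pd b (pd a u) x\<bar> * \<bar>z a * z b\<bar> \<le> \<bar>pd b (pd a u) (\<gamma> r) - pd b (pd a u) x\<bar> * N"
          by (intro mult_left_mono) auto
        then show "(pd b (pd a u) (\<gamma> r) - pd b (pd a u) x) * z a * z b \<le> \<bar>pd b (pd a u) (\<gamma> r) - pd b (pd a u) x\<bar> * N"
          by (metis abs_mult abs_le_D1 mult.assoc)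
      qed
      also have "\<dots> = d (\<gamma> r) * N" by (simp add: d_def sum_distrib_right)
      also have "\<dots> < \<eta> * N" using e(2)[OF \<gamma>e[OF r]] d0 z by (intro mult_strict_right_mono) (auto simp: N_def)
      finally show ?thesis by (simp add: q''_def)
    qed
    obtain r where r: "0 < r" "r < 1" "q 1 - q 0 = (1 - 0) * q' r"
      using MVT2[of 0 1 q q'] dq by auto
    have "q' r < q' 0"
      by (rule DERIV_neg_imp_decreasing[OF r(1)]) (use dq' neg r in \<open>meson less_le_trans less_imp_le order_trans\<close>)
    moreover have "q' 0 = 0" by (simp add: q'_def \<gamma>0 A_def)
    ultimately have "q 1 < q 0" using r by simp
    then have "u (\<gamma> 1) < u x + A + B / 2 + \<eta> / 2 * N" by (simp add: q_def \<gamma>0 algebra_simps)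
    also have "\<dots> \<le> u x + A + B / 2 + \<eta> * N" using z \<eta> by (simp add: N_def)
    finally show "u (restrict (\<lambda>a. x a + z a) {..<n}) < u x + (\<Sum>a<n. pd a u x * z a) + hess n u x z z / 2 + \<eta> * (\<Sum>a<n. z a * z a)"
      by (simp add: \<gamma>_def A_def B_def N_def)
  qed
qed


lemma sum_orthonormal:
  assumes "(\<Sum>a<n. v a * v a) = 1" "(\<Sum>a<n. w a * w a) = 1" "(\<Sum>a<n. v a * w a) = (0::real)"
  shows "(\<Sum>a<n. (s * v a + t * w a) * (s * v a + t * w a)) = s\<^sup>2 + t\<^sup>2"
proof -
  have "(\<Sum>a<n. (s * v a + t * w a) * (s * v a + t * w a)) = (\<Sum>a<n. s\<^sup>2 * (v a * v a) + t\<^sup>2 * (w a * w a) + 2 * s * t * (v a * w a))"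
    by (intro sum.cong) (auto simp: power2_eq_square algebra_simps)
  also have "\<dots> = s\<^sup>2 + t\<^sup>2"
    unfolding sum.distrib sum_distrib_left[symmetric] assms by simp
  finally show ?thesis .
qed

context log_potential
begin

text \<open>If the trace of the Hessian on the plane of \<open>v\<close>, \<open>w\<close> were negative at \<open>x\<close>, a quadratic \<open>\<phi>\<close> with negative
  trace would touch \<open>u\<close> from above strictly at \<open>x\<close> in this plane, and for small \<open>e\<close> the function \<open>ue e - \<phi>\<close>
  would have an interior maximum in a disc of the plane, where its second differences cannot satisfy the
  four-point inequality.\<close>

lemma hess_plane_nonneg:
  assumes u: "smooth_on n (Rn n) u" and x: "x \<in> Rn n"
    and vw: "(\<Sum>a<n. v a * v a) = 1" "(\<Sum>a<n. w a * w a) = 1" "(\<Sum>a<n. v a * w a) = (0::real)"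
  shows "hess n u x v v + hess n u x w w \<ge> 0"
proof (rule ccontr)
  assume neg: "\<not> ?thesis"
  define L where "L = hess n u x v v + hess n u x w w"
  have L: "L < 0" using neg by (simp add: L_def)
  \<comment> \<open>The added term contributes 4 \<eta> to the trace, so the comparison function
    keeps the negative trace L + 4 \<eta> = L / 2.\<close>
  define \<eta> where "\<eta> = - L / 8"
  have \<eta>: "\<eta> > 0" using L by (simp add: \<eta>_def)
  obtain \<rho> where \<rho>: "\<rho> > 0" "\<And>z. (\<Sum>a<n. z a * z a) \<le> \<rho>\<^sup>2 \<Longrightarrow> (\<Sum>a<n. z a * z a) > 0 \<Longrightarrow>
    u (restrict (\<lambda>a. x a + z a) {..<n}) < u x + (\<Sum>a<n. pd a u x * z a) + hess n u x z z / 2 + \<eta> * (\<Sum>a<n. z a * z a)"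
    using taylor_strict[OF u x \<eta>] by blast
  define P :: "real \<times> real \<Rightarrow> coords" where "P p = restrict (\<lambda>a. x a + (fst p * v a + snd p * w a)) {..<n}" for p
  define A1 where "A1 = (\<Sum>a<n. pd a u x * v a)"
  define A2 where "A2 = (\<Sum>a<n. pd a u x * w a)"
  define B where "B = hess n u x v w"
  define \<phi> :: "real \<times> real \<Rightarrow> real" where "\<phi> p = u x + (fst p * A1 + snd p * A2) +
    ((fst p)\<^sup>2 * hess n u x v v + 2 * fst p * snd p * B + (snd p)\<^sup>2 * hess n u x w w) / 2 + \<eta> * ((fst p)\<^sup>2 + (snd p)\<^sup>2)" for p
  have PR: "P p \<in> Rn n" for p by (simp add: P_def restrict_Rn)
  have P0: "P 0 = x" using x by (auto simp: P_def Rn_extensional extensional_def restrict_def fun_eq_iff)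
  have nrm: "(norm p)\<^sup>2 = (fst p)\<^sup>2 + (snd p)\<^sup>2" for p :: "real \<times> real"
    by (simp add: norm_prod_def)
  have below: "u (P p) < \<phi> p" if "norm p \<le> \<rho>" "p \<noteq> 0" for p
  proof -
    let ?z = "\<lambda>a. fst p * v a + snd p * w a"
    have s: "(\<Sum>a<n. ?z a * ?z a) = (norm p)\<^sup>2" unfolding sum_orthonormal[OF vw] nrm ..
    have "u (P p) < u x + (\<Sum>a<n. pd a u x * ?z a) + hess n u x ?z ?z / 2 + \<eta> * (norm p)\<^sup>2"
      unfolding P_def s[symmetric] by (rule \<rho>(2)) (use that \<rho>(1) in \<open>auto simp: s intro: power_mono\<close>)
    also have "hess n u x ?z ?z = (fst p)\<^sup>2 * hess n u x v v + 2 * fst p * snd p * B + (snd p)\<^sup>2 * hess n u x w w"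
      unfolding hess_linear B_def hess_commute[OF u x, of w v] by (simp add: power2_eq_square algebra_simps)
    also have "(\<Sum>a<n. pd a u x * ?z a) = fst p * A1 + snd p * A2"
      by (simp add: A1_def A2_def sum.distrib sum_distrib_left algebra_simps)
    finally show ?thesis by (simp add: \<phi>_def nrm)
  qed
  have dP: "edist n (P p) (P q) = dist p q" for p q
  proof -
    have "(edist n (P p) (P q))\<^sup>2 = (\<Sum>a<n. ((fst p - fst q) * v a + (snd p - snd q) * w a) * ((fst p - fst q) * v a + (snd p - snd q) * w a))"
      unfolding edist_squared by (intro sum.cong) (auto simp: P_def power2_eq_square algebra_simps)
    also have "\<dots> = (dist p q)\<^sup>2" unfolding sum_orthonormal[OF vw] by (simp add: dist_norm nrm)
    finally show ?thesis by simp
  qed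
  define M where "M = (LINT y|leb n. g y)"
  have M0: "M \<ge> 0" unfolding M_def using g_nonneg by (intro Bochner_Integration.integral_nonneg) (auto simp: space_leb)
  have cont_ue: "continuous_on D (\<lambda>p. ue e (P p))" if e: "0 < e" "e \<le> 1" for D e
    unfolding continuous_on_def
  proof
    fix p assume "p \<in> D"
    have "((\<lambda>q. dist q p) \<longlongrightarrow> 0) (at p within D)"
      using tendsto_dist[OF tendsto_ident_at[of p D] tendsto_const[of p]] by simp
    then have "((\<lambda>q. (dist q p / e + (dist q p)\<^sup>2 / e\<^sup>2) * M) \<longlongrightarrow> (0 / e + 0\<^sup>2 / e\<^sup>2) * M) (at p within D)"
      using e by (intro tendsto_intros) auto
    then have l: "((\<lambda>q. (dist q p / e + (dist q p)\<^sup>2 / e\<^sup>2) * M) \<longlongrightarrow> 0) (at p within D)" by simp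
    have "((\<lambda>q. ue e (P q) - ue e (P p)) \<longlongrightarrow> 0) (at p within D)"
      by (rule Lim_null_comparison[OF _ l])
         (use ue_lipschitz[OF PR PR e] in \<open>simp add: dP M_def\<close>)
    then show "((\<lambda>p. ue e (P p)) \<longlongrightarrow> ue e (P p)) (at p within D)" by (simp add: LIM_zero_iff)
  qed
  have cont_\<phi>: "continuous_on D \<phi>" for D unfolding \<phi>_def[abs_def] by (intro continuous_intros) auto
  define e where "e m = inverse (real (Suc m))" for m
  have e: "0 < e m" "e m \<le> 1" for m by (auto simp: e_def field_simps)
  have e_dec: "e m' \<le> e m" if "m \<le> m'" for m m' using that by (simp add: e_def field_simps)
  define F where "F m p = ue (e m) (P p) - \<phi> p" for m p
  have cont_F: "continuous_on D (F m)" for D m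
    unfolding F_def[abs_def] by (intro continuous_on_diff cont_ue cont_\<phi> e)
  \<comment> \<open>A Dini argument: these are the points of the circle where the regularised
    potential is not below \<phi>. They form compact sets that decrease with m, so if none were
    empty a common point would contradict the strict inequality for u itself.\<close>
  define K where "K m = sphere 0 \<rho> \<inter> F m -` {0..}" for m
  have "\<exists>m. K m = {}"
  proof (rule ccontr)
    assume "\<not> ?thesis"
    then have ne: "K m \<noteq> {}" for m by blast
    have "compact (K m)" for m
    proof -
      have "closed (sphere 0 \<rho> \<inter> F m -` {0..})"
        by (intro continuous_closed_preimage cont_F closed_sphere closed_atLeast)
      then show ?thesis unfolding K_def
        by (metis compact_Int_closed compact_sphere inf.absorb_iff2 inf_le1)
    qed
    moreover have "K m' \<subseteq> K m" if "m \<le> m'" for m m'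
    proof
      fix q assume q: "q \<in> K m'"
      have "ue (e m') (P q) \<le> ue (e m) (P q)"
        by (rule ue_mono[OF PR less_imp_le[OF e(1)] e_dec[OF that] e(2)])
      then show "q \<in> K m" using q by (simp add: K_def F_def)
    qed
    ultimately have "(\<Inter>m. K m) \<noteq> {}" using ne by (intro compact_nest) auto
    then obtain p where p: "\<And>m. p \<in> K m" by blast
    have "(\<lambda>m. F m p) \<longlonglongrightarrow> u (P p) - \<phi> p"
      unfolding F_def e_def by (intro tendsto_diff tendsto_const ue_tendsto PR)
    then have "0 \<le> u (P p) - \<phi> p" using p by (intro tendsto_lowerbound[of "\<lambda>m. F m p"]) (auto simp: K_def)
    moreover have "norm p = \<rho>" using p[of 0] by (simp add: K_def)
    then have "u (P p) < \<phi> p" using \<rho>(1) by (intro below) auto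
    ultimately show False by simp
  qed
  then obtain m where m: "K m = {}" by blast
  obtain p where p: "p \<in> cball 0 \<rho>" "\<And>q. q \<in> cball 0 \<rho> \<Longrightarrow> F m q \<le> F m p"
    using continuous_attains_sup[of "cball 0 \<rho>" "F m"] cont_F \<rho>(1) by auto
  \<comment> \<open>At the centre the regularised potential is at least u = \<phi>, on the circle it
    is below \<phi>; so the maximum is attained in the open disc.\<close>
  have "F m 0 \<ge> 0" using ue_ge[OF x, of "e m"] e[of m] by (simp add: F_def P0 \<phi>_def)
  then have "F m p \<ge> 0" using p(2)[of 0] \<rho>(1) by simp
  then have "p \<notin> sphere 0 \<rho>" using m by (auto simp: K_def)
  then have pn: "norm p < \<rho>" using p(1) by auto
  let ?e = "e m"
  have e4: "?e ^ 4 > 0" using e[of m] by simp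
  \<comment> \<open>At the maximum of \<open>F m\<close> the four-point difference of the potential
    is at most that of \<phi>, which is h^2 L / 2, while its lower bound is only of order h^4.
    Dividing by h^2 and letting h tend to 0 gives 0 \<le> L / 2.\<close>
  have key: "- 2 * M * h\<^sup>2 / ?e ^ 4 \<le> L / 2" if h: "0 < h" "h < ?e" "h \<le> \<rho> - norm p" "2 * h ^ 4 \<le> ?e ^ 4" for h
  proof -
    have in_ball: "p + q \<in> cball 0 \<rho>" if "norm q \<le> h" for q
      using norm_triangle_ineq[of p q] that h by simp
    define Q where "Q = [p + (h, 0), p + (-h, 0), p + (0, h), p + (0, -h)]"
    have le: "F m (p + (h, 0)) \<le> F m p" "F m (p + (-h, 0)) \<le> F m p" "F m (p + (0, h)) \<le> F m p" "F m (p + (0, -h)) \<le> F m p"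
      using in_ball h(1) by (auto intro!: p(2) simp: norm_Pair)
    have sh: "restrict (\<lambda>a. P p a + r * v a) {..<n} = P (p + (r, 0))" "restrict (\<lambda>a. P p a + r * w a) {..<n} = P (p + (0, r))" for r
      by (auto simp: P_def restrict_def fun_eq_iff algebra_simps)
    have "ln (1 - h ^ 4 / ?e ^ 4) * M \<le> ue ?e (P (p + (h, 0))) + ue ?e (P (p + (-h, 0))) + ue ?e (P (p + (0, h))) + ue ?e (P (p + (0, -h))) - 4 * ue ?e (P p)"
      using four_point_ue[OF PR h(1,2) e(2) vw, of p] unfolding sh M_def by simp
    also have "\<dots> \<le> \<phi> (p + (h, 0)) + \<phi> (p + (-h, 0)) + \<phi> (p + (0, h)) + \<phi> (p + (0, -h)) - 4 * \<phi> p"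
      using le by (simp add: F_def)
    also have "\<dots> = h\<^sup>2 * (L + 4 * \<eta>)" by (simp add: \<phi>_def L_def power2_eq_square field_simps)
    also have "\<dots> = h\<^sup>2 * (L / 2)" by (simp add: \<eta>_def)
    finally have 1: "ln (1 - h ^ 4 / ?e ^ 4) * M \<le> h\<^sup>2 * (L / 2)" .
    have x2: "h ^ 4 / ?e ^ 4 \<le> 1 / 2" using h(4) e4 by (simp add: field_simps)
    have "- 2 * (h ^ 4 / ?e ^ 4) \<le> ln (1 - h ^ 4 / ?e ^ 4)"
    proof -
      let ?t = "h ^ 4 / ?e ^ 4"
      have t: "0 \<le> ?t" using e4 by simp
      have "- ?t - 2 * ?t\<^sup>2 \<le> ln (1 - ?t)" using ln_one_minus_pos_lower_bound[OF t x2] .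
      moreover have "2 * ?t\<^sup>2 \<le> ?t" using mult_right_mono[OF x2 t] by (simp add: power2_eq_square)
      ultimately show ?thesis by linarith
    qed
    from mult_right_mono[OF this M0] 1 have "- 2 * (h ^ 4 / ?e ^ 4) * M \<le> h\<^sup>2 * (L / 2)" by linarith
    then have "h\<^sup>2 * (- 2 * M * h\<^sup>2 / ?e ^ 4) \<le> h\<^sup>2 * (L / 2)"
      by (simp add: power4_eq_xxxx power2_eq_square mult_ac)
    then show ?thesis by (rule mult_left_le_imp_le) (use h(1) in simp)
  qed
  have ev: "eventually (\<lambda>h. 0 < h \<and> h < ?e \<and> h \<le> \<rho> - norm p \<and> 2 * h ^ 4 \<le> ?e ^ 4) (at_right 0)"
  proof (intro eventually_conj)
    show "eventually (\<lambda>h. 0 < h) (at_right (0::real))" by (rule eventually_at_right_less)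
    show "eventually (\<lambda>h. h < ?e) (at_right 0)" using e[of m] by (intro eventually_at_right_real[THEN eventually_mono]) auto
    show "eventually (\<lambda>h. h \<le> \<rho> - norm p) (at_right 0)"
      using pn eventually_at_right_real[of 0 "\<rho> - norm p"] by (auto elim!: eventually_mono)
    have "((\<lambda>h::real. 2 * h ^ 4) \<longlongrightarrow> 2 * 0 ^ 4) (at_right 0)" by (intro tendsto_intros)
    then have "eventually (\<lambda>h. 2 * h ^ 4 < ?e ^ 4) (at_right 0)" using e4 by (intro order_tendstoD(2)) auto
    then show "eventually (\<lambda>h. 2 * h ^ 4 \<le> ?e ^ 4) (at_right 0)" by eventually_elim simp
  qed
  have "((\<lambda>h. - 2 * M * h\<^sup>2 / ?e ^ 4) \<longlongrightarrow> - 2 * M * 0\<^sup>2 / ?e ^ 4) (at_right 0)"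
    using e4 by (intro tendsto_intros) auto
  then have "- 2 * M * 0\<^sup>2 / ?e ^ 4 \<le> L / 2"
    by (rule tendsto_upperbound) (use ev key in \<open>auto elim!: eventually_mono\<close>)
  then show False using L by simp
qed

text \<open>Gram-Schmidt: with X = \<alpha> v and Y = \<beta> v + \<gamma> w for orthonormal v and
  w, the expression becomes \<alpha>^2 \<gamma>^2 times the trace on the plane. If X = 0 or Y is a
  multiple of X, it is 0.\<close>

lemma hess_sub_nonneg:
  assumes u: "smooth_on n (Rn n) u" and x: "x \<in> Rn n"
  shows "dot n X X * hess n u x Y Y + dot n Y Y * hess n u x X X - 2 * dot n X Y * hess n u x X Y \<ge> 0"
proof (cases "dot n X X = 0")
  case True
  then have X0: "X a = 0" if "a < n" for a
    using that by (simp add: dot_def sum_nonneg_eq_0_iff)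
  then have "hess n u x X X = 0" "dot n X Y = 0" by (simp_all add: hess_def dot_def)
  then show ?thesis using True by simp
next
  case False
  define \<alpha> where "\<alpha> = sqrt (dot n X X)"
  have \<alpha>: "\<alpha> > 0" "\<alpha> * \<alpha> = dot n X X" using False dot_self_nonneg[of n X] by (auto simp: \<alpha>_def less_le)
  define v where "v a = X a / \<alpha>" for a
  have X: "X = (\<lambda>a. \<alpha> * v a)" using \<alpha> by (auto simp: v_def)
  have vv: "dot n v v = 1"
  proof -
    have "\<alpha> * \<alpha> * dot n v v = dot n X X" unfolding X by (simp add: dot_def sum_distrib_left mult_ac)
    then show ?thesis using \<alpha> False by simp
  qed
  define \<beta> where "\<beta> = dot n v Y"
  define z where "z a = Y a - \<beta> * v a" for a
  have vz: "dot n v z = 0"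
  proof -
    have "dot n v z = dot n z v" by (rule dot_commute)
    also have "\<dots> = dot n Y v - \<beta> * dot n v v" unfolding z_def dot_diff dot_scale ..
    finally show ?thesis using vv dot_commute[of n Y v] by (simp add: \<beta>_def)
  qed
  show ?thesis
  proof (cases "dot n z z = 0")
    case True
    then have "Y a = \<beta> * v a" if "a < n" for a
      using that by (simp add: dot_def sum_nonneg_eq_0_iff z_def)
    then have hY: "hess n u x Y Y = hess n u x (\<lambda>a. \<beta> * v a) (\<lambda>a. \<beta> * v a)" "hess n u x X Y = hess n u x X (\<lambda>a. \<beta> * v a)"
      and dY: "dot n Y Y = dot n (\<lambda>a. \<beta> * v a) (\<lambda>a. \<beta> * v a)" "dot n X Y = dot n X (\<lambda>a. \<beta> * v a)"
      by (simp_all add: hess_def dot_def)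
    have hX: "hess n u x X W = \<alpha> * hess n u x v W" "hess n u x W X = \<alpha> * hess n u x W v" for W
      by (subst X, rule hess_linear)+
    have h: "hess n u x Y Y = \<beta> * (\<beta> * hess n u x v v)" "hess n u x X Y = \<alpha> * (\<beta> * hess n u x v v)"
      "hess n u x X X = \<alpha> * (\<alpha> * hess n u x v v)"
      unfolding hY unfolding hX hess_linear(1,2) by simp_all
    have pq: "dot n (\<lambda>a. p * v a) (\<lambda>a. q * v a) = p * q" for p q
    proof -
      have "dot n (\<lambda>a. p * v a) (\<lambda>a. q * v a) = p * q * dot n v v" by (simp add: dot_def sum_distrib_left mult_ac)
      then show ?thesis using vv by simp
    qed
    have dX: "dot n X W = \<alpha> * dot n v W" for W by (subst X, rule dot_scale)
    have d: "dot n Y Y = \<beta> * \<beta>" "dot n X Y = \<alpha> * \<beta>" "dot n X X = \<alpha> * \<alpha>"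
    proof -
      show "dot n Y Y = \<beta> * \<beta>" using dY(1) pq by simp
      show "dot n X Y = \<alpha> * \<beta>" by (simp only: dX \<beta>_def)
      show "dot n X X = \<alpha> * \<alpha>" using \<alpha>(2) by simp
    qed
    show ?thesis unfolding d h by (simp add: algebra_simps)
  next
    case False
    define \<gamma> where "\<gamma> = sqrt (dot n z z)"
    have \<gamma>: "\<gamma> > 0" "\<gamma> * \<gamma> = dot n z z" using False dot_self_nonneg[of n z] by (auto simp: \<gamma>_def less_le)
    define w where "w a = z a / \<gamma>" for a
    have z: "z = (\<lambda>a. \<gamma> * w a)" using \<gamma> by (auto simp: w_def)
    have ww: "dot n w w = 1"
    proof -
      have "\<gamma> * \<gamma> * dot n w w = dot n z z" unfolding z by (simp add: dot_def sum_distrib_left mult_ac)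
      then show ?thesis using \<gamma> False by simp
    qed
    have vw: "dot n v w = 0"
    proof -
      have "\<gamma> * dot n v w = dot n v z" unfolding z by (simp add: dot_def sum_distrib_left mult_ac)
      then show ?thesis using \<gamma> vz by simp
    qed
    have Y: "Y = (\<lambda>a. \<beta> * v a + \<gamma> * w a)" using fun_cong[OF z] by (auto simp: z_def fun_eq_iff algebra_simps)
    have d: "dot n X X = \<alpha>\<^sup>2" "dot n X Y = \<alpha> * \<beta>" "dot n Y Y = \<beta>\<^sup>2 + \<gamma>\<^sup>2"
    proof -
      show "dot n X X = \<alpha>\<^sup>2" using \<alpha> by (simp add: power2_eq_square)
      show "dot n X Y = \<alpha> * \<beta>" unfolding \<beta>_def by (subst X) (simp add: dot_scale)
      show "dot n Y Y = \<beta>\<^sup>2 + \<gamma>\<^sup>2" unfolding Y dot_def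
        by (rule sum_orthonormal) (use vv ww vw in \<open>simp_all add: dot_def\<close>)
    qed
    have "dot n X X * hess n u x Y Y + dot n Y Y * hess n u x X X - 2 * dot n X Y * hess n u x X Y
      = \<alpha>\<^sup>2 * \<gamma>\<^sup>2 * (hess n u x v v + hess n u x w w)"
      unfolding d unfolding X Y hess_linear hess_commute[OF u x, of w v]
      by (simp add: power2_eq_square algebra_simps)
    moreover have "hess n u x v v + hess n u x w w \<ge> 0"
      by (rule hess_plane_nonneg[OF u x]) (use vv ww vw in \<open>simp_all add: dot_def\<close>)
    ultimately show ?thesis by simp
  qed
qed

end

section \<open>Volume and area of conformal metrics\<close>

declare One_nat_def [simp del]

text \<open>The description operator needs uniqueness: a measurable set splits along the disjointed
  countable cover into pieces inside single members, where the prescribed values leave no choice. It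
  then remains to exhibit one measure with these values.\<close>

lemma glued_measure_eqI:
  assumes \<mu>: "space \<mu> = topspace X" "sets \<mu> = sigma_sets (topspace X) {U. openin X U}"
    "\<And>V \<eta> \<delta> B. (V, \<eta>, \<delta>) \<in> D \<Longrightarrow> B \<in> sets \<mu> \<Longrightarrow> B \<subseteq> V \<Longrightarrow>
        emeasure \<mu> B = (\<integral>\<^sup>+ y. ennreal (\<delta> y) * indicator (\<eta> ` B) y \<partial>leb k)"
    and cover: "\<And>i. (V i, \<eta> i, \<delta> i) \<in> D" "\<And>i::nat. openin X (V i)" "(\<Union>i. V i) = topspace X"
  shows "glued_measure k X D = \<mu>"
  unfolding glued_measure_def
proof (rule the_equality)
  show "space \<mu> = topspace X \<and> sets \<mu> = sigma_sets (topspace X) {U. openin X U} \<and>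
    (\<forall>(V, \<eta>, \<delta>)\<in>D. \<forall>B\<in>sets \<mu>. B \<subseteq> V \<longrightarrow> emeasure \<mu> B = (\<integral>\<^sup>+ y. ennreal (\<delta> y) * indicator (\<eta> ` B) y \<partial>leb k))"
    using \<mu> by blast
next
  fix \<nu> assume \<nu>: "space \<nu> = topspace X \<and> sets \<nu> = sigma_sets (topspace X) {U. openin X U} \<and>
    (\<forall>(V, \<eta>, \<delta>)\<in>D. \<forall>B\<in>sets \<nu>. B \<subseteq> V \<longrightarrow> emeasure \<nu> B = (\<integral>\<^sup>+ y. ennreal (\<delta> y) * indicator (\<eta> ` B) y \<partial>leb k))"
  have s: "sets \<nu> = sets \<mu>" using \<mu> \<nu> by simp
  show "\<nu> = \<mu>"
  proof (rule measure_eqI[OF s])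
    fix B assume "B \<in> sets \<nu>"
    then have B: "B \<in> sets \<mu>" using s by simp
    have Vs: "V i \<in> sets \<mu>" for i using cover(2) \<mu>(2) by auto
    have W: "disjointed V i \<in> sets \<mu>" for i using sets.range_disjointed_sets[of V \<mu>] Vs by auto
    define C where "C i = B \<inter> disjointed V i" for i
    have C: "C i \<in> sets \<mu>" "C i \<subseteq> V i" for i using B W disjointed_subset[of V i] by (auto simp: C_def)
    have BC: "B = (\<Union>i. C i)"
      using cover(3) sets.sets_into_space[OF B] \<mu>(1) UN_disjointed_eq[of V] by (auto simp: C_def)
    have d: "disjoint_family C" using disjoint_family_disjointed[of V] by (auto simp: disjoint_family_on_def C_def)
    have "emeasure \<nu> (C i) = emeasure \<mu> (C i)" for i
      using \<mu>(3)[OF cover(1) C] \<nu> cover(1)[of i] C[of i] s by fastforce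
    moreover have "emeasure \<nu> B = (\<Sum>i. emeasure \<nu> (C i))" unfolding BC
      using C s d by (intro suminf_emeasure[symmetric]) auto
    moreover have "emeasure \<mu> B = (\<Sum>i. emeasure \<mu> (C i))" unfolding BC
      using C d by (intro suminf_emeasure[symmetric]) auto
    ultimately show "emeasure \<nu> B = emeasure \<mu> B" by simp
  qed
qed

lemma suminf_swap_ennreal: "(\<Sum>i. \<Sum>j. f i j) = (\<Sum>j. \<Sum>i. f i j :: ennreal)" for f :: "nat \<Rightarrow> nat \<Rightarrow> ennreal"
proof -
  have "(\<Sum>j. \<Sum>i. f i j) = (\<Sum>j. \<integral>\<^sup>+i. f i j \<partial>count_space UNIV)" by (simp add: nn_integral_count_space_nat)
  also have "\<dots> = (\<integral>\<^sup>+i. (\<Sum>j. f i j) \<partial>count_space UNIV)" by (rule nn_integral_suminf[symmetric]) simp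
  also have "\<dots> = (\<Sum>i. \<Sum>j. f i j)" by (simp add: nn_integral_count_space_nat)
  finally show ?thesis ..
qed

text \<open>Conditions under which the described measure exists: a set inside a member of D has a
  prescribed measure, and \<open>compat\<close> makes it independent of the member.\<close>

locale gluing =
  fixes k :: nat and X :: "'a topology" and D :: "('a set \<times> ('a \<Rightarrow> coords) \<times> (coords \<Rightarrow> real)) set"
    and V :: "nat \<Rightarrow> 'a set" and \<eta> :: "nat \<Rightarrow> 'a \<Rightarrow> coords" and \<delta> :: "nat \<Rightarrow> coords \<Rightarrow> real"
  assumes inj: "\<And>U e d. (U, e, d) \<in> D \<Longrightarrow> inj_on e U"
    and meas: "\<And>U e d B. (U, e, d) \<in> D \<Longrightarrow> B \<in> sigma_sets (topspace X) {U. openin X U} \<Longrightarrow> B \<subseteq> U \<Longrightarrow>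
      (\<lambda>y. ennreal (d y) * indicator (e ` B) y) \<in> borel_measurable (leb k)"
    and compat: "\<And>U e d U' e' d' B. (U, e, d) \<in> D \<Longrightarrow> (U', e', d') \<in> D \<Longrightarrow>
      B \<in> sigma_sets (topspace X) {U. openin X U} \<Longrightarrow> B \<subseteq> U \<Longrightarrow> B \<subseteq> U' \<Longrightarrow>
      (\<integral>\<^sup>+ y. ennreal (d y) * indicator (e ` B) y \<partial>leb k) = (\<integral>\<^sup>+ y. ennreal (d' y) * indicator (e' ` B) y \<partial>leb k)"
    and cover: "\<And>i. (V i, \<eta> i, \<delta> i) \<in> D" "\<And>i::nat. openin X (V i)" "(\<Union>i. V i) = topspace X"
begin

lemma glued_measure_spec:
  defines "\<Sigma> \<equiv> sigma_sets (topspace X) {U. openin X U}"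
  shows "space (glued_measure k X D) = topspace X" "sets (glued_measure k X D) = \<Sigma>"
    "\<And>U e d B. (U, e, d) \<in> D \<Longrightarrow> B \<in> \<Sigma> \<Longrightarrow> B \<subseteq> U \<Longrightarrow>
        emeasure (glued_measure k X D) B = (\<integral>\<^sup>+ y. ennreal (d y) * indicator (e ` B) y \<partial>leb k)"
proof -
  have sub: "{U. openin X U} \<subseteq> Pow (topspace X)" using openin_subset by blast
  note meas = meas[folded \<Sigma>_def] and compat = compat[folded \<Sigma>_def]
  interpret sigma_algebra "topspace X" \<Sigma> unfolding \<Sigma>_def by (rule sigma_algebra_sigma_sets[OF sub])
  have Vs: "V i \<in> \<Sigma>" for i using cover(2) by (auto simp: \<Sigma>_def)
  have W: "disjointed V i \<in> \<Sigma>" for i using range_disjointed_sets[of V] Vs by auto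
  have add: "(\<Sum>j. \<integral>\<^sup>+ y. ennreal (d y) * indicator (e ` B j) y \<partial>leb k) = (\<integral>\<^sup>+ y. ennreal (d y) * indicator (e ` (\<Union>j. B j)) y \<partial>leb k)"
    if D: "(U, e, d) \<in> D" and B: "\<And>j::nat. B j \<in> \<Sigma>" "\<And>j. B j \<subseteq> U" "disjoint_family B" for U e d B
  proof -
    have dis: "disjoint_family (\<lambda>j. e ` B j)"
      unfolding disjoint_family_on_def
    proof (intro ballI impI)
      fix p q :: nat assume "p \<noteq> q"
      then have "B p \<inter> B q = {}" using B(3) by (auto simp: disjoint_family_on_def)
      then show "e ` B p \<inter> e ` B q = {}" using inj_on_image_Int[OF inj[OF D] B(2)[of p] B(2)[of q]] by auto
    qed
    have "(\<Sum>j. \<integral>\<^sup>+ y. ennreal (d y) * indicator (e ` B j) y \<partial>leb k) = (\<integral>\<^sup>+ y. (\<Sum>j. ennreal (d y) * indicator (e ` B j) y) \<partial>leb k)"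
      using meas[OF D B(1,2)] by (intro nn_integral_suminf[symmetric])
    also have "\<dots> = (\<integral>\<^sup>+ y. ennreal (d y) * indicator (\<Union>j. e ` B j) y \<partial>leb k)"
      using suminf_indicator[OF dis] by (simp add: ennreal_suminf_cmult)
    finally show ?thesis by (simp add: image_UN)
  qed
  \<comment> \<open>Each piece of the disjointed cover is measured in its own chart. Countable
    additivity holds there because the chart is injective, and carries over by interchanging two
    sums.\<close>
  define m where "m B = (\<Sum>i. \<integral>\<^sup>+ y. ennreal (\<delta> i y) * indicator (\<eta> i ` (B \<inter> disjointed V i)) y \<partial>leb k)" for B
  define \<mu> where "\<mu> = measure_of (topspace X) {U. openin X U} m"
  have sp: "space \<mu> = topspace X" "sets \<mu> = \<Sigma>" using sub by (simp_all add: \<mu>_def \<Sigma>_def)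
  have em: "emeasure \<mu> B = m B" if "B \<in> \<Sigma>" for B
  proof (rule emeasure_measure_of[OF \<mu>_def sub])
    show "positive (sets \<mu>) m" by (simp add: positive_def m_def)
    show "countably_additive (sets \<mu>) m"
      unfolding countably_additive_def
    proof (intro allI impI)
      fix A :: "nat \<Rightarrow> 'a set" assume A: "range A \<subseteq> sets \<mu>" "disjoint_family A" "\<Union> (range A) \<in> sets \<mu>"
      have "(\<Sum>j. m (A j)) = (\<Sum>i. \<Sum>j. \<integral>\<^sup>+ y. ennreal (\<delta> i y) * indicator (\<eta> i ` (A j \<inter> disjointed V i)) y \<partial>leb k)"
        unfolding m_def by (rule suminf_swap_ennreal)
      also have "\<dots> = (\<Sum>i. \<integral>\<^sup>+ y. ennreal (\<delta> i y) * indicator (\<eta> i ` (\<Union>j. A j \<inter> disjointed V i)) y \<partial>leb k)"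
      proof (intro suminf_cong add[OF cover(1)])
        fix i j
        show "A j \<inter> disjointed V i \<in> \<Sigma>" using A W sp by auto
        show "A j \<inter> disjointed V i \<subseteq> V i" using disjointed_subset[of V i] by auto
        show "disjoint_family (\<lambda>j. A j \<inter> disjointed V i)" using A(2) by (auto simp: disjoint_family_on_def)
      qed
      also have "\<dots> = m (\<Union> (range A))" unfolding m_def by simp
      finally show "(\<Sum>j. m (A j)) = m (\<Union> (range A))" .
    qed
    show "B \<in> sets \<mu>" using that sp by simp
  qed
  have em_D: "emeasure \<mu> B = (\<integral>\<^sup>+ y. ennreal (d y) * indicator (e ` B) y \<partial>leb k)"
    if D: "(U, e, d) \<in> D" and B: "B \<in> sets \<mu>" "B \<subseteq> U" for U e d B
  proof -
    have BS: "B \<in> \<Sigma>" using B sp by simp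
    have C: "B \<inter> disjointed V i \<in> \<Sigma>" "B \<inter> disjointed V i \<subseteq> V i" "B \<inter> disjointed V i \<subseteq> U" for i
      using BS W disjointed_subset[of V i] B by auto
    have U: "(\<Union>i. B \<inter> disjointed V i) = B"
      using UN_disjointed_eq[of V] cover(3) sets_into_space[OF BS] by auto
    have "emeasure \<mu> B = (\<Sum>i. \<integral>\<^sup>+ y. ennreal (d y) * indicator (e ` (B \<inter> disjointed V i)) y \<partial>leb k)"
      unfolding em[OF BS] m_def using compat[OF cover(1) D C] by simp
    also have "\<dots> = (\<integral>\<^sup>+ y. ennreal (d y) * indicator (e ` (\<Union>i. B \<inter> disjointed V i)) y \<partial>leb k)"
      using disjoint_family_disjointed[of V] by (intro add[OF D] C) (auto simp: disjoint_family_on_def)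
    finally show ?thesis unfolding U .
  qed
  have eq: "glued_measure k X D = \<mu>"
    by (rule glued_measure_eqI[OF sp(1) _ em_D cover]) (auto simp: sp \<Sigma>_def)
  show "space (glued_measure k X D) = topspace X" "sets (glued_measure k X D) = \<Sigma>"
    unfolding eq by (rule sp)+
  show "emeasure (glued_measure k X D) B = (\<integral>\<^sup>+ y. ennreal (\<delta> y) * indicator (\<eta> ` B) y \<partial>leb k)"
    if "(V, \<eta>, \<delta>) \<in> D" "B \<in> \<Sigma>" "B \<subseteq> V" for V \<eta> \<delta> B
    unfolding eq using em_D[of V \<eta> \<delta> B] that sp by simp
qed

end

section \<open>Volume of conformal metrics\<close>

lemma continuous_on_borel_measurable_leb:
  assumes "continuous_on (Rn n) (f :: coords \<Rightarrow> real)"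
  shows "f \<in> borel_measurable (leb n)"
proof -
  have "(\<lambda>x. f x * indicator (Rn n) x) \<in> borel_measurable (leb n)"
    using continuous_on_measurable_leb[OF openin_Rn assms openin_imp_sets_leb[OF openin_Rn]] by simp
  then show ?thesis
    by (rule measurable_cong[THEN iffD1, rotated]) (simp add: space_leb)
qed

context euc_chart
begin

lemma image_\<phi>_sets: "B \<in> sets (leb n) \<Longrightarrow> B \<subseteq> U \<Longrightarrow> \<phi> ` B \<in> sets (leb n)"
proof -
  assume B: "B \<in> sets (leb n)" "B \<subseteq> U"
  have "\<psi> ` V \<subseteq> Rn n" using \<psi>_in U_Rn by blast
  from vimage_in_sets_leb[OF openV continuous_\<psi> this B(1)] show ?thesis unfolding image_\<phi>[OF B(2)] .
qed

lemma jdet_\<psi>_nonzero: "x \<in> V \<Longrightarrow> jdet n \<psi> x \<noteq> 0"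
proof -
  assume x: "x \<in> V"
  have "\<psi> ` V \<subseteq> U" using \<psi>_in by blast
  from jdet_left_inverse[OF openU openV C1_\<phi> C1_\<psi> this x \<phi>_\<psi>] show ?thesis by auto
qed

lemma inj_\<psi>: "inj_on \<psi> V" by (rule inj_on_inverseI[where g=\<phi>]) (rule \<phi>_\<psi>)

lemma volume_formula_\<psi>: "volume_formula n \<psi> V"
  by (rule volume_formula_diffeo[OF openV C1_\<psi> jdet_\<psi>_nonzero inj_\<psi>])

text \<open>The Gram matrix is \<open>exp (2 * u)\<close> times A^T A, where A is the Jacobian
  matrix of the inverse chart.\<close>

lemma det_gram_conformal:
  "Determinant.det (gram n (conformal_metric n u c) x) = exp (2 * u (\<psi> x)) ^ n * (jdet n \<psi> x)\<^sup>2"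
proof -
  have "gram n (conformal_metric n u c) x = exp (2 * u (\<psi> x)) \<cdot>\<^sub>m (transpose_mat (jac n \<psi> x) * jac n \<psi> x)"
    unfolding gram_def
    by (rule eq_matI) (auto simp: conformal_metric_eq jac_def J_def scalar_prod_def lessThan_atLeast0)
  then have "Determinant.det (gram n (conformal_metric n u c) x) = exp (2 * u (\<psi> x)) ^ n * Determinant.det (transpose_mat (jac n \<psi> x) * jac n \<psi> x)"
    by (simp add: det_smult jac_def)
  also have "Determinant.det (transpose_mat (jac n \<psi> x) * jac n \<psi> x) = (jdet n \<psi> x)\<^sup>2"
    using Determinant.det_mult[of "transpose_mat (jac n \<psi> x)" n "jac n \<psi> x"] det_transpose[of "jac n \<psi> x" n]
    by (simp add: jdet_def power2_eq_square)
  finally show ?thesis .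
qed

lemma sqrt_det_gram_conformal:
  "sqrt (Determinant.det (gram n (conformal_metric n u c) x)) = exp (real n * u (\<psi> x)) * \<bar>jdet n \<psi> x\<bar>"
proof -
  have "exp (2 * u (\<psi> x)) ^ n = (exp (real n * u (\<psi> x)))\<^sup>2"
    by (simp add: exp_of_nat_mult[symmetric] power2_eq_square exp_add[symmetric] algebra_simps)
  then show ?thesis unfolding det_gram_conformal by (simp add: real_sqrt_mult)
qed

end

text \<open>The density is a candidate that can be checked in each chart by the change of variables
  formula for the inverse chart; the identity chart alone serves as countable cover.\<close>

lemma volume_measure_conformal:
  assumes u: "continuous_on (Rn n) u"
  shows "volume_measure n (euc n) (euc_charts n) (conformal_metric n u) = density (leb n) (\<lambda>x. ennreal (exp (real n * u x)))"
    (is "_ = density _ ?f")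
  unfolding volume_measure_def
proof (rule glued_measure_eqI[where V="\<lambda>_. Rn n" and \<eta>="\<lambda>_. id"])
  have mf: "(\<lambda>x. exp (real n * u x)) \<in> borel_measurable (leb n)"
    by (intro continuous_on_borel_measurable_leb continuous_intros u)
  have mf': "?f \<in> borel_measurable (leb n)" using mf by measurable
  fix V' \<eta>' \<delta>' B
  assume "(V', \<eta>', \<delta>') \<in> {(U, \<phi>, \<lambda>x. sqrt (Determinant.det (gram n (conformal_metric n u (U, \<phi>)) x))) |U \<phi>. (U, \<phi>) \<in> euc_charts n}"
    and "B \<in> sets (density (leb n) ?f)" "B \<subseteq> V'"
  then have c: "(V', \<eta>') \<in> euc_charts n" and \<delta>': "\<delta>' = (\<lambda>x. sqrt (Determinant.det (gram n (conformal_metric n u (V', \<eta>')) x)))"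
    and B: "B \<in> sets (leb n)" "B \<subseteq> V'" by auto
  interpret euc_chart n "(V', \<eta>')" by (rule euc_chartI[OF c])
  have B': "\<phi> ` B \<in> sets (leb n)" "\<phi> ` B \<subseteq> V" using image_\<phi>_sets[OF B(1)] B(2) by auto
  have \<psi>B: "\<psi> ` \<phi> ` B = B" using \<psi>_\<phi> B(2) by (auto simp: image_image subset_iff image_iff)
  have "emeasure (density (leb n) ?f) B = (\<integral>\<^sup>+ x. ?f x * indicator (\<psi> ` \<phi> ` B) x \<partial>leb n)"
    unfolding \<psi>B using B mf' by (intro emeasure_density) auto
  also have "\<dots> = (\<integral>\<^sup>+ y. ?f (\<psi> y) * ennreal \<bar>jdet n \<psi> y\<bar> * indicator (\<phi> ` B) y \<partial>leb n)"
    by (rule nn_integral_volume_formula[OF volume_formula_\<psi> openV C1_\<psi> inj_\<psi> B'])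
       (use mf' B in \<open>unfold \<psi>B, measurable\<close>)
  also have "\<dots> = (\<integral>\<^sup>+ y. ennreal (\<delta>' y) * indicator (\<eta>' ` B) y \<partial>leb n)"
    unfolding \<delta>' sqrt_det_gram_conformal by (simp add: ennreal_mult)
  finally show "emeasure (density (leb n) ?f) B = (\<integral>\<^sup>+ y. ennreal (\<delta>' y) * indicator (\<eta>' ` B) y \<partial>leb n)" .
next
  show "(Rn n, id, \<lambda>x. sqrt (Determinant.det (gram n (conformal_metric n u (Rn n, id)) x))) \<in>
    {(U, \<phi>, \<lambda>x. sqrt (Determinant.det (gram n (conformal_metric n u (U, \<phi>)) x))) |U \<phi>. (U, \<phi>) \<in> euc_charts n}"
    using id_in_euc_charts by blast
qed (auto simp: space_leb sets_leb)


section \<open>Area of hypersurfaces\<close>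

lemma sigma_sets_subtopology_leb:
  assumes S: "S \<in> sets (leb n)" and B: "B \<in> sigma_sets S {U. openin (subtopology (euc n) S) U}"
  shows "B \<in> sets (leb n)"
  using B
proof induction
  case (Basic a)
  then obtain T where "openin (euc n) T" "a = T \<inter> S" by (auto simp: openin_subtopology)
  then show ?case using S openin_imp_sets_leb by auto
qed (use S in auto)

text \<open>The interface through which area is treated: a non-empty measurable set that charts
  flatten locally. Boundaries of domains, and spheres in particular, are instances.\<close>

locale hypersurface =
  fixes n :: nat and S :: "coords set"
  assumes n: "n \<ge> 2" and S: "S \<in> sets (leb n)" "S \<noteq> {}"
    and slices: "\<And>p. p \<in> S \<Longrightarrow> \<exists>c\<in>euc_charts n. p \<in> fst c \<and> snd c ` (fst c \<inter> S) = {x \<in> snd c ` fst c. x (n - 1) = 0}"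
begin

abbreviation "k \<equiv> n - 1"

lemma kn: "k < n" "n = Suc k" using n by auto

lemma S_Rn: "S \<subseteq> Rn n" using sets.sets_into_space[OF S(1)] by (simp add: space_leb)

lemma up_Rn: "y \<in> Rn k \<Longrightarrow> y(k := 0) \<in> Rn n"
  using kn by (auto simp: Rn_extensional extensional_def)

lemma dn_up: "y \<in> Rn k \<Longrightarrow> restrict (y(k := 0)) {..<k} = y"
  by (auto simp: Rn_extensional extensional_def fun_eq_iff)

lemma up_dn: "x \<in> Rn n \<Longrightarrow> x k = 0 \<Longrightarrow> (restrict x {..<k})(k := 0) = x"
  using kn by (auto simp: Rn_extensional extensional_def fun_eq_iff)

lemma openin_up_vimage: "openin (euc n) V \<Longrightarrow> openin (euc k) {y \<in> Rn k. y(k := 0) \<in> V}"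
proof -
  assume V: "openin (euc n) V"
  have "openin (euc k) (Rn k \<inter> (\<lambda>y. y(k := 0)) -` V)"
  proof (rule openin_vimage[OF openin_Rn _ _ V])
    show "continuous_on (Rn k) (\<lambda>y. y(k := 0))"
    proof (rule continuous_on_coordsI[of n])
      show "continuous_on (Rn k) (\<lambda>x. (x(k := 0)) i)" for i
        by (cases "i = k") (auto simp: continuous_on_coord)
    qed (rule up_Rn)
  qed (use up_Rn in auto)
  moreover have "Rn k \<inter> (\<lambda>y. y(k := 0)) -` V = {y \<in> Rn k. y(k := 0) \<in> V}" by auto
  ultimately show ?thesis by simp
qed

end

locale slice_chart = hypersurface n S + euc_chart n c for n S c +
  assumes slice: "snd c ` (fst c \<inter> S) = {x \<in> snd c ` fst c. x (n - 1) = 0}"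
begin

text \<open>\<open>\<eta>\<close> gives the slice coordinates, \<open>\<sigma>\<close> is the
  parametrisation inverse to them and \<open>E\<close> the open parameter domain. Images under
  \<open>\<eta>\<close> are measurable because they are preimages under
  \<open>\<sigma>\<close>.\<close>

definition "\<eta> p = restrict (\<phi> p) {..<k}"
definition "\<sigma> y = \<psi> (y(k := 0))"
definition "E = {y \<in> Rn k. y(k := 0) \<in> V}"

lemma openE: "openin (euc k) E" unfolding E_def by (rule openin_up_vimage[OF openV])

lemma E_V: "y \<in> E \<Longrightarrow> y(k := 0) \<in> V" by (simp add: E_def)

lemma E_Rn: "y \<in> E \<Longrightarrow> y \<in> Rn k" by (simp add: E_def)

lemma \<sigma>_in: assumes "y \<in> E" shows "\<sigma> y \<in> U \<inter> S"
proof -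
  have "y(k := 0) \<in> snd c ` (fst c \<inter> S)" unfolding slice using E_V[OF assms] by simp
  then show ?thesis using \<psi>_\<phi> by (auto simp: \<sigma>_def)
qed

lemma \<eta>_\<sigma>: "y \<in> E \<Longrightarrow> \<eta> (\<sigma> y) = y"
  using \<phi>_\<psi>[OF E_V] dn_up[OF E_Rn] by (simp add: \<eta>_def \<sigma>_def)

lemma \<phi>_k: "p \<in> U \<inter> S \<Longrightarrow> \<phi> p k = 0"
  using slice by auto

lemma up_\<eta>: "p \<in> U \<inter> S \<Longrightarrow> (\<eta> p)(k := 0) = \<phi> p"
  unfolding \<eta>_def using \<phi>_k V_Rn by (intro up_dn) auto

lemma \<eta>_in: "p \<in> U \<inter> S \<Longrightarrow> \<eta> p \<in> E"
  using up_\<eta> by (auto simp: E_def \<eta>_def restrict_Rn)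

lemma \<sigma>_\<eta>: "p \<in> U \<inter> S \<Longrightarrow> \<sigma> (\<eta> p) = p"
  using up_\<eta> \<psi>_\<phi> by (auto simp: \<sigma>_def)

lemma image_\<eta>: "B \<subseteq> U \<inter> S \<Longrightarrow> \<eta> ` B = E \<inter> \<sigma> -` B"
proof (intro equalityI subsetI)
  assume B: "B \<subseteq> U \<inter> S"
  fix y
  { assume "y \<in> \<eta> ` B"
    then obtain p where p: "p \<in> B" "y = \<eta> p" by blast
    have "p \<in> U \<inter> S" using p B by blast
    from \<eta>_in[OF this] \<sigma>_\<eta>[OF this] show "y \<in> E \<inter> \<sigma> -` B" using p by simp }
  { assume "y \<in> E \<inter> \<sigma> -` B"
    then show "y \<in> \<eta> ` B" using \<eta>_\<sigma> by (metis IntD1 IntD2 imageI vimageD) }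
qed

lemma inj_\<eta>: "inj_on \<eta> (U \<inter> S)" by (rule inj_on_inverseI[where g=\<sigma>]) (rule \<sigma>_\<eta>)

lemma continuous_\<sigma>: "continuous_on E \<sigma>"
  unfolding \<sigma>_def[abs_def]
proof (rule continuous_on_compose2[OF continuous_\<psi>])
  show "continuous_on E (\<lambda>y. y(k := 0))"
  proof (rule continuous_on_coordsI[of n])
    show "continuous_on E (\<lambda>x. (x(k := 0)) i)" for i
      by (cases "i = k") (auto simp: continuous_on_coord)
  qed (use up_Rn E_Rn in auto)
qed (use E_V in auto)

lemma \<sigma>_image_Rn: "\<sigma> ` E \<subseteq> Rn n" using \<sigma>_in U_Rn by blast

lemma vimage_\<sigma>_sets: "B \<in> sets (leb n) \<Longrightarrow> E \<inter> \<sigma> -` B \<in> sets (leb k)"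
  by (rule vimage_in_sets_leb[OF openE continuous_\<sigma> \<sigma>_image_Rn])

definition "\<delta> u y = sqrt (Determinant.det (gram k (conformal_metric n u c) (y(k := 0))))"

lemma continuous_\<delta>:
  assumes u: "continuous_on (Rn n) u"
  shows "continuous_on E (\<delta> u)"
proof -
  have up: "continuous_on E (\<lambda>y. y(k := 0))"
  proof (rule continuous_on_coordsI[of n])
    show "continuous_on E (\<lambda>x. (x(k := 0)) i)" for i
      by (cases "i = k") (auto simp: continuous_on_coord)
  qed (use up_Rn E_Rn in auto)
  have "continuous_on V (\<lambda>x. u (\<psi> x))"
    by (rule continuous_on_compose2[OF u continuous_\<psi>]) (use \<psi>_in U_Rn in auto)
  then have "continuous_on V (\<lambda>x. conformal_metric n u c x i j)" if "i < k" "j < k" for i j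
    unfolding conformal_metric_eq using that kn
    by (intro continuous_intros smooth_on_continuous[OF openV smooth_J]) auto
  then have "continuous_on E (\<lambda>y. conformal_metric n u c (y(k := 0)) i j)" if "i < k" "j < k" for i j
    using that by (intro continuous_on_compose2[OF _ up]) (auto simp: E_def)
  then show ?thesis unfolding \<delta>_def[abs_def] gram_def
    by (intro continuous_on_real_sqrt continuous_on_det)
qed

lemma \<delta>_conformal: "\<delta> u y = exp (real k * u (\<sigma> y)) * \<delta> (\<lambda>_. 0) y"
proof -
  have "gram k (conformal_metric n u c) (y(k := 0)) = exp (2 * u (\<sigma> y)) \<cdot>\<^sub>m gram k (conformal_metric n (\<lambda>_. 0) c) (y(k := 0))"
    unfolding gram_def by (rule eq_matI) (auto simp: conformal_metric_eq \<sigma>_def)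
  then have "Determinant.det (gram k (conformal_metric n u c) (y(k := 0))) =
      exp (2 * u (\<sigma> y)) ^ k * Determinant.det (gram k (conformal_metric n (\<lambda>_. 0) c) (y(k := 0)))"
    by (simp add: det_smult gram_def)
  moreover have "exp (2 * u (\<sigma> y)) ^ k = (exp (real k * u (\<sigma> y)))\<^sup>2"
    by (simp add: exp_of_nat_mult[symmetric] power2_eq_square exp_add[symmetric] algebra_simps)
  ultimately show ?thesis by (simp add: \<delta>_def real_sqrt_mult)
qed

end

locale two_slice_charts = s1: slice_chart n S c + s2: slice_chart n S c' for n S c c'
begin

sublocale two_euc_charts n c c' ..

definition "T y = s2.\<eta> (s1.\<sigma> y)"
definition "E12 = s1.E \<inter> s1.\<sigma> -` fst c'"

lemma openE12: "openin (euc s1.k) E12"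
  unfolding E12_def by (rule openin_vimage[OF s1.openE s1.continuous_\<sigma> s1.\<sigma>_image_Rn s2.openU])

lemma up_W: "y \<in> E12 \<Longrightarrow> y(s1.k := 0) \<in> W"
  using s1.\<sigma>_in[of y] s1.\<phi>_\<psi>[OF s1.E_V, of y] by (auto simp: E12_def s1.\<sigma>_def image_iff) (metis IntI)

lemma T_apply: "i < s1.k \<Longrightarrow> T y i = transition c c' (y(s1.k := 0)) i"
  by (simp add: T_def s2.\<eta>_def s1.\<sigma>_def transition_def)

lemma \<sigma>_in2: "y \<in> E12 \<Longrightarrow> s1.\<sigma> y \<in> fst c' \<inter> S"
  using s1.\<sigma>_in by (auto simp: E12_def)

lemma transition_up: "y \<in> E12 \<Longrightarrow> transition c c' (y(s1.k := 0)) = (T y)(s1.k := 0)"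
  using s2.up_\<eta>[OF \<sigma>_in2] by (simp add: T_def transition_def s1.\<sigma>_def)

lemma C1_T: "C1_map s1.k E12 T"
  unfolding C1_map_def
proof (intro conjI allI impI)
  show "T ` E12 \<subseteq> Rn s1.k" by (auto simp: T_def s2.\<eta>_def restrict_Rn)
  fix i assume i: "i < s1.k"
  have "Ck_on s1.k 1 E12 (\<lambda>y. transition c c' (y(s1.k := 0)) i)"
  proof (rule Ck_on_compose[OF openW openE12 smooth_on_Ck[OF smooth_transition]])
    show "Ck_on s1.k 1 E12 (\<lambda>x. (x(s1.k := 0)) j)" for j
      by (cases "j = s1.k") (auto simp: Ck_on_const[OF openE12] Ck_on_coord[OF openE12] simp del: One_nat_def)
  qed (use i s1.kn up_W in auto)
  then show "Ck_on s1.k 1 E12 (\<lambda>x. T x i)" by (simp add: T_apply[OF i])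
qed

lemma pd_up: "j < s1.k \<Longrightarrow> pd j (\<lambda>x. f (x(s1.k := 0))) y = pd j f (y(s1.k := 0))"
  unfolding pd_def by (simp add: fun_upd_twist)

text \<open>The transition between two slice charts maps the hyperplane into itself, so its last
  component vanishes along the hyperplane, and with it the tangential derivatives.\<close>

lemma pd_transition_k:
  assumes y: "y \<in> E12" and j: "j < s1.k"
  shows "pd j (\<lambda>x. transition c c' x s1.k) (y(s1.k := 0)) = 0"
proof -
  have "pd j (\<lambda>x. transition c c' x s1.k) (y(s1.k := 0)) = pd j (\<lambda>x. transition c c' (x(s1.k := 0)) s1.k) y"
    using pd_up[OF j, of "\<lambda>x. transition c c' x s1.k"] by simp
  also have "\<dots> = pd j (\<lambda>_. 0) y"
    by (rule pd_cong[OF openE12 y j]) (simp add: transition_up)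
  also have "\<dots> = 0" by (simp add: pd_def)
  finally show ?thesis .
qed

text \<open>By \<open>pd_transition_k\<close> the terms with index n - 1 drop out of the
  transformation law of the metric. This leaves a congruence by the Jacobian matrix of
  \<open>T\<close>, and its determinant gives the transformation of area densities.\<close>

lemma gram_T:
  assumes y: "y \<in> E12"
  shows "gram s1.k (conformal_metric n u c) (y(s1.k := 0)) =
    transpose_mat (jac s1.k T y) * (gram s1.k (conformal_metric n u c') ((T y)(s1.k := 0)) * jac s1.k T y)"
    (is "?L = transpose_mat ?A * (?G * ?A)")
proof (rule eq_matI)
  have A: "?A \<in> carrier_mat s1.k s1.k" and G: "?G \<in> carrier_mat s1.k s1.k" by (simp_all add: gram_def)
  fix i j assume ij': "i < dim_row (transpose_mat ?A * (?G * ?A))" "j < dim_col (transpose_mat ?A * (?G * ?A))"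
  then have ij: "i < s1.k" "j < s1.k" by (auto simp: jac_def)
  let ?H = "\<lambda>p q. conformal_metric n u c' ((T y)(s1.k := 0)) p q"
  let ?d = "\<lambda>i p. pd i (\<lambda>x. transition c c' x p) (y(s1.k := 0))"
  have d: "pd j (\<lambda>x. T x p) y = ?d j p" if "j < s1.k" "p < s1.k" for j p
    using pd_up[OF that(1), of "\<lambda>x. transition c c' x p" y] T_apply[OF that(2)] by simp
  have "?L $$ (i, j) = (\<Sum>p<n. \<Sum>q<n. ?H p q * ?d i p * ?d j q)"
    using ij s1.kn conformal_metric_transition[OF up_W[OF y], of i j u] by (simp add: gram_def transition_up[OF y])
  also have "\<dots> = (\<Sum>p<s1.k. \<Sum>q<s1.k. ?H p q * ?d i p * ?d j q)"
  proof -
    have "{..<n} = insert s1.k {..<s1.k}" using s1.kn(1) by auto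
    then have drop: "(\<Sum>p<n. f p) = (\<Sum>p<s1.k. f p)" if "f s1.k = 0" for f :: "nat \<Rightarrow> real" using that by simp
    show ?thesis
      using pd_transition_k[OF y] ij by (subst drop, simp, intro sum.cong refl drop) simp
  qed
  also have "\<dots> = (\<Sum>p<s1.k. ?d i p * (\<Sum>q<s1.k. ?H p q * ?d j q))"
    by (simp add: sum_distrib_left mult_ac)
  also have "\<dots> = (transpose_mat ?A * (?G * ?A)) $$ (i, j)"
  proof -
    have "(transpose_mat ?A * (?G * ?A)) $$ (i, j) = (\<Sum>p=0..<s1.k. ?A $$ (p, i) * (\<Sum>q=0..<s1.k. ?G $$ (p, q) * ?A $$ (q, j)))"
      using ij by (auto simp: scalar_prod_def carrier_matD[OF A] carrier_matD[OF G] intro!: sum.cong)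
    also have "\<dots> = (\<Sum>p=0..<s1.k. ?d i p * (\<Sum>q=0..<s1.k. ?H p q * ?d j q))"
      using ij d by (intro sum.cong refl arg_cong2[where f = times]) (simp_all add: jac_def gram_def)
    finally show ?thesis by (simp add: lessThan_atLeast0)
  qed
  finally show "?L $$ (i, j) = (transpose_mat ?A * (?G * ?A)) $$ (i, j)" .
qed (auto simp: gram_def jac_def)

lemma \<delta>_T:
  assumes y: "y \<in> E12"
  shows "s1.\<delta> u y = s2.\<delta> u (T y) * \<bar>jdet s1.k T y\<bar>"
proof -
  let ?A = "jac s1.k T y" and ?G = "gram s1.k (conformal_metric n u c') ((T y)(s1.k := 0))"
  have A: "?A \<in> carrier_mat s1.k s1.k" and G: "?G \<in> carrier_mat s1.k s1.k" by (simp_all add: gram_def)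
  have "Determinant.det (transpose_mat ?A * (?G * ?A)) = (jdet s1.k T y)\<^sup>2 * Determinant.det ?G"
    using Determinant.det_mult[OF transpose_carrier_mat[THEN iffD2, OF A] mult_carrier_mat[OF G A]] Determinant.det_mult[OF G A] det_transpose[OF A]
    by (simp add: jdet_def power2_eq_square)
  then show ?thesis unfolding s1.\<delta>_def s2.\<delta>_def gram_T[OF y] by (simp add: real_sqrt_mult)
qed

end

context two_slice_charts
begin

text \<open>Exchanging the two charts provides the inverse of \<open>T\<close>.\<close>

interpretation r: two_slice_charts n S c' c ..

lemma T_image: "T ` E12 \<subseteq> r.E12"
  using \<sigma>_in2 s1.\<sigma>_in s2.\<eta>_in s2.\<sigma>_\<eta> by (fastforce simp: T_def r.E12_def E12_def)

lemma r_T: "y \<in> E12 \<Longrightarrow> r.T (T y) = y"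
  using s2.\<sigma>_\<eta>[OF \<sigma>_in2] s1.\<eta>_\<sigma> by (simp add: r.T_def T_def E12_def)

lemma jdet_T_nonzero: "y \<in> E12 \<Longrightarrow> jdet s1.k T y \<noteq> 0"
  using jdet_left_inverse[OF r.openE12 openE12 r.C1_T C1_T T_image _ r_T, of y] by auto

lemma inj_T: "inj_on T E12" by (rule inj_on_inverseI[where g=r.T]) (rule r_T)

lemma compat:
  assumes u: "continuous_on (Rn n) u"
    and B: "B \<in> sets (leb n)" "B \<subseteq> fst c \<inter> S" "B \<subseteq> fst c' \<inter> S"
  shows "(\<integral>\<^sup>+y. ennreal (s1.\<delta> u y) * indicator (s1.\<eta> ` B) y \<partial>leb s1.k) = (\<integral>\<^sup>+y. ennreal (s2.\<delta> u y) * indicator (s2.\<eta> ` B) y \<partial>leb s1.k)"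
proof -
  have B1: "s1.\<eta> ` B \<in> sets (leb s1.k)" "s2.\<eta> ` B \<in> sets (leb s1.k)"
    using s1.vimage_\<sigma>_sets[OF B(1)] s2.vimage_\<sigma>_sets[OF B(1)] s1.image_\<eta>[OF B(2)] s2.image_\<eta>[OF B(3)] by simp_all
  have sub: "s1.\<eta> ` B \<subseteq> E12" using s1.image_\<eta>[OF B(2)] B(3) by (auto simp: E12_def)
  have img: "T ` s1.\<eta> ` B = s2.\<eta> ` B"
  proof -
    have "s1.\<sigma> (s1.\<eta> p) = p" if "p \<in> B" for p using s1.\<sigma>_\<eta> B(2) that by blast
    then show ?thesis unfolding image_image T_def by (intro image_cong) simp_all
  qed
  have "(\<integral>\<^sup>+y. ennreal (s2.\<delta> u y) * indicator (s2.\<eta> ` B) y \<partial>leb s1.k) =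
    (\<integral>\<^sup>+y. ennreal (s2.\<delta> u (T y)) * ennreal \<bar>jdet s1.k T y\<bar> * indicator (s1.\<eta> ` B) y \<partial>leb s1.k)"
    unfolding img[symmetric]
  proof (rule nn_integral_volume_formula[OF volume_formula_diffeo[OF openE12 C1_T jdet_T_nonzero inj_T] openE12 C1_T inj_T B1(1) sub])
    show "(\<lambda>y. ennreal (s2.\<delta> u y) * indicator (T ` s1.\<eta> ` B) y) \<in> borel_measurable (leb s1.k)"
      unfolding img by (rule continuous_on_measurable_ennreal_leb[OF s2.openE s2.continuous_\<delta>[OF u] B1(2)])
        (use s2.image_\<eta>[OF B(3)] in auto)
  qed
  also have "\<dots> = (\<integral>\<^sup>+y. ennreal (s1.\<delta> u y) * indicator (s1.\<eta> ` B) y \<partial>leb s1.k)"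
    using \<delta>_T sub by (intro nn_integral_cong) (auto simp: indicator_def ennreal_mult'')
  finally show ?thesis ..
qed

end

context hypersurface
begin

definition "slice_charts = {c \<in> euc_charts n. snd c ` (fst c \<inter> S) = {x \<in> snd c ` fst c. x (n - 1) = 0}}"

lemma slice_chartI: "c \<in> slice_charts \<Longrightarrow> slice_chart n S c"
  unfolding slice_charts_def by (intro slice_chart.intro euc_chartI slice_chart_axioms.intro hypersurface_axioms) auto

definition "slice_data u = {(U \<inter> S, \<lambda>p. restrict (\<phi> p) {..<n - 1},
       \<lambda>y. sqrt (Determinant.det (gram (n - 1) (conformal_metric n u (U, \<phi>)) (y(n - 1 := 0))))) | U \<phi>.
      (U, \<phi>) \<in> euc_charts n \<and> \<phi> ` (U \<inter> S) = {x \<in> \<phi> ` U. x (n - 1) = 0}}"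

lemma slice_data_iff: "(V, e, d) \<in> slice_data u \<longleftrightarrow>
    (\<exists>c\<in>slice_charts. V = fst c \<inter> S \<and> e = (\<lambda>p. restrict (snd c p) {..<n - 1}) \<and>
       d = (\<lambda>y. sqrt (Determinant.det (gram (n - 1) (conformal_metric n u c) (y(n - 1 := 0))))))"
proof
  assume "(V, e, d) \<in> slice_data u"
  then obtain U \<phi> where "(U, \<phi>) \<in> euc_charts n" "\<phi> ` (U \<inter> S) = {x \<in> \<phi> ` U. x (n - 1) = 0}"
    "V = U \<inter> S" "e = (\<lambda>p. restrict (\<phi> p) {..<n - 1})"
    "d = (\<lambda>y. sqrt (Determinant.det (gram (n - 1) (conformal_metric n u (U, \<phi>)) (y(n - 1 := 0)))))"
    unfolding slice_data_def by blast
  then show "\<exists>c\<in>slice_charts. V = fst c \<inter> S \<and> e = (\<lambda>p. restrict (snd c p) {..<n - 1}) \<and>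
       d = (\<lambda>y. sqrt (Determinant.det (gram (n - 1) (conformal_metric n u c) (y(n - 1 := 0)))))"
    by (intro bexI[of _ "(U, \<phi>)"]) (simp_all add: slice_charts_def)
next
  assume "\<exists>c\<in>slice_charts. V = fst c \<inter> S \<and> e = (\<lambda>p. restrict (snd c p) {..<n - 1}) \<and>
       d = (\<lambda>y. sqrt (Determinant.det (gram (n - 1) (conformal_metric n u c) (y(n - 1 := 0)))))"
  then obtain c where "c \<in> slice_charts" "V = fst c \<inter> S" "e = (\<lambda>p. restrict (snd c p) {..<n - 1})"
       "d = (\<lambda>y. sqrt (Determinant.det (gram (n - 1) (conformal_metric n u c) (y(n - 1 := 0)))))" by blast
  then show "(V, e, d) \<in> slice_data u"
    unfolding slice_data_def slice_charts_def by (intro CollectI exI[of _ "fst c"] exI[of _ "snd c"]) simp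
qed

lemma area_measure_eq: "area_measure n (euc n) (euc_charts n) (conformal_metric n u) S = glued_measure k (subtopology (euc n) S) (slice_data u)"
  by (simp add: area_measure_def slice_data_def)

lemma topspace_S: "topspace (subtopology (euc n) S) = S"
  using S_Rn by auto

lemma countable_cover:
  "\<exists>c :: nat \<Rightarrow> coords chart. (\<forall>i. c i \<in> slice_charts) \<and> (\<Union>i. fst (c i) \<inter> S) = S"
proof -
  have op: "openin (top_of_set (Rn n)) (fst c)" if "c \<in> slice_charts" for c
    using that euc_eq_top_of_set[of n] by (auto simp: slice_charts_def euc_charts_iff)
  then obtain \<F> where \<F>: "\<F> \<subseteq> fst ` slice_charts" "countable \<F>" "\<Union>\<F> = \<Union>(fst ` slice_charts)"
    using Lindelof_openin[of "fst ` slice_charts" "Rn n"] by (metis (no_types, lifting) imageE op)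
  obtain C where C: "C \<subseteq> slice_charts" "countable C" "\<F> = fst ` C"
    using \<F>(1,2) countable_subset_image by metis
  have cov: "S \<subseteq> (\<Union>c\<in>C. fst c)"
  proof
    fix p assume "p \<in> S"
    then obtain c where c: "c \<in> euc_charts n" "p \<in> fst c" "snd c ` (fst c \<inter> S) = {x \<in> snd c ` fst c. x (n - 1) = 0}"
      using slices by blast
    have "c \<in> slice_charts" unfolding slice_charts_def using c(1,3) by simp
    then have "p \<in> \<Union>(fst ` slice_charts)" using c(2) by blast
    then show "p \<in> (\<Union>c\<in>C. fst c)" using \<F>(3) C(3) by simp
  qed
  then have "C \<noteq> {}" using S by blast
  then have r: "range (from_nat_into C) = C" using C(2) by (rule range_from_nat_into)
  show ?thesis
  proof (intro exI[of _ "from_nat_into C"] conjI allI)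
    show "from_nat_into C i \<in> slice_charts" for i using r C(1) by auto
    have "(\<Union>i. fst (from_nat_into C i) \<inter> S) = (\<Union>(fst ` range (from_nat_into C))) \<inter> S" by blast
    also have "\<dots> = S" unfolding r using cov by blast
    finally show "(\<Union>i. fst (from_nat_into C i) \<inter> S) = S" .
  qed
qed

lemma area_measure_spec:
  assumes u: "continuous_on (Rn n) u"
  defines "\<mu> \<equiv> area_measure n (euc n) (euc_charts n) (conformal_metric n u) S"
  shows "space \<mu> = S" "sets \<mu> = sigma_sets S {U. openin (subtopology (euc n) S) U}"
    "\<And>V e d B. (V, e, d) \<in> slice_data u \<Longrightarrow> B \<in> sets \<mu> \<Longrightarrow> B \<subseteq> V \<Longrightarrow>
      emeasure \<mu> B = (\<integral>\<^sup>+ y. ennreal (d y) * indicator (e ` B) y \<partial>leb k)"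
proof -
  obtain c :: "nat \<Rightarrow> coords chart" where "(\<forall>i. c i \<in> slice_charts) \<and> (\<Union>i. fst (c i) \<inter> S) = S"
    using countable_cover by blast
  then have c: "\<And>i. c i \<in> slice_charts" "(\<Union>i. fst (c i) \<inter> S) = S" by auto
  let ?e = "\<lambda>c p. restrict (snd c p) {..<n - 1}"
  let ?d = "\<lambda>c y. sqrt (Determinant.det (gram (n - 1) (conformal_metric n u c) (y(n - 1 := 0))))"
  let ?\<Sigma> = "sigma_sets (topspace (subtopology (euc n) S)) {U. openin (subtopology (euc n) S) U}"
  have 1: "inj_on e V" "\<And>B. B \<in> ?\<Sigma> \<Longrightarrow> B \<subseteq> V \<Longrightarrow> (\<lambda>y. ennreal (d y) * indicator (e ` B) y) \<in> borel_measurable (leb k)"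
    if "(V, e, d) \<in> slice_data u" for V e d
  proof -
    from that obtain c where ch: "c \<in> slice_charts" "V = fst c \<inter> S" "e = ?e c" "d = ?d c" unfolding slice_data_iff by blast
    interpret slice_chart n S c by (rule slice_chartI[OF ch(1)])
    have ed: "e = \<eta>" "d = \<delta> u" using ch by (auto simp: \<eta>_def \<delta>_def)
    show "inj_on e V" unfolding ed ch(2) by (rule inj_\<eta>)
    fix B assume "B \<in> ?\<Sigma>" "B \<subseteq> V"
    then have B: "B \<in> sets (leb n)" "B \<subseteq> fst c \<inter> S"
      using sigma_sets_subtopology_leb[OF S(1)] ch(2) unfolding topspace_S by auto
    show "(\<lambda>y. ennreal (d y) * indicator (e ` B) y) \<in> borel_measurable (leb k)"
      unfolding ed image_\<eta>[OF B(2)]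
      by (rule continuous_on_measurable_ennreal_leb[OF openE continuous_\<delta>[OF u] vimage_\<sigma>_sets[OF B(1)]]) auto
  qed
  have 2: "(\<integral>\<^sup>+ y. ennreal (d y) * indicator (e ` B) y \<partial>leb k) = (\<integral>\<^sup>+ y. ennreal (d' y) * indicator (e' ` B) y \<partial>leb k)"
    if "(V, e, d) \<in> slice_data u" "(V', e', d') \<in> slice_data u" and B: "B \<in> ?\<Sigma>" "B \<subseteq> V" "B \<subseteq> V'" for V e d V' e' d' B
  proof -
    from that(1,2) obtain c c' where c: "c \<in> slice_charts" "V = fst c \<inter> S" "e = ?e c" "d = ?d c"
      and c': "c' \<in> slice_charts" "V' = fst c' \<inter> S" "e' = ?e c'" "d' = ?d c'" unfolding slice_data_iff by blast
    interpret two_slice_charts n S c c' using slice_chartI c(1) c'(1) by (simp add: two_slice_charts_def)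
    have ed: "e = s1.\<eta>" "d = s1.\<delta> u" "e' = s2.\<eta>" "d' = s2.\<delta> u" using c c' by (auto simp: s1.\<eta>_def s1.\<delta>_def s2.\<eta>_def s2.\<delta>_def)
    show ?thesis
      unfolding ed using compat[OF u, of B] B sigma_sets_subtopology_leb[OF S(1), of B] c(2) c'(2) unfolding topspace_S by simp
  qed
  have 3: "(fst (c i) \<inter> S, ?e (c i), ?d (c i)) \<in> slice_data u" for i unfolding slice_data_iff using c(1) by blast
  have 4: "openin (subtopology (euc n) S) (fst (c i) \<inter> S)" for i
    using c(1)[of i] by (auto simp: slice_charts_def euc_charts_iff openin_subtopology)
  have 5: "(\<Union>i. fst (c i) \<inter> S) = topspace (subtopology (euc n) S)" using c(2) unfolding topspace_S .
  interpret gluing k "subtopology (euc n) S" "slice_data u" "\<lambda>i. fst (c i) \<inter> S" "\<lambda>i. ?e (c i)" "\<lambda>i. ?d (c i)"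
    by (rule gluing.intro) (erule 1(1), erule (2) 1(2), erule (4) 2, rule 3, rule 4, rule 5)
  note ex = glued_measure_spec
  show "space \<mu> = S" "sets \<mu> = sigma_sets S {U. openin (subtopology (euc n) S) U}"
    using ex(1,2) unfolding \<mu>_def area_measure_eq topspace_S .
  then show "emeasure \<mu> B = (\<integral>\<^sup>+ y. ennreal (d y) * indicator (e ` B) y \<partial>leb k)"
    if "(V, e, d) \<in> slice_data u" "B \<in> sets \<mu>" "B \<subseteq> V" for V e d B
    using ex(3)[of V e d B] that unfolding \<mu>_def area_measure_eq topspace_S by simp
qed

lemma area_measure_eqI:
  assumes "space \<mu> = S" "sets \<mu> = sigma_sets S {U. openin (subtopology (euc n) S) U}"
    "\<And>V e d B. (V, e, d) \<in> slice_data u \<Longrightarrow> B \<in> sets \<mu> \<Longrightarrow> B \<subseteq> V \<Longrightarrow>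
      emeasure \<mu> B = (\<integral>\<^sup>+ y. ennreal (d y) * indicator (e ` B) y \<partial>leb k)"
  shows "area_measure n (euc n) (euc_charts n) (conformal_metric n u) S = \<mu>"
proof -
  obtain c :: "nat \<Rightarrow> coords chart" where "(\<forall>i. c i \<in> slice_charts) \<and> (\<Union>i. fst (c i) \<inter> S) = S"
    using countable_cover by blast
  then have c: "\<And>i. c i \<in> slice_charts" "(\<Union>i. fst (c i) \<inter> S) = S" by auto
  let ?e = "\<lambda>c p. restrict (snd c p) {..<n - 1}"
  let ?d = "\<lambda>c y. sqrt (Determinant.det (gram (n - 1) (conformal_metric n u c) (y(n - 1 := 0))))"
  show ?thesis unfolding area_measure_eq
  proof (rule glued_measure_eqI[where V="\<lambda>i. fst (c i) \<inter> S" and \<eta>="\<lambda>i. ?e (c i)" and \<delta>="\<lambda>i. ?d (c i)"])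
    fix i
    show "(fst (c i) \<inter> S, ?e (c i), ?d (c i)) \<in> slice_data u" unfolding slice_data_iff using c(1) by blast
    show "openin (subtopology (euc n) S) (fst (c i) \<inter> S)"
      using c(1)[of i] by (auto simp: slice_charts_def euc_charts_iff openin_subtopology)
  qed (use assms c(2) topspace_S in auto)
qed

text \<open>In slice coordinates the area density acquires the factor
  \<open>exp ((n - 1) * u)\<close>, the hypersurface having dimension n - 1. By uniqueness the
  claimed measure need only be checked there, after transporting Euclidean area to the parameter
  domain.\<close>

lemma area_measure_conformal:
  assumes u: "continuous_on (Rn n) u"
  shows "area_measure n (euc n) (euc_charts n) (conformal_metric n u) S =
    density (euc_area_measure n S) (\<lambda>x. ennreal (exp ((real n - 1) * u x)))"
    and "(\<lambda>x. exp ((real n - 1) * u x)) \<in> borel_measurable (euc_area_measure n S)"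
    and "space (euc_area_measure n S) = S"
proof -
  have z: "continuous_on (Rn n) (\<lambda>_. 0::real)" by simp
  define \<mu> where "\<mu> = euc_area_measure n S"
  note spec = area_measure_spec[OF z, folded euc_area_measure_def, folded \<mu>_def]
  have \<mu>: "euc_area_measure n S = \<mu>" "space \<mu> = S" "sets \<mu> = sigma_sets S {U. openin (subtopology (euc n) S) U}"
    using spec by (simp_all add: \<mu>_def)
  note em = spec(3)
  let ?w = "\<lambda>x. exp ((real n - 1) * u x)"
  have sets_leb: "B \<in> sets (leb n)" if "B \<in> sets \<mu>" for B
    using sigma_sets_subtopology_leb[OF S(1)] that \<mu>(3) by simp
  show mw: "?w \<in> borel_measurable (euc_area_measure n S)"
    unfolding \<mu>(1)
  proof (rule borel_measurableI)
    fix T :: "real set" assume T: "open T"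
    have "continuous_on S ?w" by (intro continuous_intros continuous_on_subset[OF u S_Rn])
    then have "openin (top_of_set S) (S \<inter> ?w -` T)" using T by (rule continuous_openin_preimage_gen)
    then show "?w -` T \<inter> space \<mu> \<in> sets \<mu>"
      unfolding \<mu>(2,3) subtopology_euc[OF S_Rn] by (auto simp: Int_commute)
  qed
  then have mw': "(\<lambda>x. ennreal (?w x)) \<in> borel_measurable \<mu>" unfolding \<mu>(1) by measurable
  show "space (euc_area_measure n S) = S" using \<mu> by simp
  show "area_measure n (euc n) (euc_charts n) (conformal_metric n u) S = density (euc_area_measure n S) (\<lambda>x. ennreal (?w x))"
    unfolding \<mu>(1)
  proof (rule area_measure_eqI)
    fix V e d B assume VB: "(V, e, d) \<in> slice_data u" "B \<in> sets (density \<mu> (\<lambda>x. ennreal (?w x)))" "B \<subseteq> V"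
    have "B \<in> sets \<mu>" using VB(2) by simp
    with VB(1,3) obtain c where ch: "c \<in> slice_charts" "V = fst c \<inter> S" "e = (\<lambda>p. restrict (snd c p) {..<n - 1})"
       "d = (\<lambda>y. sqrt (Determinant.det (gram (n - 1) (conformal_metric n u c) (y(n - 1 := 0)))))"
      and B: "B \<in> sets \<mu>" "B \<subseteq> fst c \<inter> S" unfolding slice_data_iff by blast
    interpret slice_chart n S c by (rule slice_chartI[OF ch(1)])
    have ed: "e = \<eta>" "d = \<delta> u" using ch by (auto simp: \<eta>_def \<delta>_def)
    have mem0: "(fst c \<inter> S, \<eta>, \<delta> (\<lambda>_. 0)) \<in> slice_data (\<lambda>_. 0)"
      unfolding slice_data_iff using ch(1) by (intro bexI[of _ c] conjI ext) (simp_all add: \<eta>_def \<delta>_def)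
    obtain p0 where p0: "p0 \<in> S" using S by blast
    \<comment> \<open>The parametrisation, continued by an arbitrary point of S to a measurable map
      on all of \<open>leb k\<close>.\<close>
    define s where "s y = (if y \<in> E then \<sigma> y else p0)" for y
    define D where "D y = ennreal (\<delta> (\<lambda>_. 0) y) * indicator (\<eta> ` B) y" for y
    have mD: "D \<in> borel_measurable (leb k)"
      unfolding D_def[abs_def] image_\<eta>[OF B(2)]
      by (rule continuous_on_measurable_ennreal_leb[OF openE continuous_\<delta>[OF z] vimage_\<sigma>_sets[OF sets_leb[OF B(1)]]]) auto
    have ms: "s \<in> leb k \<rightarrow>\<^sub>M \<mu>"
    proof (rule measurableI)
      show "s y \<in> space \<mu>" for y using \<sigma>_in p0 by (auto simp: s_def \<mu>)
      fix A assume A: "A \<in> sets \<mu>"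
      have "s -` A \<inter> space (leb k) = (E \<inter> \<sigma> -` A) \<union> (if p0 \<in> A then space (leb k) - E else {})"
        using E_Rn by (auto simp: s_def space_leb split: if_splits)
      then show "s -` A \<inter> space (leb k) \<in> sets (leb k)"
        using vimage_\<sigma>_sets[OF sets_leb[OF A]] openin_imp_sets_leb[OF openE] by auto
    qed
    \<comment> \<open>Euclidean area restricted to B is the push-forward of its density in slice
      coordinates, so integrals over B can be computed there.\<close>
    have eq: "distr (density (leb k) D) \<mu> s = density \<mu> (indicator B)"
    proof (rule measure_eqI)
      fix A assume "A \<in> sets (distr (density (leb k) D) \<mu> s)"
      then have A: "A \<in> sets \<mu>" by simp
      have "emeasure (distr (density (leb k) D) \<mu> s) A = (\<integral>\<^sup>+ y. D y * indicator (s -` A \<inter> space (leb k)) y \<partial>leb k)"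
        using A ms mD measurable_sets[OF ms A] by (simp add: emeasure_distr emeasure_density)
      also have "\<dots> = (\<integral>\<^sup>+ y. ennreal (\<delta> (\<lambda>_. 0) y) * indicator (\<eta> ` (B \<inter> A)) y \<partial>leb k)"
      proof (intro nn_integral_cong)
        fix y assume y: "y \<in> space (leb k)"
        have "B \<inter> A \<subseteq> fst c \<inter> S" using B(2) by blast
        from image_\<eta>[OF this] image_\<eta>[OF B(2)]
        have "indicator (\<eta> ` B) y * indicator (s -` A \<inter> space (leb k)) y = (indicator (\<eta> ` (B \<inter> A)) y :: ennreal)"
          using y by (auto simp: s_def indicator_def)
        then show "D y * indicator (s -` A \<inter> space (leb k)) y = ennreal (\<delta> (\<lambda>_. 0) y) * indicator (\<eta> ` (B \<inter> A)) y"
          by (simp add: D_def mult.assoc)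
      qed
      also have "\<dots> = emeasure \<mu> (B \<inter> A)" using B A by (intro em[OF mem0, symmetric]) auto
      also have "\<dots> = (\<integral>\<^sup>+ x. indicator (B \<inter> A) x \<partial>\<mu>)" using A B by (intro nn_integral_indicator[symmetric]) auto
      also have "\<dots> = (\<integral>\<^sup>+ x. indicator B x * indicator A x \<partial>\<mu>)" by (simp add: indicator_inter_arith)
      also have "\<dots> = emeasure (density \<mu> (indicator B)) A" using A B by (subst emeasure_density) auto
      finally show "emeasure (distr (density (leb k) D) \<mu> s) A = emeasure (density \<mu> (indicator B)) A" .
    qed simp
    have "emeasure (density \<mu> (\<lambda>x. ennreal (?w x))) B = (\<integral>\<^sup>+ x. indicator B x * ennreal (?w x) \<partial>\<mu>)"
      using mw' B by (subst emeasure_density) (auto simp: mult.commute)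
    also have "\<dots> = (\<integral>\<^sup>+ x. ennreal (?w x) \<partial>density \<mu> (indicator B))"
      using mw' B by (subst nn_integral_density) auto
    also have "\<dots> = (\<integral>\<^sup>+ y. ennreal (?w (s y)) \<partial>density (leb k) D)"
      unfolding eq[symmetric] using mw' ms by (subst nn_integral_distr) auto
    also have "\<dots> = (\<integral>\<^sup>+ y. D y * ennreal (?w (s y)) \<partial>leb k)"
      using mD measurable_compose[OF ms mw'] by (subst nn_integral_density) auto
    also have "\<dots> = (\<integral>\<^sup>+ y. ennreal (d y) * indicator (e ` B) y \<partial>leb k)"
    proof (intro nn_integral_cong)
      fix y
      have "real n - 1 = real k" using n by simp
      show "D y * ennreal (?w (s y)) = ennreal (d y) * indicator (e ` B) y"
      proof (cases "y \<in> \<eta> ` B")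
        case True
        then have "s y = \<sigma> y" using image_\<eta>[OF B(2)] by (simp add: s_def)
        have "ennreal (\<delta> u y) = ennreal (exp (real k * u (\<sigma> y))) * ennreal (\<delta> (\<lambda>_. 0) y)"
          unfolding \<delta>_conformal[of u y] by (rule ennreal_mult') simp
        then show ?thesis
          unfolding ed D_def \<open>s y = \<sigma> y\<close> \<open>real n - 1 = real k\<close> by (simp only: mult_ac)
      qed (simp add: D_def ed)
    qed
    finally show "emeasure (density \<mu> (\<lambda>x. ennreal (?w x))) B = (\<integral>\<^sup>+ y. ennreal (d y) * indicator (e ` B) y \<partial>leb k)" .
  qed (use \<mu> in auto)
qed

end

section \<open>Compact domains with smooth boundary\<close>

lemma cube_eq_PiE: "cube k x e = PiE {..<k} (\<lambda>i. {x i - e<..<x i + e})"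
proof -
  have "\<bar>y i - x i\<bar> < e \<longleftrightarrow> y i \<in> {x i - e<..<x i + e}" for y i by auto
  then show ?thesis unfolding cube_def Rn_extensional PiE_def Pi_def by auto
qed

lemma emeasure_cube:
  assumes "e > 0"
  shows "emeasure (leb k) (cube k x e) = ennreal ((2 * e) ^ k)"
proof -
  have "emeasure (leb k) (cube k x e) = (\<Prod>i\<in>{..<k}. emeasure lborel {x i - e<..<x i + e})"
    unfolding cube_eq_PiE leb_def by (rule lborels.emeasure_PiM) auto
  also have "\<dots> = (\<Prod>i\<in>{..<k}. ennreal (2 * e))" using assms by (intro prod.cong) auto
  also have "\<dots> = ennreal ((2 * e) ^ k)" using assms by (simp add: ennreal_power)
  finally show ?thesis .
qed

lemma sets_cube: "cube k x e \<in> sets (leb k)"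
  by (rule openin_imp_sets_leb[OF openin_cube])

lemma emeasure_open_pos:
  assumes "openin (euc k) W" "x \<in> W"
  shows "emeasure (leb k) W > 0"
proof -
  obtain e where e: "e > 0" "cube k x e \<subseteq> W" using openin_imp_cube[OF assms] by blast
  have "0 < ennreal ((2 * e) ^ k)" using e by simp
  also have "\<dots> \<le> emeasure (leb k) W"
    unfolding emeasure_cube[OF e(1), symmetric, of k x] using e openin_imp_sets_leb[OF assms(1)] by (intro emeasure_mono)
  finally show ?thesis .
qed

lemma closedin_imp_sets_leb:
  assumes "closedin (euc k) A"
  shows "A \<in> sets (leb k)"
proof -
  have "Rn k - A \<in> sets (leb k)" using assms by (intro openin_imp_sets_leb) (auto simp: closedin_def)
  then have "Rn k - (Rn k - A) \<in> sets (leb k)" using openin_imp_sets_leb[OF openin_Rn] by auto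
  moreover have "Rn k - (Rn k - A) = A" using closedin_subset[OF assms] by auto
  ultimately show ?thesis by simp
qed

lemma continuous_map_euc_coord: "i < k \<Longrightarrow> continuous_map (euc k) euclideanreal (\<lambda>x. x i)"
  unfolding euc_def by (intro continuous_map_product_projection) auto

lemma compactin_euc_subset_cube:
  assumes "compactin (euc k) A"
  obtains R where "R > 0" "A \<subseteq> cube k (restrict (\<lambda>_. 0) {..<k}) R"
proof -
  have "\<exists>b. \<forall>x\<in>A. \<bar>x i\<bar> \<le> b" if "i < k" for i
  proof -
    have "compact ((\<lambda>x. x i) ` A)"
      using image_compactin[OF assms continuous_map_euc_coord[OF that]] by simp
    then have "bounded ((\<lambda>x. x i) ` A)" by (rule compact_imp_bounded)
    then show ?thesis by (auto simp: bounded_iff)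
  qed
  then obtain b where b: "\<And>i x. i < k \<Longrightarrow> x \<in> A \<Longrightarrow> \<bar>x i\<bar> \<le> b i" by metis
  define R where "R = 1 + (\<Sum>i<k. \<bar>b i\<bar>)"
  have "b i < R" if "i < k" for i
  proof -
    have "\<bar>b i\<bar> \<le> (\<Sum>i<k. \<bar>b i\<bar>)" using that by (intro member_le_sum) auto
    then show ?thesis by (simp add: R_def)
  qed
  then have "A \<subseteq> cube k (restrict (\<lambda>_. 0) {..<k}) R"
    using b compactin_subset_topspace[OF assms] by (force simp: cube_def)
  moreover have "R > 0" unfolding R_def by (intro add_pos_nonneg sum_nonneg) auto
  ultimately show thesis using that by blast
qed

lemma compactin_emeasure_finite:
  assumes "compactin (euc k) A"
  shows "emeasure (leb k) A < \<infinity>"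
proof -
  obtain R where "R > 0" "A \<subseteq> cube k (restrict (\<lambda>_. 0) {..<k}) R" by (rule compactin_euc_subset_cube[OF assms])
  then have "emeasure (leb k) A \<le> emeasure (leb k) (cube k (restrict (\<lambda>_. 0) {..<k}) R)"
    by (intro emeasure_mono sets_cube)
  also have "\<dots> < \<infinity>" using \<open>R > 0\<close> by (simp add: emeasure_cube)
  finally show ?thesis .
qed

lemma connected_space_euc: "connected_space (euc k)"
proof -
  have "connected_space euclideanreal"
    using connected_UNIV connectedin_topspace[of euclideanreal] by simp
  then show ?thesis unfolding euc_def by (simp add: connected_space_product_topology)
qed

lemma Hausdorff_euc: "Hausdorff_space (euc k)"
  unfolding euc_def by (simp add: Hausdorff_space_product_topology)

text \<open>With the last chart coordinate as height: points of negative height have a neighbourhood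
  inside \<Omega>, while at height 0 the open image of the chart contains points of positive height
  arbitrarily near, so these points are not interior.\<close>

lemma chart_boundary_slice:
  assumes c: "c \<in> euc_charts n" and n: "n \<ge> 1" and \<Omega>: "closedin (euc n) \<Omega>"
    and b: "snd c ` (fst c \<inter> \<Omega>) = {x \<in> snd c ` fst c. x (n - 1) \<le> 0}"
  shows "snd c ` (fst c \<inter> (euc n frontier_of \<Omega>)) = {x \<in> snd c ` fst c. x (n - 1) = 0}"
proof -
  interpret euc_chart n c by (rule euc_chartI[OF c])
  let ?S = "euc n frontier_of \<Omega>"
  have fr: "?S = \<Omega> - euc n interior_of \<Omega>" using \<Omega> by (simp add: frontier_of_def closure_of_closedin)
  have iff: "q \<in> \<Omega> \<longleftrightarrow> \<phi> q (n - 1) \<le> 0" if "q \<in> U" for q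
  proof
    assume "q \<in> \<Omega>"
    then have "\<phi> q \<in> \<phi> ` (U \<inter> \<Omega>)" using that by blast
    then show "\<phi> q (n - 1) \<le> 0" unfolding b by simp
  next
    assume "\<phi> q (n - 1) \<le> 0"
    then have "\<phi> q \<in> \<phi> ` (U \<inter> \<Omega>)" unfolding b using that by simp
    then obtain q' where "q' \<in> U" "q' \<in> \<Omega>" "\<phi> q = \<phi> q'" by blast
    then show "q \<in> \<Omega>" using inj_onD[OF inj_\<phi>] that by metis
  qed
  have "q \<in> ?S \<longleftrightarrow> \<phi> q (n - 1) = 0" if q: "q \<in> U" for q
  proof
    assume qS: "q \<in> ?S"
    show "\<phi> q (n - 1) = 0"
    proof (rule ccontr)
      assume ne: "\<phi> q (n - 1) \<noteq> 0"
      have lt: "\<phi> q (n - 1) < 0" using iff[OF q] qS ne by (auto simp: fr)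
      define W where "W = U \<inter> (\<lambda>x. \<phi> x (n - 1)) -` {..<0}"
      have "openin (top_of_set U) W" unfolding W_def
        by (intro continuous_openin_preimage_gen continuous_on_compose2[OF continuous_on_coord continuous_\<phi>]) auto
      then have "openin (euc n) W" using openU openin_trans euc_eq_top_of_set by metis
      moreover have "W \<subseteq> \<Omega>" using iff by (auto simp: W_def)
      moreover have "q \<in> W" using q lt by (simp add: W_def)
      ultimately have "q \<in> euc n interior_of \<Omega>" by (auto simp: interior_of_def)
      then show False using qS by (simp add: fr)
    qed
  next
    assume z: "\<phi> q (n - 1) = 0"
    have "q \<notin> euc n interior_of \<Omega>"
    proof
      assume "q \<in> euc n interior_of \<Omega>"
      then obtain O' where O': "openin (euc n) O'" "q \<in> O'" "O' \<subseteq> \<Omega>" by (auto simp: interior_of_def)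
      have "openin (euc n) (\<phi> ` (O' \<inter> U))" by (rule open_image_\<phi>) (use O' openU in auto)
      then obtain e where e: "e > 0" "cube n (\<phi> q) e \<subseteq> \<phi> ` (O' \<inter> U)"
        using openin_imp_cube[of n "\<phi> ` (O' \<inter> U)" "\<phi> q"] O' q by blast
      have qV: "\<phi> q \<in> Rn n" using V_Rn q by blast
      have "(\<phi> q)(n - 1 := e / 2) \<in> cube n (\<phi> q) e"
        using e(1) z n Rn_upd[OF qV] by (auto simp: cube_def)
      then have "(\<phi> q)(n - 1 := e / 2) \<in> \<phi> ` (O' \<inter> U)" using e(2) by blast
      then obtain p where p: "p \<in> O'" "p \<in> U" "(\<phi> q)(n - 1 := e / 2) = \<phi> p" by blast
      then have "\<phi> p (n - 1) = e / 2" by (metis fun_upd_same)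
      then show False using iff[OF p(2)] O'(3) e(1) p(1) by auto
    qed
    then show "q \<in> ?S" using iff[OF q] z by (simp add: fr)
  qed
  then show ?thesis by auto
qed

locale domain =
  fixes n :: nat and \<Omega> :: "coords set"
  assumes n: "n \<ge> 2" and dom: "smooth_compact_domain n (euc n) (euc_charts n) \<Omega>"
begin

abbreviation "S \<equiv> euc n frontier_of \<Omega>"

lemma compact_\<Omega>: "compactin (euc n) \<Omega>" and \<Omega>_ne: "\<Omega> \<noteq> {}"
  using dom by (auto simp: smooth_compact_domain_def)

lemma closed_\<Omega>: "closedin (euc n) \<Omega>"
  using compactin_imp_closedin[OF Hausdorff_euc compact_\<Omega>] .

lemma \<Omega>_sets: "\<Omega> \<in> sets (leb n)" by (rule closedin_imp_sets_leb[OF closed_\<Omega>])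

lemma \<Omega>_Rn: "\<Omega> \<subseteq> Rn n" using closedin_subset[OF closed_\<Omega>] .

lemma boundary_chart:
  assumes "p \<in> S"
  obtains c where "c \<in> euc_charts n" "p \<in> fst c" "snd c ` (fst c \<inter> \<Omega>) = {x \<in> snd c ` fst c. x (n - 1) \<le> 0}"
proof -
  have "\<exists>(U, \<phi>)\<in>euc_charts n. p \<in> U \<and> \<phi> ` (U \<inter> \<Omega>) = {x \<in> \<phi> ` U. x (n - 1) \<le> 0}"
    using dom assms unfolding smooth_compact_domain_def by blast
  then show thesis using that by fastforce
qed

text \<open>An empty frontier would make \<Omega> both open and closed, hence all of
  \<open>Rn n\<close> by connectedness, and this is not compact.\<close>

lemma S_ne: "S \<noteq> {}"
proof
  assume "S = {}"
  then have "closedin (euc n) \<Omega> \<and> openin (euc n) \<Omega>" using frontier_of_eq_empty[OF \<Omega>_Rn] by blast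
  then have "\<Omega> = Rn n" using connected_space_euc[of n] \<Omega>_ne unfolding connected_space_clopen_in by blast
  then have "compactin (euc n) (Rn n)" using compact_\<Omega> by simp
  then obtain R where R: "R > 0" "Rn n \<subseteq> cube n (restrict (\<lambda>_. 0) {..<n}) R" by (rule compactin_euc_subset_cube)
  have "restrict (\<lambda>_. R) {..<n} \<in> cube n (restrict (\<lambda>_. 0) {..<n}) R" using R(2) restrict_Rn by blast
  then have "\<forall>i<n. \<bar>restrict (\<lambda>_. R) {..<n} i - restrict (\<lambda>_. 0) {..<n} i\<bar> < R" unfolding cube_def by blast
  from this[rule_format, of 0] show False using n R(1) by simp
qed

sublocale hypersurface n S
proof
  show "2 \<le> n" by (rule n)
  show "S \<in> sets (leb n)" by (rule closedin_imp_sets_leb[OF closedin_frontier_of])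
  show "S \<noteq> {}" by (rule S_ne)
  fix p assume "p \<in> S"
  then obtain c where c: "c \<in> euc_charts n" "p \<in> fst c" "snd c ` (fst c \<inter> \<Omega>) = {x \<in> snd c ` fst c. x (n - 1) \<le> 0}"
    by (rule boundary_chart)
  then show "\<exists>c\<in>euc_charts n. p \<in> fst c \<and> snd c ` (fst c \<inter> S) = {x \<in> snd c ` fst c. x (n - 1) = 0}"
    using chart_boundary_slice[OF c(1) _ closed_\<Omega> c(3)] n by auto
qed

text \<open>In the chart at a boundary point, the points of negative height form a non-empty open
  subset of \<Omega>. The volume stands in the denominator of the isoperimetric ratio, so it must
  not vanish.\<close>

lemma emeasure_\<Omega>_pos: "emeasure (leb n) \<Omega> > 0"
proof -
  obtain p where "p \<in> S" using S_ne by blast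
  then obtain c where ch: "c \<in> euc_charts n" "p \<in> fst c" "snd c ` (fst c \<inter> \<Omega>) = {x \<in> snd c ` fst c. x (n - 1) \<le> 0}"
    by (rule boundary_chart)
  interpret euc_chart n c by (rule euc_chartI[OF ch(1)])
  have "\<phi> p \<in> \<phi> ` (U \<inter> S)" using ch(2) \<open>p \<in> S\<close> by blast
  then have z: "\<phi> p (n - 1) = 0" using chart_boundary_slice[OF ch(1) _ closed_\<Omega> ch(3)] n by auto
  have pV: "\<phi> p \<in> V" using ch(2) by blast
  obtain e where e: "e > 0" "cube n (\<phi> p) e \<subseteq> V" using openin_imp_cube[OF openV pV] by blast
  have "(\<phi> p)(n - 1 := - e / 2) \<in> cube n (\<phi> p) e"
    using e(1) z n Rn_upd[OF V_Rn[OF pV], of "n - 1"] by (auto simp: cube_def)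
  then have yV: "(\<phi> p)(n - 1 := - e / 2) \<in> V" (is "?y \<in> V") using e(2) by blast
  define W where "W = U \<inter> (\<lambda>x. \<phi> x (n - 1)) -` {..<0}"
  have "openin (top_of_set U) W" unfolding W_def
    by (intro continuous_openin_preimage_gen continuous_on_compose2[OF continuous_on_coord continuous_\<phi>]) auto
  then have W: "openin (euc n) W" using openU openin_trans euc_eq_top_of_set by metis
  have "\<psi> ?y \<in> W" using \<psi>_in[OF yV] \<phi>_\<psi>[OF yV] e(1) by (simp add: W_def)
  then have "0 < emeasure (leb n) W" by (rule emeasure_open_pos[OF W])
  also have "W \<subseteq> \<Omega>"
  proof
    fix q assume q: "q \<in> W"
    then have "\<phi> q \<in> \<phi> ` (U \<inter> \<Omega>)" unfolding ch(3) by (auto simp: W_def)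
    then obtain q' where "q' \<in> U" "q' \<in> \<Omega>" "\<phi> q = \<phi> q'" by blast
    then show "q \<in> \<Omega>" using inj_onD[OF inj_\<phi>, of q q'] q by (simp add: W_def)
  qed
  then have "emeasure (leb n) W \<le> emeasure (leb n) \<Omega>" by (intro emeasure_mono \<Omega>_sets)
  finally show ?thesis .
qed

text \<open>u is bounded on the compact domain, so the volume integral is finite. Positivity rests
  on this, since an infinite value would be read as 0.\<close>

lemma
  assumes u: "continuous_on (Rn n) u"
  shows conformal_volume_eq: "conformal_volume n u \<Omega> = measure (volume_measure n (euc n) (euc_charts n) (conformal_metric n u)) \<Omega>"
    and conformal_volume_pos: "conformal_volume n u \<Omega> > 0"
    and conformal_volume_integrable: "integrable (leb n) (\<lambda>x. indicator \<Omega> x * exp (real n * u x))"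
proof -
  let ?f = "\<lambda>x. exp (real n * u x)"
  have mf: "?f \<in> borel_measurable (leb n)"
    by (intro continuous_on_borel_measurable_leb continuous_intros u)
  have mi: "(\<lambda>x. indicator \<Omega> x * ?f x) \<in> borel_measurable (leb n)" using mf \<Omega>_sets by measurable
  have eq: "(\<integral>\<^sup>+x. ennreal (?f x) * indicator \<Omega> x \<partial>leb n) = (\<integral>\<^sup>+x. ennreal (indicator \<Omega> x * ?f x) \<partial>leb n)"
    by (intro nn_integral_cong) (auto simp: indicator_def)
  have em: "emeasure (density (leb n) (\<lambda>x. ennreal (?f x))) \<Omega> = (\<integral>\<^sup>+x. ennreal (indicator \<Omega> x * ?f x) \<partial>leb n)"
    unfolding eq[symmetric] using mf \<Omega>_sets by (intro emeasure_density) auto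
  have cv: "conformal_volume n u \<Omega> = enn2real (\<integral>\<^sup>+x. ennreal (indicator \<Omega> x * ?f x) \<partial>leb n)"
    unfolding conformal_volume_def set_lebesgue_integral_def using mi
    by (subst integral_eq_nn_integral) auto
  show "conformal_volume n u \<Omega> = measure (volume_measure n (euc n) (euc_charts n) (conformal_metric n u)) \<Omega>"
    unfolding volume_measure_conformal[OF u] cv measure_def em ..
  have "compact (u ` \<Omega>)"
  proof -
    have "continuous_map (subtopology (euc n) (Rn n)) euclideanreal u" using u continuous_map_euc[of "Rn n" n u] by simp
    then have "continuous_map (euc n) euclideanreal u" by (simp add: subtopology_topspace)
    from image_compactin[OF compact_\<Omega> this] show ?thesis by simp
  qed
  then obtain M where M: "\<And>x. x \<in> \<Omega> \<Longrightarrow> \<bar>u x\<bar> \<le> M" using compact_imp_bounded[of "u ` \<Omega>"] by (auto simp: bounded_iff)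
  have fin: "(\<integral>\<^sup>+x. ennreal (indicator \<Omega> x * ?f x) \<partial>leb n) < \<infinity>"
  proof -
    have "(\<integral>\<^sup>+x. ennreal (indicator \<Omega> x * ?f x) \<partial>leb n) \<le> (\<integral>\<^sup>+x. ennreal (exp (real n * M)) * indicator \<Omega> x \<partial>leb n)"
    proof (intro nn_integral_mono)
      fix x
      have "u x \<le> M" if "x \<in> \<Omega>" using M[OF that] by linarith
      then show "ennreal (indicator \<Omega> x * ?f x) \<le> ennreal (exp (real n * M)) * indicator \<Omega> x"
        by (auto simp: indicator_def intro!: ennreal_leI mult_left_mono)
    qed
    also have "\<dots> = ennreal (exp (real n * M)) * emeasure (leb n) \<Omega>" using \<Omega>_sets by (simp add: nn_integral_cmult_indicator)
    also have "\<dots> < \<infinity>" using compactin_emeasure_finite[OF compact_\<Omega>] by (simp add: ennreal_mult_less_top)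
    finally show ?thesis .
  qed
  show "integrable (leb n) (\<lambda>x. indicator \<Omega> x * ?f x)"
    using mi fin by (intro integrableI_nonneg) auto
  have "(\<integral>\<^sup>+x. ennreal (indicator \<Omega> x * ?f x) \<partial>leb n) \<noteq> 0"
  proof
    assume "(\<integral>\<^sup>+x. ennreal (indicator \<Omega> x * ?f x) \<partial>leb n) = 0"
    then have "emeasure (leb n) {x \<in> space (leb n). ennreal (indicator \<Omega> x * ?f x) \<noteq> 0} = 0"
      using mi by (subst (asm) nn_integral_0_iff) auto
    moreover have "{x \<in> space (leb n). ennreal (indicator \<Omega> x * ?f x) \<noteq> 0} = \<Omega>"
      using \<Omega>_Rn by (auto simp: space_leb indicator_def)
    ultimately show False using emeasure_\<Omega>_pos by simp
  qed
  then show "conformal_volume n u \<Omega> > 0" unfolding cv using fin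
    by (simp add: enn2real_positive_iff zero_less_iff_neq_zero)
qed

text \<open>Both sides are the real value of the same non-negative integral over S, once
  \<open>area_measure_conformal\<close> has identified the measure.\<close>

lemma conformal_area_eq:
  assumes u: "continuous_on (Rn n) u"
  shows "conformal_area n u \<Omega> = measure (area_measure n (euc n) (euc_charts n) (conformal_metric n u) S) S"
proof -
  let ?\<mu> = "euc_area_measure n S"
  let ?f = "\<lambda>x. exp ((real n - 1) * u x)"
  have SS: "S \<in> sets ?\<mu>" using area_measure_conformal(3)[OF u] sets.top[of ?\<mu>] by simp
  have "emeasure (density ?\<mu> (\<lambda>x. ennreal (?f x))) S = (\<integral>\<^sup>+x. ennreal (?f x) * indicator S x \<partial>?\<mu>)"
    using area_measure_conformal(2)[OF u] SS by (intro emeasure_density) auto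
  also have "\<dots> = (\<integral>\<^sup>+x. ennreal (?f x) \<partial>?\<mu>)"
    using area_measure_conformal(3)[OF u] by (intro nn_integral_cong) auto
  finally have "measure (density ?\<mu> (\<lambda>x. ennreal (?f x))) S = enn2real (\<integral>\<^sup>+x. ennreal (?f x) \<partial>?\<mu>)"
    by (simp add: measure_def)
  moreover have "conformal_area n u \<Omega> = enn2real (\<integral>\<^sup>+x. ennreal (?f x) \<partial>?\<mu>)"
    unfolding conformal_area_def using area_measure_conformal(2)[OF u] by (intro integral_eq_nn_integral) auto
  ultimately show ?thesis unfolding area_measure_conformal(1)[OF u] by simp
qed

end

section \<open>Balls as domains with smooth boundary\<close>

lemma enorm_continuous: "continuous_on A (enorm n)"
  unfolding enorm_def[abs_def] L2_set_def by (intro continuous_intros continuous_on_coord)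

definition ball_n :: "nat \<Rightarrow> real \<Rightarrow> coords set" where
  "ball_n n r = {x \<in> Rn n. enorm n x \<le> r}"

definition sphere_n :: "nat \<Rightarrow> real \<Rightarrow> coords set" where
  "sphere_n n r = {x \<in> Rn n. enorm n x = r}"

lemma abs_coord_le_enorm: "i < n \<Longrightarrow> \<bar>x i\<bar> \<le> enorm n x"
  unfolding enorm_def using member_le_L2_set[of "{..<n}" i "\<lambda>i. \<bar>x i\<bar>"] by (simp add: L2_set_def)

lemma closedin_ball_n: "closedin (euc n) (ball_n n r)"
proof -
  have "closedin (top_of_set (Rn n)) (Rn n \<inter> enorm n -` {..r})"
    by (intro continuous_closedin_preimage enorm_continuous) auto
  moreover have "Rn n \<inter> enorm n -` {..r} = ball_n n r" by (auto simp: ball_n_def)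
  ultimately show ?thesis using euc_eq_top_of_set[of n] by metis
qed

lemma compactin_ball_n: "compactin (euc n) (ball_n n r)"
proof (rule closed_compactin)
  show "compactin (euc n) (PiE {..<n} (\<lambda>_. {-r..r}))"
    unfolding euc_def compactin_PiE by auto
  show "ball_n n r \<subseteq> PiE {..<n} (\<lambda>_. {-r..r})"
  proof
    fix x assume "x \<in> ball_n n r"
    then have x: "x \<in> extensional {..<n}" "enorm n x \<le> r" by (simp_all add: ball_n_def Rn_extensional)
    have "x i \<in> {-r..r}" if "i < n" for i using abs_coord_le_enorm[OF that, of x] x(2) by (simp add: abs_le_iff)
    then show "x \<in> PiE {..<n} (\<lambda>_. {-r..r})" using x(1) by (simp add: PiE_iff)
  qed
qed (rule closedin_ball_n)

lemma enorm_scale: "enorm n (restrict (\<lambda>a. t * x a) {..<n}) = \<bar>t\<bar> * enorm n x"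
proof -
  have "(\<Sum>i<n. (restrict (\<lambda>a. t * x a) {..<n} i)\<^sup>2) = t\<^sup>2 * (\<Sum>i<n. (x i)\<^sup>2)"
    by (simp add: sum_distrib_left power_mult_distrib)
  then show ?thesis by (simp add: enorm_def L2_set_def real_sqrt_mult)
qed

text \<open>A ball is the union of the segments from the origin to its points.\<close>

lemma connectedin_ball_n: "r \<ge> 0 \<Longrightarrow> connectedin (euc n) (ball_n n r)"
proof -
  assume r: "r \<ge> 0"
  define seg where "seg x = (\<lambda>t. restrict (\<lambda>a. t * x a) {..<n}) ` {0..1::real}" for x :: coords
  have "connected (seg x)" for x
    unfolding seg_def
  proof (rule connected_continuous_image)
    show "continuous_on {0..1} (\<lambda>t. restrict (\<lambda>a. t * x a) {..<n})"
      by (rule continuous_on_coordsI[of n]) (auto intro!: continuous_intros simp: restrict_Rn)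
  qed auto
  moreover have "restrict (\<lambda>_. 0) {..<n} \<in> seg x" for x
    unfolding seg_def by (rule image_eqI[of _ _ 0]) auto
  ultimately have "connected (\<Union>(seg ` ball_n n r))" by (intro connected_Union) blast+
  moreover have "\<Union>(seg ` ball_n n r) = ball_n n r"
  proof (intro equalityI subsetI)
    fix y assume "y \<in> \<Union>(seg ` ball_n n r)"
    then obtain x t where xt: "enorm n x \<le> r" "0 \<le> t" "t \<le> 1" "y = restrict (\<lambda>a. t * x a) {..<n}"
      by (auto simp: seg_def ball_n_def)
    have "t * enorm n x \<le> 1 * r" using xt by (intro mult_mono) auto
    then show "y \<in> ball_n n r" using xt by (simp add: ball_n_def restrict_Rn enorm_scale)
  next
    fix y assume y: "y \<in> ball_n n r"
    then have "y = restrict (\<lambda>a. 1 * y a) {..<n}" by (auto simp: ball_n_def Rn_extensional extensional_def restrict_def fun_eq_iff)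
    then have "y \<in> seg y" unfolding seg_def by (intro image_eqI[of _ _ 1]) auto
    then show "y \<in> \<Union>(seg ` ball_n n r)" using y by blast
  qed
  ultimately have "connected (ball_n n r)" by simp
  then show ?thesis
    by (subst euc_eq_top_of_set) (auto simp: connectedin_subtopology ball_n_def)
qed

text \<open>\<open>G s\<close> is the s-th derivative of \<open>t powr (1/2)\<close>, the product
  being the falling factorial of 1/2. This is the family of derivatives that
  \<open>Ck_on_real_compose\<close> asks for.\<close>

lemma smooth_on_sqrt:
  assumes U: "openin (euc k) U" and f: "smooth_on k U f" "\<And>x. x \<in> U \<Longrightarrow> f x > 0"
  shows "smooth_on k U (\<lambda>x. sqrt (f x))"
proof -
  define G where "G s t = (\<Prod>j<s. 1/2 - real j) * t powr (1/2 - real s)" for s :: nat and t :: real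
  have G: "(G s has_real_derivative G (Suc s) t) (at t)" if "t \<in> {0<..}" for s t
  proof -
    have "(G s has_real_derivative (\<Prod>j<s. 1/2 - real j) * ((1/2 - real s) * t powr (1/2 - real s - 1))) (at t)"
      unfolding G_def[abs_def] using that by (intro DERIV_cmult has_real_derivative_powr) auto
    then show ?thesis by (simp add: G_def algebra_simps)
  qed
  have "smooth_on k U (\<lambda>x. G 0 (f x))"
    unfolding smooth_on_def
  proof
    fix r
    show "Ck_on k r U (\<lambda>x. G 0 (f x))"
      by (rule Ck_on_real_compose[OF U, where G=G and I="{0<..}" and s=0]) (use f G in \<open>auto intro: smooth_on_Ck\<close>)
  qed
  then show ?thesis
    by (rule smooth_on_cong[OF U]) (use f(2) in \<open>auto simp: G_def powr_half_sqrt less_imp_le\<close>)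
qed

text \<open>On the open half-space where coordinate i has sign s, that coordinate is replaced by
  |x|^2 - r^2, which together with the other coordinates determines it, and is then moved to the
  last place, where boundary charts have their defining function. The charts for all i and both
  signs cover the sphere.\<close>

definition sphere_chart :: "nat \<Rightarrow> real \<Rightarrow> nat \<Rightarrow> real \<Rightarrow> coords chart" where
  "sphere_chart n r i s = ({x \<in> Rn n. s * x i > 0}, \<lambda>x. swp i (n - 1) (x(i := (\<Sum>j<n. x j * x j) - r\<^sup>2)))"

lemma sphere_chart:
  assumes i: "i < n" and s: "s = 1 \<or> s = -1"
  shows "sphere_chart n r i s \<in> euc_charts n"
proof -
  let ?k = "n - 1"
  have k: "?k < n" using i by simp
  define q where "q x = (\<Sum>j<n. x j * x j) - r\<^sup>2" for x :: coords
  define U where "U = {x \<in> Rn n. s * x i > 0}"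
  define \<phi> where "\<phi> x = swp i ?k (x(i := q x))" for x
  \<comment> \<open>The square of the replaced coordinate, recovered from the new coordinates; the
    inverse chart takes its root with sign s.\<close>
  define w where "w z = z ?k + r\<^sup>2 - (\<Sum>j\<in>{..<n} - {i}. swp i ?k z j * swp i ?k z j)" for z
  define \<xi> where "\<xi> z = (swp i ?k z)(i := s * sqrt (w z))" for z
  define V where "V = {z \<in> Rn n. w z > 0}"
  have s2: "s * s = 1" using s by auto
  have split: "(\<Sum>j<n. x j * x j) = x i * x i + (\<Sum>j\<in>{..<n} - {i}. x j * x j)" for x :: coords
    using i by (subst sum.remove[of _ i]) auto
  have swp_k: "swp i ?k z i = z ?k" for z by (simp add: swp_def)
  have w_\<phi>: "w (\<phi> x) = x i * x i" for x
  proof -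
    have "w (\<phi> x) = \<phi> x ?k + r\<^sup>2 - (\<Sum>j\<in>{..<n} - {i}. x j * x j)"
      by (simp add: w_def \<phi>_def)
    moreover have "\<phi> x ?k = q x" by (simp add: \<phi>_def swp_def)
    ultimately show ?thesis by (simp add: q_def split)
  qed
  have \<phi>_V: "\<phi> x \<in> V" if "x \<in> U" for x
  proof -
    have "x i \<noteq> 0" using that by (auto simp: U_def)
    then have "w (\<phi> x) > 0" unfolding w_\<phi> by (metis not_real_square_gt_zero)
    moreover have "\<phi> x \<in> Rn n" using that i k by (auto simp: \<phi>_def U_def intro!: swp_Rn Rn_upd)
    ultimately show ?thesis by (simp add: V_def)
  qed
  have \<xi>_\<phi>: "\<xi> (\<phi> x) = x" if "x \<in> U" for x
  proof -
    have "s * sqrt (x i * x i) = x i" using that s by (auto simp: U_def)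
    then show ?thesis unfolding \<xi>_def w_\<phi> by (simp add: \<phi>_def)
  qed
  have \<xi>_U: "\<xi> z \<in> U" if "z \<in> V" for z
    using that s2 i k swp_Rn[of i n ?k z] by (auto simp: \<xi>_def U_def V_def Rn_upd mult.assoc[symmetric])
  have q_\<xi>: "q (\<xi> z) = z ?k" if "z \<in> V" for z
  proof -
    have wz: "w z > 0" using that by (simp add: V_def)
    have "(s * sqrt (w z)) * (s * sqrt (w z)) = (s * s) * (sqrt (w z) * sqrt (w z))" by (simp add: mult_ac)
    also have "\<dots> = w z" using wz s2 by simp
    finally have "q (\<xi> z) = w z + (\<Sum>j\<in>{..<n} - {i}. swp i ?k z j * swp i ?k z j) - r\<^sup>2"
      unfolding q_def split by (simp add: \<xi>_def)
    then show ?thesis by (simp add: w_def)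
  qed
  have \<phi>_\<xi>: "\<phi> (\<xi> z) = z" if "z \<in> V" for z
  proof -
    have "(\<xi> z)(i := q (\<xi> z)) = swp i ?k z" unfolding q_\<xi>[OF that] by (auto simp: \<xi>_def fun_eq_iff swp_k)
    then show ?thesis by (simp add: \<phi>_def)
  qed
  have im: "\<phi> ` U = V"
  proof (intro equalityI subsetI)
    fix z assume "z \<in> V"
    then show "z \<in> \<phi> ` U" using \<phi>_\<xi> \<xi>_U by (metis imageI)
  qed (use \<phi>_V in auto)
  have inj: "inj_on \<phi> U" by (rule inj_on_inverseI[where g=\<xi>]) (rule \<xi>_\<phi>)
  have smq: "smooth_on n A q" if "openin (euc n) A" for A
    unfolding q_def[abs_def] using that
    by (intro smooth_on_diff smooth_on_sum smooth_on_mult smooth_on_coord smooth_on_const)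
  have smw: "smooth_on n A w" if "openin (euc n) A" for A
    unfolding w_def[abs_def] swp_apply using that
    by (intro smooth_on_diff smooth_on_add smooth_on_sum smooth_on_mult smooth_on_coord smooth_on_const)
  have oU: "openin (euc n) U"
  proof -
    have "openin (top_of_set (Rn n)) (Rn n \<inter> (\<lambda>x. s * x i) -` {0<..})"
      by (intro continuous_openin_preimage_gen continuous_intros continuous_on_coord)
    moreover have "Rn n \<inter> (\<lambda>x. s * x i) -` {0<..} = U" by (auto simp: U_def)
    ultimately show ?thesis using euc_eq_top_of_set[of n] by metis
  qed
  have oV: "openin (euc n) V"
  proof -
    have "openin (top_of_set (Rn n)) (Rn n \<inter> w -` {0<..})"
      by (intro continuous_openin_preimage_gen smooth_on_continuous[OF openin_Rn smw[OF openin_Rn]]) auto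
    moreover have "Rn n \<inter> w -` {0<..} = V" by (auto simp: V_def)
    ultimately show ?thesis using euc_eq_top_of_set[of n] by metis
  qed
  have sm\<phi>: "smooth_on n U (\<lambda>x. \<phi> x l)" for l
    unfolding \<phi>_def swp_apply
    by (cases "Transposition.transpose i ?k l = i") (simp_all add: smq[OF oU] smooth_on_coord[OF oU])
  have sm\<xi>: "smooth_on n V (\<lambda>z. \<xi> z l)" for l
  proof (cases "l = i")
    case True
    have "smooth_on n V (\<lambda>z. s * sqrt (w z))"
      by (intro smooth_on_mult[OF oV] smooth_on_const[OF oV] smooth_on_sqrt[OF oV] smw[OF oV]) (auto simp: V_def)
    then show ?thesis using True by (simp add: \<xi>_def)
  next
    case False
    then show ?thesis by (simp add: \<xi>_def swp_apply smooth_on_coord[OF oV])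
  qed
  have "smooth_on n V (\<lambda>z. inv_into U \<phi> z l)" for l
  proof (rule smooth_on_cong[OF oV sm\<xi>])
    fix z assume "z \<in> V"
    then have "inv_into U \<phi> z = \<xi> z" using inv_into_f_f[OF inj \<xi>_U] \<phi>_\<xi> by metis
    then show "\<xi> z l = inv_into U \<phi> z l" by simp
  qed
  moreover have "sphere_chart n r i s = (U, \<phi>)" by (simp add: sphere_chart_def U_def \<phi>_def[abs_def] q_def)
  ultimately show ?thesis using oU oV inj sm\<phi> im by (simp add: euc_charts_iff)
qed

lemma enorm_le_iff: "r \<ge> 0 \<Longrightarrow> enorm n x \<le> r \<longleftrightarrow> (\<Sum>j<n. x j * x j) \<le> r\<^sup>2"
proof -
  assume r: "r \<ge> 0"
  have "enorm n x \<le> r \<longleftrightarrow> (enorm n x)\<^sup>2 \<le> r\<^sup>2" using r by (simp add: abs_le_square_iff[symmetric])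
  then show ?thesis unfolding enorm_squared by (simp add: power2_eq_square)
qed

lemma sphere_chart_ball:
  assumes i: "i < n" and s: "s = 1 \<or> s = -1" and r: "r \<ge> 0"
  defines "c \<equiv> sphere_chart n r i s"
  shows "snd c ` (fst c \<inter> ball_n n r) = {x \<in> snd c ` fst c. x (n - 1) \<le> 0}"
proof -
  have k: "snd c x (n - 1) = (\<Sum>j<n. x j * x j) - r\<^sup>2" for x
    by (simp add: c_def sphere_chart_def swp_def)
  have "x \<in> ball_n n r \<longleftrightarrow> snd c x (n - 1) \<le> 0" if "x \<in> fst c" for x
    using that enorm_le_iff[OF r, of n x] unfolding k by (auto simp: ball_n_def c_def sphere_chart_def)
  then show ?thesis by auto
qed

lemma sphere_chart_at:
  assumes p: "p \<in> Rn n" "enorm n p = r" and r: "r > 0"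
  obtains i s where "i < n" "s = 1 \<or> s = -1" "p \<in> fst (sphere_chart n r i s)"
proof -
  have "\<exists>i<n. p i \<noteq> 0"
  proof (rule ccontr)
    assume "\<not> ?thesis"
    then have "enorm n p = 0" by (simp add: enorm_def L2_set_def)
    then show False using p r by simp
  qed
  then obtain i where i: "i < n" "p i \<noteq> 0" by blast
  have "sgn (p i) * p i > 0" using i by (auto simp: sgn_if)
  then show thesis using that[of i "sgn (p i)"] i p by (auto simp: sphere_chart_def sgn_if)
qed

lemma frontier_ball_n_subset: "euc n frontier_of ball_n n r \<subseteq> sphere_n n r"
proof -
  have "openin (top_of_set (Rn n)) (Rn n \<inter> enorm n -` {..<r})"
    by (intro continuous_openin_preimage_gen enorm_continuous) auto
  then have o: "openin (euc n) (Rn n \<inter> enorm n -` {..<r})" using euc_eq_top_of_set[of n] by metis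
  have "Rn n \<inter> enorm n -` {..<r} \<subseteq> euc n interior_of ball_n n r"
    by (rule interior_of_maximal[OF _ o]) (auto simp: ball_n_def)
  then show ?thesis
    using closure_of_closedin[OF closedin_ball_n[of n r]] by (auto simp: frontier_of_def ball_n_def sphere_n_def)
qed

lemma smooth_compact_domain_ball_n:
  assumes "r > 0"
  shows "smooth_compact_domain n (euc n) (euc_charts n) (ball_n n r)"
  unfolding smooth_compact_domain_def
proof (intro conjI ballI)
  show "compactin (euc n) (ball_n n r)" by (rule compactin_ball_n)
  show "connectedin (euc n) (ball_n n r)" using assms by (intro connectedin_ball_n) simp
  have "restrict (\<lambda>_. 0) {..<n} \<in> ball_n n r" using assms enorm_scale[of n 0 "\<lambda>_. 0"] by (simp add: ball_n_def restrict_Rn)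
  then show "ball_n n r \<noteq> {}" by blast
  fix p assume "p \<in> euc n frontier_of ball_n n r"
  then have p: "p \<in> Rn n" "enorm n p = r" using frontier_ball_n_subset by (auto simp: sphere_n_def)
  obtain i s where ch: "i < n" "s = 1 \<or> s = -1" "p \<in> fst (sphere_chart n r i s)" by (rule sphere_chart_at[OF p assms])
  show "\<exists>(U, \<phi>)\<in>euc_charts n. p \<in> U \<and> \<phi> ` (U \<inter> ball_n n r) = {x \<in> \<phi> ` U. x (n - 1) \<le> 0}"
    using sphere_chart[OF ch(1,2), of r] sphere_chart_ball[OF ch(1,2), of r] ch(3) assms
    by (intro bexI[of _ "sphere_chart n r i s"]) (auto simp: case_prod_unfold)
qed

text \<open>For the remaining inclusion, the chart at a point of the sphere takes it to height 0,
  and by \<open>chart_boundary_slice\<close> such points belong to the frontier.\<close>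

lemma frontier_ball_n:
  assumes "r > 0"
  shows "euc n frontier_of ball_n n r = sphere_n n r"
proof (intro equalityI frontier_ball_n_subset subsetI)
  fix p assume "p \<in> sphere_n n r"
  then have p: "p \<in> Rn n" "enorm n p = r" by (auto simp: sphere_n_def)
  obtain i s where ch: "i < n" "s = 1 \<or> s = -1" "p \<in> fst (sphere_chart n r i s)" by (rule sphere_chart_at[OF p assms])
  define c where "c = sphere_chart n r i s"
  have c: "c \<in> euc_charts n" unfolding c_def by (rule sphere_chart[OF ch(1,2)])
  interpret euc_chart n c by (rule euc_chartI[OF c])
  have "snd c p (n - 1) = (\<Sum>j<n. p j * p j) - r\<^sup>2" by (simp add: c_def sphere_chart_def swp_def)
  also have "\<dots> = 0" using enorm_squared[of n p] p(2) by (simp add: power2_eq_square)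
  finally have "snd c p \<in> snd c ` (fst c \<inter> euc n frontier_of ball_n n r)"
    using chart_boundary_slice[OF c _ closedin_ball_n] sphere_chart_ball[OF ch(1,2), of r] ch assms unfolding c_def[symmetric] by auto
  then obtain p' where "p' \<in> fst c" "p' \<in> euc n frontier_of ball_n n r" "snd c p = snd c p'" by blast
  then show "p \<in> euc n frontier_of ball_n n r" using inj_onD[OF inj_\<phi>, of p p'] ch(3) by (simp add: c_def)
qed

section \<open>The area of spheres\<close>

context slice_chart
begin

text \<open>A null vector of the tangential block, continued by 0 in the last component, would have
  length 0 for the positive definite metric.\<close>

lemma det_gram_slice_nonzero:
  assumes y: "y \<in> E"
  shows "Determinant.det (gram k (conformal_metric n (\<lambda>_. 0) c) (y(k := 0))) \<noteq> 0"
proof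
  let ?H = "conformal_metric n (\<lambda>_. 0) c" and ?x = "y(k := 0)"
  have car: "gram k ?H ?x \<in> carrier_mat k k" by (simp add: gram_def)
  assume "Determinant.det (gram k ?H ?x) = 0"
  then obtain v where v: "v \<in> carrier_vec k" "v \<noteq> 0\<^sub>v k" "gram k ?H ?x *\<^sub>v v = 0\<^sub>v k"
    using det_0_iff_vec_prod_zero[OF car] by blast
  define v' where "v' i = (if i < k then vec_index v i else 0)" for i
  have "\<exists>i<n. v' i \<noteq> 0"
  proof (rule ccontr)
    assume z: "\<not> ?thesis"
    have "vec_index v i = 0" if "i < k" for i
    proof -
      have "v' i = 0" using z that kn(1) by (meson less_trans)
      then show ?thesis using that by (simp add: v'_def)
    qed
    then have "v = 0\<^sub>v k" using v(1) by (intro eq_vecI) auto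
    then show False using v(2) by simp
  qed
  then have pos: "form n ?H ?x v' v' > 0"
    using riemannian_metric_conformal[OF smooth_on_const[OF openin_Rn]] c E_V[OF y] unfolding riemannian_metric_def by blast
  have n_eq: "{..<n} = insert k {..<k}" using kn(1) by auto
  have "(\<Sum>j<n. ?H ?x i j * v' j) = 0" if "i < k" for i
  proof -
    have "vec_index (gram k ?H ?x *\<^sub>v v) i = 0" using v(3) that by simp
    then have "(\<Sum>j<k. ?H ?x i j * v' j) = 0"
      using that v(1) by (simp add: gram_def scalar_prod_def v'_def lessThan_atLeast0)
    then show ?thesis unfolding n_eq by (simp add: v'_def)
  qed
  moreover have "form n ?H ?x v' v' = (\<Sum>i<n. v' i * (\<Sum>j<n. ?H ?x i j * v' j))"
    by (simp add: form_def sum_distrib_left mult_ac)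
  moreover have "\<dots> = (\<Sum>i<k. v' i * (\<Sum>j<n. ?H ?x i j * v' j))"
    by (subst n_eq) (simp add: v'_def)
  ultimately show False using pos by simp
qed

end

locale sphere =
  fixes n :: nat and r :: real
  assumes n2: "n \<ge> 2" and r: "r > 0"
begin

sublocale domain n "ball_n n r"
  by unfold_locales (rule n2, rule smooth_compact_domain_ball_n[OF r])

lemma S_iff: "x \<in> S \<longleftrightarrow> x \<in> Rn n \<and> enorm n x = r"
  by (simp add: frontier_ball_n[OF r] sphere_n_def)

end

locale sphere_slice = sphere n r + slice_chart n "euc n frontier_of ball_n n r" c for n r c
begin

text \<open>Polar coordinates. The slice coordinate that vanishes on the sphere is reused as radial
  factor: \<open>\<rho>0\<close> is the point of the sphere given by the other coordinates, and
  \<open>\<Phi>\<close> is its multiple by \<open>z k\<close>.\<close>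

definition "\<rho>0 z = \<psi> (z(k := 0))"
definition "\<Phi> z = restrict (\<lambda>a. z k * \<rho>0 z a) {..<n}"
definition "E' = {z \<in> Rn n. z(k := 0) \<in> V \<and> z k > 0}"

lemma openE': "openin (euc n) E'"
proof -
  have c0: "continuous_on (Rn n) (\<lambda>z. z(k := 0))"
  proof (rule continuous_on_coordsI[of n])
    show "continuous_on (Rn n) (\<lambda>x. (x(k := 0)) i)" for i
      by (cases "i = k") (auto simp: continuous_on_coord)
  qed (use Rn_upd kn in auto)
  have "openin (euc n) (Rn n \<inter> (\<lambda>z. z(k := 0)) -` V)"
    by (rule openin_vimage[OF openin_Rn c0 _ openV]) (use Rn_upd kn in auto)
  moreover have "openin (euc n) (Rn n \<inter> (\<lambda>z. z k) -` {0<..})"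
    using continuous_openin_preimage_gen[OF continuous_on_coord[of "Rn n" k] open_greaterThan[of 0]] euc_eq_top_of_set[of n] by metis
  ultimately have "openin (euc n) ((Rn n \<inter> (\<lambda>z. z(k := 0)) -` V) \<inter> (Rn n \<inter> (\<lambda>z. z k) -` {0<..}))" by (rule openin_Int)
  moreover have "(Rn n \<inter> (\<lambda>z. z(k := 0)) -` V) \<inter> (Rn n \<inter> (\<lambda>z. z k) -` {0<..}) = E'" by (auto simp: E'_def)
  ultimately show ?thesis by simp
qed

lemma dn_E: "z \<in> E' \<Longrightarrow> restrict z {..<k} \<in> E"
proof -
  assume z: "z \<in> E'"
  have "(restrict z {..<k})(k := 0) = z(k := 0)"
    using z kn by (auto simp: E'_def Rn_extensional extensional_def fun_eq_iff)
  then show ?thesis using z by (simp add: E'_def E_def restrict_Rn)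
qed

lemma \<rho>0_eq: "z \<in> E' \<Longrightarrow> \<rho>0 z = \<sigma> (restrict z {..<k})"
proof -
  assume z: "z \<in> E'"
  have "(restrict z {..<k})(k := 0) = z(k := 0)"
    using z kn by (auto simp: E'_def Rn_extensional extensional_def fun_eq_iff)
  then show ?thesis by (simp add: \<rho>0_def \<sigma>_def)
qed

lemma \<rho>0_in: "z \<in> E' \<Longrightarrow> \<rho>0 z \<in> U \<inter> S"
  using \<rho>0_eq \<sigma>_in[OF dn_E] by simp

lemma Ck_\<rho>0: "a < n \<Longrightarrow> Ck_on n 1 E' (\<lambda>z. \<rho>0 z a)"
  unfolding \<rho>0_def
proof (rule Ck_on_compose[OF openV openE' smooth_on_Ck[OF smooth_\<psi>]])
  show "Ck_on n 1 E' (\<lambda>x. (x(k := 0)) i)" for i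
    by (cases "i = k") (auto simp: Ck_on_const[OF openE'] Ck_on_coord[OF openE'])
qed (auto simp: E'_def)

lemma C1_\<Phi>: "C1_map n E' \<Phi>"
  unfolding C1_map_def
proof (intro conjI allI impI)
  fix a assume a: "a < n"
  have "Ck_on n 1 E' (\<lambda>z. z k * \<rho>0 z a)"
    by (intro Ck_on_mult[OF openE'] Ck_on_coord[OF openE'] Ck_\<rho>0 a)
  then show "Ck_on n 1 E' (\<lambda>x. \<Phi> x a)" using a by (simp add: \<Phi>_def)
qed (auto simp: \<Phi>_def restrict_Rn)

lemma pd_\<Phi>:
  assumes z: "z \<in> E'" and a: "a < n" and j: "j < n"
  shows "pd j (\<lambda>z. \<Phi> z a) z = (if j = k then \<rho>0 z a else z k * J a j (z(k := 0)))"
proof -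
  have eq: "(\<lambda>z. \<Phi> z a) = (\<lambda>z. z k * \<psi> (z(k := 0)) a)" using a by (simp add: \<Phi>_def \<rho>0_def)
  have "has_pd j (\<lambda>z. z k * \<psi> (z(k := 0)) a) (if j = k then \<rho>0 z a else z k * J a j (z(k := 0))) z"
  proof (cases "j = k")
    case True
    then show ?thesis unfolding has_pd_def \<rho>0_def by (auto intro!: derivative_eq_intros)
  next
    case False
    have "has_pd j (\<lambda>x. \<psi> x a) (J a j (z(k := 0))) (z(k := 0))"
      unfolding J_def by (rule smooth_on_has_pd[OF openV smooth_\<psi>[OF a] j]) (use z in \<open>simp add: E'_def\<close>)
    then have "((\<lambda>t. \<psi> ((z(k := 0))(j := t)) a) has_real_derivative J a j (z(k := 0))) (at (z j))"
      using False by (simp add: has_pd_def)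
    from DERIV_cmult[OF this, of "z k"] show ?thesis
      using False unfolding has_pd_def by (simp add: fun_upd_twist)
  qed
  from has_pd_imp_pd[OF this] show ?thesis unfolding eq .
qed

lemma norm_\<rho>0: "z \<in> E' \<Longrightarrow> (\<Sum>a<n. \<rho>0 z a * \<rho>0 z a) = r\<^sup>2"
  using \<rho>0_in[of z] enorm_squared[of n "\<rho>0 z"] S_iff by (simp add: power2_eq_square)

text \<open>Tangent vectors of a sphere are orthogonal to the position vector: the constant
  |\<sigma>|^2 = r^2 is differentiated along the slice.\<close>

lemma orthogonal:
  assumes z: "z \<in> E'" and i: "i < k"
  shows "(\<Sum>a<n. J a i (z(k := 0)) * \<rho>0 z a) = 0"
proof -
  define f where "f x = (\<Sum>a<n. \<psi> x a * \<psi> x a)" for x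
  have xV: "z(k := 0) \<in> V" using z by (simp add: E'_def)
  have "has_pd i f (\<Sum>a<n. J a i (z(k := 0)) * \<rho>0 z a + \<rho>0 z a * J a i (z(k := 0))) (z(k := 0))"
    unfolding f_def[abs_def] J_def \<rho>0_def using i kn
    by (intro has_pd_sum has_pd_mult smooth_on_has_pd[OF openV smooth_\<psi> _ xV]) auto
  then have 1: "pd i f (z(k := 0)) = 2 * (\<Sum>a<n. J a i (z(k := 0)) * \<rho>0 z a)"
    using has_pd_imp_pd[of i f] by (simp add: sum_distrib_left mult_ac)
  have up: "(restrict z {..<k})(k := 0) = z(k := 0)"
    using z kn by (auto simp: E'_def Rn_extensional extensional_def fun_eq_iff)
  have "pd i (\<lambda>y. f (y(k := 0))) (restrict z {..<k}) = pd i (\<lambda>_. r\<^sup>2) (restrict z {..<k})"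
  proof (rule pd_cong[OF openE dn_E[OF z] i])
    fix y assume "y \<in> E"
    then have "\<sigma> y \<in> S" using \<sigma>_in by blast
    then show "f (y(k := 0)) = r\<^sup>2" using enorm_squared[of n "\<sigma> y"] S_iff by (simp add: f_def \<sigma>_def power2_eq_square)
  qed
  moreover have "pd i (\<lambda>y. f (y(k := 0))) (restrict z {..<k}) = pd i f (z(k := 0))"
  proof -
    have "(restrict z {..<k})(i := t, k := 0) = z(k := 0, i := t)" for t
      using up i by (metis fun_upd_twist less_irrefl)
    then show ?thesis using i by (simp add: pd_def)
  qed
  ultimately have "pd i f (z(k := 0)) = 0" by (simp add: pd_def)
  then show ?thesis using 1 by simp
qed

text \<open>Radial and tangential directions are orthogonal, so for the Jacobian matrix A the
  product A^T A is block diagonal. The tangential block is the square of \<open>z k\<close> times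
  the Gram matrix of the slice, the radial entry is r^2.\<close>

lemma jdet_\<Phi>_squared:
  assumes z: "z \<in> E'"
  shows "(jdet n \<Phi> z)\<^sup>2 = (z k ^ k * r)\<^sup>2 * Determinant.det (gram k (conformal_metric n (\<lambda>_. 0) c) (z(k := 0)))"
proof -
  let ?A = "jac n \<Phi> z" and ?G = "gram k (conformal_metric n (\<lambda>_. 0) c) (z(k := 0))"
  let ?B1 = "(z k)\<^sup>2 \<cdot>\<^sub>m ?G" and ?B4 = "mat 1 1 (\<lambda>_. r\<^sup>2) :: real mat"
  have A: "?A \<in> carrier_mat n n" by simp
  have G: "?G \<in> carrier_mat k k" by (simp add: gram_def)
  have B: "transpose_mat ?A * ?A = four_block_mat ?B1 (0\<^sub>m k 1) (0\<^sub>m 1 k) ?B4"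
  proof (rule eq_matI)
    fix i j assume "i < dim_row (four_block_mat ?B1 (0\<^sub>m k 1) (0\<^sub>m 1 k) ?B4)" "j < dim_col (four_block_mat ?B1 (0\<^sub>m k 1) (0\<^sub>m 1 k) ?B4)"
    then have ij: "i < n" "j < n" using kn G by auto
    have "(transpose_mat ?A * ?A) $$ (i, j) = (\<Sum>a<n. pd i (\<lambda>z. \<Phi> z a) z * pd j (\<lambda>z. \<Phi> z a) z)"
      using ij by (auto simp: jac_def scalar_prod_def lessThan_atLeast0 intro!: sum.cong)
    also have "\<dots> = (\<Sum>a<n. (if i = k then \<rho>0 z a else z k * J a i (z(k := 0))) * (if j = k then \<rho>0 z a else z k * J a j (z(k := 0))))"
      using pd_\<Phi>[OF z] ij by (intro sum.cong) auto
    also have "\<dots> = four_block_mat ?B1 (0\<^sub>m k 1) (0\<^sub>m 1 k) ?B4 $$ (i, j)"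
    proof -
      consider "i < k" "j < k" | "i < k" "j = k" | "i = k" "j < k" | "i = k" "j = k" using ij kn by linarith
      then show ?thesis
      proof cases
        case 1
        then show ?thesis using G ij kn
          by (simp add: gram_def conformal_metric_eq sum_distrib_left power2_eq_square mult_ac)
      next
        case 2
        then show ?thesis using G ij kn orthogonal[OF z 2(1)]
          by (simp add: mult.assoc sum_distrib_left[symmetric])
      next
        case 3
        then show ?thesis using G ij kn orthogonal[OF z 3(2)]
          by (simp add: mult_ac sum_distrib_left[symmetric])
      next
        case 4
        then show ?thesis using G ij kn norm_\<rho>0[OF z] by simp
      qed
    qed
    finally show "(transpose_mat ?A * ?A) $$ (i, j) = four_block_mat ?B1 (0\<^sub>m k 1) (0\<^sub>m 1 k) ?B4 $$ (i, j)" .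
  qed (use kn G in \<open>auto simp: jac_def\<close>)
  have "Determinant.det (transpose_mat ?A * ?A) = (jdet n \<Phi> z)\<^sup>2"
    using Determinant.det_mult[OF transpose_carrier_mat[THEN iffD2, OF A] A] det_transpose[OF A] by (simp add: jdet_def power2_eq_square)
  moreover have "Determinant.det (four_block_mat ?B1 (0\<^sub>m k 1) (0\<^sub>m 1 k) ?B4) = Determinant.det ?B1 * Determinant.det ?B4"
    by (rule Determinant.det_four_block_mat_lower_left_zero) (use G in auto)
  moreover have "Determinant.det ?B1 = ((z k)\<^sup>2) ^ k * Determinant.det ?G" by (simp add: det_smult gram_def)
  moreover have "Determinant.det ?B4 = r\<^sup>2" by (subst det_single) auto
  ultimately have "(jdet n \<Phi> z)\<^sup>2 = ((z k)\<^sup>2) ^ k * Determinant.det ?G * r\<^sup>2" unfolding B by metis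
  moreover have "((z k)\<^sup>2) ^ k = (z k ^ k)\<^sup>2" by (simp add: power_mult[symmetric] mult.commute)
  ultimately show ?thesis by (simp add: power_mult_distrib mult_ac)
qed

lemma abs_jdet_\<Phi>:
  assumes z: "z \<in> E'"
  shows "\<bar>jdet n \<Phi> z\<bar> = z k ^ k * r * \<delta> (\<lambda>_. 0) (restrict z {..<k})"
proof -
  have up: "(restrict z {..<k})(k := 0) = z(k := 0)"
    using z kn by (auto simp: E'_def Rn_extensional extensional_def fun_eq_iff)
  have "\<bar>jdet n \<Phi> z\<bar> = sqrt ((jdet n \<Phi> z)\<^sup>2)" by simp
  also have "\<dots> = \<bar>z k ^ k * r\<bar> * \<delta> (\<lambda>_. 0) (restrict z {..<k})"
    unfolding jdet_\<Phi>_squared[OF z] \<delta>_def up by (simp add: real_sqrt_mult)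
  also have "\<bar>z k ^ k * r\<bar> = z k ^ k * r" using z r by (simp add: E'_def)
  finally show ?thesis .
qed

lemma jdet_\<Phi>_nonzero: "z \<in> E' \<Longrightarrow> jdet n \<Phi> z \<noteq> 0"
proof
  assume z: "z \<in> E'" "jdet n \<Phi> z = 0"
  have up: "(restrict z {..<k})(k := 0) = z(k := 0)"
    using z kn by (auto simp: E'_def Rn_extensional extensional_def fun_eq_iff)
  have "z k ^ k * r \<noteq> 0" using z r by (simp add: E'_def)
  then show False using jdet_\<Phi>_squared[OF z(1)] det_gram_slice_nonzero[OF dn_E[OF z(1)]] z(2) unfolding up by simp
qed

lemma enorm_\<Phi>: "z \<in> E' \<Longrightarrow> enorm n (\<Phi> z) = z k * r"
  unfolding \<Phi>_def enorm_scale using \<rho>0_in[of z] S_iff by (simp add: E'_def)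

lemma inj_\<Phi>: "inj_on \<Phi> E'"
proof (rule inj_onI)
  fix z z' assume z: "z \<in> E'" "z' \<in> E'" "\<Phi> z = \<Phi> z'"
  have k: "z k = z' k" using enorm_\<Phi>[OF z(1)] enorm_\<Phi>[OF z(2)] z(3) r by simp
  have "\<rho>0 z = \<rho>0 z'"
  proof (rule Rn_eqI)
    show "\<rho>0 z \<in> Rn n" "\<rho>0 z' \<in> Rn n" using \<rho>0_in z(1,2) S_iff by blast+
    fix a assume "a < n"
    then show "\<rho>0 z a = \<rho>0 z' a" using fun_cong[OF z(3), of a] k z(1) by (simp add: \<Phi>_def E'_def)
  qed
  moreover have "z(k := 0) \<in> V" "z'(k := 0) \<in> V" using z(1,2) unfolding E'_def by blast+
  ultimately have zz: "z(k := 0) = z'(k := 0)" unfolding \<rho>0_def using \<phi>_\<psi> by metis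
  show "z = z'"
  proof
    fix a show "z a = z' a" using fun_cong[OF zz, of a] k by (cases "a = k") auto
  qed
qed

lemma continuous_\<rho>0: "continuous_on E' \<rho>0"
  by (rule continuous_on_coordsI[of n]) (use Ck_\<rho>0 Ck_on_continuous[OF openE'] \<rho>0_in S_iff in blast)+

text \<open>In polar coordinates the Jacobian is \<open>t ^ k * r\<close> times the area density,
  and integrating \<open>t ^ k\<close> with k = n - 1 over the unit interval gives the factor 1 /
  n.\<close>

lemma emeasure_cone:
  assumes B: "B \<in> sets (leb n)" "B \<subseteq> U \<inter> S"
  defines "C \<equiv> {x \<in> Rn n. 0 < enorm n x \<and> enorm n x \<le> r \<and> restrict (\<lambda>a. r / enorm n x * x a) {..<n} \<in> B}"
  shows "emeasure (leb n) C = ennreal (r / real n) * (\<integral>\<^sup>+y. ennreal (\<delta> (\<lambda>_. 0) y) * indicator (\<eta> ` B) y \<partial>leb k)"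
proof -
  define B' where "B' = {z \<in> E'. \<rho>0 z \<in> B \<and> z k \<le> 1}"
  have B'E: "B' \<subseteq> E'" by (auto simp: B'_def)
  have sB': "B' \<in> sets (leb n)"
  proof -
    have "E' \<inter> \<rho>0 -` B \<in> sets (leb n)"
      by (rule vimage_in_sets_leb[OF openE' continuous_\<rho>0 _ B(1)]) (use \<rho>0_in S_iff in auto)
    moreover have "{z \<in> space (leb n). z k \<le> 1} \<in> sets (leb n)"
      using measurable_leb_coord[OF kn(1)] by measurable
    moreover have "B' = (E' \<inter> \<rho>0 -` B) \<inter> {z \<in> space (leb n). z k \<le> 1}"
      by (auto simp: B'_def space_leb E'_def)
    ultimately show ?thesis by auto
  qed
  have BR: "b \<in> Rn n \<and> enorm n b = r" if "b \<in> B" for b using that B(2) S_iff by blast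
  have img: "\<Phi> ` B' = C"
  proof (intro equalityI subsetI)
    fix x assume "x \<in> \<Phi> ` B'"
    then obtain z where z: "z \<in> E'" "\<rho>0 z \<in> B" "z k \<le> 1" "x = \<Phi> z" by (auto simp: B'_def)
    have en: "enorm n x = z k * r" using enorm_\<Phi> z by simp
    have zk: "z k > 0" using z(1) by (simp add: E'_def)
    have "restrict (\<lambda>a. r / enorm n x * x a) {..<n} = \<rho>0 z"
    proof (rule Rn_eqI)
      show "\<rho>0 z \<in> Rn n" using BR z(2) by blast
      fix a assume "a < n"
      then show "restrict (\<lambda>a. r / enorm n x * x a) {..<n} a = \<rho>0 z a" unfolding en using zk r by (simp add: z(4) \<Phi>_def)
    qed (rule restrict_Rn)
    moreover have "z k * r \<le> 1 * r" using z(3) r by (intro mult_right_mono) auto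
    moreover have "x \<in> Rn n" unfolding z(4) \<Phi>_def by (rule restrict_Rn)
    ultimately show "x \<in> C" using z(2) zk r en by (simp add: C_def)
  next
    fix x assume "x \<in> C"
    then have x: "x \<in> Rn n" "0 < enorm n x" "enorm n x \<le> r" "restrict (\<lambda>a. r / enorm n x * x a) {..<n} \<in> B" by (auto simp: C_def)
    define b where "b = restrict (\<lambda>a. r / enorm n x * x a) {..<n}"
    have b: "b \<in> B" "b \<in> U \<inter> S" using x(4) B(2) by (auto simp: b_def)
    define z where "z = (\<eta> b)(k := enorm n x / r)"
    have z0: "z(k := 0) = \<phi> b" using up_\<eta>[OF b(2)] by (simp add: z_def)
    have zR: "z \<in> Rn n"
    proof -
      have "z = (\<phi> b)(k := enorm n x / r)" using z0 by (metis fun_upd_same fun_upd_triv fun_upd_upd z_def)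
      then show ?thesis using Rn_upd[OF V_Rn kn(1)] b(2) by auto
    qed
    have zE: "z \<in> E'" using zR z0 b(2) x(2) r by (auto simp: E'_def) (simp add: z_def)
    have \<rho>z: "\<rho>0 z = b" using z0 \<psi>_\<phi> b(2) by (simp add: \<rho>0_def)
    have zk: "z k = enorm n x / r" by (simp add: z_def)
    have "\<Phi> z = x"
    proof (rule Rn_eqI[OF _ x(1)])
      show "\<Phi> z \<in> Rn n" unfolding \<Phi>_def by (rule restrict_Rn)
      fix a assume "a < n"
      then show "\<Phi> z a = x a" unfolding \<Phi>_def \<rho>z zk using x(2) r by (simp add: b_def)
    qed
    moreover have "z \<in> B'" using zE \<rho>z b(1) x(3) r zk by (simp add: B'_def)
    ultimately show "x \<in> \<Phi> ` B'" by blast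
  qed
  have mj: "(\<lambda>z. ennreal \<bar>jdet n \<Phi> z\<bar> * indicator B' z) \<in> borel_measurable (leb n)"
    by (intro continuous_on_measurable_ennreal_leb[OF openE' _ sB' B'E] continuous_on_rabs continuous_on_jdet[OF openE' C1_\<Phi>])
  have "emeasure (leb n) C = (\<integral>\<^sup>+z. ennreal \<bar>jdet n \<Phi> z\<bar> * indicator B' z \<partial>leb n)"
    using volume_formula_diffeo[OF openE' C1_\<Phi> jdet_\<Phi>_nonzero inj_\<Phi>] sB' B'E unfolding volume_formula_def img[symmetric] by blast
  also have "\<dots> = (\<integral>\<^sup>+y. (\<integral>\<^sup>+t. ennreal \<bar>jdet n \<Phi> (y(k := t))\<bar> * indicator B' (y(k := t)) \<partial>lborel) \<partial>PiM ({..<n} - {k}) (\<lambda>_. lborel))"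
    by (rule nn_integral_leb_coord[OF kn(1) mj])
  also have "{..<n} - {k} = {..<k}" using kn by auto
  also have "(\<integral>\<^sup>+y. (\<integral>\<^sup>+t. ennreal \<bar>jdet n \<Phi> (y(k := t))\<bar> * indicator B' (y(k := t)) \<partial>lborel) \<partial>PiM {..<k} (\<lambda>_. lborel))
     = (\<integral>\<^sup>+y. ennreal (r / real n) * (ennreal (\<delta> (\<lambda>_. 0) y) * indicator (\<eta> ` B) y) \<partial>leb k)"
    unfolding leb_def[symmetric]
  proof (intro nn_integral_cong)
    fix y assume "y \<in> space (leb k)"
    then have y: "y \<in> Rn k" by (simp add: space_leb)
    have dn: "restrict (y(k := t)) {..<k} = y" for t using y by (auto simp: Rn_extensional extensional_def fun_eq_iff)
    have yR: "y(k := t) \<in> Rn n" for t using Rn_upd[OF up_Rn[OF y] kn(1), of t] by simp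
    have E'_iff: "y(k := t) \<in> E' \<longleftrightarrow> y \<in> E \<and> t > 0" for t
      using yR[of t] y by (auto simp: E'_def E_def)
    have B'_iff: "y(k := t) \<in> B' \<longleftrightarrow> y \<in> \<eta> ` B \<and> 0 < t \<and> t \<le> 1" for t
      unfolding image_\<eta>[OF B(2)] using E'_iff[of t] by (auto simp: B'_def \<rho>0_def \<sigma>_def)
    show "(\<integral>\<^sup>+t. ennreal \<bar>jdet n \<Phi> (y(k := t))\<bar> * indicator B' (y(k := t)) \<partial>lborel) = ennreal (r / real n) * (ennreal (\<delta> (\<lambda>_. 0) y) * indicator (\<eta> ` B) y)"
    proof (cases "y \<in> \<eta> ` B")
      case False
      then have "indicator B' (y(k := t)) = (0::ennreal)" for t using B'_iff by simp
      then show ?thesis using False by simp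
    next
      case True
      have yE: "y \<in> E" using True image_\<eta>[OF B(2)] by blast
      have d0: "\<delta> (\<lambda>_. 0) y \<ge> 0"
      proof -
        have "0 \<le> \<bar>jdet n \<Phi> (y(k := 1))\<bar>" by simp
        also have "\<dots> = 1 ^ k * r * \<delta> (\<lambda>_. 0) y" using abs_jdet_\<Phi>[of "y(k := 1)"] E'_iff[of 1] yE dn by simp
        finally show ?thesis using r by (simp add: zero_le_mult_iff)
      qed
      have "(\<integral>\<^sup>+t. ennreal \<bar>jdet n \<Phi> (y(k := t))\<bar> * indicator B' (y(k := t)) \<partial>lborel) =
        (\<integral>\<^sup>+t. ennreal (r * \<delta> (\<lambda>_. 0) y) * (ennreal (t ^ k) * indicator {0..1} t) \<partial>lborel)"
      proof (intro nn_integral_cong)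
        fix t :: real
        \<comment> \<open>As k is positive the power vanishes at t = 0, so the half-open range of t
          can be replaced by the closed interval pointwise.\<close>
        have k0: "k \<noteq> 0" using n2 by simp
        show "ennreal \<bar>jdet n \<Phi> (y(k := t))\<bar> * indicator B' (y(k := t)) = ennreal (r * \<delta> (\<lambda>_. 0) y) * (ennreal (t ^ k) * indicator {0..1} t)"
        proof (cases "0 < t \<and> t \<le> 1")
          case t: True
          have "\<bar>jdet n \<Phi> (y(k := t))\<bar> = (r * \<delta> (\<lambda>_. 0) y) * t ^ k"
            using abs_jdet_\<Phi>[of "y(k := t)"] E'_iff[of t] t yE dn[of t] by (simp add: mult_ac)
          then show ?thesis using t True B'_iff[of t] d0 r by (simp add: ennreal_mult)
        next
          case f: False
          then have "indicator B' (y(k := t)) = (0::ennreal)" using B'_iff by simp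
          moreover have "t ^ k * indicator {0..1} t = 0" using f k0 by (auto simp: indicator_def)
          ultimately show ?thesis using k0 f by (cases "t = 0") (auto simp: indicator_def)
        qed
      qed
      also have "\<dots> = ennreal (r * \<delta> (\<lambda>_. 0) y) * (\<integral>\<^sup>+t. ennreal (t ^ k) * indicator {0..1} t \<partial>lborel)"
        by (intro nn_integral_cmult) auto
      also have "(\<integral>\<^sup>+t. ennreal (t ^ k) * indicator {0..1} t \<partial>lborel) = ennreal (1 ^ Suc k / real (Suc k) - 0 ^ Suc k / real (Suc k))"
      proof (rule nn_integral_FTC_Icc[where F = "\<lambda>t. t ^ Suc k / real (Suc k)"])
        fix t :: real
        have "((\<lambda>t. t ^ Suc k / real (Suc k)) has_real_derivative real (Suc k) * t ^ (Suc k - Suc 0) / real (Suc k)) (at t)"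
          by (rule DERIV_cdivide[OF DERIV_pow])
        then show "((\<lambda>t. t ^ Suc k / real (Suc k)) has_real_derivative t ^ k) (at t)"
          by (simp del: of_nat_Suc power_Suc)
      qed auto
      also have "ennreal (r * \<delta> (\<lambda>_. 0) y) * \<dots> = ennreal (r / real n) * ennreal (\<delta> (\<lambda>_. 0) y)"
        unfolding kn(2)[symmetric] using r d0 n2 by (simp add: ennreal_mult[symmetric] zero_power)
      finally show ?thesis using True by (simp del: fun_upd_apply)
    qed
  qed
  also have "\<dots> = ennreal (r / real n) * (\<integral>\<^sup>+y. ennreal (\<delta> (\<lambda>_. 0) y) * indicator (\<eta> ` B) y \<partial>leb k)"
  proof (intro nn_integral_cmult)
    have "\<eta> ` B \<in> sets (leb k)" unfolding image_\<eta>[OF B(2)] by (rule vimage_\<sigma>_sets[OF B(1)])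
    then show "(\<lambda>y. ennreal (\<delta> (\<lambda>_. 0) y) * indicator (\<eta> ` B) y) \<in> borel_measurable (leb k)"
      using image_\<eta>[OF B(2)] by (intro continuous_on_measurable_ennreal_leb[OF openE continuous_\<delta>]) auto
  qed
  finally show ?thesis .
qed

end

lemma emeasure_ball_n:
  assumes r: "r > 0"
  shows "emeasure (leb n) (ball_n n r) = ennreal (r ^ n) * emeasure (leb n) (ball_n n 1)"
proof -
  define T where "T x = restrict (\<lambda>a. r * x a) {..<n}" for x :: coords
  have C1: "C1_map n (Rn n) T"
    unfolding C1_map_def
  proof (intro conjI allI impI)
    fix i assume "i < n"
    then show "Ck_on n 1 (Rn n) (\<lambda>x. T x i)"
      by (simp add: T_def Ck_on_mult Ck_on_const Ck_on_coord)
  qed (auto simp: T_def restrict_Rn)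
  have jd: "jdet n T x = r ^ n" for x
  proof -
    have "pd j (\<lambda>y. T y i) x = (if i = j then r else 0)" if "i < n" "j < n" for i j
      by (rule has_pd_imp_pd) (use that in \<open>auto simp: T_def has_pd_def intro!: derivative_eq_intros\<close>)
    then have "jac n T x = r \<cdot>\<^sub>m 1\<^sub>m n" unfolding jac_def by (intro eq_matI) auto
    then show ?thesis by (simp add: jdet_def det_smult)
  qed
  have inj: "inj_on T (Rn n)"
  proof (rule inj_onI)
    fix x y assume xy: "x \<in> Rn n" "y \<in> Rn n" "T x = T y"
    show "x = y"
    proof (rule Rn_eqI[OF xy(1,2)])
      fix i assume "i < n"
      then show "x i = y i" using fun_cong[OF xy(3), of i] r by (simp add: T_def)
    qed
  qed
  have img: "T ` ball_n n 1 = ball_n n r"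
  proof (intro equalityI subsetI)
    fix x assume x: "x \<in> ball_n n r"
    define y where "y = restrict (\<lambda>a. (1 / r) * x a) {..<n}"
    have "enorm n y = enorm n x / r" unfolding y_def enorm_scale using r by simp
    then have "y \<in> ball_n n 1" using x r by (simp add: ball_n_def y_def restrict_Rn)
    moreover have "T y = x" by (rule Rn_eqI[of _ n]) (use x r in \<open>auto simp: T_def y_def restrict_Rn ball_n_def\<close>)
    ultimately show "x \<in> T ` ball_n n 1" by blast
  next
    fix x assume "x \<in> T ` ball_n n 1"
    then obtain y where y: "enorm n y \<le> 1" "x = T y" by (auto simp: ball_n_def)
    have "r * enorm n y \<le> r * 1" using y r by (intro mult_left_mono) auto
    then show "x \<in> ball_n n r" using y r by (simp add: ball_n_def T_def restrict_Rn enorm_scale)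
  qed
  have B: "ball_n n 1 \<in> sets (leb n)" "ball_n n 1 \<subseteq> Rn n"
    using closedin_imp_sets_leb[OF closedin_ball_n] by (auto simp: ball_n_def)
  have "volume_formula n T (Rn n)"
    by (rule volume_formula_diffeo[OF openin_Rn C1 _ inj]) (use jd r in simp)
  then have "emeasure (leb n) (ball_n n r) = (\<integral>\<^sup>+x. ennreal \<bar>jdet n T x\<bar> * indicator (ball_n n 1) x \<partial>leb n)"
    using B unfolding volume_formula_def img[symmetric] by blast
  also have "\<dots> = ennreal (r ^ n) * emeasure (leb n) (ball_n n 1)"
    unfolding jd using B r by (simp add: nn_integral_cmult_indicator)
  finally show ?thesis .
qed

context sphere
begin

text \<open>The cone measure: up to the factor \<open>n / r\<close>, the area of a part of the sphere is the volume of the cone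
  over it with vertex at the origin.\<close>

lemma area_sphere: "emeasure (euc_area_measure n S) S = ennreal (real n / r) * emeasure (leb n) (ball_n n r)"
proof -
  obtain p0 where p0: "p0 \<in> S" using S_ne by blast
  define O' where "O' = Rn n \<inter> enorm n -` {0<..}"
  have O': "openin (euc n) O'"
    unfolding O'_def using continuous_openin_preimage_gen[OF enorm_continuous[of "Rn n" n] open_greaterThan[of 0]] euc_eq_top_of_set[of n] by metis
  define p where "p x = restrict (\<lambda>a. r / enorm n x * x a) {..<n}" for x :: coords
  \<comment> \<open>Radial projection to the sphere; where it is undefined, in particular at the
    origin, an arbitrary point of the sphere is taken.\<close>
  define \<rho> where "\<rho> x = (if x \<in> O' then p x else p0)" for x
  define D where "D x = ennreal (real n / r) * indicator (O' \<inter> ball_n n r) x" for x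
  define MS where "MS = sigma S {U. openin (subtopology (euc n) S) U}"
  have sub: "{U. openin (subtopology (euc n) S) U} \<subseteq> Pow S" using openin_subset topspace_S by blast
  have MS: "space MS = S" "sets MS = sigma_sets S {U. openin (subtopology (euc n) S) U}" using sub by (simp_all add: MS_def)
  have leb_MS: "A \<in> sets (leb n)" if "A \<in> sets MS" for A using sigma_sets_subtopology_leb[OF S(1)] that MS by simp
  have pS: "p x \<in> S" if "x \<in> O'" for x
  proof -
    have "enorm n x > 0" using that by (simp add: O'_def)
    then have "enorm n (p x) = r" unfolding p_def enorm_scale using r by simp
    then show ?thesis by (simp add: S_iff p_def restrict_Rn)
  qed
  have cp: "continuous_on O' p"
  proof (rule continuous_on_coordsI[of n])
    show "continuous_on O' (\<lambda>x. p x i)" if "i < n" for i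
      using that by (auto simp: p_def O'_def intro!: continuous_intros enorm_continuous continuous_on_coord)
  qed (simp add: p_def restrict_Rn)
  have sO: "O' \<in> sets (leb n)" "ball_n n r \<in> sets (leb n)" by (rule openin_imp_sets_leb[OF O']) (rule \<Omega>_sets)
  have m\<rho>: "\<rho> \<in> leb n \<rightarrow>\<^sub>M MS"
  proof (rule measurableI)
    show "\<rho> x \<in> space MS" for x using pS p0 by (auto simp: \<rho>_def MS)
    fix A assume A: "A \<in> sets MS"
    have "\<rho> -` A \<inter> space (leb n) = (O' \<inter> p -` A) \<union> (if p0 \<in> A then space (leb n) - O' else {})"
      by (auto simp: \<rho>_def space_leb O'_def split: if_splits)
    moreover have "O' \<inter> p -` A \<in> sets (leb n)"
      by (rule vimage_in_sets_leb[OF O' cp _ leb_MS[OF A]]) (auto simp: p_def restrict_Rn)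
    ultimately show "\<rho> -` A \<inter> space (leb n) \<in> sets (leb n)" using sO by auto
  qed
  have mD: "D \<in> borel_measurable (leb n)" unfolding D_def[abs_def] using sO by measurable
  \<comment> \<open>The candidate for the area measure: n / r times the volume of the cone over a
    set. \<open>emeasure_cone\<close> verifies it in every slice chart.\<close>
  define \<mu> where "\<mu> = distr (density (leb n) D) MS \<rho>"
  have em: "emeasure \<mu> A = ennreal (real n / r) * emeasure (leb n) {x \<in> Rn n. 0 < enorm n x \<and> enorm n x \<le> r \<and> p x \<in> A}" (is "_ = _ * emeasure _ ?C")
    if A: "A \<in> sets MS" for A
  proof -
    have C: "O' \<inter> ball_n n r \<inter> (\<rho> -` A \<inter> space (leb n)) = ?C"
      by (auto simp: \<rho>_def O'_def ball_n_def space_leb)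
    have sC: "?C \<in> sets (leb n)" unfolding C[symmetric] using sO measurable_sets[OF m\<rho> A] by auto
    have "emeasure \<mu> A = (\<integral>\<^sup>+x. D x * indicator (\<rho> -` A \<inter> space (leb n)) x \<partial>leb n)"
      unfolding \<mu>_def using A m\<rho> mD measurable_sets[OF m\<rho> A] by (simp add: emeasure_distr emeasure_density)
    also have "\<dots> = (\<integral>\<^sup>+x. ennreal (real n / r) * indicator ?C x \<partial>leb n)"
      unfolding D_def C[symmetric] by (simp add: indicator_inter_arith mult.assoc)
    also have "\<dots> = ennreal (real n / r) * emeasure (leb n) ?C" using sC by (simp add: nn_integral_cmult_indicator)
    finally show ?thesis .
  qed
  have "euc_area_measure n S = \<mu>"
    unfolding euc_area_measure_def
  proof (rule area_measure_eqI)
    show "space \<mu> = S" "sets \<mu> = sigma_sets S {U. openin (subtopology (euc n) S) U}" by (simp_all add: \<mu>_def MS)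
    fix V e d B assume VB: "(V, e, d) \<in> slice_data (\<lambda>_. 0)" "B \<in> sets \<mu>" "B \<subseteq> V"
    have BM: "B \<in> sets MS" using VB(2) by (simp add: \<mu>_def)
    from VB(1,3) obtain c where ch: "c \<in> slice_charts" "V = fst c \<inter> S" "e = (\<lambda>p. restrict (snd c p) {..<n - 1})"
       "d = (\<lambda>y. sqrt (Determinant.det (gram (n - 1) (conformal_metric n (\<lambda>_. 0) c) (y(n - 1 := 0)))))"
       "B \<subseteq> fst c \<inter> S" unfolding slice_data_iff by blast
    interpret sl: sphere_slice n r c
      using slice_chartI[OF ch(1)] by (simp add: sphere_slice_def sphere_axioms)
    have ed: "e = sl.\<eta>" "d = sl.\<delta> (\<lambda>_. 0)" using ch by (auto simp: sl.\<eta>_def sl.\<delta>_def)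
    have "emeasure \<mu> B = ennreal (real n / r) * (ennreal (r / real n) * (\<integral>\<^sup>+y. ennreal (sl.\<delta> (\<lambda>_. 0) y) * indicator (sl.\<eta> ` B) y \<partial>leb k))"
      unfolding em[OF BM] p_def using sl.emeasure_cone[OF leb_MS[OF BM] ch(5)] by simp
    also have "\<dots> = (\<integral>\<^sup>+y. ennreal (sl.\<delta> (\<lambda>_. 0) y) * indicator (sl.\<eta> ` B) y \<partial>leb k)"
      using r n2 by (simp add: mult.assoc[symmetric] ennreal_mult[symmetric])
    finally show "emeasure \<mu> B = (\<integral>\<^sup>+y. ennreal (d y) * indicator (e ` B) y \<partial>leb k)" unfolding ed .
  qed
  moreover have "S \<in> sets MS" using sets.top[of MS] MS by simp
  \<comment> \<open>The cone over the whole sphere is the ball without its centre, and the centre is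
    a null set.\<close>
  moreover have "emeasure (leb n) {x \<in> Rn n. 0 < enorm n x \<and> enorm n x \<le> r \<and> p x \<in> S} = emeasure (leb n) (ball_n n r)"
  proof -
    let ?o = "restrict (\<lambda>_. 0 :: real) {..<n}"
    have eq: "{x \<in> Rn n. 0 < enorm n x \<and> enorm n x \<le> r \<and> p x \<in> S} = ball_n n r - {?o}"
    proof -
      have "0 < enorm n x \<longleftrightarrow> x \<noteq> ?o" if "x \<in> Rn n" for x using enorm_eq_0_iff[OF that] enorm_nonneg[of n x] by (metis less_le)
      then show ?thesis using pS by (auto simp: ball_n_def O'_def)
    qed
    show ?thesis unfolding eq
      by (rule emeasure_Diff_null_set) (use singleton_null_leb[of n ?o] n2 sO restrict_Rn in auto)
  qed
  ultimately show ?thesis using em by simp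
qed

end

section \<open>The isoperimetric ratio\<close>

lemma continuous_imp_ball_n:
  fixes u :: "coords \<Rightarrow> real"
  assumes u: "continuous_on (Rn n) u" and n: "n \<ge> 1" and e: "e > 0"
  defines "p0 \<equiv> restrict (\<lambda>_. 0 :: real) {..<n}"
  obtains r where "r > 0" "\<And>x. x \<in> ball_n n r \<Longrightarrow> \<bar>u x - u p0\<bar> \<le> e"
proof -
  have "openin (euc n) (Rn n \<inter> u -` {u p0 - e<..<u p0 + e})"
    using continuous_openin_preimage_gen[OF u open_greaterThanLessThan] euc_eq_top_of_set[of n] by metis
  moreover have "p0 \<in> Rn n \<inter> u -` {u p0 - e<..<u p0 + e}" using e by (simp add: p0_def restrict_Rn)
  ultimately obtain d where d: "d > 0" "cube n p0 d \<subseteq> Rn n \<inter> u -` {u p0 - e<..<u p0 + e}"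
    using openin_imp_cube by blast
  show thesis
  proof (rule that[of "d / 2"])
    fix x assume x: "x \<in> ball_n n (d / 2)"
    have "\<bar>x i\<bar> < d" if "i < n" for i
      using abs_coord_le_enorm[OF that, of x] x d(1) by (simp add: ball_n_def)
    then have "x \<in> cube n p0 d" using x by (auto simp: cube_def p0_def ball_n_def abs_less_iff)
    then have "u x \<in> {u p0 - e<..<u p0 + e}" using d(2) by blast
    then show "\<bar>u x - u p0\<bar> \<le> e" by (auto simp: abs_le_iff)
  qed (use d in simp)
qed

context sphere
begin

lemma ball_volume: "ball_volume n > 0" "emeasure (leb n) (ball_n n 1) = ennreal (ball_volume n)"
proof -
  have eq: "ball_volume n = measure (leb n) (ball_n n 1)" by (simp add: ball_volume_def ball_n_def)
  interpret b: domain n "ball_n n 1"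
    by unfold_locales (rule n2, rule smooth_compact_domain_ball_n, simp)
  have fin: "emeasure (leb n) (ball_n n 1) < \<infinity>" by (rule compactin_emeasure_finite[OF b.compact_\<Omega>])
  then show *: "emeasure (leb n) (ball_n n 1) = ennreal (ball_volume n)"
    unfolding eq by (simp add: emeasure_eq_ennreal_measure)
  show "ball_volume n > 0" using b.emeasure_\<Omega>_pos unfolding * by simp
qed

lemma measure_ball: "emeasure (leb n) (ball_n n r) = ennreal (r ^ n * ball_volume n)"
  unfolding emeasure_ball_n[OF r] ball_volume(2) using r ball_volume(1) by (simp add: ennreal_mult)

lemma conformal_volume_ge:
  assumes u: "continuous_on (Rn n) u" and l: "\<And>x. x \<in> ball_n n r \<Longrightarrow> l \<le> u x"
  shows "exp (real n * l) * (r ^ n * ball_volume n) \<le> conformal_volume n u (ball_n n r)"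
proof -
  have m: "measure (leb n) (ball_n n r) = r ^ n * ball_volume n"
    unfolding measure_def measure_ball using r ball_volume(1) by simp
  have "exp (real n * l) * (r ^ n * ball_volume n) = (LINT x|leb n. indicator (ball_n n r) x * exp (real n * l))"
    using \<Omega>_sets \<Omega>_Rn by (simp add: m[symmetric] space_leb Int_absorb2)
  also have "\<dots> \<le> (LINT x|leb n. indicator (ball_n n r) x * exp (real n * u x))"
  proof (rule integral_mono[OF _ conformal_volume_integrable[OF u]])
    show "integrable (leb n) (\<lambda>x. indicator (ball_n n r) x * exp (real n * l))"
      by (intro integrable_mult_left integrable_real_indicator \<Omega>_sets) (simp add: measure_ball)
    show "indicator (ball_n n r) x * exp (real n * l) \<le> indicator (ball_n n r) x * exp (real n * u x)" for x
      using l[of x] by (auto simp: indicator_def intro!: mult_left_mono)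
  qed
  also have "\<dots> = conformal_volume n u (ball_n n r)"
    by (simp add: conformal_volume_def set_lebesgue_integral_def)
  finally show ?thesis .
qed

lemma conformal_area_le:
  assumes u: "continuous_on (Rn n) u" and l: "\<And>x. x \<in> ball_n n r \<Longrightarrow> u x \<le> l"
  shows "conformal_area n u (ball_n n r) \<le> exp ((real n - 1) * l) * (real n * r ^ (n - 1) * ball_volume n)"
proof -
  let ?\<mu> = "euc_area_measure n S"
  have S_ball: "S \<subseteq> ball_n n r" using frontier_ball_n_subset by (auto simp: sphere_n_def ball_n_def)
  have rr: "real n / r * (r ^ n * ball_volume n) = real n * r ^ k * ball_volume n"
    using r by (subst (2) kn(2)) (simp add: field_simps del: kn(2))
  have "conformal_area n u (ball_n n r) = enn2real (\<integral>\<^sup>+x. ennreal (exp ((real n - 1) * u x)) \<partial>?\<mu>)"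
    unfolding conformal_area_def using area_measure_conformal(2)[OF u] by (intro integral_eq_nn_integral) auto
  also have "\<dots> \<le> enn2real (\<integral>\<^sup>+x. ennreal (exp ((real n - 1) * l)) \<partial>?\<mu>)"
  \<comment> \<open>Passing to real values is monotone only below infinity; finiteness comes from
    the known area of the sphere.\<close>
  proof (rule enn2real_mono)
    show "(\<integral>\<^sup>+x. ennreal (exp ((real n - 1) * u x)) \<partial>?\<mu>) \<le> (\<integral>\<^sup>+x. ennreal (exp ((real n - 1) * l)) \<partial>?\<mu>)"
    proof (rule nn_integral_mono)
      fix x assume "x \<in> space ?\<mu>"
      then have "u x \<le> l" using l S_ball area_measure_conformal(3)[OF u] by blast
      then show "ennreal (exp ((real n - 1) * u x)) \<le> ennreal (exp ((real n - 1) * l))"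
        using n2 by (intro ennreal_leI) (simp add: mult_left_mono)
    qed
    show "(\<integral>\<^sup>+x. ennreal (exp ((real n - 1) * l)) \<partial>?\<mu>) < Orderings.top"
      by (simp add: area_measure_conformal(3)[OF u] area_sphere measure_ball ennreal_mult_less_top)
  qed
  also have "(\<integral>\<^sup>+x. ennreal (exp ((real n - 1) * l)) \<partial>?\<mu>) = ennreal (exp ((real n - 1) * l) * (real n * r ^ k * ball_volume n))"
    unfolding rr[symmetric] using r ball_volume(1)
    by (simp add: area_measure_conformal(3)[OF u] area_sphere measure_ball ennreal_mult[symmetric])
  also have "enn2real \<dots> = exp ((real n - 1) * l) * (real n * r ^ k * ball_volume n)"
    using r ball_volume(1) by (intro enn2real_ennreal) simp
  finally show ?thesis .
qed

text \<open>Euclidean balls have ratio exactly 1, so the Euclidean factors cancel. For s - e \<le> u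
  \<le> s + e the area contributes at most \<open>exp (n * (s + e))\<close> after taking the power n
  / (n - 1), the volume at least \<open>exp (n * (s - e))\<close>.\<close>

lemma isoperimetric_ratio_of_ball_le:
  assumes u: "continuous_on (Rn n) u" and l: "\<And>x. x \<in> ball_n n r \<Longrightarrow> \<bar>u x - s\<bar> \<le> e"
  shows "isoperimetric_ratio_of n u (ball_n n r) \<le> exp (2 * real n * e)"
proof -
  let ?p = "real n / (real n - 1)" and ?\<omega> = "ball_volume n"
  let ?D = "real n powr ?p * ?\<omega> powr (1 / (real n - 1))"
  let ?a = "exp ((real n - 1) * (s + e)) * (real n * r ^ (n - 1) * ?\<omega>)"
  let ?v = "exp (real n * (s - e)) * (r ^ n * ?\<omega>)"
  have w: "?\<omega> > 0" by (rule ball_volume)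
  have n1: "real n - 1 > 0" using n2 by simp
  have D: "?D > 0" using w n2 by simp
  have v: "?v > 0" using w r by simp
  have "conformal_volume n u (ball_n n r) \<ge> ?v"
    by (rule conformal_volume_ge[OF u]) (use l in \<open>force simp: abs_le_iff\<close>)
  moreover have "conformal_area n u (ball_n n r) \<le> ?a"
    by (rule conformal_area_le[OF u]) (use l in \<open>force simp: abs_le_iff\<close>)
  moreover have "conformal_area n u (ball_n n r) \<ge> 0" by (simp add: conformal_area_def)
  ultimately have "isoperimetric_ratio_of n u (ball_n n r) \<le> ?a powr ?p / (?D * ?v)"
    unfolding isoperimetric_ratio_of_def using D v n1
    by (intro frac_le powr_mono2 mult_left_mono) auto
  also have "?a powr ?p = exp (real n * (s + e)) * (real n powr ?p * r ^ n * (?\<omega> powr (1 / (real n - 1)) * ?\<omega>))"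
  proof -
    have "exp ((real n - 1) * (s + e)) powr ?p = exp (real n * (s + e))"
      using n1 by (simp add: powr_def)
    moreover have "(r ^ (n - 1)) powr ?p = r ^ n"
    proof -
      have "(r ^ (n - 1)) powr ?p = r powr (real (n - 1) * ?p)"
        using r by (simp add: powr_realpow[symmetric] powr_powr)
      also have "real (n - 1) * ?p = real n" using n1 n2 by (simp add: of_nat_diff)
      finally show ?thesis using r by (simp add: powr_realpow)
    qed
    moreover have "?\<omega> powr ?p = ?\<omega> powr (1 / (real n - 1)) * ?\<omega>"
    proof -
      have "?p = 1 / (real n - 1) + 1" using n1 by (simp add: field_simps)
      then show ?thesis using w by (simp add: powr_add)
    qed
    ultimately show ?thesis using r w by (simp add: powr_mult mult_ac)
  qed
  also have "\<dots> / (?D * ?v) = exp (real n * (s + e)) / exp (real n * (s - e))"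
    using w r D n2 by simp
  also have "\<dots> = exp (2 * real n * e)" by (simp add: exp_diff[symmetric] algebra_simps)
  finally show ?thesis .
qed

end

text \<open>The conjecture for the standard structure of \<open>euc n\<close> compares numerator and
  denominator of the ratio, once its area and volume are rewritten as the conformal ones. Positivity
  of the denominator then allows the division.\<close>

lemma (in domain) isoperimetric_ratio_of_ge_1:
  assumes ch: "cartan_hadamard_conjecture n" and u: "smooth_on n (Rn n) u"
    and "complete_metric n (euc n) (euc_charts n) (conformal_metric n u)"
    and "nonpositive_curvature n (euc_charts n) (conformal_metric n u)"
  shows "isoperimetric_ratio_of n u \<Omega> \<ge> 1"
proof -
  have c: "continuous_on (Rn n) u" using smooth_on_continuous[OF openin_Rn u] .
  interpret s: sphere n 1 by unfold_locales (use n in auto)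
  let ?p = "real n / (real n - 1)"
  let ?D = "real n powr ?p * ball_volume n powr (1 / (real n - 1)) * conformal_volume n u \<Omega>"
  have "conformal_area n u \<Omega> powr ?p \<ge> ?D"
    unfolding conformal_area_eq[OF c] conformal_volume_eq[OF c]
    using ch smooth_manifold_euc simply_connected_space_euc riemannian_metric_conformal[OF u] assms(3,4) dom
    unfolding cartan_hadamard_conjecture_def by blast
  moreover have "?D > 0" using n s.ball_volume(1) conformal_volume_pos[OF c] by simp
  ultimately show ?thesis unfolding isoperimetric_ratio_of_def by (simp add: le_divide_eq)
qed

lemma nonpositive_curvature_normal:
  assumes n: "n \<ge> 1" and u: "smooth_on n (Rn n) u" and nm: "normal_metric n u"
    and Q: "\<forall>x\<in>Rn n. Q_curvature n u x \<le> 0"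
  shows "nonpositive_curvature n (euc_charts n) (conformal_metric n u)"
proof -
  define c where "c = 2 / (fact (n - 1) * sphere_volume n)"
  define q where "q y = Q_curvature n u y * exp (real n * u y)" for y
  define g where "g y = - (c * q y)" for y
  \<comment> \<open>\<open>sphere_volume\<close> is the value of a measure, hence non-negative; the
    sign of c is what makes g non-negative.\<close>
  have c0: "c \<ge> 0" by (simp add: c_def sphere_volume_def)
  \<comment> \<open>Valid also where a distance is 0: both logarithms are then 0 by the conventions
    for division and \<open>ln 0\<close>.\<close>
  have ln_swap: "ln (enorm n y / edist n x y) * q y = - (ln (edist n x y / enorm n y) * q y)" for x y
  proof -
    have "ln (enorm n y / edist n x y) = - ln (edist n x y / enorm n y)"
      using ln_inverse[of "edist n x y / enorm n y"] by (simp add: inverse_eq_divide)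
    then show ?thesis by simp
  qed
  have q: "integrable (leb n) q" using nm by (simp add: normal_metric_def finite_total_Q_def q_def[abs_def])
  obtain C where C: "\<And>x. x \<in> Rn n \<Longrightarrow> integrable (leb n) (\<lambda>y. ln (enorm n y / edist n x y) * q y)"
      "\<And>x. x \<in> Rn n \<Longrightarrow> u x = c * (LINT y|leb n. ln (enorm n y / edist n x y) * q y) + C"
    using nm unfolding normal_metric_def c_def[symmetric] q_def[symmetric] by blast
  have gk: "ln (edist n x y / enorm n y) * g y = c * (ln (enorm n y / edist n x y) * q y)" for x y
    by (simp add: g_def ln_swap)
  interpret log_potential n g C u
  proof
    show "integrable (leb n) g" unfolding g_def[abs_def] using q by simp
    show "g y \<ge> 0" if "y \<in> Rn n" for y
      using Q that c0 by (simp add: g_def q_def mult_nonneg_nonpos mult_nonpos_nonneg)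
    show "integrable (leb n) (\<lambda>y. ln (edist n x y / enorm n y) * g y)" if "x \<in> Rn n" for x
      unfolding gk using C(1)[OF that] by simp
    show "u x = (LINT y|leb n. ln (edist n x y / enorm n y) * g y) + C" if "x \<in> Rn n" for x
      unfolding gk using C(2)[OF that] by simp
  qed (rule n)
  show ?thesis
    by (rule nonpositive_curvature_conformal[OF u]) (use hess_sub_nonneg[OF u] in \<open>simp add: hess_def\<close>)
qed

theorem theorem1p3:
  fixes n :: nat and u :: "coords \<Rightarrow> real"
  assumes "\<forall>m\<ge>2. cartan_hadamard_conjecture m"
    and "n \<ge> 2"
    and "smooth_on n (Rn n) u"
    and "Q_well_defined n u"
    and "complete_metric n (euc n) (euc_charts n) (conformal_metric n u)"
    and "normal_metric n u"
    and "\<forall>x\<in>Rn n. Q_curvature n u x \<le> 0"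
  shows "isoperimetric_ratio n u = 1"
proof -
  let ?D = "{\<Omega>. smooth_compact_domain n (euc n) (euc_charts n) \<Omega>}" and ?I = "isoperimetric_ratio_of n u"
  have c: "continuous_on (Rn n) u" using smooth_on_continuous[OF openin_Rn assms(3)] .
  have npc: "nonpositive_curvature n (euc_charts n) (conformal_metric n u)"
    by (rule nonpositive_curvature_normal) (use assms in auto)
  have ge: "1 \<le> ?I \<Omega>" if "\<Omega> \<in> ?D" for \<Omega>
  proof -
    interpret domain n \<Omega> by unfold_locales (use assms that in auto)
    show ?thesis by (rule isoperimetric_ratio_of_ge_1) (use assms npc in auto)
  qed
  have ball: "ball_n n r \<in> ?D" if "r > 0" for r using smooth_compact_domain_ball_n[OF that] by simp
  \<comment> \<open>The unit ball shows that the index set is not empty; otherwise a lower bound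
    would say nothing about a real infimum.\<close>
  have "(INF \<Omega>\<in>?D. ?I \<Omega>) \<ge> 1"
    by (rule cINF_greatest) (use ball[of 1] ge in auto)
  moreover have "(INF \<Omega>\<in>?D. ?I \<Omega>) \<le> 1"
  proof (rule field_le_epsilon)
    fix e :: real assume e: "e > 0"
    \<comment> \<open>Chosen so that \<open>exp (2 * n * d) = 1 + e\<close>.\<close>
    define d where "d = ln (1 + e) / (2 * real n)"
    have "d > 0" using e assms(2) by (simp add: d_def)
    then obtain r where near: "r > 0" "\<And>x. x \<in> ball_n n r \<Longrightarrow> \<bar>u x - u (restrict (\<lambda>_. 0) {..<n})\<bar> \<le> d"
      using continuous_imp_ball_n[OF c, of d] assms(2) by auto
    interpret sphere n r by unfold_locales (use assms(2) near in auto)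
    have "?I (ball_n n r) \<le> exp (2 * real n * d)" by (rule isoperimetric_ratio_of_ball_le[OF c near(2)])
    also have "\<dots> = 1 + e" using e assms(2) by (simp add: d_def)
    finally have "?I (ball_n n r) \<le> 1 + e" .
    \<comment> \<open>The bound from below by 1 ensures that the real infimum is a lower bound of
      the ratios.\<close>
    then show "(INF \<Omega>\<in>?D. ?I \<Omega>) \<le> 1 + e"
      by (rule cINF_lower2[OF bdd_belowI2[of _ 1] ball[OF near(1)], rotated]) (use ge in auto)
  qed
  ultimately show ?thesis unfolding isoperimetric_ratio_def by simp
qed

end
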